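(* Let $k\ge1$ be an integer and $\rho,\varepsilon_0>0$. There exist constants $C_1,C_2>0$, independent of the mesh (i.e. of the polygon $F$ and of its size), such that for every polygon $F$ satisfying the mesh regularity assumption (M) with parameter $\rho$ and the uniform convexity condition (MC) with parameter $\varepsilon_0$, the bilinear form on $\mathbf{SV}^e_k(F)\times\mathbf{SV}^e_k(F)$ $$S^{s,F}_e(\mathbf v_h,\mathbf w_h)=h_F\sum_{e\subseteq\partial F}(\mathbf v_h\cdot\mathbf t_e,\mathbf w_h\cdot\mathbf t_e)_e+h_F^2(\mathrm{rot}_F\mathbf v_h,\mathrm{rot}_F\mathbf w_h)_F+(\mathbf\Pi^e_S\mathbf v_h,\mathbf\Pi^e_S\mathbf w_h)_F$$ satisfies $$C_1\|\mathbf v_h\|_F^2\le S^{s,F}_e(\mathbf v_h,\mathbf v_h)\le C_2\|\mathbf v_h\|_F^2\qquad\forall\mathbf v_h\in\mathbf{SV}^e_k(F).$$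
   Context: (M): $F\subset\mathbb R^2$ is a polygon with diameter $h_F$ and barycenter $\mathbf b_F$; $F$ is star-shaped with respect to a disk of radius $\ge\rho h_F$, and every edge $e$ has length $h_e\ge\rho h_F$. (MC): $F$ is convex and each internal angle $\theta$ of $F$ satisfies $\varepsilon_0\le\theta\le\pi-\varepsilon_0$. $(\cdot,\cdot)_D$ and $\|\cdot\|_D$ are the $L^2(D)$ inner product and norm. $\mathbf n_e$ is the unit outer normal on $e$, $\mathbf t_e=(-n_2,n_1)$ if $\mathbf n_e=(n_1,n_2)$; $\mathbf t_{\partial F}|_e=\mathbf t_e$. $\mathrm{rot}_F\mathbf v=\partial_{x_1}v_2-\partial_{x_2}v_1$, $\mathrm{div}_F\mathbf v=\partial_{x_1}v_1+\partial_{x_2}v_2$, $\bm{\nabla}_F$ is the gradient, $\mathbf x_F:=\mathbf x-\mathbf b_F$. $\mathbb P_k(D)$: polynomials of degree at most $k$, $\mathbb P_{-\ell}(D)=\{0\}$ for $\ell\ge1$; $\mathbb P^0_{k}(F)$: those with zero average on either $F$ or $\partial F$. $\mathbf V^e_k(F)=\{\mathbf v_h\in\mathbf L^2(F):\mathrm{div}_F\mathbf v_h\in\mathbb P_k(F),\ \mathrm{rot}_F\mathbf v_h\in\mathbb P_{k-1}(F),\ \mathbf v_h\cdot\mathbf t_e\in\mathbb P_k(e)\ \forall e\subseteq\partial F\}$. $\eta_F$ is the minimum number of straight lines necessary to cover $\partial F$, and $\beta_F:=k+1-\eta_F$. The (well defined) projection $\mathbf\Pi^e_S:\mathbf V^e_k(F)\to(\mathbb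 P_k(F))^2$ is given by (a) $\int_{\partial F}[(\mathbf v_h-\mathbf\Pi^e_S\mathbf v_h)\cdot\mathbf t_{\partial F}][\bm{\nabla}_Fp_{k+1}\cdot\mathbf t_{\partial F}]=0$ for all $p_{k+1}\in\mathbb P_{k+1}(F)$; (b) $\int_{\partial F}(\mathbf v_h-\mathbf\Pi^e_S\mathbf v_h)\cdot\mathbf t_{\partial F}=0$; (c) $\int_F\mathrm{rot}_F(\mathbf v_h-\mathbf\Pi^e_S\mathbf v_h)p^0_{k-1}=0$ for all $p^0_{k-1}\in\mathbb P^0_{k-1}(F)$ (only for $k>1$); (d) $\int_F(\mathbf v_h-\mathbf\Pi^e_S\mathbf v_h)\cdot\mathbf x_F\,p_{\beta_F}=0$ for all $p_{\beta_F}\in\mathbb P_{\beta_F}(F)$ (only for $\beta_F\ge0$). $\mathbf{SV}^e_k(F)=\{\mathbf v_h\in\mathbf V^e_k(F):\int_F(\mathbf v_h-\mathbf\Pi^e_S\mathbf v_h)\cdot\mathbf x_F\,p=0\ \forall p\in\mathbb P_{\beta_F|k}(F)\}$, where $\mathbb P_{\beta_F|k}(F)$ is a chosen space with $\mathbb P_k(F)=\mathbb P_{\beta_F}(F)\oplus\mathbb P_{\beta_F|k}(F)$. *)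

theory Defs
  imports "HOL-Analysis.Analysis"
begin

section \<open>Polygons\<close>

type_synonym point = "real^2"

text \<open>An edge is the pair of its end points. A polygon is given by the cyclic list of its
  vertices, in either orientation; everything below is independent of the orientation and of
  the starting vertex.\<close>

type_synonym edge = "point \<times> point"

definition edges :: "point list \<Rightarrow> edge set" where
  "edges vs = {(vs ! i, vs ! (Suc i mod length vs)) | i. i < length vs}"

definition seg :: "edge \<Rightarrow> point set" where
  "seg e = closed_segment (fst e) (snd e)"

definition simple_polygon :: "point list \<Rightarrow> bool" where
  "simple_polygon vs \<longleftrightarrow> length vs \<ge> 3 \<and> distinct vs \<and>
     (\<forall>e\<in>edges vs. \<forall>e'\<in>edges vs. e \<noteq> e' \<longrightarrow>
        seg e \<inter> seg e' = {fst e, snd e} \<inter> {fst e', snd e'})"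

definition bdry :: "point list \<Rightarrow> point set" where
  "bdry vs = (\<Union>e\<in>edges vs. seg e)"

definition region :: "point list \<Rightarrow> point set" where
  "region vs = bdry vs \<union> inside (bdry vs)"

definition elen :: "edge \<Rightarrow> real" where
  "elen e = dist (fst e) (snd e)"

definition barycenter :: "point set \<Rightarrow> point" where
  "barycenter F = (1 / measure lebesgue F) *\<^sub>R (LINT x|lebesgue_on F. x)"

definition outer_normal :: "point list \<Rightarrow> edge \<Rightarrow> point" where
  "outer_normal vs e = (THE n. norm n = 1 \<and> n \<bullet> (snd e - fst e) = 0 \<and>
     (\<exists>\<delta>>0. \<forall>s. 0 < s \<and> s < \<delta> \<longrightarrow> midpoint (fst e) (snd e) + s *\<^sub>R n \<notin> region vs))"

definition tangent :: "point list \<Rightarrow> edge \<Rightarrow> point" where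
  "tangent vs e = vector [- (outer_normal vs e $ 2), outer_normal vs e $ 1]"

definition edge_int :: "edge \<Rightarrow> (point \<Rightarrow> real) \<Rightarrow> real" where
  "edge_int e f = elen e * (LINT t|lebesgue_on {0..1}. f (linepath (fst e) (snd e) t))"

text \<open>Integral over the boundary of a function given edge by edge (two-valued at vertices).\<close>

definition bdry_int :: "point list \<Rightarrow> (edge \<Rightarrow> point \<Rightarrow> real) \<Rightarrow> real" where
  "bdry_int vs g = (\<Sum>e\<in>edges vs. edge_int e (g e))"

subsection \<open>Assumptions (M) and (MC)\<close>

definition star_shaped_wrt :: "point set \<Rightarrow> point set \<Rightarrow> bool" where
  "star_shaped_wrt F B \<longleftrightarrow> (\<forall>y\<in>B. \<forall>x\<in>F. closed_segment y x \<subseteq> F)"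

definition mesh_regular :: "real \<Rightarrow> point list \<Rightarrow> bool" where
  "mesh_regular \<rho> vs \<longleftrightarrow>
     (\<exists>c r. r \<ge> \<rho> * diameter (region vs) \<and> star_shaped_wrt (region vs) (ball c r)) \<and>
     (\<forall>e\<in>edges vs. elen e \<ge> \<rho> * diameter (region vs))"

text \<open>The angle in \<open>[0, \<pi>]\<close> between consecutive edges. For a convex polygon, the only case in
  which it is used, this is the internal angle at the common vertex \<open>b\<close>.\<close>

definition vertex_angle :: "point \<Rightarrow> point \<Rightarrow> point \<Rightarrow> real" where
  "vertex_angle a b c = arccos (((a - b) \<bullet> (c - b)) / (norm (a - b) * norm (c - b)))"

definition uniformly_convex :: "real \<Rightarrow> point list \<Rightarrow> bool" where
  "uniformly_convex \<epsilon> vs \<longleftrightarrow> convex (region vs) \<and>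
     (\<forall>a b c. (a, b) \<in> edges vs \<and> (b, c) \<in> edges vs \<longrightarrow>
        \<epsilon> \<le> vertex_angle a b c \<and> vertex_angle a b c \<le> pi - \<epsilon>)"

subsection \<open>The numbers \<open>\<eta>\<close> and \<open>\<beta>\<close>\<close>

definition eta :: "point list \<Rightarrow> nat" where
  "eta vs = (LEAST n. \<exists>L. finite L \<and> card L = n \<and>
     (\<forall>l\<in>L. affine l \<and> aff_dim l = 1) \<and> bdry vs \<subseteq> \<Union>L)"

definition beta :: "nat \<Rightarrow> point list \<Rightarrow> int" where
  "beta k vs = int k + 1 - int (eta vs)"

section \<open>Polynomials\<close>

text \<open>Polynomials are represented as functions on the whole plane; this is faithful since a
  polygon has nonempty interior. The degree bound is an integer, so that a negative bound gives
  the zero space. Restricted to an edge they give the polynomials in the arc length.\<close>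

definition Pol :: "int \<Rightarrow> (point \<Rightarrow> real) set" where
  "Pol m = {p. \<exists>c. \<forall>x. p x = (\<Sum>(i, j)\<in>{(i, j). int (i + j) \<le> m}. c i j * (x $ 1) ^ i * (x $ 2) ^ j)}"

definition Pol_vec :: "int \<Rightarrow> (point \<Rightarrow> point) set" where
  "Pol_vec m = {p. \<forall>i. (\<lambda>x. p x $ i) \<in> Pol m}"

text \<open>The zero average condition may be imposed on the polygon or on its boundary.\<close>

datatype average = Over_region | Over_boundary

definition Pol0 :: "average \<Rightarrow> int \<Rightarrow> point list \<Rightarrow> (point \<Rightarrow> real) set" where
  "Pol0 avg m vs = {p \<in> Pol m.
     case avg of Over_region \<Rightarrow> (LINT x|lebesgue_on (region vs). p x) = 0
               | Over_boundary \<Rightarrow> bdry_int vs (\<lambda>_. p) = 0}"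

text \<open>\<open>A = B \<oplus> W\<close> for spaces of functions, where \<open>W\<close> is required to be a linear subspace.\<close>

definition direct_complement ::
  "(point \<Rightarrow> real) set \<Rightarrow> (point \<Rightarrow> real) set \<Rightarrow> (point \<Rightarrow> real) set \<Rightarrow> bool" where
  "direct_complement A B W \<longleftrightarrow>
     W \<subseteq> A \<and> (\<lambda>_. 0) \<in> W \<and>
     (\<forall>p\<in>W. \<forall>q\<in>W. \<forall>a b. (\<lambda>x. a * p x + b * q x) \<in> W) \<and>
     (\<forall>p\<in>A. \<exists>!(q, r). q \<in> B \<and> r \<in> W \<and> p = (\<lambda>x. q x + r x))"

section \<open>Weak differential operators and traces\<close>

definition partial :: "2 \<Rightarrow> (point \<Rightarrow> real) \<Rightarrow> point \<Rightarrow> real" where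
  "partial i f x = frechet_derivative f (at x) (axis i 1)"

definition grad :: "(point \<Rightarrow> real) \<Rightarrow> point \<Rightarrow> point" where
  "grad f x = (\<chi> i. partial i f x)"

definition C1_fun :: "(point \<Rightarrow> real) \<Rightarrow> bool" where
  "C1_fun \<phi> \<longleftrightarrow> (\<forall>x. \<phi> differentiable (at x)) \<and> (\<forall>i. continuous_on UNIV (partial i \<phi>))"

definition test_fun :: "point set \<Rightarrow> (point \<Rightarrow> real) \<Rightarrow> bool" where
  "test_fun F \<phi> \<longleftrightarrow> C1_fun \<phi> \<and> (\<exists>K. compact K \<and> K \<subseteq> interior F \<and> (\<forall>x. x \<notin> K \<longrightarrow> \<phi> x = 0))"

definition L2_on :: "'a::euclidean_space set \<Rightarrow> ('a \<Rightarrow> 'b::euclidean_space) \<Rightarrow> bool" where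
  "L2_on D f \<longleftrightarrow> f \<in> borel_measurable (lebesgue_on D) \<and> integrable (lebesgue_on D) (\<lambda>x. (norm (f x))\<^sup>2)"

definition L2_inner :: "point set \<Rightarrow> (point \<Rightarrow> 'b::euclidean_space) \<Rightarrow> (point \<Rightarrow> 'b) \<Rightarrow> real" where
  "L2_inner D f g = (LINT x|lebesgue_on D. f x \<bullet> g x)"

definition L2_norm :: "point set \<Rightarrow> (point \<Rightarrow> 'b::euclidean_space) \<Rightarrow> real" where
  "L2_norm D f = sqrt (L2_inner D f f)"

definition has_weak_div :: "point set \<Rightarrow> (point \<Rightarrow> point) \<Rightarrow> (point \<Rightarrow> real) \<Rightarrow> bool" where
  "has_weak_div F v d \<longleftrightarrow> L2_on F d \<and>
     (\<forall>\<phi>. test_fun F \<phi> \<longrightarrow>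
        (LINT x|lebesgue_on F. d x * \<phi> x) =
        - (LINT x|lebesgue_on F. v x $ 1 * partial 1 \<phi> x + v x $ 2 * partial 2 \<phi> x))"

definition has_weak_rot :: "point set \<Rightarrow> (point \<Rightarrow> point) \<Rightarrow> (point \<Rightarrow> real) \<Rightarrow> bool" where
  "has_weak_rot F v r \<longleftrightarrow> L2_on F r \<and>
     (\<forall>\<phi>. test_fun F \<phi> \<longrightarrow>
        (LINT x|lebesgue_on F. r x * \<phi> x) =
        - (LINT x|lebesgue_on F. v x $ 2 * partial 1 \<phi> x - v x $ 1 * partial 2 \<phi> x))"

text \<open>A representative of the weak rotation, determined up to a null set when it exists.\<close>

definition rot :: "point set \<Rightarrow> (point \<Rightarrow> point) \<Rightarrow> point \<Rightarrow> real" where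
  "rot F v = (SOME r. has_weak_rot F v r)"

text \<open>The tangential trace of a field in \<open>L\<^sup>2\<close> with rotation in \<open>L\<^sup>2\<close> is defined, as usual, by
  Green's formula
  \<open>\<integral>\<^sub>F rot v \<phi> + \<integral>\<^sub>F (v\<^sub>2 \<partial>\<^sub>1 \<phi> - v\<^sub>1 \<partial>\<^sub>2 \<phi>) = \<integral>\<^bsub>\<partial>F\<^esub> (v \<bullet> t) \<phi>\<close>,
  where \<open>t = (- n\<^sub>2, n\<^sub>1)\<close> for the unit outer normal \<open>n\<close>. A trace \<open>g\<close> here is the family of its
  restrictions to the edges, each of them square integrable.\<close>

definition has_tan_trace :: "point list \<Rightarrow> (point \<Rightarrow> point) \<Rightarrow> (edge \<Rightarrow> point \<Rightarrow> real) \<Rightarrow> bool" where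
  "has_tan_trace vs v g \<longleftrightarrow>
     (\<forall>e\<in>edges vs. L2_on {0..1} (\<lambda>t. g e (linepath (fst e) (snd e) t))) \<and>
     (\<forall>\<phi>. C1_fun \<phi> \<longrightarrow>
        (LINT x|lebesgue_on (region vs). rot (region vs) v x * \<phi> x) +
        (LINT x|lebesgue_on (region vs). v x $ 2 * partial 1 \<phi> x - v x $ 1 * partial 2 \<phi> x) =
        bdry_int vs (\<lambda>e x. g e x * \<phi> x))"

definition tan_trace :: "point list \<Rightarrow> (point \<Rightarrow> point) \<Rightarrow> edge \<Rightarrow> point \<Rightarrow> real" where
  "tan_trace vs v = (SOME g. has_tan_trace vs v g)"

section \<open>The edge virtual element spaces\<close>

definition Ve :: "nat \<Rightarrow> point list \<Rightarrow> (point \<Rightarrow> point) set" where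
  "Ve k vs = {v. L2_on (region vs) v \<and>
     (\<exists>d\<in>Pol (int k). has_weak_div (region vs) v d) \<and>
     (\<exists>r\<in>Pol (int k - 1). has_weak_rot (region vs) v r) \<and>
     (\<exists>g. has_tan_trace vs v g \<and> (\<forall>e\<in>edges vs. \<exists>p\<in>Pol (int k). \<forall>x\<in>seg e. g e x = p x))}"

definition int_against_x :: "point list \<Rightarrow> (point \<Rightarrow> point) \<Rightarrow> (point \<Rightarrow> real) \<Rightarrow> real" where
  "int_against_x vs w p =
     (LINT x|lebesgue_on (region vs). (w x \<bullet> (x - barycenter (region vs))) * p x)"

definition is_Pi_S :: "nat \<Rightarrow> average \<Rightarrow> point list \<Rightarrow> (point \<Rightarrow> point) \<Rightarrow> (point \<Rightarrow> point) \<Rightarrow> bool" where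
  "is_Pi_S k avg vs v P \<longleftrightarrow> P \<in> Pol_vec (int k) \<and>
     (let w = (\<lambda>x. v x - P x) in
       (\<forall>p\<in>Pol (int k + 1).
          bdry_int vs (\<lambda>e x. tan_trace vs w e x * (grad p x \<bullet> tangent vs e)) = 0) \<and>
       bdry_int vs (tan_trace vs w) = 0 \<and>
       (k > 1 \<longrightarrow> (\<forall>p\<in>Pol0 avg (int k - 1) vs.
          (LINT x|lebesgue_on (region vs). rot (region vs) w x * p x) = 0)) \<and>
       (beta k vs \<ge> 0 \<longrightarrow> (\<forall>p\<in>Pol (beta k vs). int_against_x vs w p = 0)))"

definition Pi_S :: "nat \<Rightarrow> average \<Rightarrow> point list \<Rightarrow> (point \<Rightarrow> point) \<Rightarrow> point \<Rightarrow> point" where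
  "Pi_S k avg vs v = (THE P. is_Pi_S k avg vs v P)"

text \<open>\<open>W\<close> plays the role of the chosen complement of \<open>Pol \<beta>\<close> in \<open>Pol k\<close>.\<close>

definition SVe :: "nat \<Rightarrow> average \<Rightarrow> (point \<Rightarrow> real) set \<Rightarrow> point list \<Rightarrow> (point \<Rightarrow> point) set" where
  "SVe k avg W vs = {v \<in> Ve k vs. \<forall>p\<in>W. int_against_x vs (\<lambda>x. v x - Pi_S k avg vs v x) p = 0}"

definition S_form ::
  "nat \<Rightarrow> average \<Rightarrow> point list \<Rightarrow> (point \<Rightarrow> point) \<Rightarrow> (point \<Rightarrow> point) \<Rightarrow> real" where
  "S_form k avg vs v w = (let F = region vs; h = diameter F in
     h * (\<Sum>e\<in>edges vs. edge_int e (\<lambda>x. tan_trace vs v e x * tan_trace vs w e x)) +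
     h\<^sup>2 * L2_inner F (rot F v) (rot F w) +
     L2_inner F (Pi_S k avg vs v) (Pi_S k avg vs w))"

end

theory Submission
 imports Defs
begin

text \<open>For \<open>v\<close> in the serendipity space choose a polynomial \<open>p\<close> with \<open>div (x\<^sub>F p) = div v\<close>; the Euler operator is invertible.
Removing from \<open>v\<close> a polynomial multiple of the rotated \<open>x\<^sub>F\<close> with the same rotation and a curl-free lifting of the
remaining trace leaves a curl-free field with zero trace, which is orthogonal to \<open>v - x\<^sub>F p\<close>. So \<open>\<parallel>v\<parallel>\<^sup>2\<close> is controlled
by the rotation, the trace and \<open>(v, x\<^sub>F p) = (\<Pi>v, x\<^sub>F p)\<close>. The upper bound tests with bump functions. All constants come
from the equivalence of norms on polynomials over disks of radius comparable to the diameter.\<close>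

text \<open>The fields have only weak derivatives, so the orthogonality of curl-free fields with
  zero trace to divergence-free ones is not a direct integration by parts: the former are smoothed
  by a kernel with an explicit potential and dilated about the inscribed disk, which turns them into
  gradients of test functions. The projection is stable because of a degree count. Uniform convexity
  puts distinct edges on distinct lines, so \<open>eta\<close> is the number \<open>N\<close> of
  edges, and a polynomial of degree \<open>k + 1\<close> vanishing on the boundary is the product of
  the \<open>N\<close> edge equations with a factor of degree \<open>beta\<close>; condition (d)
  tests with exactly this space. The moments against \<open>x_F p\<close> reach that factor because
  integration by parts converts them into the Euler operator, which is diagonal in centred
  monomials. The constants depend on \<open>N\<close>, which an area formula bounds in terms of
  \<open>rho\<close>, so finitely many of them are merged at the end. No compactness over shapes is
  used: polynomials are compared on disks by scaling, and the angles enter through lower bounds for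
  the distances to the edge lines.\<close>

abbreviation leb :: "'a::euclidean_space set => 'a measure" where "leb S == lebesgue_on S"
abbreviation el :: "point * point => real => point" where "el e == linepath (fst e) (snd e)"
abbreviation (input) iff_ascii (infixr "<->" 25) where "A <-> B == A = (B::bool)"
lemmas int_congr = Bochner_Integration.integral_cong
lemmas cont_meas = continuous_imp_measurable_on_sets_lebesgue
notation inner (infixl "<.>" 70)
notation scaleR (infixr "*R" 75)

section \<open>Positive semidefinite forms\<close>

definition qf :: "'i set => ('i => 'i => real) => ('i => real) => ('i => real) => real" where
 "qf I M a b = (SUM i:I. SUM j:I. a i * b j * M i j)"

lemma qf_add_left: "qf I M (%i. s * a i + t * b i) c = s * qf I M a c + t * qf I M b c"
 unfolding qf_def by (simp add: algebra_simps sum.distrib sum_distrib_left)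

lemma qf_sym: "ALL i:I. ALL j:I. M i j = M j i ==> qf I M a b = qf I M b a"
 unfolding qf_def by (subst sum.swap) (auto intro!: sum.cong)

lemma qf_CS:
 assumes sym: "ALL i:I. ALL j:I. M i j = M j i" and psd: "ALL a. 0 <= qf I M a a"
 shows "(qf I M a b)^2 <= qf I M a a * qf I M b b" proof -
 have e: "qf I M (%i. s * a i + t * b i) (%i. s * a i + t * b i) =
   s^2 * qf I M a a + 2 * s * t * qf I M a b + t^2 * qf I M b b" for s t
  by (simp add: qf_add_left qf_sym[OF sym, of _ "%i. s * a i + t * b i"] qf_sym[OF sym, of b a]
   power2_eq_square algebra_simps)
 have A: "0 <= qf I M a a" "0 <= qf I M b b" using psd by auto
 show ?thesis proof (cases "qf I M b b = 0")
  case False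
  define s where "s = qf I M b b"
  define t where "t = - qf I M a b"
  have "0 <= s * (s * qf I M a a - (qf I M a b)^2)" using e[of s t] psd[rule_format, of "%i. s * a i + t * b i"]
   by (simp add: s_def t_def power2_eq_square algebra_simps)
  moreover have "s > 0" using A False by (simp add: s_def)
  ultimately show ?thesis by (simp add: zero_le_mult_iff s_def algebra_simps)
 next
  case True
  have "qf I M a b = 0" proof (rule ccontr)
   assume n: "qf I M a b ~= 0"
   \<comment> \<open>With \<open>qf I M b b = 0\<close> the form is affine in \<open>t\<close>; this
     \<open>t\<close> makes it equal to \<open>-1\<close>, so a nonzero mixed term is
     impossible.\<close>
   define t where "t = - (qf I M a a + 1) / (2 * qf I M a b)"
   have "0 <= qf I M a a + 2 * t * qf I M a b" using e[of 1 t] psd[rule_format, of "%i. 1 * a i + t * b i"] True by simp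
   also have "... = -1" using n by (simp add: t_def field_simps)
   finally show False by simp
  qed
  thus ?thesis using True by simp
 qed
qed

lemma qf_insert:
 assumes "finite I" "x ~: I" and sym: "ALL i:insert x I. ALL j:insert x I. M i j = M j i"
 shows "qf (insert x I) M a b = qf I M a b + a x * (SUM j:I. b j * M x j) + b x * (SUM i:I. a i * M x i)
   + a x * b x * M x x" proof -
 have "(SUM i:I. a i * b x * M i x) = b x * (SUM i:I. a i * M x i)" unfolding sum_distrib_left proof (rule sum.cong)
  fix i assume "i : I"
  hence "M i x = M x i" using sym by blast
  thus "a i * b x * M i x = b x * (a i * M x i)" by simp
 qed simp
 moreover have "(SUM j:I. a x * b j * M x j) = a x * (SUM j:I. b j * M x j)" by (simp add: sum_distrib_left mult.assoc)
 moreover have "qf (insert x I) M a b = (a x * b x * M x x + (SUM j:I. a x * b j * M x j)) +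
   ((SUM i:I. a i * b x * M i x) + qf I M a b)"
  unfolding qf_def sum.insert[OF assms(1,2)] sum.distrib by (simp add: ac_simps)
 ultimately show ?thesis by simp
qed

text \<open>Compatibility with the null vectors of the form suffices for solvability. Induction over
  the index set by block elimination: the new index contributes a scalar equation whose pivot is a
  Schur complement. Semidefinite matrices are treated because the boundary form of the projection
  has constants in its kernel.\<close>

lemma psd_solve:
 assumes "finite I" "ALL i:I. ALL j:I. M i j = M j i" "ALL a. 0 <= qf I M a a"
  "ALL a. qf I M a a = 0 --> (SUM i:I. a i * L i) = 0" shows "EX b. ALL i:I. (SUM j:I. M i j * b j) = L i" using assms
proof (induction I arbitrary: L rule: finite_induct)
 case empty
 thus ?case by simp
next
 case (insert x I L)
 note q = qf_insert[OF insert.hyps(1,2) insert.prems(1)]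
 have sym: "ALL i:I. ALL j:I. M i j = M j i" using insert.prems(1) by blast
 have ext: "qf (insert x I) M (a(x := 0)) (a(x := 0)) = qf I M a a" for a proof -
  have "qf I M (a(x := 0)) (a(x := 0)) = qf I M a a" unfolding qf_def using insert.hyps(2) by (intro sum.cong) auto
  thus ?thesis by (simp add: q)
 qed
 have psd: "ALL a. 0 <= qf I M a a" using insert.prems(2) ext by metis
 have kL: "ALL a. qf I M a a = 0 --> (SUM i:I. a i * L i) = 0" proof (intro allI impI)
  fix a assume "qf I M a a = 0"
  hence "(SUM i:insert x I. (a(x := 0)) i * L i) = 0" using insert.prems(3) ext by metis
  moreover have "(SUM i:I. (a(x := 0)) i * L i) = (SUM i:I. a i * L i)" using insert.hyps(2) by (intro sum.cong) auto
  ultimately show "(SUM i:I. a i * L i) = 0" using insert.hyps by simp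
 qed
 \<comment> \<open>The new row is itself an admissible right-hand side: by Cauchy-Schwarz, null
   vectors of the old form are orthogonal to it.\<close>
 have kx: "ALL a. qf I M a a = 0 --> (SUM i:I. a i * M x i) = 0" proof (intro allI impI)
  fix a assume a0: "qf I M a a = 0"
  define a' where "a' = a(x := 0)"
  define e where "e = (%i. if i = x then 1 else 0 :: real)"
  have z: "qf I M a' e = 0" "(SUM j:I. e j * M x j) = 0"
   unfolding qf_def e_def using insert.hyps(2) by (auto intro!: sum.neutral)
  have "qf (insert x I) M a' e = (SUM i:I. a' i * M x i)"
   unfolding q by (simp add: a'_def z[unfolded a'_def]) (simp add: e_def)
  moreover have "(qf (insert x I) M a' e)^2 <= 0"
   using qf_CS[OF insert.prems(1,2), of a' e] ext[of a] a0 by (simp add: a'_def)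
  moreover have "(SUM i:I. a' i * M x i) = (SUM i:I. a i * M x i)"
   using insert.hyps(2) by (intro sum.cong) (auto simp: a'_def)
  ultimately show "(SUM i:I. a i * M x i) = 0" by simp
 qed
 obtain b0 where b0: "ALL i:I. (SUM j:I. M i j * b0 j) = L i" using insert.IH[OF sym psd kL] by blast
 obtain p where p: "ALL i:I. (SUM j:I. M i j * p j) = M x i" using insert.IH[OF sym psd kx] by blast
 \<comment> \<open>\<open>D\<close> is the Schur complement, the value of the form at
   \<open>e\<close>, the new unit vector minus \<open>p\<close>.\<close>
 define D where "D = M x x - (SUM j:I. M x j * p j)"
 define e where "e = (%i. if i = x then 1 else - p i)"
 have eI: "(SUM i:I. e i * f i) = - (SUM i:I. p i * f i)" for f
  unfolding sum_negf[symmetric] using insert.hyps(2) by (intro sum.cong) (auto simp: e_def)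
 have pp: "qf I M p p = (SUM j:I. M x j * p j)" proof -
  have "qf I M p p = (SUM i:I. p i * (SUM j:I. M i j * p j))"
   unfolding qf_def by (simp add: sum_distrib_left mult.assoc mult.left_commute mult.commute)
  also have "... = (SUM j:I. M x j * p j)" using p by (auto intro!: sum.cong)
  finally show ?thesis .
 qed
 have "qf I M e e = qf I M p p" unfolding qf_def using insert.hyps(2) by (intro sum.cong) (auto simp: e_def)
 hence "qf (insert x I) M e e = D" unfolding q eI pp by (simp add: e_def D_def mult.commute)
 \<comment> \<open>If the pivot is zero then \<open>e\<close> is a null vector and compatibility
   makes the last equation hold automatically; otherwise \<open>s\<close> is the value of the new
   unknown.\<close>
 show ?case proof (cases "D = 0")
  case True
  hence "(SUM i:insert x I. e i * L i) = 0" using insert.prems(3) \<open>qf (insert x I) M e e = D\<close> by blast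
  hence Lx: "L x = (SUM i:I. p i * L i)" using insert.hyps by (simp add: eI) (simp add: e_def)
  have "(SUM i:I. p i * L i) = (SUM i:I. SUM j:I. p i * (M i j * b0 j))"
   using b0 by (auto simp: sum_distrib_left[symmetric] intro!: sum.cong)
  also have "... = (SUM j:I. SUM i:I. p i * (M i j * b0 j))" by (rule sum.swap)
  also have "... = (SUM j:I. b0 j * (SUM i:I. M j i * p i))" using sym by (auto simp: sum_distrib_left intro!: sum.cong)
  also have "... = (SUM j:I. M x j * b0 j)" using p by (auto intro!: sum.cong)
  finally have Lx': "L x = (SUM j:I. M x j * b0 j)" using Lx by simp
  have *: "(SUM j:I. M i j * (b0(x := 0)) j) = (SUM j:I. M i j * b0 j)" for i
   using insert.hyps(2) by (intro sum.cong) auto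
  show ?thesis by (rule exI[of _ "b0(x := 0)"]) (use insert.hyps b0 Lx' * in auto)
 next
  case False
  define s where "s = (L x - (SUM j:I. M x j * b0 j)) / D"
  define b where "b = (%i. if i = x then s else b0 i - s * p i)"
  have bI: "(SUM j:I. M i j * b j) = (SUM j:I. M i j * b0 j) - s * (SUM j:I. M i j * p j)" for i
   unfolding sum_distrib_left sum_subtractf[symmetric] using insert.hyps(2)
   by (intro sum.cong) (auto simp: b_def algebra_simps)
  have "(SUM j:insert x I. M i j * b j) = L i" if "i : insert x I" for i proof (cases "i = x")
   case True
   have "b x = s" by (simp add: b_def)
   have "(SUM j:insert x I. M x j * b j) = M x x * s + (SUM j:I. M x j * b j)"
   using insert.hyps \<open>b x = s\<close> by simp
   also have "... = s * D + (SUM j:I. M x j * b0 j)" unfolding bI D_def by (simp add: algebra_simps)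
   finally have "(SUM j:insert x I. M x j * b j) = s * D + (SUM j:I. M x j * b0 j)" .
   thus ?thesis using True False by (simp add: s_def)
  next
   case F: False
   hence "i : I" using that by simp
   have "b x = s" by (simp add: b_def)
   have "M i x = M x i" using \<open>i : I\<close> insert.prems(1) by blast
   have "(SUM j:insert x I. M i j * b j) = M i x * b x + (SUM j:I. M i j * b j)" using insert.hyps by simp
   also have "... = M i x * s + (L i - s * M x i)" unfolding bI \<open>b x = s\<close> using b0 p \<open>i : I\<close> by simp
   also have "... = L i" using \<open>M i x = M x i\<close> by simp
   finally show ?thesis .
  qed
  hence "ALL i:insert x I. (SUM j:insert x I. M i j * b j) = L i" by (rule ballI)
  thus ?thesis by (rule exI[of "%b. ALL i:insert x I. (SUM j:insert x I. M i j * b j) = L i" b])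
 qed
qed

text \<open>Each coordinate is the pairing with a dual vector, obtained by solving the system for a
  unit right-hand side, so Cauchy-Schwarz bounds it. The constant is explicit and no compactness of
  a unit sphere is invoked.\<close>

lemma pd_coercive:
 assumes fin: "finite I" and sym: "ALL i:I. ALL j:I. M i j = M j i" and psd: "ALL a. 0 <= qf I M a a"
  and pd: "!!a i. qf I M a a = 0 ==> i : I ==> a i = 0" shows "EX C>0. ALL a. (SUM i:I. (a i)^2) <= C * qf I M a a"
proof -
 have "EX b. ALL i:I. (SUM j:I. M i j * b j) = (if i = x then 1 else 0)" for x
  using pd by (intro psd_solve fin sym psd) (auto intro!: sum.neutral)
 then obtain b where b: "!!x i. i : I ==> (SUM j:I. M i j * b x j) = (if i = x then 1 else 0)" by metis
 have e: "a x = qf I M a (b x)" if "x : I" for a x proof -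
  have "qf I M a (b x) = (SUM i:I. a i * (SUM j:I. M i j * b x j))"
   unfolding qf_def by (simp add: sum_distrib_left mult.assoc mult.commute mult.left_commute)
  also have "... = (SUM i:I. a i * (if i = x then 1 else 0))" using b by (auto intro!: sum.cong)
  finally show ?thesis using that fin by (simp add: if_distrib[of "%z. _ * z"] cong: if_cong)
 qed
 define C where "C = 1 + (SUM x:I. qf I M (b x) (b x))"
 have C: "C > 0" unfolding C_def using psd by (simp add: add_pos_nonneg sum_nonneg)
 have "(SUM i:I. (a i)^2) <= C * qf I M a a" for a proof -
  have "(SUM i:I. (a i)^2) <= (SUM i:I. qf I M a a * qf I M (b i) (b i))"
   using e qf_CS[OF sym psd] by (intro sum_mono) metis
  also have "... = qf I M a a * (C - 1)" by (simp add: C_def sum_distrib_left)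
  also have "... <= C * qf I M a a" using psd by (simp add: algebra_simps)
  finally show ?thesis .
 qed
 with C show ?thesis by blast
qed

section \<open>Polynomials in two variables\<close>

definition idx :: "int => (nat \<times> nat) set" where
 "idx m = {(i, j). int (i + j) <= m}"

definition mon :: "point => nat \<times> nat => real" where
 "mon x k = (x $ 1) ^ fst k * (x $ 2) ^ snd k"

lemma finite_idx [simp]: "finite (idx m)" proof (rule finite_subset)
 show "idx m <= {..nat m} \<times> {..nat m}" by (auto simp: idx_def)
qed simp

lemma Pol_iff: "p : Pol m <-> (EX c. p = (%x. SUM k:idx m. c k * mon x k))" proof -
 have *: "(SUM (i, j):{(i, j). int (i + j) <= m}. c i j * (x $ 1) ^ i * (x $ 2) ^ j) =
   (SUM k:idx m. c (fst k) (snd k) * mon x k)" for c and x :: point unfolding idx_def mon_def by (intro sum.cong) auto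
 show ?thesis proof
  assume "p : Pol m"
  thus "EX c. p = (%x. SUM k:idx m. c k * mon x k)" unfolding Pol_def * by fast
 next
  assume "EX c. p = (%x. SUM k:idx m. c k * mon x k)"
  then obtain c where c: "p = (%x. SUM k:idx m. c k * mon x k)" by blast
  show "p : Pol m" unfolding Pol_def * by (rule CollectI, rule exI[of _ "%i j. c (i, j)"]) (simp add: c)
 qed
qed

lemma Pol_zero [simp, intro]: "(%_. 0) : Pol m" unfolding Pol_iff by (rule exI[of _ "%_. 0"]) simp

lemma Pol_lin:
 assumes "p : Pol m" "q : Pol m" shows "(%x. a * p x + b * q x) : Pol m" proof -
 obtain c d where "p = (%x. SUM k:idx m. c k * mon x k)" "q = (%x. SUM k:idx m. d k * mon x k)"
  using assms unfolding Pol_iff by blast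
 thus ?thesis unfolding Pol_iff
  by (intro exI[of _ "%k. a * c k + b * d k"]) (simp add: algebra_simps sum.distrib sum_distrib_left)
qed

lemma Pol_add [intro]: "p : Pol m ==> q : Pol m ==> (%x. p x + q x) : Pol m" using Pol_lin[of p m q 1 1] by simp

lemma Pol_diff [intro]: "p : Pol m ==> q : Pol m ==> (%x. p x - q x) : Pol m" using Pol_lin[of p m q 1 "-1"] by simp

lemma Pol_smult [intro]: "p : Pol m ==> (%x. a * p x) : Pol m" using Pol_lin[of p m p a 0] by simp

lemma Pol_sum: "(!!i. i : I ==> p i : Pol m) ==> (%x. SUM i:I. p i x) : Pol m"
 by (induction I rule: infinite_finite_induct) auto

lemma Pol_mon: "k : idx m ==> (%x. mon x k) : Pol m" unfolding Pol_iff by (rule exI[of _ "%l. if l = k then 1 else 0"])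
   (simp add: if_distrib[of "%z. z * _"] cong: if_cong)

lemma Pol_induct [consumes 1, case_names zero add mono]:
 assumes "p : Pol m" "Q (%_. 0)" "!!p q. p : Pol m ==> q : Pol m ==> Q p ==> Q q ==> Q (%x. p x + q x)"
  "!!a k. k : idx m ==> Q (%x. a * mon x k)" shows "Q p" proof -
 obtain c where c: "p = (%x. SUM k:idx m. c k * mon x k)" using assms(1) unfolding Pol_iff by blast
 have "J <= idx m ==> Q (%x. SUM k:J. c k * mon x k) & (%x. SUM k:J. c k * mon x k) : Pol m" if "finite J" for J
  using that proof (induction J rule: finite_induct)
  case (insert x J)
  hence "(%y. c x * mon y x) : Pol m" by (intro Pol_smult Pol_mon) auto
  thus ?case using insert assms(3)[of "%y. c x * mon y x" "%y. SUM k:J. c k * mon y k"] assms(4)[of x "c x"]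
   by (auto intro!: Pol_add)
 qed (use assms(2) in simp)
 from this[OF finite_idx] show ?thesis using c by simp
qed

lemma Pol_mono: "p : Pol m ==> m <= n ==> p : Pol n"
 by (induction rule: Pol_induct) (auto simp: idx_def intro!: Pol_smult Pol_mon)

lemma Pol_const: "0 <= m ==> (%_. a) : Pol m"
 using Pol_smult[OF Pol_mon[of "(0, 0)" m], of a] by (simp add: idx_def mon_def)

lemma Pol_coord: "(%x. x $ i) : Pol 1" proof -
 have "(%x. x $ 1) : Pol 1" "(%x. x $ 2) : Pol 1"
  using Pol_mon[of "(1, 0)" 1] Pol_mon[of "(0, 1)" 1] by (simp_all add: idx_def mon_def)
 thus ?thesis using exhaust_2[of i] by auto
qed

lemma Pol_neg: "m < 0 ==> p : Pol m <-> p = (%_. 0)" unfolding Pol_iff idx_def by (auto simp: fun_eq_iff)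

lemma Pol_mult:
 assumes "p : Pol m" "q : Pol n" shows "(%x. p x * q x) : Pol (m + n)" using assms(1) proof (induction rule: Pol_induct)
 case (mono a k)
 show ?case using assms(2) proof (induction rule: Pol_induct)
  case (mono b l)
  have "(fst k + fst l, snd k + snd l) : idx (m + n)"
   using mono.hyps \<open>k : idx m\<close> mono unfolding idx_def by auto
  from Pol_smult[OF Pol_mon[OF this], of "a * b"] show ?case by (simp add: mon_def power_add mult_ac)
 qed (auto simp: distrib_left)
qed (auto simp: distrib_right)

lemma Pol_power: "p : Pol m ==> (%x. p x ^ n) : Pol (int n * m)" proof (induction n)
 case (Suc n)
 thus ?case using Pol_mult[of p m "%x. p x ^ n" "int n * m"] by (simp add: algebra_simps)
qed (simp add: Pol_const)

lemma Pol_prod: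
 "finite I ==> (!!i. i : I ==> p i : Pol 1) ==> (%x. PROD i:I. p i x) : Pol (int (card I))"
proof (induction I rule: finite_induct)
 case (insert i I)
 thus ?case using Pol_mult[of "p i" 1 "%x. PROD i:I. p i x" "int (card I)"] by simp
qed (simp add: Pol_const)

lemma Pol_comp:
 assumes "p : Pol m" and f: "!!i. (%x. f x $ i) : Pol 1" shows "(%x. p (f x)) : Pol m" using assms(1)
proof (induction rule: Pol_induct)
 case (mono a k)
 have "(%x. (f x $ 1) ^ fst k * (f x $ 2) ^ snd k) : Pol (int (fst k) * 1 + int (snd k) * 1)"
  by (intro Pol_mult Pol_power f)
 moreover have "int (fst k) * 1 + int (snd k) * 1 <= m" using mono by (auto simp: idx_def)
 ultimately show ?case unfolding mon_def by (intro Pol_smult) (rule Pol_mono)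
qed auto

lemma Pol_inner: "(%x. n <.> (x - a)) : Pol 1" proof -
 have "(%x. n $ 1 * x $ 1 + n $ 2 * x $ 2 - n <.> a) : Pol 1"
  by (intro Pol_add Pol_diff Pol_smult Pol_coord Pol_const) simp
 thus ?thesis by (simp add: inner_vec_def sum_2 algebra_simps)
qed

lemma Pol_deriv:
 assumes "p : Pol m"
 shows "EX p1:Pol (m - 1). EX p2:Pol (m - 1). ALL x. (p has_derivative (%h. p1 x * h $ 1 + p2 x * h $ 2)) (at x)"
 using assms proof (induction rule: Pol_induct)
 case zero
 have "ALL x. ((%_. 0) has_derivative (%h. 0 * h $ 1 + 0 * h $ 2)) (at (x::point))" by simp
 thus ?case by (intro bexI[of _ "%_. 0"]) (use Pol_zero in blast)+
next
 case (add p q)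
 then obtain p1 p2 q1 q2 where *: "p1 : Pol (m - 1)" "p2 : Pol (m - 1)" "q1 : Pol (m - 1)" "q2 : Pol (m - 1)"
  "ALL x. (p has_derivative (%h. p1 x * h $ 1 + p2 x * h $ 2)) (at x)"
  "ALL x. (q has_derivative (%h. q1 x * h $ 1 + q2 x * h $ 2)) (at x)" by blast
 have "ALL x. ((%x. p x + q x) has_derivative (%h. (p1 x + q1 x) * h $ 1 + (p2 x + q2 x) * h $ 2)) (at x)"
  using *(5,6) by (auto intro!: derivative_eq_intros simp: algebra_simps)
 moreover have "(%x. p1 x + q1 x) : Pol (m - 1)" "(%x. p2 x + q2 x) : Pol (m - 1)" using * by auto
 ultimately show ?case by (intro bexI[of _ "%x. p1 x + q1 x"] bexI[of _ "%x. p2 x + q2 x"])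
next
 case (mono a k)
 obtain i j where k: "k = (i, j)" by (cases k)
 define p1 where "p1 = (%x::point. a * real i * (x $ 1) ^ (i - 1) * (x $ 2) ^ j)"
 define p2 where "p2 = (%x::point. a * real j * (x $ 1) ^ i * (x $ 2) ^ (j - 1))"
 have "p1 : Pol (m - 1)" proof (cases "i = 0")
  case False
  hence "(i - 1, j) : idx (m - 1)" using mono k by (auto simp: idx_def)
  from Pol_smult[OF Pol_mon[OF this], of "a * real i"] show ?thesis by (simp add: p1_def mon_def mult.assoc)
 qed (simp add: p1_def)
 moreover have "p2 : Pol (m - 1)" proof (cases "j = 0")
  case False
  hence "(i, j - 1) : idx (m - 1)" using mono k by (auto simp: idx_def)
  from Pol_smult[OF Pol_mon[OF this], of "a * real j"] show ?thesis by (simp add: p2_def mon_def mult_ac)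
 qed (simp add: p2_def)
 moreover have "ALL x. ((%x. a * mon x k) has_derivative (%h. p1 x * h $ 1 + p2 x * h $ 2)) (at x)"
  unfolding mon_def p1_def p2_def k
  by (auto intro!: derivative_eq_intros bounded_linear.has_derivative[OF bounded_linear_vec_nth has_derivative_ident]
   simp: algebra_simps)
 ultimately show ?case by blast
qed

lemma partial_eq:
 assumes "(p has_derivative (%h. a * h $ 1 + b * h $ 2)) (at x)" shows "partial 1 p x = a" and "partial 2 p x = b"
 unfolding partial_def frechet_derivative_at[OF assms, symmetric] by (simp_all add: axis_def)

lemma Pol_partial: "p : Pol m ==> partial i p : Pol (m - 1)" proof -
 assume "p : Pol m"
 then obtain p1 p2 where *: "p1 : Pol (m - 1)" "p2 : Pol (m - 1)"
   "ALL x. (p has_derivative (%h. p1 x * h $ 1 + p2 x * h $ 2)) (at x)" using Pol_deriv by blast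
 hence "partial 1 p = p1" "partial 2 p = p2" using partial_eq by blast+
 thus ?thesis using *(1,2) exhaust_2[of i] by auto
qed

lemma differentiable_partial:
 assumes "p differentiable (at x)" shows "(p has_derivative (%h. partial 1 p x * h $ 1 + partial 2 p x * h $ 2)) (at x)"
proof -
 have d: "(p has_derivative frechet_derivative p (at x)) (at x)" using assms frechet_derivative_works by blast
 interpret bounded_linear "frechet_derivative p (at x)" using d by (rule has_derivative_bounded_linear)
 have "frechet_derivative p (at x) h = partial 1 p x * h $ 1 + partial 2 p x * h $ 2" for h :: point proof -
  have "h = (h $ 1) *R axis 1 1 + (h $ 2) *R axis 2 1" by (simp add: vec_eq_iff axis_def forall_2)
  hence "frechet_derivative p (at x) h =
   frechet_derivative p (at x) ((h $ 1) *R axis 1 1 + (h $ 2) *R axis 2 1)" by simp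
  thus ?thesis unfolding partial_def by (simp add: add scaleR)
 qed
 hence "frechet_derivative p (at x) = (%h. partial 1 p x * h $ 1 + partial 2 p x * h $ 2)" by blast
 thus ?thesis using d by simp
qed

lemma Pol_has_derivative:
 "p : Pol m ==> (p has_derivative (%h. partial 1 p x * h $ 1 + partial 2 p x * h $ 2)) (at x)"
 by (rule differentiable_partial) (unfold differentiable_def, use Pol_deriv in blast)

lemma Pol_continuous: "p : Pol m ==> continuous_on S p"
 by (intro continuous_at_imp_continuous_on ballI) (rule has_derivative_continuous[OF Pol_has_derivative])

lemma Pol_C1: "p : Pol m ==> C1_fun p" unfolding C1_fun_def
 by (auto intro!: Pol_continuous Pol_partial simp: differentiable_def intro: Pol_has_derivative)

text \<open>The map \<open>\<pi>\<close> shifts \<open>x\<close> along \<open>w\<close> by a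
  multiple of the linear form, so \<open>p\<close> and its pull back agree on the zero set of the
  form. With \<open>\<pi>\<close> the orthogonal projection to an edge line, this splits off the
  factor of that edge.\<close>

lemma Pol_division:
 assumes "p : Pol m" "!!x. \<pi> x = x + ((n <.> (x - a)) * s) *R w"
 shows "EX q:Pol (m - 1). ALL x. p x - p (\<pi> x) = n <.> (x - a) * q x" proof -
 define l where "l x = n <.> (x - a)" for x :: point
 have l: "l : Pol 1" unfolding l_def by (rule Pol_inner)
 have coord: "(%x. \<pi> x $ i) : Pol 1" for i
  unfolding assms(2) using Pol_add[OF Pol_coord Pol_smult[OF l, of "s * w $ i"], of i]
  by (simp add: l_def algebra_simps)
 have dif: "x $ i - \<pi> x $ i = l x * (- s * w $ i)" for x i unfolding assms(2) l_def by simp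
 \<comment> \<open>Powers telescope: the difference at exponent \<open>Suc k\<close> is
   \<open>x $ i\<close> times the difference at \<open>k\<close>, plus the first-power difference
   times a power.\<close>
 have P: "EX q:Pol (int k - 1). ALL x. (x $ i) ^ k - (\<pi> x $ i) ^ k = l x * q x" for i k proof (induction k)
  case (Suc k)
  then obtain q where q: "q : Pol (int k - 1)" "ALL x. (x $ i) ^ k - (\<pi> x $ i) ^ k = l x * q x" by blast
  define r where "r = (%x::point. x $ i * q x + (- s * w $ i) * (\<pi> x $ i) ^ k)"
  have "(%x::point. x $ i * q x) : Pol (1 + (int k - 1))" by (intro Pol_mult Pol_coord q)
  moreover have "(%x. (\<pi> x $ i) ^ k) : Pol (int k)" using Pol_power[OF coord, of i k] by simp
  ultimately have "r : Pol (int (Suc k) - 1)" unfolding r_def by (intro Pol_add Pol_smult) auto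
  moreover have "(x $ i) ^ Suc k - (\<pi> x $ i) ^ Suc k = l x * r x" for x proof -
   have "(x $ i) ^ Suc k - (\<pi> x $ i) ^ Suc k =
   x $ i * ((x $ i) ^ k - (\<pi> x $ i) ^ k) + (x $ i - \<pi> x $ i) * (\<pi> x $ i) ^ k" by (simp add: algebra_simps)
   also have "... = l x * r x" unfolding dif q(2)[rule_format] r_def by (simp add: algebra_simps)
   finally show ?thesis .
  qed
  ultimately show ?case by blast
 qed (auto intro!: bexI[of _ "%_. 0"])
 show ?thesis unfolding l_def[symmetric] using assms(1) proof (induction rule: Pol_induct)
  case zero
  show ?case by (auto intro!: bexI[of _ "%_. 0"])
 next
  case (add p q)
  then obtain p' q' where *: "p' : Pol (m - 1)" "q' : Pol (m - 1)"
   "ALL x. p x - p (\<pi> x) = l x * p' x" "ALL x. q x - q (\<pi> x) = l x * q' x" by blast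
  have "p x + q x - (p (\<pi> x) + q (\<pi> x)) = l x * (p' x + q' x)" for x proof -
   have "p x + q x - (p (\<pi> x) + q (\<pi> x)) = (p x - p (\<pi> x)) + (q x - q (\<pi> x))" by simp
   also have "... = l x * (p' x + q' x)" unfolding *(3)[rule_format] *(4)[rule_format] by (simp add: distrib_left)
   finally show ?thesis .
  qed
  with * show ?case by (intro bexI[of _ "%x. p' x + q' x"]) auto
 next
  case (mono c k)
  obtain i j where k: "k = (i, j)" by (cases k)
  obtain q1 q2 where q: "q1 : Pol (int i - 1)" "ALL x. (x $ 1) ^ i - (\<pi> x $ 1) ^ i = l x * q1 x"
   "q2 : Pol (int j - 1)" "ALL x. (x $ 2) ^ j - (\<pi> x $ 2) ^ j = l x * q2 x" using P by meson
  define r where "r = (%x. c * (q1 x * (x $ 2) ^ j + (\<pi> x $ 1) ^ i * q2 x))"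
  have ij: "int i + int j <= m" using mono k by (simp add: idx_def)
  have "(%x::point. q1 x * (x $ 2) ^ j) : Pol ((int i - 1) + int j * 1)" by (intro Pol_mult Pol_power Pol_coord q)
  moreover have "(%x::point. (\<pi> x $ 1) ^ i * q2 x) : Pol (int i * 1 + (int j - 1))"
   by (intro Pol_mult Pol_power coord q)
  ultimately have "r : Pol (m - 1)" unfolding r_def using ij by (intro Pol_add Pol_smult) (auto elim!: Pol_mono)
  moreover have "c * mon x k - c * mon (\<pi> x) k = l x * r x" for x proof -
   have "c * mon x k - c * mon (\<pi> x) k =
   c * (((x $ 1) ^ i - (\<pi> x $ 1) ^ i) * (x $ 2) ^ j + (\<pi> x $ 1) ^ i * ((x $ 2) ^ j - (\<pi> x $ 2) ^ j))"
   unfolding mon_def k by (simp add: algebra_simps)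
   also have "... = l x * r x" unfolding q(2)[rule_format] q(4)[rule_format] r_def by (simp add: algebra_simps)
   finally show ?thesis .
  qed
  ultimately show ?case by blast
 qed
qed

lemma Pol_line:
 assumes "p : Pol (int m)" shows "EX c. ALL t. p (a + t *R d) = (SUM j<=m. c j * t ^ j)" proof -
 have mul: "EX c. ALL t. (x + t * y) * (SUM j<=n. e j * t ^ j) = (SUM j<=Suc n. c j * t ^ j)" for x y :: real and e n
 proof (intro exI allI)
  fix t
  have "(SUM j<=Suc n. ((if j <= n then x * e j else 0) + (if j = 0 then 0 else y * e (j - 1))) * t ^ j) =
   (SUM j<=Suc n. (if j <= n then x * e j else 0) * t ^ j) + (SUM j<=Suc n. (if j = 0 then 0 else y * e (j - 1)) * t ^ j)"
   by (simp add: distrib_right sum.distrib)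
  also have "(SUM j<=Suc n. (if j <= n then x * e j else 0) * t ^ j) = x * (SUM j<=n. e j * t ^ j)"
   by (auto simp: sum_distrib_left mult.assoc intro!: sum.cong)
  also have "(SUM j<=Suc n. (if j = 0 then 0 else y * e (j - 1)) * t ^ j) = t * y * (SUM j<=n. e j * t ^ j)"
   by (subst sum.atMost_Suc_shift) (simp add: sum_distrib_left mult_ac)
  finally show "(x + t * y) * (SUM j<=n. e j * t ^ j) =
   (SUM j<=Suc n. ((if j <= n then x * e j else 0) + (if j = 0 then 0 else y * e (j - 1))) * t ^ j)"
   by (simp add: algebra_simps)
 qed
 have up: "EX c. ALL t. q t = (SUM j<=m'. c j * t ^ j)"
  if ex: "EX c::nat => real. ALL t. q t = (SUM j<=n. c j * t ^ j)" and "n <= m'" for q :: "real => real" and n m'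
 proof -
  obtain c where c: "ALL t. q t = (SUM j<=n. c j * t ^ j)" using ex by (rule exE)
  have "(SUM j<=m'. (if j <= n then c j else 0) * t ^ j) = (SUM j<=n. c j * t ^ j)" for t
   using \<open>n <= m'\<close> by (intro sum.mono_neutral_cong_right) auto
  thus ?thesis using c by (intro exI[of _ "%j. if j <= n then c j else 0"]) simp
 qed
 have pw: "EX c. ALL t. (x + t * y) ^ i * (x' + t * y') ^ j = (SUM l<=i+j. c l * t ^ l)" for x y x' y' :: real and i j
 proof (induction i)
  case 0
  show ?case proof (induction j)
   case 0
   show ?case by (rule exI[of _ "%_. 1"]) simp
  next
   case (Suc j)
   then obtain c where c: "ALL t. (x' + t * y') ^ j = (SUM l<=j. c l * t ^ l)" by auto
   from mul[of x' y' c j] obtain e where "ALL t. (x' + t * y') * (x' + t * y') ^ j = (SUM l<=Suc j. e l * t ^ l)"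
   unfolding c[rule_format, symmetric] by (rule exE)
   thus ?case by (intro exI[of _ e]) simp
  qed
 next
  case (Suc i)
  then obtain c where c: "ALL t. (x + t * y) ^ i * (x' + t * y') ^ j = (SUM l<=i+j. c l * t ^ l)" by auto
  from mul[of x y c "i + j"] obtain e where
   "ALL t. (x + t * y) * ((x + t * y) ^ i * (x' + t * y') ^ j) = (SUM l<=Suc (i + j). e l * t ^ l)"
   unfolding c[rule_format, symmetric] by (rule exE)
  thus ?case by (intro exI[of _ e]) (simp add: mult.assoc)
 qed
 show ?thesis using assms proof (induction rule: Pol_induct)
  case zero
  show ?case by (rule exI[of _ "%_. 0"]) simp
 next
  case (add p q)
  then obtain c e where "ALL t. p (a + t *R d) = (SUM j<=m. c j * t ^ j)"
   "ALL t. q (a + t *R d) = (SUM j<=m. e j * t ^ j)" by blast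
  thus ?case by (intro exI[of _ "%j. c j + e j"]) (simp add: distrib_right sum.distrib)
 next
  case (mono b k)
  obtain i j where k: "k = (i, j)" by (cases k)
  have ij: "i + j <= m" using mono k by (simp add: idx_def)
  obtain c where c: "ALL t. (a $ 1 + t * d $ 1) ^ i * (a $ 2 + t * d $ 2) ^ j = (SUM l<=m. c l * t ^ l)"
   using up[OF pw[of "a $ 1" "d $ 1" i "a $ 2" "d $ 2" j] ij] by (rule exE)
  show ?case by (rule exI[of _ "%l. b * c l"]) (simp add: mon_def k c sum_distrib_left mult.assoc)
 qed
qed

text \<open>Finiteness of roots is applied once in each variable: on a small square every slice
  polynomial in the first coordinate vanishes identically, then every coefficient polynomial in the
  second. This is the linear independence of the monomials on any disk.\<close>

lemma Pol_vanish:
 assumes "e > 0" "!!x. x : ball z e ==> (SUM k:idx m. c k * mon x k) = 0" "k : idx m" shows "c k = 0" proof -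
 define n where "n = nat m"
 define d where "d = (%i j. if (i, j) : idx m then c (i, j) else 0)"
 have sub: "idx m <= {..n} \<times> {..n}" by (auto simp: idx_def n_def)
 have S: "(SUM k:idx m. c k * mon x k) = (SUM i<=n. (SUM j<=n. d i j * (x $ 2) ^ j) * (x $ 1) ^ i)" for x proof -
  have "(SUM i<=n. (SUM j<=n. d i j * (x $ 2) ^ j) * (x $ 1) ^ i) =
   (SUM k:{..n} \<times> {..n}. d (fst k) (snd k) * mon x k)" unfolding sum_distrib_right sum.cartesian_product
   by (intro sum.cong) (auto simp: mon_def)
  also have "... = (SUM k:idx m. c k * mon x k)" using sub by (intro sum.mono_neutral_cong_right) (auto simp: d_def)
  finally show ?thesis by simp
 qed
 have inf: "infinite {y - e/2<..<y + e/2 :: real}" for y using assms(1) infinite_Ioo[of "y - e/2" "y + e/2"] by simp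
 have "d i j = 0" if ij: "i <= n" "j <= n" for i j proof -
  have 1: "(SUM j<=n. d i j * b ^ j) = 0" if b: "b : {z $ 2 - e/2<..<z $ 2 + e/2}" for b proof (rule ccontr)
   assume "(SUM j<=n. d i j * b ^ j) ~= 0"
   hence "finite {a. (SUM i<=n. (SUM j<=n. d i j * b ^ j) * a ^ i) = 0}" using ij by (subst polyfun_finite_roots) blast
   moreover have "{z $ 1 - e/2<..<z $ 1 + e/2} <= {a. (SUM i<=n. (SUM j<=n. d i j * b ^ j) * a ^ i) = 0}" proof
   fix a assume a: "a : {z $ 1 - e/2<..<z $ 1 + e/2}"
   define x :: point where "x = vector [a, b]"
   have "dist z x <= \<bar>z $ 1 - a\<bar> + \<bar>z $ 2 - b\<bar>"
   unfolding dist_norm by (rule order_trans[OF norm_le_l1_cart]) (simp add: sum_2 x_def)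
   also have "... < e" using a b by (simp add: abs_if)
   finally have "(SUM k:idx m. c k * mon x k) = 0" using assms(2) by simp
   thus "a : {a. (SUM i<=n. (SUM j<=n. d i j * b ^ j) * a ^ i) = 0}" unfolding S by (simp add: x_def)
   qed
   ultimately show False using inf finite_subset by blast
  qed
  show "d i j = 0" proof (rule ccontr)
   assume "d i j ~= 0"
   hence "finite {b. (SUM j<=n. d i j * b ^ j) = 0}" using ij by (subst polyfun_finite_roots) blast
   moreover have "{z $ 2 - e/2<..<z $ 2 + e/2} <= {b. (SUM j<=n. d i j * b ^ j) = 0}" using 1 by blast
   ultimately show False using inf finite_subset by blast
  qed
 qed
 moreover have "fst k <= n" "snd k <= n" using assms(3) sub by auto
 ultimately have "d (fst k) (snd k) = 0" by blast
 moreover have "d (fst k) (snd k) = c k" using assms(3) unfolding d_def by simp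
 ultimately show ?thesis by simp
qed

section \<open>Norm estimates for polynomials\<close>

lemma compact_leb: "compact S ==> S : sets lebesgue" using lmeasurable_compact fmeasurableD by blast

lemma int_cont:
 fixes f :: "'a::euclidean_space => 'b::euclidean_space"
 assumes "compact S" "continuous_on S f" shows "integrable (leb S) f" proof -
 have S: "S : lmeasurable" using assms(1) by (rule lmeasurable_compact)
 interpret finite_measure "leb S" using S by (rule finite_measure_lebesgue_on)
 have "bounded (f ` S)" using assms compact_continuous_image compact_imp_bounded by blast
 then obtain B where "ALL x:S. norm (f x) <= B" unfolding bounded_iff by auto
 thus ?thesis using assms S by (intro integrable_const_bound[of f B] cont_meas)
   (auto intro!: AE_I2 simp: fmeasurable_def)
qed

lemma integral_sq_zero_imp:
 fixes f :: "'a::euclidean_space => real"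
 assumes "compact S" "continuous_on S f" "(LINT x|leb S. (f x)^2) = 0" "x : interior S" shows "f x = 0"
proof (rule ccontr)
 assume nz: "f x ~= 0"
 have S: "S : sets lebesgue" using assms(1) by (rule compact_leb)
 have "integrable (leb S) (%x. (f x)^2)" using assms(1,2) by (intro int_cont continuous_intros)
 hence "AE x in leb S. (f x)^2 = 0" using assms(3) by (subst integral_nonneg_eq_0_iff_AE[symmetric]) auto
 hence "AE x in lebesgue. x : S --> (f x)^2 = 0" by (subst (asm) AE_restrict_space_iff) (use S in auto)
 then obtain N where N: "negligible N" "{x. ~ (x : S --> (f x)^2 = 0)} <= N"
  unfolding eventually_ae_filter_negligible by blast
 define U where "U = {y : interior S. f y : - {0}}"
 have "open U" unfolding U_def by (rule continuous_open_preimage[unfolded vimage_def, simplified Int_def, simplified])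
   (use assms(2) continuous_on_subset interior_subset in blast, auto)
 moreover have "x : U" using nz assms(4) by (simp add: U_def)
 moreover have "U <= N" using N(2) interior_subset unfolding U_def by force
 ultimately show False using N(1) negligible_subset open_not_negligible by (metis empty_iff)
qed

text \<open>Norm equivalence on a finite-dimensional function space: the Gram matrix of the family
  is positive definite by independence on the interior, hence coercive.\<close>

lemma coefficient_bound:
 fixes f :: "'i => 'a::euclidean_space => real"
 assumes "finite I" "compact S" "!!i. i : I ==> continuous_on S (f i)"
  "!!c i. (!!x. x : interior S ==> (SUM i:I. c i * f i x) = 0) ==> i : I ==> c i = 0"
 shows "EX C>0. ALL c. (SUM i:I. (c i)^2) <= C * (LINT x|leb S. (SUM i:I. c i * f i x)^2)" proof -
 define M where "M i j = (LINT x|leb S. f i x * f j x)" for i j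
 have q: "qf I M c c = (LINT x|leb S. (SUM i:I. c i * f i x)^2)" for c proof -
  have "(SUM i:I. c i * f i x)^2 = (SUM i:I. SUM j:I. c i * c j * (f i x * f j x))" for x
   unfolding power2_eq_square sum_product by (simp add: mult_ac)
  moreover have "integrable (leb S) (%x. f i x * f j x)" if "i : I" "j : I" for i j
   using assms that by (intro int_cont continuous_intros) auto
  ultimately show ?thesis unfolding qf_def M_def by (simp add: integrable_sum)
 qed
 have "EX C>0. ALL a. (SUM i:I. (a i)^2) <= C * qf I M a a" proof (rule pd_coercive)
  show "ALL a. 0 <= qf I M a a" unfolding q by (auto intro!: integral_nonneg_AE)
  fix a i assume "qf I M a a = 0" "i : I"
  have "continuous_on S (%x. SUM i:I. a i * f i x)" using assms(3) by (intro continuous_intros) auto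
  hence "(SUM i:I. a i * f i x) = 0" if "x : interior S" for x
   using integral_sq_zero_imp[of S "%x. SUM i:I. a i * f i x"] assms(2) that
   \<open>qf I M a a = 0\<close> unfolding q by simp
  thus "a i = 0" using assms(4) \<open>i : I\<close> by blast
 qed (auto simp: assms M_def mult.commute)
 thus ?thesis unfolding q .
qed

text \<open>One substitution rule that serves the scaling of disks, the exchange of coordinates and
  the passage from the reference triangle.\<close>

lemma affine_subst:
 fixes f :: "point => real" and z a b :: point
 defines "g == %x::point. z + (x $ 1) *R a + (x $ 2) *R b"
 assumes D: "a $ 1 * b $ 2 - a $ 2 * b $ 1 ~= 0" and S: "compact S" and f: "continuous_on (g ` S) f"
 shows "(LINT y|leb (g ` S). f y) = \<bar>a $ 1 * b $ 2 - a $ 2 * b $ 1\<bar> * (LINT x|leb S. f (g x))" proof -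
 define D where "D = a $ 1 * b $ 2 - a $ 2 * b $ 1"
 define L where "L = (%x::point. (x $ 1) *R a + (x $ 2) *R b)"
 have "bounded_linear L" unfolding L_def
  by (intro bounded_linear_add bounded_linear_scaleR_left[THEN bounded_linear_compose] bounded_linear_vec_nth)
 have der: "(g has_derivative L) (at x within S)" for x proof -
  have "((%x. z + L x) has_derivative L) (at x within S)"
   using bounded_linear.has_derivative[OF \<open>bounded_linear L\<close> has_derivative_ident]
   by (auto intro!: derivative_eq_intros)
  thus ?thesis by (simp add: g_def L_def add.assoc)
 qed
 have det: "det (matrix L) = D" proof -
  have "L (axis 1 1) = a" "L (axis 2 1) = b" unfolding L_def by (simp_all add: axis_def)
  hence "matrix L $ i $ 1 = a $ i" "matrix L $ i $ 2 = b $ i" for i unfolding matrix_def by simp_all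
  thus ?thesis unfolding det_2 D_def by (simp add: mult.commute)
 qed
 have cg: "continuous_on S g" by (rule has_derivative_continuous_on) (rule der)
 have inj: "inj_on g S" proof (rule inj_onI)
  fix x y assume "g x = g y"
  hence *: "(x $ 1 - y $ 1) * a $ i + (x $ 2 - y $ 2) * b $ i = 0" for i
   unfolding g_def by (simp add: vec_eq_iff algebra_simps)
  have "(x $ 1 - y $ 1) * D = ((x $ 1 - y $ 1) * a $ 1 + (x $ 2 - y $ 2) * b $ 1) * b $ 2
   - ((x $ 1 - y $ 1) * a $ 2 + (x $ 2 - y $ 2) * b $ 2) * b $ 1" unfolding D_def by (simp add: algebra_simps)
  moreover have "(x $ 2 - y $ 2) * D = ((x $ 1 - y $ 1) * a $ 2 + (x $ 2 - y $ 2) * b $ 2) * a $ 1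
   - ((x $ 1 - y $ 1) * a $ 1 + (x $ 2 - y $ 2) * b $ 1) * a $ 2" unfolding D_def by (simp add: algebra_simps)
  ultimately show "x = y" unfolding * using D by (simp add: D_def vec_eq_iff forall_2)
 qed
 have Sl: "S : sets lebesgue" using S by (rule compact_leb)
 have cgS: "compact (g ` S)" using cg S by (rule compact_continuous_image)
 hence gSl: "g ` S : sets lebesgue" by (rule compact_leb)
 have i1: "integrable (leb (g ` S)) f" using cgS f by (rule int_cont)
 have i2: "integrable (leb S) (%x. f (g x))" by (rule int_cont[OF S continuous_on_compose2[OF f cg subset_refl]])
 \<comment> \<open>The change of variables formula is applied to functions with values in
   \<open>real^1\<close>.\<close>
 let ?v = "%x. (vec (f x) :: real^1)"
 have "f absolutely_integrable_on (g ` S)" using i1 gSl by (simp add: integrable_restrict_space set_integrable_def)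
 hence "?v absolutely_integrable_on (g ` S)" by (simp add: absolutely_integrable_on_1_iff)
 hence "integral (g ` S) ?v = integral S (%x. \<bar>D\<bar> *R ?v (g x))"
  using integral_change_of_variables[OF Sl der inj, where f = ?v] by (simp add: det)
 hence "integral (g ` S) f = integral S (%x. \<bar>D\<bar> * f (g x))" by (simp add: integral_on_1_eq vec_eq_iff)
 thus ?thesis
  using lebesgue_integral_eq_integral[OF i1 gSl] lebesgue_integral_eq_integral[OF i2 Sl] by (simp add: D_def)
qed

lemma cball_scaled: "y : cball z (S * h) ==> h > 0 ==> (y - z) /\<^sub>R h : cball 0 S"
 for y :: "'a::real_normed_vector" proof -
 assume "y : cball z (S * h)" "h > 0"
 hence "norm (y - z) / h <= S" by (simp add: dist_norm norm_minus_commute divide_le_eq)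
 moreover have "norm ((y - z) /\<^sub>R h) = norm (y - z) / h" using \<open>h > 0\<close> by (simp add: divide_inverse mult.commute)
 ultimately show ?thesis by simp
qed

lemma scaling_subst:
 fixes f :: "point => real"
 assumes "h > 0" "R >= 0" "continuous_on (cball z (R * h)) f"
 shows "(LINT y|leb (cball z (R * h)). f y) = h^2 * (LINT x|leb (cball 0 R). f (z + h *R x))" proof -
 have e: "z + (x $ 1) *R (h *R axis 1 1) + (x $ 2) *R (h *R axis 2 1) = z + h *R x" for x :: point
  by (simp add: vec_eq_iff forall_2 axis_def)
 have im: "(%x. z + h *R x) ` cball 0 R = cball z (R * h)" proof (intro equalityI subsetI)
  fix y assume "y : cball z (R * h)"
  hence "y = z + h *R ((y - z) /\<^sub>R h)" "(y - z) /\<^sub>R h : cball 0 R" using assms(1) cball_scaled by auto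
  thus "y : (%x. z + h *R x) ` cball 0 R" by blast
 qed (use assms(1) in \<open>auto simp: dist_norm mult.commute\<close>)
 from affine_subst[of "h *R axis 1 1" "h *R axis 2 1" "cball 0 R" z f, unfolded e im] assms
 show ?thesis by (simp add: axis_def power2_eq_square)
qed

lemma Pol_coefficient_bound:
 assumes "R > 0"
 shows "EX C>0. ALL c. (SUM k:idx m. (c k)^2) <= C * (LINT x|leb (cball 0 R). (SUM k:idx m. c k * mon x k)^2)"
proof (rule coefficient_bound[of "idx m" "cball 0 R" "%k x. mon x k"])
 show "c k = 0" if "!!x. x : interior (cball 0 R) ==> (SUM k:idx m. c k * mon x k) = 0" "k : idx m" for c k
 proof (rule Pol_vanish[where c = c and k = k and z = 0 and m = m and e = R])
  show "(SUM k:idx m. c k * mon x k) = 0" if "x : ball 0 R" for x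
   using that \<open>!!x. x : interior (cball 0 R) ==> (SUM k:idx m. c k * mon x k) = 0\<close> by simp
 qed (use assms that in auto)
 show "continuous_on (cball 0 R) (%x. mon x k)" if "k : idx m" for k using Pol_continuous[OF Pol_mon[OF that]] .
qed simp_all

lemma Pol_scaled_coefficients:
 assumes "p : Pol m" "h ~= 0"
 obtains c where "!!x. p (z + h *R x) = (SUM k:idx m. c k * mon x k)"
  "!!x. p x = (SUM k:idx m. c k * mon ((x - z) /\<^sub>R h) k)" proof -
 have "(%x. (z + h *R x) $ i) : Pol 1" for i
  using Pol_add[OF Pol_const[of 1 "z $ i"] Pol_smult[OF Pol_coord, of h i]] by simp
 hence "(%x. p (z + h *R x)) : Pol m" by (rule Pol_comp[OF assms(1)])
 then obtain c where c: "(%x. p (z + h *R x)) = (%x. SUM k:idx m. c k * mon x k)" unfolding Pol_iff by blast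
 have "p x = (SUM k:idx m. c k * mon ((x - z) /\<^sub>R h) k)" for x
  using fun_cong[OF c, of "(x - z) /\<^sub>R h"] assms(2) by simp
 with fun_cong[OF c] that show thesis by blast
qed

lemma partial_lin:
 assumes "p differentiable (at x)" "q differentiable (at x)"
 shows "partial i (%x. a * p x + b * q x) x = a * partial i p x + b * partial i q x" proof -
 have "((%x. a * p x + b * q x) has_derivative (%h. (a * partial 1 p x + b * partial 1 q x) * h $ 1 +
   (a * partial 2 p x + b * partial 2 q x) * h $ 2)) (at x)"
  using differentiable_partial[OF assms(1)] differentiable_partial[OF assms(2)]
  by (auto intro!: derivative_eq_intros simp: algebra_simps)
 thus ?thesis using partial_eq exhaust_2[of i] by auto
qed

lemma partial_mult:
 assumes "p differentiable (at x)" "q differentiable (at x)"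
 shows "partial i (%x. p x * q x) x = p x * partial i q x + partial i p x * q x" proof -
 have "((%x. p x * q x) has_derivative (%h. (p x * partial 1 q x + partial 1 p x * q x) * h $ 1 +
   (p x * partial 2 q x + partial 2 p x * q x) * h $ 2)) (at x)"
  using differentiable_partial[OF assms(1)] differentiable_partial[OF assms(2)]
  by (auto intro!: derivative_eq_intros simp: algebra_simps)
 thus ?thesis using partial_eq exhaust_2[of i] by auto
qed

lemma Pol_differentiable: "p : Pol m ==> p differentiable (at x)" using Pol_has_derivative differentiable_def by blast

lemma partial_sum:
 assumes "finite I" "!!k. k : I ==> f k differentiable (at x)"
 shows "partial i (%x. SUM k:I. c k * f k x) x = (SUM k:I. c k * partial i (f k) x)" using assms
proof (induction I rule: finite_induct)
 case empty
 have "((%_::point. 0::real) has_derivative (%h. 0 * h $ 1 + 0 * h $ 2)) (at x)" by simp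
 from partial_eq[OF this] show ?case using exhaust_2[of i] by auto
next
 case (insert k I)
 have "(%x. SUM k:I. c k * f k x) differentiable (at x)"
  using insert by (intro differentiable_sum differentiable_mult) auto
 from partial_lin[OF _ this, of "f k" i "c k" 1] show ?case using insert by simp
qed

lemma partial_scaled:
 assumes "p differentiable (at (z + h *R y))" shows "partial i (%y. p (z + h *R y)) y = h * partial i p (z + h *R y)"
proof -
 have "((%y. z + h *R y) has_derivative (%d. h *R d)) (at y)" by (auto intro!: derivative_eq_intros)
 from diff_chain_at[OF this differentiable_partial[OF assms]]
 have "((%y. p (z + h *R y)) has_derivative (%d. (h * partial 1 p (z + h *R y)) * d $ 1 +
   (h * partial 2 p (z + h *R y)) * d $ 2)) (at y)" by (simp add: o_def algebra_simps)
 thus ?thesis using partial_eq exhaust_2[of i] by auto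
qed

lemma sum_mult_sq_le:
 fixes c f :: "'i => real"
 assumes "!!i. i : I ==> \<bar>f i\<bar> <= B"
 shows "(SUM i:I. c i * f i)^2 <= (SUM i:I. (c i)^2) * (real (card I) * B^2)" proof -
 have "(SUM i:I. c i * f i)^2 <= (SUM i:I. (c i)^2) * (SUM i:I. (f i)^2)" by (rule Cauchy_Schwarz_ineq_sum)
 also have "(SUM i:I. (f i)^2) <= (SUM i:I. B^2)"
  using assms by (intro sum_mono) (metis abs_ge_zero abs_le_square_iff abs_of_nonneg order_trans)
 finally show ?thesis by (simp add: mult_left_mono sum_nonneg)
qed

lemma Pol_bounded_family:
 assumes "finite I" "!!k. k : I ==> f k : Pol (m k)" shows "EX B>0. ALL k:I. ALL x:cball 0 S. \<bar>f k x\<bar> <= B"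
 using assms proof (induction I rule: finite_induct)
 case (insert k I)
 then obtain B where B: "B > 0" "ALL k:I. ALL x:cball 0 S. \<bar>f k x\<bar> <= B" by auto
 have "bounded (f k ` cball 0 S)"
  using insert.prems by (intro compact_imp_bounded compact_continuous_image Pol_continuous) auto
 then obtain B' where "ALL x:cball 0 S. \<bar>f k x\<bar> <= B'" unfolding bounded_iff by auto
 have "ALL l:insert k I. ALL x:cball 0 S. \<bar>f l x\<bar> <= max B B'"
  using B(2) \<open>ALL x:cball 0 S. \<bar>f k x\<bar> <= B'\<close> by (auto simp: le_max_iff_disj)
 moreover have "max B B' > 0" using B(1) by simp
 ultimately show ?case by blast
next
 case empty
 show ?case by (rule exI[of _ 1]) simp
qed

lemma mon_bounded: "EX B>0. ALL k:idx m. ALL x:cball 0 S. \<bar>mon x k\<bar> <= B"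
 by (rule Pol_bounded_family[where f = "%k x. mon x k" and m = "%_. m"]) (simp_all add: Pol_mon)

text \<open>Scaling to a reference disk reduces everything to a bound on finitely many coefficients;
  the area element accounts for \<open>h^2\<close> and each derivative costs another factor
  \<open>h\<close>. The evaluation disk \<open>S * h\<close> may be larger than the integration disk
  \<open>R * h\<close>, so values outside the polygon are controlled as well.\<close>

lemma Pol_inverse_estimate:
 assumes "R > 0" shows "EX C>0. ALL p:Pol m. ALL z. ALL h>0. ALL x:cball z (S * h).
  (p x)^2 <= C / h^2 * (LINT y|leb (cball z (R * h)). (p y)^2) &
  (ALL i. (partial i p x)^2 <= C / h^4 * (LINT y|leb (cball z (R * h)). (p y)^2))" proof -
 obtain C where C: "C > 0" "ALL c. (SUM k:idx m. (c k)^2) <=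
   C * (LINT x|leb (cball 0 R). (SUM k:idx m. c k * mon x k)^2)"
  using Pol_coefficient_bound[OF assms, of m] by (elim exE conjE)
 obtain B0 where B0: "B0 > 0" "ALL k:idx m. ALL x:cball 0 S. \<bar>mon x k\<bar> <= B0"
  using mon_bounded[of m S] by (elim exE conjE)
 have "EX B>0. ALL k:idx m. ALL x:cball 0 S. \<bar>partial i (%x. mon x k) x\<bar> <= B" for i
  by (rule Pol_bounded_family[OF finite_idx Pol_partial[OF Pol_mon]])
 then obtain Bi where Bi: "!!i. Bi i > 0" "!!i. ALL k:idx m. ALL x:cball 0 S. \<bar>partial i (%x. mon x k) x\<bar> <= Bi i"
  by metis
 define B where "B = B0 + Bi 1 + Bi 2"
 have B: "B > 0" using B0(1) Bi(1)[of 1] Bi(1)[of 2] by (simp add: B_def)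
 have BB: "\<bar>mon x k\<bar> <= B" "\<bar>partial i (%x. mon x k) x\<bar> <= B" if "k : idx m" "x : cball 0 S" for x k i
 proof -
  show "\<bar>mon x k\<bar> <= B" using B0(2) that Bi(1)[of 1] Bi(1)[of 2] unfolding B_def by force
  have "\<bar>partial i (%x. mon x k) x\<bar> <= Bi i" using Bi(2) that by blast
  thus "\<bar>partial i (%x. mon x k) x\<bar> <= B"
   using B0(1) Bi(1)[of 1] Bi(1)[of 2] exhaust_2[of i] unfolding B_def by auto
 qed
 define K where "K = C * (real (card (idx m)) * B^2) + 1"
 have K: "K > 0" using C(1) by (simp add: K_def add_nonneg_pos)
 have "(p x)^2 <= K / h^2 * (LINT y|leb (cball z (R * h)). (p y)^2) &
  (ALL i. (partial i p x)^2 <= K / h^4 * (LINT y|leb (cball z (R * h)). (p y)^2))"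
  if p: "p : Pol m" and h: "h > 0" and x: "x : cball z (S * h)" for p z h x proof -
  obtain c where c: "!!x. p (z + h *R x) = (SUM k:idx m. c k * mon x k)"
   by (rule Pol_scaled_coefficients[OF p, of h z]) (use h in auto)
  define I where "I = (LINT y|leb (cball z (R * h)). (p y)^2)"
  define y where "y = (x - z) /\<^sub>R h"
  have xy: "x = z + h *R y" using h by (simp add: y_def)
  have y: "y : cball 0 S" unfolding y_def using x h by (rule cball_scaled)
  have "I = h^2 * (LINT x|leb (cball 0 R). (SUM k:idx m. c k * mon x k)^2)" unfolding I_def c[symmetric] using h assms p
   by (intro scaling_subst continuous_intros Pol_continuous) auto
  hence "h^2 * (SUM k:idx m. (c k)^2) <= C * I" using mult_left_mono[OF C(2)[rule_format, of c], of "h^2"] h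
   by (simp add: mult.left_commute)
  hence cI: "(SUM k:idx m. (c k)^2) <= C * I / h^2" using h by (simp add: field_simps)
  have I0: "0 <= I" unfolding I_def by (auto intro!: integral_nonneg_AE)
  have gen: "(SUM k:idx m. c k * f k)^2 <= K * I / h^2" if "!!k. k : idx m ==> \<bar>f k\<bar> <= B" for f proof -
   have "(SUM k:idx m. c k * f k)^2 <= C * I / h^2 * (real (card (idx m)) * B^2)"
   by (rule order_trans[OF sum_mult_sq_le[where I = "idx m" and f = f and B = B, OF that] mult_right_mono[OF cI]]) simp_all
   also have "... = (K - 1) * I / h^2" by (simp add: K_def mult_ac)
   also have "... <= K * I / h^2" using I0 by (intro divide_right_mono mult_right_mono) auto
   finally show ?thesis .
  qed
  have "(p x)^2 <= K * I / h^2" unfolding xy c by (rule gen) (use BB y in auto)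
  moreover have "(partial i p x)^2 <= K / h^4 * I" for i proof -
   have "h * partial i p x = partial i (%y. p (z + h *R y)) y"
   unfolding xy by (rule partial_scaled[symmetric]) (rule Pol_differentiable[OF p])
   also have "... = (SUM k:idx m. c k * partial i (%x. mon x k) y)"
   unfolding c by (rule partial_sum) (auto intro: Pol_differentiable[OF Pol_mon])
   finally have "(h * partial i p x)^2 <= K * I / h^2" using gen BB y by metis
   hence "h^2 * (partial i p x)^2 <= K * I / h^2" by (simp add: power_mult_distrib)
   hence "(partial i p x)^2 <= K * I / h^2 / h^2" using h by (simp add: field_simps)
   thus ?thesis by (simp add: power_mult_distrib[symmetric] power2_eq_square power4_eq_xxxx)
  qed
  ultimately show ?thesis unfolding I_def[symmetric] by auto
 qed
 with K show ?thesis by blast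
qed

text \<open>In monomials centred at \<open>z\<close> the operator is diagonal with eigenvalues
  \<open>i + j + 2\<close>, so it is inverted by dividing coefficients. The eigenvalues exceed 1, so
  the coefficients of \<open>s\<close> are no larger than those of \<open>r\<close> and the
  coefficient bound for \<open>r\<close> passes to \<open>s\<close>.\<close>

lemma Pol_euler_inverse:
 "EX C>0. ALL r:Pol m. ALL z. ALL h>0. EX s:Pol m.
  (ALL x. 2 * s x + (x - z) <.> grad s x = r x) &
  (ALL x:cball z (S * h). (s x)^2 <= C / h^2 * (LINT y|leb (cball z h). (r y)^2))" proof -
 obtain C where C: "C > 0" "ALL c. (SUM k:idx m. (c k)^2) <=
   C * (LINT x|leb (cball 0 1). (SUM k:idx m. c k * mon x k)^2)"
  using Pol_coefficient_bound[OF zero_less_one, of m] by (elim exE conjE)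
 obtain B where B: "B > 0" "ALL k:idx m. ALL x:cball 0 S. \<bar>mon x k\<bar> <= B"
  using mon_bounded[of m S] by (elim exE conjE)
 define K where "K = C * (real (card (idx m)) * B^2) + 1"
 have K: "K > 0" using C(1) by (simp add: K_def add_nonneg_pos)
 have "EX s:Pol m. (ALL x. 2 * s x + (x - z) <.> grad s x = r x) &
  (ALL x:cball z (S * h). (s x)^2 <= K / h^2 * (LINT y|leb (cball z h). (r y)^2))"
  if r: "r : Pol m" and h: "h > 0" for r z h proof -
  obtain c where c: "!!x. r (z + h *R x) = (SUM k:idx m. c k * mon x k)"
   "!!x. r x = (SUM k:idx m. c k * mon ((x - z) /\<^sub>R h) k)"
   by (rule Pol_scaled_coefficients[OF r, of h z]) (use h in auto)
  define d where "d k = c k / real (fst k + snd k + 2)" for k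
  define f where "f k x = mon ((x - z) /\<^sub>R h) k" for k x
  define s where "s = (%x. SUM k:idx m. d k * f k x)"
  have co: "(%x. ((x - z) /\<^sub>R h) $ i) : Pol 1" for i
   using Pol_smult[OF Pol_diff[OF Pol_coord Pol_const[of 1 "z $ i"]], of "inverse h" i] by simp
  have f: "f k : Pol m" if "k : idx m" for k unfolding f_def by (rule Pol_comp[OF Pol_mon[OF that] co])
  have s: "s : Pol m" unfolding s_def using f by (intro Pol_sum Pol_smult) auto
  \<comment> \<open>Euler's identity for homogeneous polynomials.\<close>
  have ef: "(x - z) <.> grad (f k) x = real (fst k + snd k) * f k x" if k: "k : idx m" for k x proof -
   have "((%x. ((x - z) /\<^sub>R h) $ i) has_derivative (%d. d $ i / h)) (at x)" for i
   using h by (auto intro!: derivative_eq_intros bounded_linear.has_derivative[OF bounded_linear_vec_nth has_derivative_ident] simp: field_simps)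
   note d = this
   obtain i j where ij: "k = (i, j)" by (cases k)
   have pw: "u * (real i * u ^ (i - 1)) = real i * u ^ i" for u :: real and i by (cases i) auto
   let ?u = "((x - z) /\<^sub>R h) $ 1" and ?v = "((x - z) /\<^sub>R h) $ 2"
   let ?D = "%e. ?u ^ i * (real j * (e $ 2 / h) * ?v ^ (j - 1)) + (real i * (e $ 1 / h) * ?u ^ (i - 1)) * ?v ^ j"
   have "(f k has_derivative ?D) (at x)" unfolding f_def mon_def ij fst_conv snd_conv
   by (rule has_derivative_mult[OF has_derivative_power[OF d] has_derivative_power[OF d]])
   from has_derivative_unique[OF this Pol_has_derivative[OF f[OF k], of x]]
   have "?D (x - z) = partial 1 (f k) x * (x - z) $ 1 + partial 2 (f k) x * (x - z) $ 2" by metis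
   moreover have "?D (x - z) = (?u * (real i * ?u ^ (i - 1))) * ?v ^ j + ?u ^ i * (?v * (real j * ?v ^ (j - 1)))"
   proof -
   have uv: "(x - z) $ 1 / h = ?u" "(x - z) $ 2 / h = ?v" by (simp_all add: divide_inverse algebra_simps)
   show ?thesis unfolding uv by (simp only: ac_simps)
   qed
   ultimately have "partial 1 (f k) x * (x - z) $ 1 + partial 2 (f k) x * (x - z) $ 2 =
   real i * ?u ^ i * ?v ^ j + ?u ^ i * (real j * ?v ^ j)" unfolding pw by simp
   thus ?thesis unfolding f_def mon_def ij by (simp add: inner_vec_def sum_2 grad_def algebra_simps)
  qed
  have "2 * s x + (x - z) <.> grad s x = r x" for x proof -
   have "grad s x = (SUM k:idx m. d k *R grad (f k) x)"
   using partial_sum[of "idx m" f x _ d, OF finite_idx Pol_differentiable[OF f]]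
   by (simp add: vec_eq_iff grad_def s_def)
   hence "2 * s x + (x - z) <.> grad s x = (SUM k:idx m. d k * (2 * f k x + (x - z) <.> grad (f k) x))"
   by (simp add: s_def inner_sum_right sum_distrib_left distrib_left sum.distrib mult.left_commute[of 2])
   also have "... = (SUM k:idx m. c k * f k x)" by (intro sum.cong) (auto simp: ef d_def field_simps)
   finally show ?thesis by (simp add: c(2) f_def)
  qed
  moreover have "(s x)^2 <= K / h^2 * (LINT y|leb (cball z h). (r y)^2)" if x: "x : cball z (S * h)" for x proof -
   define I where "I = (LINT y|leb (cball z h). (r y)^2)"
   have y: "(x - z) /\<^sub>R h : cball 0 S" using x h by (rule cball_scaled)
   have "I = h^2 * (LINT x|leb (cball 0 1). (SUM k:idx m. c k * mon x k)^2)"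
   unfolding I_def c(1)[symmetric] using scaling_subst[of h 1 z "%y. (r y)^2"] h
   continuous_on_power[OF Pol_continuous[OF r], of "cball z h" 2] by simp
   hence "h^2 * (SUM k:idx m. (c k)^2) <= C * I" using mult_left_mono[OF C(2)[rule_format, of c], of "h^2"] h
   by (simp add: mult.left_commute)
   hence cI: "(SUM k:idx m. (c k)^2) <= C * I / h^2" using h by (simp add: field_simps)
   have I0: "0 <= I" unfolding I_def by (auto intro!: integral_nonneg_AE)
   have "(d k)^2 <= (c k)^2" for k unfolding d_def
   by (simp add: power_divide divide_le_eq add_pos_nonneg mult_le_cancel_left1)
   hence "(SUM k:idx m. (d k)^2) <= C * I / h^2" by (intro order_trans[OF sum_mono cI])
   hence "(s x)^2 <= C * I / h^2 * (real (card (idx m)) * B^2)" unfolding s_def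
   by (intro order_trans[OF sum_mult_sq_le[where I = "idx m" and f = "%k. f k x" and B = B] mult_right_mono])
   (use B(2) y in \<open>simp_all add: f_def\<close>)
   also have "... = (K - 1) * I / h^2" by (simp add: K_def mult_ac)
   also have "... <= K * I / h^2" using I0 by (intro divide_right_mono mult_right_mono) auto
   finally show ?thesis by (simp add: I_def)
  qed
  ultimately show ?thesis using s by blast
 qed
 with K show ?thesis by blast
qed

text \<open>The interval keeps away from the end points because the weights attached to an edge
  vanish at its vertices and are bounded below only in its middle part.\<close>

lemma univariate_coefficient_bound:
 "EX C>0. ALL c::nat=>real. (SUM j<=n. (c j)^2) <= C * (LINT t|leb {1/4..3/4}. (SUM j<=n. c j * t ^ j)^2)"
proof (rule coefficient_bound[of "{..n}" "{1/4..3/4}" "%j t. t ^ j"])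
 fix c :: "nat => real" and i
 assume c: "!!x. x : interior {1/4..3/4::real} ==> (SUM i<=n. c i * x ^ i) = 0" and i: "i : {..n}"
 show "c i = 0" proof (rule ccontr)
  assume "c i ~= 0"
  hence "finite {x. (SUM i<=n. c i * x ^ i) = 0}" using i by (subst polyfun_finite_roots) auto
  moreover have "{1/4<..<3/4::real} <= {x. (SUM i<=n. c i * x ^ i) = 0}" using c by auto
  ultimately have "finite {1/4<..<3/4::real}" by (rule finite_subset[rotated])
  moreover have "infinite {1/4<..<3/4::real}" by (rule infinite_Ioo) simp
  ultimately show False by contradiction
 qed
qed (auto intro!: continuous_intros)

section \<open>Polygons as Jordan curves\<close>

fun polyline :: "point list => real => point" where
 "polyline (a # b # c # xs) = linepath a b +++ polyline (b # c # xs)"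
| "polyline [a, b] = linepath a b"
| "polyline [a] = linepath a a"
| "polyline [] = linepath 0 0"

lemma UN_lessThan_Suc_shift: "(UN i<Suc m. A i) = A 0 Un (UN i<m. A (Suc i))"
 by (simp add: lessThan_Suc_eq_insert_0 image_image)

lemma polyline_props:
 assumes "2 <= length xs" shows "pathstart (polyline xs) = hd xs & pathfinish (polyline xs) = last xs &
  path_image (polyline xs) = (UN i<length xs - 1. closed_segment (xs ! i) (xs ! Suc i))" using assms
proof (induction xs rule: polyline.induct)
 case (1 a b c xs)
 hence IH: "pathstart (polyline (b # c # xs)) = b" "pathfinish (polyline (b # c # xs)) = last (c # xs)"
  "path_image (polyline (b # c # xs)) =
   (UN i<length (c # xs). closed_segment ((b # c # xs) ! i) ((b # c # xs) ! Suc i))" by auto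
 have "(UN i<length (a # b # c # xs) - 1. closed_segment ((a # b # c # xs) ! i) ((a # b # c # xs) ! Suc i)) =
   closed_segment a b Un (UN i<length (c # xs). closed_segment ((b # c # xs) ! i) ((b # c # xs) ! Suc i))"
  using UN_lessThan_Suc_shift[of "%i. closed_segment ((a # b # c # xs) ! i) ((a # b # c # xs) ! Suc i)" "length (c # xs)"]
  by simp
 thus ?case using IH by (simp add: path_image_join)
qed auto

lemma arc_polyline:
 assumes "2 <= length xs" "distinct xs"
  "!!i j. i < j ==> Suc j < length xs ==> closed_segment (xs ! i) (xs ! Suc i) Int closed_segment (xs ! j) (xs ! Suc j)
   <= (if j = Suc i then {xs ! j} else {})" shows "arc (polyline xs)" using assms
proof (induction xs rule: polyline.induct)
 case (1 a b c xs)
 let ?ys = "b # c # xs"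
 have "arc (polyline ?ys)" proof (rule "1.IH")
  fix i j assume ij: "i < j" "Suc j < length ?ys"
  have "closed_segment ((a # ?ys) ! Suc i) ((a # ?ys) ! Suc (Suc i)) \<inter>
   closed_segment ((a # ?ys) ! Suc j) ((a # ?ys) ! Suc (Suc j))
   <= (if Suc j = Suc (Suc i) then {(a # ?ys) ! Suc j} else {})" by (rule "1.prems"(3)) (use ij in simp_all)
  thus "closed_segment (?ys ! i) (?ys ! Suc i) Int closed_segment (?ys ! j) (?ys ! Suc j)
   <= (if j = Suc i then {?ys ! j} else {})" by (simp only: nth_Cons_Suc nat.inject)
 qed (use "1.prems" in auto)
 moreover have "closed_segment a b Int path_image (polyline ?ys) <= {b}" proof -
  have "closed_segment a b Int closed_segment (?ys ! j) (?ys ! Suc j) <= {b}" if "j < length ?ys - 1" for j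
   using "1.prems"(3)[of 0 "Suc j"] that by (auto split: if_splits)
  thus ?thesis using polyline_props[of ?ys] by auto
 qed
 ultimately show ?case using "1.prems"(2) polyline_props[of ?ys] by (auto intro!: arc_join)
qed auto

definition nth_edge :: "point list => nat => edge" where
 "nth_edge vs i = (vs ! i, vs ! (Suc i mod length vs))"

lemma edges_nth: "edges vs = nth_edge vs ` {..<length vs}" unfolding edges_def nth_edge_def by auto

text \<open>The boundary is the image of a simple closed path, hence a topological circle, and the
  Jordan-Brouwer theorem makes it the full frontier of the outer component; \<open>region\<close> is
  the complement of that component. Supporting lines at boundary points and the fan decomposition
  rely on this.\<close>

lemma frontier_region:
 assumes "simple_polygon vs" shows "frontier (region vs) = bdry vs" "compact (region vs)" proof -
 define n where "n = length vs"
 have n: "n >= 3" "distinct vs" using assms by (auto simp: simple_polygon_def n_def)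
 have vs: "vs ~= []" using n(1) by (auto simp: n_def)
 have hdl: "hd vs = vs ! 0" "last vs = vs ! (n - 1)" using vs by (simp_all add: hd_conv_nth last_conv_nth n_def)
 have int: "seg (nth_edge vs i) Int seg (nth_edge vs j) =
   {vs ! i, vs ! (Suc i mod n)} Int {vs ! j, vs ! (Suc j mod n)}" if "i < n" "j < n" "i ~= j" for i j proof -
  have "nth_edge vs i ~= nth_edge vs j" using that n(2) by (simp add: nth_edge_def n_def nth_eq_iff_index_eq)
  moreover have "nth_edge vs i : edges vs" "nth_edge vs j : edges vs" using that by (auto simp: edges_nth n_def)
  ultimately have "seg (nth_edge vs i) Int seg (nth_edge vs j) =
   {fst (nth_edge vs i), snd (nth_edge vs i)} Int {fst (nth_edge vs j), snd (nth_edge vs j)}"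
   using assms unfolding simple_polygon_def by blast
  thus ?thesis by (simp add: nth_edge_def n_def)
 qed
 have sg: "seg (nth_edge vs i) = closed_segment (vs ! i) (vs ! Suc i)" if "Suc i < n" for i
  using that by (simp add: seg_def nth_edge_def n_def)
 have sl: "seg (nth_edge vs (n - 1)) = closed_segment (vs ! (n - 1)) (vs ! 0)" proof -
  have "Suc (n - 1) mod n = 0" using n(1) by simp
  thus ?thesis by (simp add: seg_def nth_edge_def n_def)
 qed
 have eqi: "vs ! i = vs ! j <-> i = j" if "i < n" "j < n" for i j
  using that n(2) by (simp add: n_def nth_eq_iff_index_eq)
 define p where "p = polyline vs"
 have P: "pathstart p = vs ! 0" "pathfinish p = vs ! (n - 1)"
  "path_image p = (UN i<n - 1. closed_segment (vs ! i) (vs ! Suc i))"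
  using polyline_props[of vs] n(1) hdl unfolding p_def n_def by auto
 have "arc p" unfolding p_def proof (rule arc_polyline)
  fix i j assume ij: "i < j" "Suc j < length vs"
  hence "closed_segment (vs ! i) (vs ! Suc i) Int closed_segment (vs ! j) (vs ! Suc j) =
   {vs ! i, vs ! Suc i} Int {vs ! j, vs ! Suc j}" using int[of i j] sg[of i] sg[of j] by (simp add: n_def)
  thus "closed_segment (vs ! i) (vs ! Suc i) Int closed_segment (vs ! j) (vs ! Suc j)
   <= (if j = Suc i then {vs ! j} else {})"
   using ij eqi[of i j] eqi[of i "Suc j"] eqi[of "Suc i" j] eqi[of "Suc i" "Suc j"] by (auto simp: n_def)
 qed (use n in \<open>auto simp: n_def\<close>)
 define q where "q = p +++ linepath (vs ! (n - 1)) (vs ! 0)"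
 have "simple_path q" unfolding q_def proof (rule simple_path_join_loop)
  show "arc (linepath (vs ! (n - 1)) (vs ! 0))" using eqi[of "n - 1" 0] n(1) by auto
  have "closed_segment (vs ! i) (vs ! Suc i) Int closed_segment (vs ! (n - 1)) (vs ! 0) <= {vs ! 0, vs ! (n - 1)}"
   if "i < n - 1" for i proof -
   have "Suc (n - 1) mod n = 0" using n(1) by simp
   thus ?thesis using int[of i "n - 1"] sg[of i] sl that n(1) by auto
  qed
  thus "path_image p Int path_image (linepath (vs ! (n - 1)) (vs ! 0)) <=
   {pathstart p, pathstart (linepath (vs ! (n - 1)) (vs ! 0))}" using P by auto
 qed (use P \<open>arc p\<close> in auto)
 have img: "path_image q = bdry vs" proof -
  have "path_image q = (UN i<n - 1. seg (nth_edge vs i)) Un seg (nth_edge vs (n - 1))"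
   unfolding q_def using P sg sl by (simp add: path_image_join)
  also have "... = (UN i:insert (n - 1) {..<n - 1}. seg (nth_edge vs i))" by auto
  also have "insert (n - 1) {..<n - 1} = {..<n}" using n(1) by auto
  also have "(UN i<n. seg (nth_edge vs i)) = bdry vs" by (simp add: bdry_def edges_nth n_def)
  finally show ?thesis .
 qed
 have loop: "pathfinish q = pathstart q" using P by (simp add: q_def)
 have "path_image q homeomorphic sphere (0::complex) 1"
  using \<open>simple_path q\<close> loop by (rule homeomorphic_simple_path_image_circle) simp
 moreover have "sphere (0::complex) 1 homeomorphic sphere (0::point) 1" by (rule homeomorphic_spheres_gen) auto
 ultimately have hom: "bdry vs homeomorphic sphere (0::point) 1" using img homeomorphic_trans by metis
 have cb: "compact (bdry vs)" unfolding img[symmetric]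
  using \<open>simple_path q\<close> simple_path_imp_path compact_path_image by blast
 hence "outside (bdry vs) : components (- bdry vs)"
  by (auto simp: outside_in_components connected_outside compact_imp_bounded outside_bounded_nonempty)
 hence "frontier (outside (bdry vs)) = bdry vs" using Jordan_Brouwer_frontier[OF hom] by simp
 moreover have reg: "region vs = - outside (bdry vs)" unfolding region_def by (simp add: outside_inside)
 ultimately show "frontier (region vs) = bdry vs" by simp
 have "bounded (region vs)" unfolding region_def using cb by (simp add: bounded_inside compact_imp_bounded)
 moreover have "closed (region vs)" unfolding reg using cb by (intro closed_Compl open_outside compact_imp_closed)
 ultimately show "compact (region vs)" by (simp add: compact_eq_bounded_closed)
qed

lemma edges_relations:
 assumes "simple_polygon vs"
 shows "finite (edges vs)" "card (edges vs) = length vs" "inj_on (nth_edge vs) {..<length vs}"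
  "fst ` edges vs = set vs" "snd ` edges vs = set vs" "inj_on fst (edges vs)" "inj_on snd (edges vs)"
  "(a, b) : edges vs ==> a ~= b" proof -
 define n where "n = length vs"
 have n: "n >= 3" "distinct vs" using assms by (auto simp: simple_polygon_def n_def)
 have eqi: "vs ! i = vs ! j <-> i = j" if "i < n" "j < n" for i j
  using that n(2) by (simp add: n_def nth_eq_iff_index_eq)
 have sm: "Suc i mod n < n" for i using n(1) by simp
 have sm': "Suc i mod n = Suc j mod n ==> i = j" if "i < n" "j < n" for i j
  using that n(1) by (auto simp: mod_Suc split: if_splits)
 have sn: "i ~= Suc i mod n" if "i < n" for i using that n(1) by (auto simp: mod_Suc)
 show "finite (edges vs)" by (simp add: edges_nth)
 show inj: "inj_on (nth_edge vs) {..<length vs}" using eqi by (auto simp: inj_on_def nth_edge_def n_def)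
 show "card (edges vs) = length vs" unfolding edges_nth by (simp add: card_image[OF inj])
 show "fst ` edges vs = set vs" by (auto simp: edges_nth nth_edge_def image_image set_conv_nth)
 have "(%i. Suc i mod n) ` {..<n} = {..<n}" proof (rule endo_inj_surj)
  show "inj_on (%i. Suc i mod n) {..<n}" by (rule inj_onI) (use sm' in blast)
  show "(%i. Suc i mod n) ` {..<n} <= {..<n}" using sm by blast
 qed simp
 hence "(%i. vs ! i) ` (%i. Suc i mod n) ` {..<n} = (%i. vs ! i) ` {..<n}" by (rule arg_cong)
 moreover have "snd ` edges vs = (%i. vs ! i) ` (%i. Suc i mod n) ` {..<n}"
  by (simp add: edges_nth nth_edge_def image_image n_def)
 moreover have "set vs = (%i. vs ! i) ` {..<n}" by (auto simp: set_conv_nth n_def)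
 ultimately show "snd ` edges vs = set vs" by simp
 show "inj_on fst (edges vs)" using eqi by (auto simp: inj_on_def edges_nth nth_edge_def n_def)
 show "inj_on snd (edges vs)" proof (rule inj_onI)
  fix e e' assume "e : edges vs" "e' : edges vs" and s: "snd e = snd e'"
  then obtain i j where ij: "i < n" "j < n" "e = nth_edge vs i" "e' = nth_edge vs j" by (auto simp: edges_nth n_def)
  hence "Suc i mod n = Suc j mod n" using s eqi[OF sm sm] by (simp add: nth_edge_def n_def)
  thus "e = e'" using sm'[OF ij(1,2)] ij by simp
 qed
 show "a ~= b" if ab: "(a, b) : edges vs" proof -
  obtain i where "i < n" "a = vs ! i" "b = vs ! (Suc i mod n)" using ab by (auto simp: edges_nth nth_edge_def n_def)
  thus ?thesis using eqi[OF _ sm, of i i] sn by auto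
 qed
qed

lemma edges_sum_telescope:
 fixes f :: "point => real"
 assumes "simple_polygon vs" shows "(SUM e:edges vs. f (snd e) - f (fst e)) = 0" proof -
 note E = edges_relations[OF assms]
 have "(SUM e:edges vs. f (snd e)) = (SUM v:set vs. f v)" using sum.reindex[OF E(7), of f] E(5) by (simp add: o_def)
 moreover have "(SUM e:edges vs. f (fst e)) = (SUM v:set vs. f v)" using sum.reindex[OF E(6), of f] E(4) by (simp add: o_def)
 ultimately show ?thesis by (simp add: sum_subtractf)
qed

text \<open>Walking along the list from its head reaches every vertex, so the total variation around
  the cycle bounds the oscillation.\<close>

lemma edges_walk:
 fixes f :: "point => real"
 assumes "simple_polygon vs" "v : set vs"
 shows "\<bar>f v - f (hd vs)\<bar> <= (SUM e:edges vs. \<bar>f (snd e) - f (fst e)\<bar>)" proof -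
 note E = edges_relations[OF assms(1)]
 let ?g = "%e. \<bar>f (snd e) - f (fst e)\<bar>"
 have w: "\<bar>f (vs ! i) - f (vs ! 0)\<bar> <= (SUM j<i. ?g (nth_edge vs j))" if "i < length vs" for i using that
 proof (induction i)
  case (Suc i)
  hence "?g (nth_edge vs i) = \<bar>f (vs ! Suc i) - f (vs ! i)\<bar>" by (simp add: nth_edge_def)
  with Suc show ?case by simp
 qed simp
 obtain i where i: "i < length vs" "v = vs ! i" using assms(2) by (auto simp: in_set_conv_nth)
 have "(SUM j<i. ?g (nth_edge vs j)) <= (SUM j<length vs. ?g (nth_edge vs j))" using i by (intro sum_mono2) auto
 also have "... = (SUM e:edges vs. ?g e)" unfolding edges_nth by (simp add: sum.reindex[OF E(3)])
 finally have s: "(SUM j<i. ?g (nth_edge vs j)) <= (SUM e:edges vs. ?g e)" .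
 have "hd vs = vs ! 0" using assms(2) by (cases vs) auto
 have "\<bar>f (vs ! i) - f (vs ! 0)\<bar> <= (SUM e:edges vs. ?g e)" using w[OF i(1)] s by (rule order_trans)
 thus ?thesis using i(2) \<open>hd vs = vs ! 0\<close> by simp
qed

text \<open>A discrete antiderivative on the cycle: partial sums of the increments, with the zero
  total closing the last edge.\<close>

lemma edges_potential:
 fixes d :: "edge => real"
 assumes "simple_polygon vs" "(SUM e:edges vs. d e) = 0"
 shows "EX f. f (hd vs) = 0 & (ALL e:edges vs. f (snd e) - f (fst e) = d e)" proof -
 note E = edges_relations[OF assms(1)]
 define n where "n = length vs"
 have n: "n >= 3" "distinct vs" using assms by (auto simp: simple_polygon_def n_def)
 define k where "k v = (THE i. i < n & vs ! i = v)" for v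
 have k: "k (vs ! i) = i" if "i < n" for i unfolding k_def
  using that n(2) by (intro the_equality) (auto simp: n_def nth_eq_iff_index_eq)
 define f where "f v = (SUM j<k v. d (nth_edge vs j))" for v
 have tot: "(SUM j<n. d (nth_edge vs j)) = 0"
  using assms(2) unfolding edges_nth by (simp add: sum.reindex[OF E(3)] n_def)
 have "f (vs ! (Suc i mod n)) - f (vs ! i) = d (nth_edge vs i)" if i: "i < n" for i proof (cases "Suc i = n")
  case True
  hence "f (vs ! (Suc i mod n)) = 0" using k[of 0] n(1) by (simp add: f_def)
  moreover have "f (vs ! i) = - d (nth_edge vs i)" using tot k[OF i] True by (auto simp: f_def)
  ultimately show ?thesis by simp
 next
  case False
  thus ?thesis using i k[of i] k[of "Suc i"] by (simp add: f_def)
 qed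
 moreover have "f (hd vs) = 0" using k[of 0] n(1) by (cases vs) (auto simp: f_def n_def)
 ultimately show ?thesis by (intro exI[of _ f]) (auto simp: edges_nth nth_edge_def n_def)
qed

section \<open>Uniformly convex polygons\<close>

definition cross :: "point => point => real" where
 "cross a b = a $ 1 * b $ 2 - a $ 2 * b $ 1"

lemma inner_point: "(a::point) <.> b = a $ 1 * b $ 1 + a $ 2 * b $ 2" by (simp add: inner_vec_def sum_2)

lemma norm_point: "(norm (a::point))^2 = (a $ 1)^2 + (a $ 2)^2"
 unfolding power2_norm_eq_inner inner_point by (simp add: power2_eq_square)

lemma cross_inner: "(cross a b)^2 + (a <.> b)^2 = (norm a)^2 * (norm b)^2"
 unfolding norm_point cross_def inner_point by (simp add: power2_eq_square algebra_simps)

definition rotl :: "point => point" where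
 "rotl n = vector [- (n $ 2), n $ 1]"

lemma rotl_simps [simp]: "rotl n $ 1 = - (n $ 2)" "rotl n $ 2 = n $ 1" by (simp_all add: rotl_def)

lemma norm_rotl [simp]: "norm (rotl n) = norm n" proof -
 have "(norm (rotl n))^2 = (norm n)^2" unfolding norm_point by simp
 thus ?thesis by (rule power2_eq_imp_eq) simp_all
qed

lemma orthogonal_rotl:
 assumes "norm n = 1" "n <.> x = 0" shows "x = (x <.> rotl n) *R rotl n" "\<bar>x <.> rotl n\<bar> = norm x" proof -
 have n: "(n $ 1)^2 + (n $ 2)^2 = 1" using norm_point[of n] assms(1) by simp
 have e: "n $ 1 * x $ 1 + n $ 2 * x $ 2 = 0" using assms(2) by (simp add: inner_point)
 have "x $ 1 = (x $ 1 * - (n $ 2) + x $ 2 * n $ 1) * - (n $ 2)" proof -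
  have "(x $ 1 * - (n $ 2) + x $ 2 * n $ 1) * - (n $ 2) =
   x $ 1 * ((n $ 1)^2 + (n $ 2)^2) - n $ 1 * (n $ 1 * x $ 1 + n $ 2 * x $ 2)"
   by (simp add: power2_eq_square algebra_simps)
  thus ?thesis unfolding n e by simp
 qed
 moreover have "x $ 2 = (x $ 1 * - (n $ 2) + x $ 2 * n $ 1) * n $ 1" proof -
  have "(x $ 1 * - (n $ 2) + x $ 2 * n $ 1) * n $ 1 =
   x $ 2 * ((n $ 1)^2 + (n $ 2)^2) - n $ 2 * (n $ 1 * x $ 1 + n $ 2 * x $ 2)"
   by (simp add: power2_eq_square algebra_simps)
  thus ?thesis unfolding n e by simp
 qed
 ultimately show *: "x = (x <.> rotl n) *R rotl n" by (simp add: vec_eq_iff forall_2 inner_point)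
 have "norm x = \<bar>x <.> rotl n\<bar> * norm (rotl n)" by (subst *) simp
 thus "\<bar>x <.> rotl n\<bar> = norm x" using assms(1) by simp
qed

lemma tangent_rotl: "tangent vs e = rotl (outer_normal vs e)" by (simp add: tangent_def rotl_def)

locale mesh_polygon =
 fixes vs :: "point list" and rho eps :: real
 assumes rho: "rho > 0" and eps: "eps > 0" and simple: "simple_polygon vs"
  and mesh: "mesh_regular rho vs" and uconv: "uniformly_convex eps vs"
begin

abbreviation "F == region vs"
abbreviation "h == diameter (region vs)"
abbreviation "E == edges vs"
abbreviation "nrm == outer_normal vs"
abbreviation "tng == tangent vs"

text \<open>The signed distance to the line of the edge, nonnegative on the polygon. The polynomial
  weights that vanish on edges are products of these forms.\<close>

definition lin :: "edge => point => real" where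
 "lin e x = nrm e <.> (fst e - x)"

lemmas E_rel = edges_relations[OF simple]

lemma compact_F: "compact F" and frontier_F: "frontier F = bdry vs" using frontier_region[OF simple] by auto

lemma convex_F: "convex F" using uconv by (simp add: uniformly_convex_def)

lemma closed_F: "closed F" using compact_F by (rule compact_imp_closed)

lemma seg_F: "e : E ==> seg e <= F" unfolding region_def bdry_def by auto

lemma ends_F: "e : E ==> fst e : F" "e : E ==> snd e : F"
 using seg_F[of e] unfolding seg_def by (blast intro: ends_in_segment)+

lemma E_nonempty: "E ~= {}" using E_rel(2) simple by (auto simp: simple_polygon_def)

lemma dist_le_h: "x : F ==> y : F ==> dist x y <= h"
 using diameter_bounded_bound compact_imp_bounded[OF compact_F] by blast

lemma h_pos: "h > 0" proof -
 obtain e where e: "e : E" using E_nonempty by blast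
 hence "fst e ~= snd e" using E_rel(8)[of "fst e" "snd e"] by simp
 hence "0 < dist (fst e) (snd e)" by simp
 also have "... <= h" using dist_le_h ends_F e by blast
 finally show ?thesis .
qed

lemma elen_bounds: "e : E ==> rho * h <= elen e" "e : E ==> elen e <= h" "e : E ==> 0 < elen e" proof -
 show 1: "e : E ==> rho * h <= elen e" using mesh by (simp add: mesh_regular_def)
 show "e : E ==> elen e <= h" unfolding elen_def using dist_le_h ends_F by blast
 show "e : E ==> 0 < elen e" using 1 mult_pos_pos[OF rho h_pos] by linarith
qed

lemma ex_ball: "EX c. ball c (rho * h) <= F" proof -
 obtain c r where r: "r >= rho * h" "star_shaped_wrt F (ball c r)" using mesh by (auto simp: mesh_regular_def)
 obtain e where "e : E" using E_nonempty by blast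
 hence "fst e : F" by (rule ends_F)
 hence "ball c r <= F" using r(2) unfolding star_shaped_wrt_def by (meson ends_in_segment(1) subset_iff)
 thus ?thesis using r(1) subset_ball by blast
qed

definition ctr :: point where "ctr = (SOME c. ball c (rho * h) <= F)"

lemma ball_F: "ball ctr (rho * h) <= F" unfolding ctr_def by (rule someI_ex[OF ex_ball])

lemma rhoh_pos: "0 < rho * h" using rho h_pos by simp

lemma ctr_F: "ctr : F" using ball_F rhoh_pos by auto

lemma ctr_interior: "ctr : interior F" using ball_F rhoh_pos by (meson centre_in_ball interiorI open_ball)

lemma cball_rho_F: "cball ctr (rho * h) <= F" using closure_mono[OF ball_F] closure_closed[OF closed_F] rhoh_pos by simp

lemma F_cball: "F <= cball ctr h" using dist_le_h ctr_F by auto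

text \<open>A supporting line at the midpoint contains both end points, because the supporting
  functional is minimal at their mean. Only existence is obtained here; that the direction is the
  one selected by \<open>outer_normal\<close> is shown in \<open>outer_nml\<close>.\<close>

lemma ex_support:
 assumes e: "e : E" shows "EX n. norm n = 1 & n <.> (snd e - fst e) = 0 & (ALL x:F. 0 <= n <.> (fst e - x))" proof -
 define m where "m = midpoint (fst e) (snd e)"
 have "m : seg e" by (simp add: m_def seg_def)
 hence "m : frontier F" using e frontier_F by (auto simp: bdry_def)
 hence m: "m : closure F" "m ~: rel_interior F"
  using ctr_interior rel_interior_nonempty_interior[of F] by (auto simp: frontier_def)
 obtain a where a: "a ~= 0" "!!y. y : F ==> a <.> m <= a <.> y"
  using supporting_hyperplane_relative_frontier[OF convex_F m] closure_closed[OF closed_F] by metis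
 have m2: "2 * (a <.> m) = a <.> fst e + a <.> snd e" by (simp add: m_def midpoint_def inner_add_right)
 have "a <.> m <= a <.> fst e" "a <.> m <= a <.> snd e" using a(2) ends_F e by auto
 hence eq: "a <.> fst e = a <.> m" "a <.> snd e = a <.> m" using m2 by auto
 define n where "n = - (a /\<^sub>R norm a)"
 have "norm n = 1" using a(1) by (simp add: n_def)
 moreover have "n <.> (snd e - fst e) = 0" by (simp add: n_def inner_diff_right eq)
 moreover have "0 <= n <.> (fst e - x)" if "x : F" for x
  using a(2)[OF that] a(1) by (simp add: n_def inner_diff_right eq divide_right_mono)
 ultimately show ?thesis by blast
qed

text \<open>The centre can be moved by the full inscribed radius towards the supporting line without
  leaving the polygon.\<close>

lemma support_ctr:
 assumes "norm n = 1" "ALL x:F. 0 <= n <.> (a - x)" shows "rho * h <= n <.> (a - ctr)" proof -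
 have "ctr + (rho * h) *R n : F"
  by (rule subsetD[OF cball_rho_F]) (use assms(1) rhoh_pos in \<open>simp add: dist_norm\<close>)
 hence "0 <= n <.> (a - (ctr + (rho * h) *R n))" using assms(2) by blast
 moreover have "n <.> n = 1" using assms(1) by (simp add: dot_square_norm)
 ultimately show ?thesis by (simp add: inner_diff_right inner_add_right)
qed

text \<open>The definite description in \<open>outer_normal\<close> has two candidate unit normals,
  and the inner one has to be excluded. A short inward step from the midpoint lies on a segment from
  a nearby point of the edge to the centre, so it stays in the polygon by convexity.\<close>

lemma midpoint_inward:
 assumes e: "e : E" and n: "norm n = 1" "n <.> (snd e - fst e) = 0" "ALL x:F. 0 <= n <.> (fst e - x)"
 shows "EX dl>0. ALL s. 0 < s & s < dl --> midpoint (fst e) (snd e) + s *R (- n) : F" proof -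
 define L where "L = n <.> (fst e - ctr)"
 define m where "m = midpoint (fst e) (snd e)"
 define d where "d = snd e - fst e"
 have L: "L > 0" using support_ctr[OF n(1,3)] rhoh_pos by (simp add: L_def)
 have nm: "n <.> (m - ctr) = L" proof -
  have "m = fst e + (1/2) *R d" by (simp add: m_def d_def midpoint_def vec_eq_iff field_simps)
  thus ?thesis using n(2) by (simp add: L_def d_def inner_diff_right inner_add_right)
 qed
 have dn: "d ~= 0" using E_rel(8)[of "fst e" "snd e"] e by (simp add: d_def)
 \<comment> \<open>\<open>- n\<close> is decomposed into a multiple of the direction to the centre
   and a remainder \<open>w\<close>, which is tangential and hence a multiple of the edge
   vector.\<close>
 define w where "w = - n - (1 / L) *R (ctr - m)"
 have "n <.> w = - (n <.> n) - (1 / L) * (- (n <.> (m - ctr)))" by (simp add: w_def inner_diff_right)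
 hence "n <.> w = 0" using n(1) L unfolding nm by (simp add: dot_square_norm)
 have "n <.> d = 0" using n(2) by (simp add: d_def)
 note w1 = orthogonal_rotl[OF n(1) \<open>n <.> w = 0\<close>] and d1 = orthogonal_rotl[OF n(1) \<open>n <.> d = 0\<close>]
 have "d <.> rotl n ~= 0" using d1(2) dn by auto
 define ta where "ta = (w <.> rotl n) / (d <.> rotl n)"
 have w: "w = ta *R d"
  by (subst w1(1), subst d1(1)) (use \<open>d <.> rotl n ~= 0\<close> in \<open>simp add: ta_def\<close>)
 \<comment> \<open>The first bound keeps the weight \<open>l\<close> of the centre below one half,
   the second keeps the parameter \<open>u\<close> of the point on the edge in the unit
   interval.\<close>
 define dl where "dl = min (L / 2) (1 / (4 * (\<bar>ta\<bar> + 1)))"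
 have "dl > 0" using L by (simp add: dl_def add_nonneg_pos)
 moreover have "m + s *R (- n) : F" if s: "0 < s" "s < dl" for s proof -
  define l where "l = s / L"
  have l: "0 < l" "l < 1/2" using s L by (auto simp: l_def dl_def field_simps)
  define u where "u = 1/2 + s * ta / (1 - l)"
  have "\<bar>s * ta\<bar> <= 1/4" proof -
   have "\<bar>s * ta\<bar> <= s * (\<bar>ta\<bar> + 1)" using s by (simp add: abs_mult mult_left_mono)
   also have "... <= 1 / (4 * (\<bar>ta\<bar> + 1)) * (\<bar>ta\<bar> + 1)"
   using s by (intro mult_right_mono) (auto simp: dl_def)
   also have "... = 1/4" by (simp add: field_simps add_nonneg_eq_0_iff)
   finally show ?thesis .
  qed
  hence "\<bar>s * ta / (1 - l)\<bar> <= 1/2" using l by (simp add: abs_divide divide_le_eq)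
  hence u: "0 <= u" "u <= 1" unfolding u_def by linarith+
  have q: "(1 - u) *R fst e + u *R snd e : F" using convexD_alt[OF convex_F ends_F(1)[OF e] ends_F(2)[OF e] u] .
  have "(1 - u) *R fst e + u *R snd e = m + (s * ta / (1 - l)) *R d"
   by (simp add: u_def m_def d_def midpoint_def algebra_simps)
  moreover have "(1 - l) *R (m + (s * ta / (1 - l)) *R d) + l *R ctr = m + s *R (- n)" proof -
   have "s *R (- n) = s *R w + l *R (ctr - m)" using L by (simp add: w_def l_def algebra_simps)
   also have "... = (s * ta) *R d + l *R (ctr - m)" unfolding w by simp
   finally have 1: "s *R (- n) = (s * ta) *R d + l *R (ctr - m)" .
   have "(1 - l) *R ((s * ta / (1 - l)) *R d) = (s * ta) *R d" using l by simp
   hence "(1 - l) *R (m + (s * ta / (1 - l)) *R d) = (1 - l) *R m + (s * ta) *R d" unfolding scaleR_add_right by simp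
   thus ?thesis unfolding 1 by (simp add: algebra_simps)
  qed
  ultimately show ?thesis using convexD_alt[OF convex_F q ctr_F, of l] l by simp
 qed
 ultimately show ?thesis unfolding m_def by blast
qed

text \<open>The supporting normal satisfies the description. Any other unit vector orthogonal to the
  edge is its negative, by the Lagrange identity in the plane, and the negative points into the
  polygon.\<close>

lemma outer_nml:
 assumes e: "e : E" shows "norm (nrm e) = 1" "nrm e <.> (snd e - fst e) = 0" "x : F ==> 0 <= lin e x" proof -
 obtain n where n: "norm n = 1" "n <.> (snd e - fst e) = 0" "ALL x:F. 0 <= n <.> (fst e - x)"
  using ex_support[OF e] by blast
 define m where "m = midpoint (fst e) (snd e)"
 have nm: "n <.> (fst e - m) = 0" proof -
  have "fst e - m = - (1/2) *R (snd e - fst e)" by (simp add: m_def midpoint_def vec_eq_iff field_simps)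
  thus ?thesis using n(2) by simp
 qed
 have "nrm e = n" unfolding outer_normal_def m_def[symmetric] proof (rule the_equality)
  have "m + s *R n ~: F" if "0 < s" for s proof
   assume "m + s *R n : F"
   hence "0 <= n <.> (fst e - (m + s *R n))" using n(3) by blast
   also have "... = n <.> (fst e - m) - s * (n <.> n)" by (simp add: inner_diff_right inner_add_right)
   also have "... = - s" using n(1) nm by (simp add: dot_square_norm)
   finally show False using that by simp
  qed
  thus "norm n = 1 & n <.> (snd e - fst e) = 0 & (EX dl>0. ALL s. 0 < s & s < dl --> m + s *R n ~: F)"
   using n by (auto intro: exI[of _ 1])
 next
  fix n' assume n': "norm n' = 1 & n' <.> (snd e - fst e) = 0 &
   (EX dl>0. ALL s. 0 < s & s < dl --> m + s *R n' ~: F)"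
  define d where "d = snd e - fst e"
  have d0: "norm d ~= 0" using E_rel(8)[of "fst e" "snd e"] e by (simp add: d_def)
  have nd: "n <.> d = 0" "n' <.> d = 0" using n n' by (auto simp: d_def)
  have "cross d n * cross d n' = (norm d)^2 * (n <.> n') - (n <.> d) * (n' <.> d)"
   unfolding norm_point cross_def inner_point by (simp add: power2_eq_square algebra_simps)
  moreover have "(cross d n)^2 = (norm d)^2" "(cross d n')^2 = (norm d)^2"
   using cross_inner[of d n] cross_inner[of d n'] nd n(1) n' by (auto simp: inner_commute)
  hence "(cross d n * cross d n')^2 = ((norm d)^2)^2" unfolding power_mult_distrib by (simp add: power2_eq_square)
  ultimately have "((norm d)^2)^2 * (n <.> n')^2 = ((norm d)^2)^2 * 1" using nd by (simp add: power_mult_distrib)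
  hence "(n <.> n')^2 = 1" using d0 by simp
  hence "n <.> n' = 1 | n <.> n' = - 1" by (simp add: power2_eq_1_iff)
  moreover have "n <.> n' = 1 ==> n' = n" using n(1) n' norm_cauchy_schwarz_eq[of n n'] by simp
  moreover have "n <.> n' ~= - 1" proof
   assume "n <.> n' = - 1"
   hence "- n' = n" using n(1) n' norm_cauchy_schwarz_eq[of n "- n'"] by simp
   hence "n' = - n" by (metis minus_minus)
   moreover obtain dl where "dl > 0" "ALL s. 0 < s & s < dl --> m + s *R n' ~: F" using n' by blast
   moreover obtain dl' where "dl' > 0" "ALL s. 0 < s & s < dl' --> m + s *R (- n) : F"
   using midpoint_inward[OF e n] by (auto simp: m_def)
   moreover have "0 < min dl dl' / 2" "min dl dl' / 2 < dl" "min dl dl' / 2 < dl'"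
   using \<open>dl > 0\<close> \<open>dl' > 0\<close> by (auto simp: min_def)
   ultimately show False by blast
  qed
  ultimately show "n' = n" by blast
 qed
 thus "norm (nrm e) = 1" "nrm e <.> (snd e - fst e) = 0" "x : F ==> 0 <= lin e x" using n by (auto simp: lin_def)
qed

lemma lin_ctr: "e : E ==> rho * h <= lin e ctr"
 unfolding lin_def using outer_nml[of e] by (intro support_ctr) (auto simp: lin_def)

lemma lin_snd: "e : E ==> lin e (snd e) = 0" using outer_nml(2)[of e] by (simp add: lin_def inner_diff_right)

lemma lin_fst: "lin e (fst e) = 0" by (simp add: lin_def)

lemma lin_affine: "lin e ((1 - t) *R x + t *R y) = (1 - t) * lin e x + t * lin e y"
 by (simp add: lin_def inner_diff_right inner_add_right algebra_simps)

lemma lin_seg: "e : E ==> x : seg e ==> lin e x = 0" unfolding seg_def closed_segment_def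
 using lin_affine[of e _ "fst e" "snd e"] lin_fst[of e] lin_snd[of e] by auto

lemma lin_dist: "e : E ==> \<bar>lin e x - lin e y\<bar> <= dist x y" proof -
 assume e: "e : E"
 have "lin e x - lin e y = nrm e <.> (y - x)" by (simp add: lin_def inner_diff_right)
 thus ?thesis using Cauchy_Schwarz_ineq2[of "nrm e" "y - x"] outer_nml(1)[OF e]
  by (simp add: dist_norm norm_minus_commute)
qed

text \<open>The cross product is, up to sign, the product of the lengths times the sine of the
  angle, and on the admissible range of angles the sine is at least \<open>sin eps\<close>.
  Positivity of \<open>sin eps\<close> comes from an actual vertex: an angle between
  \<open>eps\<close> and \<open>pi - eps\<close> forces \<open>eps\<close> to be at most
  \<open>pi / 2\<close>.\<close>

lemma sin_eps_pos: "sin eps > 0" and vertex_cross: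
 "(a, b) : E ==> (b, c) : E ==> sin eps * (norm (a - b) * norm (c - b)) <= \<bar>cross (a - b) (c - b)\<bar>" proof -
 have main: "sin eps > 0 & sin eps * (norm (a - b) * norm (c - b)) <= \<bar>cross (a - b) (c - b)\<bar>"
  if "(a, b) : E" "(b, c) : E" for a b c proof -
  define N where "N = norm (a - b) * norm (c - b)"
  define th where "th = vertex_angle a b c"
  have th: "eps <= th" "th <= pi - eps" using uconv that unfolding uniformly_convex_def th_def by auto
  have "a ~= b" "b ~= c" using E_rel(8) that by blast+
  hence N: "N > 0" by (simp add: N_def)
  have ab: "\<bar>(a - b) <.> (c - b)\<bar> <= N" unfolding N_def by (rule Cauchy_Schwarz_ineq2)
  have cos: "cos th = ((a - b) <.> (c - b)) / N" unfolding th_def vertex_angle_def N_def[symmetric] using ab N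
   by (intro cos_arccos) (auto simp: field_simps abs_le_iff)
  have "th >= 0" "th <= pi" using th eps by auto
  hence s0: "sin th >= 0" by (rule sin_ge_zero)
  have "(cross (a - b) (c - b))^2 = N^2 - (N * cos th)^2" proof -
   have "N * cos th = (a - b) <.> (c - b)" using N by (simp add: cos)
   moreover have "N^2 = (norm (a - b))^2 * (norm (c - b))^2" by (simp add: N_def power_mult_distrib)
   ultimately show ?thesis using cross_inner[of "a - b" "c - b"] by simp
  qed
  also have "... = (N * sin th)^2" by (simp add: power_mult_distrib sin_squared_eq algebra_simps)
  finally have "\<bar>cross (a - b) (c - b)\<bar> = \<bar>N * sin th\<bar>" by (simp add: power2_eq_iff abs_eq_iff)
  hence cr: "\<bar>cross (a - b) (c - b)\<bar> = N * sin th" using N s0 by (simp add: abs_mult)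
  have e2: "eps <= pi / 2" using th by simp
  have "sin eps <= sin th" proof (cases "th <= pi / 2")
   case True
   thus ?thesis using th eps by (intro sin_monotone_2pi_le) auto
  next
   case False
   hence "sin eps <= sin (pi - th)" using th eps e2 by (intro sin_monotone_2pi_le) auto
   thus ?thesis by simp
  qed
  moreover have "sin eps > 0" using eps e2 by (intro sin_gt_zero) (auto simp: pi_gt_zero intro: order.strict_trans1[OF e2])
  ultimately show ?thesis using cr N mult_left_mono[of "sin eps" "sin th" N] by (simp add: N_def[symmetric] mult.commute)
 qed
 obtain e where e: "e : E" using E_nonempty by blast
 hence "snd e : fst ` E" using E_rel(4,5) by blast
 then obtain e' where "e' : E" "fst e' = snd e" by auto
 thus "sin eps > 0" using main[of "fst e" "snd e" "snd e'"] e by (metis prod.collapse)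
 show "(a, b) : E ==> (b, c) : E ==> sin eps * (norm (a - b) * norm (c - b)) <= \<bar>cross (a - b) (c - b)\<bar>"
  using main by blast
qed

text \<open>The lower bound, relative to \<open>h\<close>, for the distance of a vertex to the line
  of an edge that it does not belong to; see \<open>lin_next\<close> and
  \<open>lin_vertex\<close>.\<close>

definition dl :: real where "dl = sin eps * rho"

lemma delta_pos: "dl > 0" using sin_eps_pos rho by (simp add: dl_def)

text \<open>The distance of the far end of a neighbouring edge is the length of that edge times the
  sine of the angle between the two.\<close>

lemma lin_next:
 assumes e: "(a, b) : E" "(b, c) : E" shows "dl * h <= lin (a, b) c" "dl * h <= lin (b, c) a" proof -
 have gen: "dl * h <= \<bar>n <.> y\<bar>" if n: "norm n = 1" "n <.> x = 0" and x: "x ~= 0" and y: "rho * h <= norm y"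
  and cr: "sin eps * (norm x * norm y) <= \<bar>cross x y\<bar>" for n x y proof -
  have "cross x y = - (x <.> rotl n) * (n <.> y)"
   by (subst orthogonal_rotl(1)[OF n]) (simp add: cross_def inner_point algebra_simps)
  hence "\<bar>cross x y\<bar> = norm x * \<bar>n <.> y\<bar>" using orthogonal_rotl(2)[OF n] by (simp add: abs_mult)
  hence "norm x * (sin eps * norm y) <= norm x * \<bar>n <.> y\<bar>" using cr by (simp add: mult_ac)
  hence "sin eps * norm y <= \<bar>n <.> y\<bar>" using x by simp
  moreover have "sin eps * (rho * h) <= sin eps * norm y" using sin_eps_pos y by simp
  ultimately show ?thesis by (simp add: dl_def mult.assoc)
 qed
 have ne: "a ~= b" "b ~= c" using E_rel(8) e by auto
 have len: "rho * h <= norm (a - b)" "rho * h <= norm (c - b)"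
  using elen_bounds(1)[OF e(1)] elen_bounds(1)[OF e(2)] by (simp_all add: elen_def dist_norm norm_minus_commute)
 have F: "a : F" "c : F" using ends_F(1)[OF e(1)] ends_F(2)[OF e(2)] by auto
 have "dl * h <= \<bar>nrm (a, b) <.> (c - b)\<bar>"
  using gen[of "nrm (a, b)" "a - b" "c - b"] outer_nml[OF e(1)] ne len vertex_cross[OF e]
  by (simp add: inner_diff_right)
 moreover have "nrm (a, b) <.> (c - b) = - lin (a, b) c" using outer_nml(2)[OF e(1)]
  by (simp add: lin_def inner_diff_right)
 ultimately show "dl * h <= lin (a, b) c" using outer_nml(3)[OF e(1) F(2)] by simp
 have "\<bar>cross (c - b) (a - b)\<bar> = \<bar>cross (a - b) (c - b)\<bar>" by (simp add: cross_def abs_minus_commute mult.commute)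
 hence "dl * h <= \<bar>nrm (b, c) <.> (a - b)\<bar>"
  using gen[of "nrm (b, c)" "c - b" "a - b"] outer_nml[OF e(2)] ne len vertex_cross[OF e]
  by (simp add: mult.commute)
 moreover have "nrm (b, c) <.> (a - b) = - lin (b, c) a" by (simp add: lin_def inner_diff_right)
 ultimately show "dl * h <= lin (b, c) a" using outer_nml(3)[OF e(2) F(1)] by simp
qed

text \<open>Cramer's rule gives the coordinates; their signs are those of the linear forms of the
  two edges at \<open>b\<close>, which are nonnegative on the polygon and positive at the opposite
  neighbour.\<close>

lemma cone:
 assumes e: "(a, b) : E" "(b, c) : E" and x: "x : F"
 obtains al be where "0 <= al" "0 <= be" "x - b = al *R (a - b) + be *R (c - b)" proof -
 have D: "cross (a - b) (c - b) ~= 0" proof -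
  have "a ~= b" "b ~= c" using E_rel(8) e by blast+
  hence "0 < norm (a - b) * norm (c - b)" by simp
  thus ?thesis using vertex_cross[OF e] mult_pos_pos[OF sin_eps_pos] by fastforce
 qed
 define al where "al = cross (x - b) (c - b) / cross (a - b) (c - b)"
 define be where "be = cross (a - b) (x - b) / cross (a - b) (c - b)"
 have gen: "cross p q *R z = cross z q *R p + cross p z *R q" for p q z
  by (simp add: vec_eq_iff forall_2 cross_def algebra_simps)
 have xb: "x - b = al *R (a - b) + be *R (c - b)" proof -
  have "x - b = (1 / cross (a - b) (c - b)) *R (cross (a - b) (c - b) *R (x - b))" using D by simp
  also have "... = al *R (a - b) + be *R (c - b)"
   unfolding gen[of "a - b" "c - b" "x - b"] by (simp add: al_def be_def scaleR_add_right)
  finally show ?thesis .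
 qed
 have l: "lin e' x = lin e' b + al * (lin e' a - lin e' b) + be * (lin e' c - lin e' b)" for e' proof -
  have "lin e' x = lin e' b - nrm e' <.> (x - b)" by (simp add: lin_def inner_diff_right)
  thus ?thesis unfolding xb by (simp add: lin_def inner_diff_right inner_add_right algebra_simps)
 qed
 have pos: "0 < lin (a, b) c" "0 < lin (b, c) a" using lin_next[OF e] mult_pos_pos[OF delta_pos h_pos] by linarith+
 have "lin (a, b) x = be * lin (a, b) c" using l[of "(a, b)"] lin_fst[of "(a, b)"] lin_snd[OF e(1)] by simp
 hence "0 <= be" using outer_nml(3)[OF e(1) x] pos by (simp add: zero_le_mult_iff)
 have "lin (b, c) x = al * lin (b, c) a" using l[of "(b, c)"] lin_fst[of "(b, c)"] lin_snd[OF e(2)] by simp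
 hence "0 <= al" using outer_nml(3)[OF e(2) x] pos by (simp add: zero_le_mult_iff)
 thus thesis using \<open>0 <= be\<close> xb that by blast
qed

lemma next_edge: "v : set vs ==> EX w. (v, w) : E" and prev_edge: "v : set vs ==> EX u. (u, v) : E"
 using E_rel(4,5) by (metis image_iff prod.collapse)+

lemma edge_ends: "(a, b) : E ==> a : set vs" "(a, b) : E ==> b : set vs" using E_rel(4,5) by force+

lemma edge_unique: "(a, b) : E ==> (a, c) : E ==> b = c" "(a, c) : E ==> (b, c) : E ==> a = b"
 using E_rel(6,7) unfolding inj_on_def by (metis fst_conv snd_conv)+

lemma set_F: "v : set vs ==> v : F" using next_edge ends_F by (metis fst_conv)

text \<open>A vertex minimising the distance to the line of an edge among the vertices off that edge
 is either a neighbour of the edge or a minimum over the whole polygon, because the polygon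
 lies in the cone spanned by the two edges at that vertex.\<close>

lemma lin_vertex:
 assumes e: "(a, b) : E" and v: "v : set vs" "v ~= a" "v ~= b" shows "dl * h <= lin (a, b) v" proof -
 let ?S = "set vs - {a, b}"
 have "finite ?S" "?S ~= {}" using v by auto
 then obtain w where w: "w : ?S" "!!y. y : ?S ==> lin (a, b) w <= lin (a, b) y"
  using arg_min_if_finite[of ?S "lin (a, b)"] by (metis not_le_imp_less)
 have "dl * h <= lin (a, b) w" proof (rule ccontr)
  assume small: "~ dl * h <= lin (a, b) w"
  obtain u z where uz: "(u, w) : E" "(w, z) : E" using next_edge prev_edge w(1) by blast
  obtain c where c: "(b, c) : E" using next_edge edge_ends(2)[OF e] by blast
  obtain d where d: "(d, a) : E" using prev_edge edge_ends(1)[OF e] by blast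
  have "u ~= a" using edge_unique(1)[OF e] uz(1) w(1) by blast
  moreover have "u ~= b" using edge_unique(1)[OF c] uz(1) lin_next(1)[OF e c] small by blast
  ultimately have "u : ?S" using edge_ends(1)[OF uz(1)] by blast
  have "z ~= b" using edge_unique(2)[OF e] uz(2) w(1) by blast
  moreover have "z ~= a" using edge_unique(2)[OF d] uz(2) lin_next(2)[OF d e] small by blast
  ultimately have "z : ?S" using edge_ends(2)[OF uz(2)] by blast
  have "lin (a, b) a >= lin (a, b) w" proof -
   obtain al be where ab: "0 <= al" "0 <= be" "a - w = al *R (u - w) + be *R (z - w)"
   using cone[OF uz set_F[OF edge_ends(1)[OF e]]] by blast
   have "lin (a, b) a = lin (a, b) w - nrm (a, b) <.> (a - w)" by (simp add: lin_def inner_diff_right)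
   also have "... = lin (a, b) w + al * (lin (a, b) u - lin (a, b) w) + be * (lin (a, b) z - lin (a, b) w)"
   unfolding ab(3) by (simp add: lin_def inner_diff_right inner_add_right algebra_simps)
   finally show ?thesis using ab w(2)[OF \<open>u : ?S\<close>] w(2)[OF \<open>z : ?S\<close>] by simp
  qed
  hence w0: "lin (a, b) w = 0" using lin_fst[of "(a, b)"] outer_nml(3)[OF e set_F, of w] w(1) by simp
  have wF: "w : F" using set_F w(1) by blast
  \<comment> \<open>Now \<open>w\<close> lies on the line of the edge. The cones at \<open>b\<close>
    and at \<open>a\<close> confine it to two opposite rays on that line, so to the edge itself,
    which contradicts simplicity.\<close>
  obtain al be where 1: "0 <= al" "w - b = al *R (a - b) + be *R (c - b)" using cone[OF e c wF] by blast
  obtain al' be' where 2: "0 <= be'" "w - a = al' *R (d - a) + be' *R (b - a)" using cone[OF d e wF] by blast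
  have "0 < lin (a, b) c" "0 < lin (a, b) d"
   using lin_next[OF e c] lin_next[OF d e] mult_pos_pos[OF delta_pos h_pos] by linarith+
  have "lin (a, b) w = lin (a, b) b - nrm (a, b) <.> (w - b)" by (simp add: lin_def inner_diff_right)
  also have "... = lin (a, b) b + al * (lin (a, b) a - lin (a, b) b) + be * (lin (a, b) c - lin (a, b) b)"
   unfolding 1(2) by (simp add: lin_def inner_diff_right inner_add_right algebra_simps)
  finally have "be = 0" using w0 lin_fst[of "(a, b)"] lin_snd[OF e] \<open>0 < lin (a, b) c\<close> by simp
  have "lin (a, b) w = lin (a, b) a - nrm (a, b) <.> (w - a)" by (simp add: lin_def inner_diff_right)
  also have "... = lin (a, b) a + al' * (lin (a, b) d - lin (a, b) a) + be' * (lin (a, b) b - lin (a, b) a)"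
   unfolding 2(2) by (simp add: lin_def inner_diff_right inner_add_right algebra_simps)
  finally have "al' = 0" using w0 lin_fst[of "(a, b)"] lin_snd[OF e] \<open>0 < lin (a, b) d\<close> by simp
  have w1: "w = b + al *R (a - b)" using 1(2) \<open>be = 0\<close> by (simp add: algebra_simps)
  have w2: "w = a + be' *R (b - a)" using 2(2) \<open>al' = 0\<close> by (simp add: algebra_simps)
  have "(al + be' - 1) *R (a - b) = 0" using w1 w2 by (simp add: algebra_simps)
  hence "be' = 1 - al" using E_rel(8)[OF e] by simp
  hence "be' <= 1" using 1(1) by simp
  hence "w : seg (a, b)" unfolding seg_def closed_segment_def
   using w2 2(1) by (auto intro!: exI[of _ be'] simp: algebra_simps)
  moreover have "w : seg (w, z)" by (simp add: seg_def)
  moreover have "(w, z) ~= (a, b)" using w(1) by blast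
  ultimately have "w : {fst (a, b), snd (a, b)}" using simple e uz(2) unfolding simple_polygon_def by (metis IntE IntI)
  thus False using w(1) by simp
 qed
 thus ?thesis using w(2)[of v] v by simp
qed

end

section \<open>Separation of the edges and orientation of the boundary\<close>

context mesh_polygon
begin

text \<open>The form of another edge is affine and nonnegative along \<open>e\<close>, and at least
  one end point of \<open>e\<close> does not belong to the other edge. Hence it is bounded below by
  a linear function vanishing at one end; the factor \<open>t * (1 - t)\<close> covers both
  ends.\<close>

lemma lin_on_edge:
 assumes e: "e : E" "e' : E" "e ~= e'" and t: "0 <= t" "t <= 1" shows "dl * h * (t * (1 - t)) <= lin e' (el e t)"
proof -
 obtain a b a' b' where ab: "e = (a, b)" "e' = (a', b')" by (metis surj_pair)
 have lp: "lin e' (linepath a b t) = (1 - t) * lin e' a + t * lin e' b" unfolding linepath_def by (rule lin_affine)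
 have F: "0 <= lin e' a" "0 <= lin e' b" using outer_nml(3)[OF e(2)] ends_F[OF e(1)] ab by auto
 have dh: "0 < dl * h" using delta_pos h_pos by simp
 have "a ~= a'" using edge_unique(1)[of a b b'] e ab by auto
 have "dl * h <= lin e' a | dl * h <= lin e' b" proof (cases "a = b'")
  case True
  thus ?thesis using lin_next(1)[of a' a b] e ab by simp
 next
  case False
  thus ?thesis using lin_vertex[of a' b' a] edge_ends(1)[of a b] e ab \<open>a ~= a'\<close> by simp
 qed
 thus ?thesis proof
  assume "dl * h <= lin e' a"
  hence "(1 - t) * (dl * h) <= (1 - t) * lin e' a" using t by (intro mult_left_mono) auto
  moreover have "dl * h * (t * (1 - t)) <= dl * h * (1 * (1 - t))" using t dh
   by (intro mult_left_mono mult_right_mono) auto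
  ultimately show ?thesis using lp t F ab by (simp add: mult.commute add_increasing2)
 next
  assume "dl * h <= lin e' b"
  hence "t * (dl * h) <= t * lin e' b" using t by (intro mult_left_mono) auto
  moreover have "dl * h * (t * (1 - t)) <= dl * h * (t * 1)" using t dh by (intro mult_left_mono) auto
  ultimately show ?thesis using lp t F ab by (simp add: mult.commute add_increasing)
 qed
qed

text \<open>Distinct edges span distinct lines, because the form of one is positive at the midpoint
  of the other. Conversely, a finite family of lines covering an edge has a member that meets it in
  two points and therefore is the line of that edge. Thus \<open>beta\<close> is
  \<open>k + 1\<close> minus the number of edges.\<close>

lemma eta_eq: "eta vs = length vs" unfolding eta_def proof (rule Least_equality)
 define l where "l e = affine hull {fst e, snd e}" for e :: edge
 have ad: "aff_dim (l e) = 1" if "e : E" for e using E_rel(8)[of "fst e" "snd e"] that by (simp add: l_def aff_dim_2)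
 have inj: "e = e'" if e: "e : E" "e' : E" and s: "seg e <= l e'" for e e' proof (rule ccontr)
  assume n: "e ~= e'"
  have "l e' <= {x. nrm e' <.> x = nrm e' <.> fst e'}" unfolding l_def using outer_nml(2)[OF e(2)]
   by (intro hull_minimal affine_hyperplane) (auto simp: inner_diff_right)
  moreover have "el e (1/2) : seg e" unfolding seg_def by (auto simp: linepath_in_path)
  ultimately have "lin e' (el e (1/2)) = 0" using s by (auto simp: lin_def inner_diff_right)
  thus False using lin_on_edge[OF e n, of "1/2"] mult_pos_pos[OF delta_pos h_pos] by simp
 qed
 show "EX L. finite L & card L = length vs & (ALL l:L. affine l & aff_dim l = 1) & bdry vs <= \<Union>L"
 proof (intro exI conjI)
  have sl: "seg e <= l e" for e unfolding l_def seg_def segment_convex_hull by (rule convex_hull_subset_affine_hull)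
  have "inj_on l E" by (rule inj_onI) (metis inj sl)
  thus "card (l ` E) = length vs" using E_rel(2) by (simp add: card_image)
  show "bdry vs <= \<Union>(l ` E)" unfolding bdry_def using sl by blast
  show "ALL l:l ` E. affine l & aff_dim l = 1" using ad by (auto simp: l_def affine_affine_hull)
 qed (use E_rel(1) in auto)
 fix m assume "EX L. finite L & card L = m & (ALL l:L. affine l & aff_dim l = 1) & bdry vs <= \<Union>L"
 then obtain L where L: "finite L" "card L = m" "ALL l:L. affine l & aff_dim l = 1" "bdry vs <= \<Union>L" by blast
 have "EX g:L. g = l e" if e: "e : E" for e proof -
  have "fst e ~= snd e" using E_rel(8)[of "fst e" "snd e"] e by simp
  hence "infinite (seg e)" unfolding seg_def using uncountable_closed_segment countable_finite by blast
  moreover have "seg e <= (UN g:L. seg e Int g)" using L(4) e unfolding bdry_def by blast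
  ultimately have "~ (ALL g:L. finite (seg e Int g))" using L(1) by (meson finite_UN_I finite_subset)
  then obtain g where g: "g : L" "infinite (seg e Int g)" by blast
  then obtain x where x: "x : seg e Int g" using infinite_imp_nonempty by blast
  have "infinite (seg e Int g - {x})" using g(2) by simp
  then obtain y where y: "y : seg e Int g - {x}" using infinite_imp_nonempty by blast
  have xy: "x : seg e Int g" "y : seg e Int g" "x ~= y" using x y by auto
  have "affine g" "aff_dim g = 1" using L(3) g(1) by auto
  have hull: "affine hull {x, y} = g'" if "affine g'" "x : g'" "y : g'" "aff_dim g' = 1" for g'
  proof (rule affine_dim_equal)
   show "affine hull {x, y} <= g'" using that by (intro hull_minimal) auto
   show "aff_dim (affine hull {x, y}) = aff_dim g'" using that(4) xy(3) by simp
  qed (use that in \<open>auto simp: affine_affine_hull\<close>)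
  have g1: "affine hull {x, y} = g" using hull[OF \<open>affine g\<close> _ _ \<open>aff_dim g = 1\<close>] xy by blast
  have "x : l e" "y : l e" using xy(1,2) convex_hull_subset_affine_hull[of "{fst e, snd e}"]
   unfolding l_def seg_def segment_convex_hull by auto
  hence "affine hull {x, y} = l e" by (intro hull ad[OF e]) (auto simp: l_def affine_affine_hull)
  thus ?thesis using g1 g(1) by auto
 qed
 hence "l ` E <= L" by auto
 moreover have "inj_on l E" proof (rule inj_onI)
  have sl: "seg e <= l e" for e unfolding l_def seg_def segment_convex_hull by (rule convex_hull_subset_affine_hull)
  fix e e' assume "e : E" "e' : E" "l e = l e'"
  thus "e = e'" using inj sl by metis
 qed
 ultimately show "length vs <= m" using L(1,2) card_mono[of L "l ` E"] E_rel(2) by (simp add: card_image)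
qed

lemma tangent_cross: "e : E ==> snd e - fst e = ((snd e - fst e) <.> tng e) *R tng e"
 "e : E ==> \<bar>(snd e - fst e) <.> tng e\<bar> = elen e"
 using orthogonal_rotl[of "nrm e" "snd e - fst e"] outer_nml[of e]
 by (simp_all add: tangent_rotl elen_def dist_norm norm_minus_commute)

lemma norm_tangent: "e : E ==> norm (tng e) = 1" using outer_nml(1) by (simp add: tangent_rotl)

text \<open>Whether the list of vertices runs in the direction of the tangents.\<close>

definition ori :: real where
 "ori = sgn ((snd (nth_edge vs 0) - fst (nth_edge vs 0)) <.> tng (nth_edge vs 0))"

text \<open>The cross product of consecutive edge vectors can be evaluated from either edge; both
  evaluations have a positive distance as second factor, so the signs agree. Orientation is
  therefore a single global sign \<open>ori\<close>.\<close>

lemma ori_next: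
 assumes e: "(a, b) : E" "(b, c) : E" shows "sgn ((b - a) <.> tng (a, b)) = sgn ((c - b) <.> tng (b, c))" proof -
 define s where "s = (b - a) <.> tng (a, b)"
 define s' where "s' = (c - b) <.> tng (b, c)"
 have 1: "b - a = s *R tng (a, b)" using tangent_cross(1)[OF e(1)] by (simp add: s_def)
 have 2: "c - b = s' *R tng (b, c)" using tangent_cross(1)[OF e(2)] by (simp add: s'_def)
 have "cross (b - a) (c - b) = - s * (nrm (a, b) <.> (c - b))"
  unfolding 1 tangent_rotl by (simp add: cross_def inner_point algebra_simps)
 also have "nrm (a, b) <.> (c - b) = - lin (a, b) c"
  using outer_nml(2)[OF e(1)] by (simp add: lin_def inner_diff_right)
 finally have c1: "cross (b - a) (c - b) = s * lin (a, b) c" by simp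
 have "cross (b - a) (c - b) = s' * (nrm (b, c) <.> (b - a))"
  unfolding 2 tangent_rotl by (simp add: cross_def inner_point algebra_simps)
 also have "nrm (b, c) <.> (b - a) = lin (b, c) a" by (simp add: lin_def inner_diff_right)
 finally have c2: "s * lin (a, b) c = s' * lin (b, c) a" using c1 by simp
 have "0 < lin (a, b) c" "0 < lin (b, c) a" using lin_next[OF e] mult_pos_pos[OF delta_pos h_pos] by linarith+
 hence "sgn s = sgn (s * lin (a, b) c)" "sgn s' = sgn (s' * lin (b, c) a)" by (simp_all add: sgn_mult)
 thus ?thesis using c2 by (simp add: s_def s'_def)
qed

lemma edge_tangent:
 assumes e: "e : E" shows "snd e - fst e = (ori * elen e) *R tng e" proof -
 let ?s = "%e. (snd e - fst e) <.> tng e"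
 have step: "sgn (?s (nth_edge vs i)) = ori" if "i < length vs" for i using that proof (induction i)
  case (Suc i)
  hence "nth_edge vs i : E" "nth_edge vs (Suc i) : E" by (auto simp: edges_nth)
  hence "sgn (?s (nth_edge vs i)) = sgn (?s (nth_edge vs (Suc i)))"
   using ori_next[of "vs ! i" "vs ! Suc i" "vs ! (Suc (Suc i) mod length vs)"] Suc by (simp add: nth_edge_def)
  thus ?case using Suc by simp
 qed (simp add: ori_def)
 obtain i where "i < length vs" "e = nth_edge vs i" using e by (auto simp: edges_nth)
 hence "sgn (?s e) = ori" using step by simp
 hence "?s e = ori * elen e" using tangent_cross(2)[OF e] by (metis mult_sgn_abs)
 thus ?thesis using tangent_cross(1)[OF e] by simp
qed

lemma ori_sq: "ori * ori = 1" "\<bar>ori\<bar> = 1" proof -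
 obtain e where e: "e : E" using E_nonempty by blast
 have "norm (snd e - fst e) = elen e" by (simp add: elen_def dist_norm norm_minus_commute)
 moreover have "norm (snd e - fst e) = \<bar>ori\<bar> * elen e"
  using norm_tangent[OF e] elen_bounds(3)[OF e] by (subst edge_tangent[OF e]) (simp add: abs_mult)
 ultimately show 1: "\<bar>ori\<bar> = 1" using elen_bounds(3)[OF e] by simp
 show "ori * ori = 1" using 1 by (metis abs_mult_self_eq mult_1)
qed

lemma cross_edge:
 assumes e: "e : E" shows "cross (fst e - ctr) (snd e - ctr) = ori * elen e * lin e ctr" proof -
 have "cross (fst e - ctr) (snd e - ctr) = cross (fst e - ctr) (snd e - fst e)" by (simp add: cross_def algebra_simps)
 also have "... = ori * elen e * cross (fst e - ctr) (tng e)"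
  unfolding edge_tangent[OF e] by (simp add: cross_def algebra_simps)
 also have "cross (fst e - ctr) (tng e) = lin e ctr"
  by (simp add: tangent_rotl cross_def lin_def inner_point algebra_simps)
 finally show ?thesis .
qed

end

section \<open>Green's formula\<close>

lemma continuous_on_vector2:
 assumes "continuous_on S a" "continuous_on S b" shows "continuous_on S (%t. vector [a t, b t] :: point)" proof -
 have e: "(vector [a t, b t] :: point) = a t *R axis 1 1 + b t *R axis 2 1" for t
  by (simp add: vec_eq_iff forall_2 axis_def)
 show ?thesis unfolding e by (intro continuous_intros assms)
qed

lemma vector_pair_measurable: "(%p. vector [fst p, snd p] :: point) : borel_measurable (lborel \<Otimes>\<^sub>M lborel)"
proof -
 have "(%p::real\<times>real. vector [fst p, snd p] :: point) = (%p. \<chi> i. if i = 1 then fst p else snd p)"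
  by (auto simp: fun_eq_iff vec_eq_iff forall_2)
 moreover have "continuous_on UNIV (%p::real\<times>real. (\<chi> i. if i = 1 then fst p else snd p) :: point)"
 proof (rule continuous_on_vec_lambda)
  show "continuous_on UNIV (%p::real\<times>real. if i = 1 then fst p else snd p)" for i :: 2
   by (cases "i = 1") (auto intro!: continuous_intros)
 qed
 ultimately show ?thesis unfolding lborel_prod by (simp add: borel_measurable_continuous_onI)
qed

text \<open>Makes the iterated integrals of Fubini's theorem available for the Lebesgue measure on
  \<open>real^2\<close>.\<close>

lemma pair_lborel_point: "distr (lborel \<Otimes>\<^sub>M lborel) borel (%p. vector [fst p, snd p]) = (lborel :: point measure)"
proof (rule lborel_eqI[symmetric])
 note m = vector_pair_measurable
 show "sets (distr (lborel \<Otimes>\<^sub>M lborel) borel (%p. vector [fst p, snd p] :: point)) = sets borel" by simp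
 fix l u :: point
 have B: "(Basis :: point set) = {axis 1 1, axis 2 1}" by (auto simp: Basis_vec_def UNIV_2)
 have ne: "axis 1 1 ~= (axis 2 1 :: point)" by (simp add: axis_eq_axis)
 assume "!!b. b : Basis ==> l <.> b <= u <.> b"
 from this[of "axis 1 1"] this[of "axis 2 1"] have lu: "l $ 1 <= u $ 1" "l $ 2 <= u $ 2"
  unfolding B by (auto simp: inner_axis)
 have "(%p. vector [fst p, snd p] :: point) -` box l u = {l $ 1<..<u $ 1} \<times> {l $ 2<..<u $ 2}"
  by (auto simp: mem_box_cart forall_2)
 hence "emeasure (distr (lborel \<Otimes>\<^sub>M lborel) borel (%p. vector [fst p, snd p] :: point)) (box l u) =
   emeasure (lborel \<Otimes>\<^sub>M lborel) ({l $ 1<..<u $ 1} \<times> {l $ 2<..<u $ 2})"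
  using m by (subst emeasure_distr) (auto simp: space_pair_measure)
 also have "... = ennreal (u $ 1 - l $ 1) * ennreal (u $ 2 - l $ 2)"
  using lu by (subst lborel.emeasure_pair_measure_Times) auto
 also have "... = ennreal (PROD b:Basis. (u - l) <.> b)" unfolding B using ne lu by (simp add: inner_axis ennreal_mult)
 finally show "emeasure (distr (lborel \<Otimes>\<^sub>M lborel) borel (%p. vector [fst p, snd p] :: point)) (box l u) =
   ennreal (PROD b:Basis. (u - l) <.> b)" .
qed

definition simplex2 :: "point set" where
 "simplex2 = {x. 0 <= x $ 1 & 0 <= x $ 2 & x $ 1 + x $ 2 <= 1}"

lemma compact_simplex2: "compact simplex2" proof -
 have "closed simplex2" unfolding simplex2_def by (intro closed_Collect_conj closed_Collect_le continuous_intros)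
 moreover have "simplex2 <= cbox 0 1" unfolding simplex2_def by (auto simp: mem_box_cart forall_2)
 ultimately show ?thesis by (meson bounded_cbox bounded_subset compact_eq_bounded_closed)
qed

text \<open>Fubini and the fundamental theorem in the first variable; the slices run from the
  vertical leg to the hypotenuse.\<close>

lemma simplex2_integral_1:
 fixes f f1 :: "point => real"
 assumes der: "!!s t. ((%s. f (vector [s, t])) has_real_derivative f1 (vector [s, t])) (at s)"
  and c1: "continuous_on UNIV f1"
  and cf: "continuous_on UNIV (%t. f (vector [1 - t, t]))" "continuous_on UNIV (%t. f (vector [0, t]))"
 shows "(LINT x|leb simplex2. f1 x) =
  (LINT t|leb {0..1}. f (vector [1 - t, t]) - f (vector [0, t]))" proof -
 define S where "S = simplex2"
 have Sb: "S : sets borel" unfolding S_def using compact_simplex2 by (simp add: borel_compact)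
 have Sl: "S : sets lebesgue" unfolding S_def using compact_simplex2 by (rule compact_leb)
 define g where "g x = indicator S x *R f1 x" for x
 have gm: "g : borel_measurable borel" unfolding g_def
  using Sb c1 by (intro borel_measurable_scaleR borel_measurable_indicator borel_measurable_continuous_onI)
 have "integrable (leb S) f1" unfolding S_def
  by (rule int_cont[OF compact_simplex2]) (rule continuous_on_subset[OF c1], simp)
 hence "integrable lebesgue g" unfolding g_def using Sl by (subst (asm) integrable_restrict_space) auto
 hence gi: "integrable lborel g" using gm by (simp add: integrable_completion)
 have "(LINT x|leb S. f1 x) = integral\<^sup>L lebesgue g"
  unfolding g_def using Sl by (subst integral_restrict_space) auto
 also have "... = integral\<^sup>L lborel g" using gm by (simp add: integral_completion)
 also have "... = integral\<^sup>L (lborel \<Otimes>\<^sub>M lborel) (%p. g (vector [fst p, snd p]))"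
  using gm vector_pair_measurable by (subst pair_lborel_point[symmetric], subst integral_distr) auto
 also have "... = (LINT t|lborel. LINT s|lborel. g (vector [s, t]))" proof -
  have "integrable (distr (lborel \<Otimes>\<^sub>M lborel) borel (%p. vector [fst p, snd p])) g"
   using gi by (simp add: pair_lborel_point)
  hence "integrable (lborel \<Otimes>\<^sub>M lborel) (%p. g (vector [fst p, snd p]))"
   using gm vector_pair_measurable by (subst (asm) integrable_distr_eq) auto
  hence "integrable (lborel \<Otimes>\<^sub>M lborel) (case_prod (%s t. g (vector [s, t])))"
   unfolding case_prod_unfold .
  from lborel_pair.integral_snd[OF this] show ?thesis unfolding case_prod_unfold by simp
 qed
 also have "... = (LINT t|lborel. indicator {0..1} t *R (f (vector [1 - t, t]) - f (vector [0, t])))"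
 proof (rule int_congr)
  fix t :: real
  show "(LINT s|lborel. g (vector [s, t])) = indicator {0..1} t *R (f (vector [1 - t, t]) - f (vector [0, t]))"
  proof (cases "0 <= t & t <= 1")
   case True
   have "g (vector [s, t]) = indicator {0..1 - t} s *R f1 (vector [s, t])" for s
   unfolding g_def S_def simplex2_def using True by (auto simp: indicator_def)
   moreover have "(LINT s|lborel. indicator {0..1 - t} s *R f1 (vector [s, t])) =
   f (vector [1 - t, t]) - f (vector [0, t])" proof (rule integral_FTC_atLeastAtMost)
   show "((%s. f (vector [s, t])) has_vector_derivative f1 (vector [s, t])) (at s within {0..1 - t})" for s
   using der[of t s] by (simp add: has_real_derivative_iff_has_vector_derivative has_vector_derivative_at_within)
   have "continuous_on {0..1 - t} (%s. vector [s, t] :: point)" by (intro continuous_on_vector2 continuous_intros)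
   thus "continuous_on {0..1 - t} (%s. f1 (vector [s, t]))" by (rule continuous_on_compose2[OF c1]) simp
   qed (use True in simp)
   ultimately show ?thesis using True by simp
  next
   case False
   have "g (vector [s, t]) = 0" for s unfolding g_def S_def simplex2_def using False by (auto simp: indicator_def)
   thus ?thesis using False by (auto simp: indicator_def)
  qed
 qed simp
 also have "... = (LINT t|leb {0..1}. f (vector [1 - t, t]) - f (vector [0, t]))" proof -
  have fc: "continuous_on UNIV (%t. f (vector [a t, t]))" if "a = (%t. 1 - t) | a = (%_. 0)" for a :: "real => real"
   using cf that by auto
  show ?thesis by (subst integral_restrict_space)
   (auto intro!: integral_completion[symmetric] borel_measurable_diff borel_measurable_scaleR
   borel_measurable_continuous_onI fc simp del: real_scaleR_def)
 qed
 finally show ?thesis by (simp add: S_def)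
qed

lemma swap_simplex2: "(%x. vector [x $ 2, x $ 1] :: point) ` simplex2 = simplex2" proof (intro equalityI subsetI)
 fix x :: point assume "x : simplex2"
 hence "vector [x $ 2, x $ 1] : simplex2" by (simp add: simplex2_def)
 moreover have "x = vector [(vector [x $ 2, x $ 1] :: point) $ 2, (vector [x $ 2, x $ 1] :: point) $ 1]"
  by (simp add: vec_eq_iff forall_2)
 ultimately show "x : (%x. vector [x $ 2, x $ 1] :: point) ` simplex2" by blast
qed (auto simp: simplex2_def)

lemma simplex2_integral_2:
 fixes f f2 :: "point => real"
 assumes der: "!!s t. ((%s. f (vector [t, s])) has_real_derivative f2 (vector [t, s])) (at s)"
  and c2: "continuous_on UNIV f2" and cf: "continuous_on UNIV f" shows "(LINT x|leb simplex2. f2 x) =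
  (LINT t|leb {0..1}. f (vector [t, 1 - t]) - f (vector [t, 0]))" proof -
 have sw: "(vector [x $ 2, x $ 1] :: point) = 0 + (x $ 1) *R axis 2 1 + (x $ 2) *R axis 1 1" for x :: point
  by (simp add: vec_eq_iff forall_2 axis_def)
 have csw: "continuous_on UNIV (%x::point. vector [x $ 2, x $ 1] :: point)" unfolding sw by (intro continuous_intros)
 note cl = continuous_on_vector2
 have "(LINT x|leb simplex2. f2 x) = (LINT x|leb simplex2. f2 (vector [x $ 2, x $ 1]))"
  using affine_subst[of "axis 2 1" "axis 1 1" simplex2 0 f2, folded sw, unfolded swap_simplex2]
   compact_simplex2 continuous_on_subset[OF c2] by (simp add: axis_def)
 also have "... = (LINT t|leb {0..1}. f (vector [t, 1 - t]) - f (vector [t, 0]))" proof -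
  have "(LINT x|leb simplex2. (%x. f2 (vector [x $ 2, x $ 1])) x) = (LINT t|leb {0..1}.
   (%x::point. f (vector [x $ 2, x $ 1])) (vector [1 - t, t]) - (%x::point. f (vector [x $ 2, x $ 1])) (vector [0, t]))"
  proof (rule simplex2_integral_1)
   show "continuous_on UNIV (%x::point. f2 (vector [x $ 2, x $ 1]))" by (rule continuous_on_compose2[OF c2 csw]) simp
  qed (use der in \<open>auto intro!: continuous_on_compose2[OF cf] cl continuous_intros\<close>)
  thus ?thesis by simp
 qed
 finally show ?thesis .
qed

lemma C1_line:
 assumes "C1_fun q" shows "((%s. q (z + s *R a)) has_real_derivative
  (partial 1 q (z + s *R a) * a $ 1 + partial 2 q (z + s *R a) * a $ 2)) (at s)" proof -
 have 1: "((%s. z + s *R a) has_derivative (%d. d *R a)) (at s)" by (auto intro!: derivative_eq_intros)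
 have "q differentiable (at (z + s *R a))" using assms by (simp add: C1_fun_def)
 from diff_chain_at[OF 1 differentiable_partial[OF this]]
 have "((%s. q (z + s *R a)) has_derivative (%d. partial 1 q (z + s *R a) * (d * a $ 1) +
   partial 2 q (z + s *R a) * (d * a $ 2))) (at s)" by (simp add: o_def)
 thus ?thesis unfolding has_field_derivative_def by (rule has_derivative_eq_rhs) (auto simp: fun_eq_iff algebra_simps)
qed

lemma C1_continuous: "C1_fun q ==> continuous_on S q" and C1_partial_continuous: "C1_fun q ==> continuous_on S (partial i q)"
 unfolding C1_fun_def
 by (auto intro: continuous_on_subset simp: differentiable_imp_continuous_within continuous_at_imp_continuous_on)

section \<open>Green's formula on a triangle\<close>

definition rotp :: "(point => point) => point => real" where
 "rotp Q x = partial 1 (%y. Q y $ 2) x - partial 2 (%y. Q y $ 1) x"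

definition triangle_at :: "point => point => point => point set" where
 "triangle_at c a b = (%x. c + (x $ 1) *R (a - c) + (x $ 2) *R (b - c)) ` simplex2"

lemma compact_triangle_at: "compact (triangle_at c a b)"
 unfolding triangle_at_def by (intro compact_continuous_image compact_simplex2 continuous_intros)

definition line_int :: "(point => point) => point => point => real" where
 "line_int Q a b = (LINT t|leb {0..1}. Q (linepath a b t) <.> (b - a))"

lemma reflect_unit_integral:
 assumes "continuous_on {0..1} (f :: real => real)" shows "(LINT t|leb {0..1}. f (1 - t)) = (LINT t|leb {0..1}. f t)"
proof -
 have i: "integrable (leb {0..1}) f" using assms by (rule continuous_imp_integrable_real)
 have i': "integrable (leb {0..1}) (%t. f (1 - t))"
  by (intro continuous_imp_integrable_real continuous_on_compose2[OF assms] continuous_intros) auto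
 have "(f has_integral integral\<^sup>L (leb {0..1}) f) (cbox 0 1)"
  using has_integral_integral_lebesgue_on[OF i] by simp
 from has_integral_affinity[OF this, of "-1" 1]
 have "((%t. f (1 - t)) has_integral integral\<^sup>L (leb {0..1}) f) ((%x. 1 - x) ` {0..1})" by simp
 moreover have "(%x. 1 - x) ` {0..1::real} = {0..1}" by (auto intro!: image_eqI[of _ _ "1 - _"])
 ultimately show ?thesis using has_integral_integral_lebesgue_on[OF i'] by (simp add: has_integral_unique)
qed

text \<open>Pulled back to the reference triangle, the components of \<open>Q\<close> along the two
  sides at \<open>c\<close> form a field whose rotation is \<open>rotp Q\<close> times the
  determinant. The formulas for the reference triangle then leave the three sides, and the sign of
  the determinant records the orientation.\<close>

lemma green_triangle:
 assumes Q: "!!i. C1_fun (%x. Q x $ i)" and D: "cross (a - c) (b - c) ~= 0"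
 shows "(LINT x|leb (triangle_at c a b). rotp Q x) =
  sgn (cross (a - c) (b - c)) * (line_int Q c a + line_int Q a b - line_int Q c b)" proof -
 define a' b' where "a' = a - c" and "b' = b - c"
 define D where "D = cross a' b'"
 have D0: "D ~= 0" using assms(2) by (simp add: D_def a'_def b'_def)
 define g where "g x = c + (x $ 1) *R a' + (x $ 2) *R b'" for x :: point
 have T: "triangle_at c a b = g ` simplex2" by (simp add: triangle_at_def g_def a'_def b'_def)
 have cg: "continuous_on S g" for S unfolding g_def by (intro continuous_intros)
 define u where "u x = Q (g x) <.> b'" for x
 define w where "w x = Q (g x) <.> a'" for x
 define u1 where "u1 x = (partial 1 (%y. Q y $ 1) (g x) * a' $ 1 + partial 2 (%y. Q y $ 1) (g x) * a' $ 2) * b' $ 1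
   + (partial 1 (%y. Q y $ 2) (g x) * a' $ 1 + partial 2 (%y. Q y $ 2) (g x) * a' $ 2) * b' $ 2" for x
 define w2 where "w2 x = (partial 1 (%y. Q y $ 1) (g x) * b' $ 1 + partial 2 (%y. Q y $ 1) (g x) * b' $ 2) * a' $ 1
   + (partial 1 (%y. Q y $ 2) (g x) * b' $ 1 + partial 2 (%y. Q y $ 2) (g x) * b' $ 2) * a' $ 2" for x
 have cQ: "continuous_on UNIV (%x. Q (g x) $ i)" for i
  by (rule continuous_on_compose2[OF C1_continuous[OF Q, of UNIV] cg]) simp
 have cP: "continuous_on UNIV (%x. partial j (%y. Q y $ i) (g x))" for i j
  by (rule continuous_on_compose2[OF C1_partial_continuous[OF Q, of UNIV] cg]) simp
 have cu: "continuous_on UNIV u" "continuous_on UNIV w" unfolding u_def w_def inner_point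
  by (intro continuous_intros cQ)+
 have cu1: "continuous_on UNIV u1" "continuous_on UNIV w2" unfolding u1_def w2_def by (intro continuous_intros cP)+
 have rot: "D * rotp Q (g x) = u1 x - w2 x" for x
  unfolding u1_def w2_def rotp_def D_def cross_def by (simp add: algebra_simps)
 note cl = continuous_on_vector2
 have I1: "(LINT x|leb simplex2. u1 x) =
  (LINT t|leb {0..1}. u (vector [1 - t, t]) - u (vector [0, t]))" proof (rule simplex2_integral_1[OF _ cu1(1)])
  show "((%s. u (vector [s, t])) has_real_derivative u1 (vector [s, t])) (at s)" for s t proof -
   have e: "g (vector [s, t]) = (c + t *R b') + s *R a'" for s by (simp add: g_def algebra_simps)
   show ?thesis unfolding u_def u1_def inner_point e
   using C1_line[OF Q[of 1], of "c + t *R b'" a' s] C1_line[OF Q[of 2], of "c + t *R b'" a' s]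
   by (intro DERIV_add DERIV_cmult_right)
  qed
 qed (auto intro!: continuous_on_compose2[OF cu(1)] cl continuous_intros)
 have I2: "(LINT x|leb simplex2. w2 x) =
  (LINT t|leb {0..1}. w (vector [t, 1 - t]) - w (vector [t, 0]))" proof (rule simplex2_integral_2[OF _ cu1(2) cu(2)])
  show "((%s. w (vector [t, s])) has_real_derivative w2 (vector [t, s])) (at s)" for s t proof -
   have e: "g (vector [t, s]) = (c + t *R a') + s *R b'" for s by (simp add: g_def algebra_simps)
   show ?thesis unfolding w_def w2_def inner_point e
   using C1_line[OF Q[of 1], of "c + t *R a'" b' s] C1_line[OF Q[of 2], of "c + t *R a'" b' s]
   by (intro DERIV_add DERIV_cmult_right)
  qed
 qed
 have i: "integrable (leb {0..1}) (%t. f (vector [p t, q t]))"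
  if "continuous_on UNIV f" "continuous_on UNIV p" "continuous_on UNIV q" for f :: "point => real" and p q :: "real => real"
  by (intro continuous_imp_integrable_real continuous_on_compose2[OF that(1) continuous_on_subset[OF cl[OF that(2,3)]]]) auto
 \<comment> \<open>The two formulas parametrise the side from \<open>a\<close> to \<open>b\<close>
   in opposite directions.\<close>
 have R: "(LINT t|leb {0..1}. w (vector [t, 1 - t])) = (LINT t|leb {0..1}. w (vector [1 - t, t]))" proof -
  have "continuous_on {0..1::real} (%t. w (vector [t, 1 - t]))"
   by (rule continuous_on_compose2[OF cu(2) cl]) (auto intro!: continuous_intros)
  from reflect_unit_integral[OF this] show ?thesis by simp
 qed
 have J: "(LINT x|leb simplex2. u1 x) - (LINT x|leb simplex2. w2 x) =
   line_int Q a b - line_int Q c b + line_int Q c a" proof -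
  have g1: "g (vector [1 - t, t]) = linepath a b t" "g (vector [0, t]) = linepath c b t"
   "g (vector [t, 0]) = linepath c a t" for t by (simp_all add: g_def a'_def b'_def linepath_def algebra_simps)
  have ba: "b - a = b' - a'" by (simp add: a'_def b'_def)
  have "line_int Q a b = (LINT t|leb {0..1}. u (vector [1 - t, t]) - w (vector [1 - t, t]))"
   unfolding line_int_def u_def w_def g1 ba inner_diff_right ..
  moreover have "line_int Q c b = (LINT t|leb {0..1}. u (vector [0, t]))" unfolding line_int_def u_def g1 b'_def ..
  moreover have "line_int Q c a = (LINT t|leb {0..1}. w (vector [t, 0]))" unfolding line_int_def w_def g1 a'_def ..
  moreover have "(LINT t|leb {0..1}. u (vector [1 - t, t]) - w (vector [1 - t, t])) =
   (LINT t|leb {0..1}. u (vector [1 - t, t])) - (LINT t|leb {0..1}. w (vector [1 - t, t]))"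
   by (intro Bochner_Integration.integral_diff i cu continuous_intros)
  moreover have "(LINT t|leb {0..1}. u (vector [1 - t, t]) - u (vector [0, t])) =
   (LINT t|leb {0..1}. u (vector [1 - t, t])) - (LINT t|leb {0..1}. u (vector [0, t]))"
   by (intro Bochner_Integration.integral_diff i cu continuous_intros)
  moreover have "(LINT t|leb {0..1}. w (vector [t, 1 - t]) - w (vector [t, 0])) =
   (LINT t|leb {0..1}. w (vector [t, 1 - t])) - (LINT t|leb {0..1}. w (vector [t, 0]))"
   by (intro Bochner_Integration.integral_diff i cu continuous_intros)
  ultimately show ?thesis unfolding I1 I2 R by linarith
 qed
 have "(LINT x|leb (triangle_at c a b). rotp Q x) = \<bar>D\<bar> * (LINT x|leb simplex2. rotp Q (g x))" proof -
  have "continuous_on UNIV (rotp Q)" unfolding rotp_def by (intro continuous_intros C1_partial_continuous Q)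
  hence "continuous_on (g ` simplex2) (rotp Q)" by (rule continuous_on_subset) simp
  thus ?thesis using affine_subst[of a' b' simplex2 c "rotp Q", folded g_def] D0 compact_simplex2
   unfolding T D_def cross_def by blast
 qed
 also have "... = sgn D * (LINT x|leb simplex2. D * rotp Q (g x))" by (simp add: abs_sgn mult_ac)
 also have "... = sgn D * ((LINT x|leb simplex2. u1 x) - (LINT x|leb simplex2. w2 x))" unfolding rot
  by (subst Bochner_Integration.integral_diff)
   (auto intro!: int_cont[OF compact_simplex2] continuous_on_subset[OF cu1(1)]
   continuous_on_subset[OF cu1(2)])
 finally show ?thesis unfolding J by (simp add: D_def a'_def b'_def algebra_simps)
qed

section \<open>The fan of triangles from the centre to the edges\<close>

context mesh_polygon
begin

abbreviation tri :: "edge => point set" where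
 "tri e == triangle_at ctr (fst e) (snd e)"

lemma tri_iff: "x : tri e <-> (EX al be. 0 <= al & 0 <= be & al + be <= 1 &
  x = ctr + al *R (fst e - ctr) + be *R (snd e - ctr))" proof
 assume "EX al be. 0 <= al & 0 <= be & al + be <= 1 &
  x = ctr + al *R (fst e - ctr) + be *R (snd e - ctr)"
 then obtain al be where *: "0 <= al" "0 <= be" "al + be <= 1"
  "x = ctr + al *R (fst e - ctr) + be *R (snd e - ctr)" by blast
 hence "vector [al, be] : simplex2" by (simp add: simplex2_def)
 thus "x : tri e" unfolding triangle_at_def by (rule rev_image_eqI) (simp add: *)
qed (auto simp: triangle_at_def simplex2_def)

lemma tri_subset: "e : E ==> tri e <= F" proof
 fix x assume e: "e : E" and "x : tri e"
 then obtain al be where *: "0 <= al" "0 <= be" "al + be <= 1"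
  "x = ctr + al *R (fst e - ctr) + be *R (snd e - ctr)" unfolding tri_iff by blast
 have "x = (1 - al - be) *R ctr + al *R fst e + be *R snd e" using *(4) by (simp add: algebra_simps)
 moreover have "convex hull {ctr, fst e, snd e} <= F" using ends_F[OF e] ctr_F convex_F by (intro hull_minimal) auto
 moreover have "(1 - al - be) *R ctr + al *R fst e + be *R snd e : convex hull {ctr, fst e, snd e}"
  unfolding convex_hull_3 mem_Collect_eq
  by (rule exI[of _ "1 - al - be"], rule exI[of _ al], rule exI[of _ be]) (use * in auto)
 ultimately show "x : F" by blast
qed

text \<open>By convexity everything strictly between an interior point and a point of the closure is
  interior, so a ray from the centre meets the frontier at most once.\<close>

lemma frontier_ray_unique:
 assumes "y : frontier F" "y' : frontier F" "y - ctr = s *R l" "y' - ctr = s' *R l" "0 < s" "0 < s'" shows "y = y'"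
proof -
 have no: False if f: "y : frontier F" "y' : frontier F" and e: "y - ctr = s *R l" "y' - ctr = s' *R l"
  and s: "0 < s" "s < s'" for y y' s s' proof -
  have "y' - ctr = (s' / s) *R (y - ctr)" using e s by simp
  hence "(s / s') *R (y' - ctr) = y - ctr" using s by simp
  hence "y = ctr + (s / s') *R (y' - ctr)" by simp
  hence y: "y = (1 - s / s') *R ctr + (s / s') *R y'" by (simp add: scaleR_diff_right scaleR_left_diff_distrib)
  have "y' ~= ctr" using f(2) ctr_interior by (auto simp: frontier_def)
  hence "y : open_segment ctr y'" unfolding in_segment using y s by (auto intro!: exI[of _ "s / s'"])
  moreover have "open_segment ctr y' <= interior F"
   using f(2) by (intro in_interior_closure_convex_segment convex_F ctr_interior) (simp add: frontier_def)
  ultimately show False using f(1) by (auto simp: frontier_def)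
 qed
 have "~ s < s'" using no[OF assms(1-4) assms(5)] by blast
 moreover have "~ s' < s" using no[OF assms(2,1,4,3) assms(6)] by blast
 ultimately have "y - ctr = y' - ctr" using assms(3,4) by simp
 thus ?thesis by simp
qed

lemma tri_frontier:
 assumes e: "e : E" and x: "x : tri e" "x ~= ctr" shows "EX s y. 0 < s & s <= 1 & y : seg e & x - ctr = s *R (y - ctr)"
proof -
 obtain al be where *: "0 <= al" "0 <= be" "al + be <= 1"
  "x = ctr + al *R (fst e - ctr) + be *R (snd e - ctr)" using x unfolding tri_iff by blast
 define s where "s = al + be"
 have s: "0 < s" proof (rule ccontr)
  assume "~ 0 < s"
  hence "al = 0" "be = 0" using * by (auto simp: s_def)
  thus False using *(4) x(2) by simp
 qed
 define y where "y = (1 - be / s) *R fst e + (be / s) *R snd e"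
 have "y : seg e" unfolding seg_def closed_segment_def y_def using * s by (auto intro!: exI[of _ "be / s"] simp: s_def)
 moreover have "s *R (y - ctr) = x - ctr" proof -
  have "s *R y = (s - be) *R fst e + be *R snd e" using s by (simp add: y_def scaleR_add_right right_diff_distrib)
  thus ?thesis using *(4) by (simp add: s_def scaleR_diff_right algebra_simps)
 qed
 ultimately show ?thesis using s *(3) by (intro exI[of _ s] exI[of _ y]) (auto simp: s_def)
qed

lemma seg_frontier: "e : E ==> y : seg e ==> y : frontier F" unfolding frontier_F bdry_def by blast

text \<open>Radial projection from the centre sends a point of a triangle to its edge. Two triangles
  can therefore share a point only over a common vertex, that is, on a spoke.\<close>

lemma fan_unique:
 assumes e: "e : E" "e' : E" "x : tri e" "x : tri e'" "!!v. v : set vs ==> x ~: closed_segment ctr v" shows "e = e'"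
proof (rule ccontr)
 assume ne: "e ~= e'"
 have "set vs ~= {}" using simple by (auto simp: simple_polygon_def)
 hence xc: "x ~= ctr" using assms(5) by fastforce
 obtain s y where 1: "0 < s" "s <= 1" "y : seg e" "x - ctr = s *R (y - ctr)" using tri_frontier[OF e(1,3) xc] by blast
 obtain s' y' where 2: "0 < s'" "s' <= 1" "y' : seg e'" "x - ctr = s' *R (y' - ctr)" using tri_frontier[OF e(2,4) xc] by blast
 have "y - ctr = (1 / s) *R (x - ctr)" unfolding 1(4) using 1(1) by simp
 moreover have "y' - ctr = (1 / s') *R (x - ctr)" unfolding 2(4) using 2(1) by simp
 ultimately
 have "y = y'" using 1 2 seg_frontier e by (intro frontier_ray_unique[of y y' "1 / s" "x - ctr" "1 / s'"]) auto
 hence "y : {fst e, snd e} Int {fst e', snd e'}" using simple e ne 1(3) 2(3) unfolding simple_polygon_def by blast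
 hence "y : set vs" using edge_ends[of "fst e" "snd e"] e by auto
 moreover have "x : closed_segment ctr y" unfolding closed_segment_def using 1
  by (auto intro!: exI[of _ s] simp: algebra_simps)
 ultimately show False using assms(5) by blast
qed

lemma fan_cover:
 assumes x: "x : F" "x ~= ctr" shows "EX e:E. x : tri e" proof -
 obtain d where d: "0 < d" "ctr + d *R (x - ctr) : frontier F"
  using ray_to_frontier[OF compact_imp_bounded[OF compact_F] ctr_interior, of "x - ctr"] x(2) by auto
 define y where "y = ctr + d *R (x - ctr)"
 have d1: "1 <= d" proof (rule ccontr)
  assume "~ 1 <= d"
  hence "y : open_segment ctr x" unfolding in_segment y_def
   using d(1) x(2) by (auto intro!: exI[of _ d] simp: algebra_simps)
  moreover have "open_segment ctr x <= interior F"
   using x closure_subset by (intro in_interior_closure_convex_segment convex_F ctr_interior) auto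
  ultimately show False using d(2) by (auto simp: frontier_def y_def)
 qed
 obtain e where e: "e : E" "y : seg e" using d(2) unfolding frontier_F bdry_def y_def by blast
 obtain u where u: "0 <= u" "u <= 1" "y = (1 - u) *R fst e + u *R snd e"
  using e(2) unfolding seg_def closed_segment_def by blast
 have "x - ctr = (1 / d) *R (y - ctr)" using d1 by (simp add: y_def)
 also have "y - ctr = (1 - u) *R (fst e - ctr) + u *R (snd e - ctr)" using u(3) by (simp add: algebra_simps)
 finally have "x - ctr = ((1 - u) / d) *R (fst e - ctr) + (u / d) *R (snd e - ctr)" by (simp add: scaleR_add_right)
 hence "x = ctr + ((1 - u) / d) *R (fst e - ctr) + (u / d) *R (snd e - ctr)" by (simp only: diff_eq_eq ac_simps)
 moreover have "(1 - u) / d + u / d <= 1" using d1 by (simp add: add_divide_distrib[symmetric])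
 ultimately have "x : tri e" unfolding tri_iff using u d1 by (intro exI[of _ "(1 - u) / d"] exI[of _ "u / d"]) auto
 thus ?thesis using e(1) by blast
qed

text \<open>The spokes are segments, hence negligible; off them each point of the polygon lies in
  exactly one triangle.\<close>

lemma fan_AE: "AE x in lebesgue. (SUM e:E. indicator (tri e) x) = (indicator F x :: real)" proof -
 define N where "N = (UN v:set vs. closed_segment ctr v)"
 have "negligible (closed_segment ctr v)" for v :: point proof (cases "v = ctr")
  case False
  have "aff_dim (closed_segment ctr v) <= 1"
   unfolding segment_convex_hull using aff_dim_le_card[of "{ctr, v}"] False by (simp add: aff_dim_convex_hull)
  hence "interior (closed_segment ctr v) = {}" by (intro low_dim_interior) auto
  thus ?thesis by (simp add: negligible_convex_interior)
 qed simp
 hence "negligible N" unfolding N_def by (intro negligible_Union) auto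
 moreover have "(SUM e:E. indicator (tri e) x) = (indicator F x :: real)" if x: "x ~: N" for x proof (cases "x : F")
  case True
  have "set vs ~= {}" using simple by (auto simp: simple_polygon_def)
  hence "x ~= ctr" using x by (fastforce simp: N_def)
  then obtain e where e: "e : E" "x : tri e" using fan_cover True by blast
  have "indicator (tri e') x = (if e' = e then 1 else 0 :: real)" if "e' : E" for e' proof (cases "e' = e")
   case False
   have "x ~: closed_segment ctr v" if "v : set vs" for v using x that unfolding N_def by blast
   hence "x ~: tri e'" using fan_unique[OF e(1) that e(2)] False by blast
   thus ?thesis using False by simp
  qed (use e(2) in simp)
  hence "(SUM e:E. indicator (tri e) x) = (SUM e':E. if e' = e then 1 else 0 :: real)" by (intro sum.cong) auto
  thus ?thesis using e(1) E_rel(1) True by simp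
 next
  case False
  hence "(SUM e:E. indicator (tri e) x) = (0::real)" using tri_subset by (intro sum.neutral) (auto simp: indicator_def)
  thus ?thesis using False by simp
 qed
 ultimately show ?thesis unfolding eventually_ae_filter_negligible by (intro exI[of _ N]) blast
qed

lemma F_lebesgue: "F : sets lebesgue" using compact_F by (rule compact_leb)

lemma tri_lebesgue: "tri e : sets lebesgue" using compact_triangle_at by (rule compact_leb)

lemma fan_integral:
 fixes f :: "point => real"
 assumes "continuous_on F f" shows "(LINT x|leb F. f x) = (SUM e:E. LINT x|leb (tri e). f x)" proof -
 have i: "integrable lebesgue (%x. indicator (tri e) x *R f x)" if "e : E" for e
  using int_cont[OF compact_triangle_at continuous_on_subset[OF assms tri_subset[OF that]]]
   tri_lebesgue by (subst (asm) integrable_restrict_space) auto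
 have iF: "integrable lebesgue (%x. indicator F x *R f x)" using int_cont[OF compact_F assms] F_lebesgue
  by (subst (asm) integrable_restrict_space) auto
 have "(LINT x|leb F. f x) = (LINT x|lebesgue. indicator F x *R f x)"
  using F_lebesgue by (subst integral_restrict_space) auto
 also have "... = (LINT x|lebesgue. (SUM e:E. indicator (tri e) x *R f x))" proof (rule integral_cong_AE)
  show "(%x. SUM e:E. indicator (tri e) x *R f x) : borel_measurable lebesgue"
   using i by (intro borel_measurable_sum) auto
  show "AE x in lebesgue. indicator F x *R f x = (SUM e:E. indicator (tri e) x *R f x)"
   using fan_AE by eventually_elim (simp add: sum_distrib_right[symmetric])
 qed (use iF in auto)
 also have "... = (SUM e:E. LINT x|lebesgue. indicator (tri e) x *R f x)"
  using i by (rule Bochner_Integration.integral_sum)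
 also have "... = (SUM e:E. LINT x|leb (tri e). f x)"
  using tri_lebesgue by (intro sum.cong) (auto simp: integral_restrict_space)
 finally show ?thesis .
qed

lemma green_tri:
 assumes e: "e : E" and Q: "!!i. C1_fun (%x. Q x $ i)" shows "(LINT x|leb (tri e). rotp Q x) =
  edge_int e (%x. Q x <.> tng e) + ori * (line_int Q ctr (fst e) - line_int Q ctr (snd e))" proof -
 have pos: "0 < elen e * lin e ctr" using elen_bounds(3)[OF e] lin_ctr[OF e] rhoh_pos by simp
 \<comment> \<open>The signed area of the triangle has the sign \<open>ori\<close>, because the
   distance of the centre to the edge line is positive.\<close>
 hence sg: "sgn (cross (fst e - ctr) (snd e - ctr)) = ori" "cross (fst e - ctr) (snd e - ctr) ~= 0"
  using cross_edge[OF e] ori_sq(2) by (auto simp: sgn_mult mult.assoc sgn_if abs_if split: if_splits)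
 have "line_int Q (fst e) (snd e) = ori * edge_int e (%x. Q x <.> tng e)"
  unfolding line_int_def edge_int_def edge_tangent[OF e] by (simp add: mult.assoc)
 hence "ori * line_int Q (fst e) (snd e) = edge_int e (%x. Q x <.> tng e)" using ori_sq(1) by (simp flip: mult.assoc)
 thus ?thesis using green_triangle[OF Q sg(2)] by (simp add: sg(1) algebra_simps)
qed

text \<open>Summing over the fan, the spoke integrals telescope around the cycle and only the edges
  remain.\<close>

theorem green_polygon:
 assumes Q: "!!i. C1_fun (%x. Q x $ i)" shows "(LINT x|leb F. rotp Q x) = bdry_int vs (%e x. Q x <.> tng e)" proof -
 have "continuous_on F (rotp Q)" unfolding rotp_def by (intro continuous_intros C1_partial_continuous Q)
 hence "(LINT x|leb F. rotp Q x) = (SUM e:E. LINT x|leb (tri e). rotp Q x)" by (rule fan_integral)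
 also have "... = (SUM e:E. edge_int e (%x. Q x <.> tng e) -
   ori * (line_int Q ctr (snd e) - line_int Q ctr (fst e)))"
  using green_tri[OF _ Q] by (intro sum.cong) (auto simp: algebra_simps)
 also have "... = bdry_int vs (%e x. Q x <.> tng e)" using edges_sum_telescope[OF simple, of "line_int Q ctr"]
  unfolding bdry_int_def sum_subtractf sum_distrib_left[symmetric] by simp
 finally show ?thesis .
qed

end

section \<open>Square integrable functions\<close>

lemma quadratic_discriminant:
 fixes A B C :: real
 assumes "!!s t. 0 <= s^2 * A + 2 * s * t * B + t^2 * C" shows "B^2 <= A * C" proof -
 have A: "0 <= A" and C: "0 <= C" using assms[of 1 0] assms[of 0 1] by auto
 show ?thesis proof (cases "C = 0")
  case True
  have "B = 0" proof (rule ccontr)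
   assume n: "B ~= 0"
   thus False using assms[of 1 "- (A + 1) / (2 * B)"] True by (simp add: field_simps)
  qed
  thus ?thesis using True by simp
 next
  case False
  have "0 <= C * (A * C - B^2)" using assms[of C "- B"] by (simp add: power2_eq_square algebra_simps)
  thus ?thesis using C False by (simp add: zero_le_mult_iff)
 qed
qed

lemma L2_onI: "f : borel_measurable (leb D) ==> integrable (leb D) (%x. (norm (f x))^2) ==> L2_on D f"
 by (simp add: L2_on_def)

lemma L2_measurable: "L2_on D f ==> f : borel_measurable (leb D)" by (simp add: L2_on_def)

lemma L2_square: "L2_on D f ==> integrable (leb D) (%x. (norm (f x))^2)" by (simp add: L2_on_def)

lemma L2_inner_int:
 assumes "L2_on D f" "L2_on D g" shows "integrable (leb D) (%x. f x <.> g x)"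
proof (rule Bochner_Integration.integrable_bound)
 show "integrable (leb D) (%x. (norm (f x))^2 + (norm (g x))^2)" using assms by (auto simp: L2_on_def)
 show "(%x. f x <.> g x) : borel_measurable (leb D)" using assms by (intro borel_measurable_inner L2_measurable)
 have "\<bar>a <.> b\<bar> <= (norm a)^2 + (norm b)^2" for a b :: 'b proof -
  have "0 <= (norm a - norm b)^2" by simp
  hence "2 * (norm a * norm b) <= (norm a)^2 + (norm b)^2" by (simp add: power2_diff)
  moreover have "0 <= norm a * norm b" by simp
  ultimately show ?thesis using Cauchy_Schwarz_ineq2[of a b] by linarith
 qed
 thus "AE x in leb D. norm (f x <.> g x) <= norm ((norm (f x))^2 + (norm (g x))^2)" by (intro AE_I2) simp
qed

lemma L2_lin:
 assumes "L2_on D f" "L2_on D g" shows "L2_on D (%x. a *R f x + b *R g x)" proof (rule L2_onI)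
 show "(%x. a *R f x + b *R g x) : borel_measurable (leb D)"
  using assms by (intro borel_measurable_add borel_measurable_scaleR borel_measurable_const L2_measurable)
 have "(norm (a *R f x + b *R g x))^2 = a^2 * (f x <.> f x) + 2 * a * b * (f x <.> g x) + b^2 * (g x <.> g x)" for x
  unfolding power2_norm_eq_inner by (simp add: inner_add_left inner_add_right inner_commute power2_eq_square)
 moreover have "integrable (leb D) (%x. a^2 * (f x <.> f x) + 2 * a * b * (f x <.> g x) + b^2 * (g x <.> g x))"
  using L2_inner_int assms by (intro Bochner_Integration.integrable_add integrable_mult_right) auto
 ultimately show "integrable (leb D) (%x. (norm (a *R f x + b *R g x))^2)" by simp
qed

lemma L2_add: "L2_on D f ==> L2_on D g ==> L2_on D (%x. f x + g x)" using L2_lin[of D f g 1 1] by simp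

lemma L2_diff: "L2_on D f ==> L2_on D g ==> L2_on D (%x. f x - g x)" using L2_lin[of D f g 1 "-1"] by simp

lemma L2_CS:
 assumes f: "L2_on D f" and g: "L2_on D g" shows "(LINT x|leb D. f x <.> g x)^2 <=
  (LINT x|leb D. (norm (f x))^2) * (LINT x|leb D. (norm (g x))^2)" proof (rule quadratic_discriminant)
 fix s t
 note i = L2_inner_int
 have "0 <= (LINT x|leb D. (norm (s *R f x + t *R g x))^2)" by simp
 also have "... = (LINT x|leb D. s^2 * (f x <.> f x) + 2 * s * t * (f x <.> g x) + t^2 * (g x <.> g x))"
  unfolding power2_norm_eq_inner by (simp add: inner_add_left inner_add_right inner_commute power2_eq_square algebra_simps)
 also have "... = s^2 * (LINT x|leb D. f x <.> f x) + 2 * s * t * (LINT x|leb D. f x <.> g x) +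
   t^2 * (LINT x|leb D. g x <.> g x)" using i[OF f f] i[OF f g] i[OF g g] by simp
 finally show "0 <= s^2 * (LINT x|leb D. (norm (f x))^2) + 2 * s * t * (LINT x|leb D. f x <.> g x) +
   t^2 * (LINT x|leb D. (norm (g x))^2)" by (simp add: power2_norm_eq_inner)
qed

lemma L2_continuous: "compact D ==> continuous_on D f ==> L2_on D f"
 by (intro L2_onI cont_meas compact_leb
   int_cont continuous_intros)

lemma L2_integrable:
 assumes "compact D" "L2_on D f" shows "integrable (leb D) f" proof (rule Bochner_Integration.integrable_bound)
 show "integrable (leb D) (%x. 1 + (norm (f x))^2)"
  using assms int_cont[OF assms(1), of "%_. 1::real"] by (auto simp: L2_on_def)
 have "a <= 1 + a^2" for a :: real proof -
  have "0 <= (a - 1)^2 + a^2 + 1" by simp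
  thus ?thesis by (simp add: power2_diff)
 qed
 thus "AE x in leb D. norm (f x) <= norm (1 + (norm (f x))^2)"
  by (intro AE_I2) (simp add: abs_of_nonneg add_nonneg_nonneg)
qed (use assms in \<open>simp add: L2_on_def\<close>)

lemma L2_mult_bounded:
 fixes f :: "'a::euclidean_space => 'b::euclidean_space"
 assumes "L2_on D f" "g : borel_measurable (leb D)" "!!x. x : D ==> \<bar>g x\<bar> <= B" "D : sets lebesgue"
 shows "L2_on D (%x. g x *R f x)" proof (rule L2_onI)
 show "(%x. g x *R f x) : borel_measurable (leb D)"
  using assms(2) L2_measurable[OF assms(1)] by (rule borel_measurable_scaleR)
 hence m: "(%x. (norm (g x *R f x))^2) : borel_measurable (leb D)"
  unfolding power2_norm_eq_inner by (intro borel_measurable_inner)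
 have i: "integrable (leb D) (%x. B^2 * (norm (f x))^2)" using L2_square[OF assms(1)] by (rule integrable_mult_right)
 have le: "(norm (g x *R f x))^2 <= B^2 * (norm (f x))^2" if "x : D" for x proof -
  have "(\<bar>g x\<bar> * norm (f x))^2 <= (B * norm (f x))^2"
   using assms(3)[OF that] by (intro power_mono mult_right_mono) auto
  thus ?thesis by (simp add: power_mult_distrib)
 qed
 show "integrable (leb D) (%x. (norm (g x *R f x))^2)"
  by (rule Bochner_Integration.integrable_bound[OF i m], rule AE_I2)
   (use le assms(4) in \<open>simp add: abs_of_nonneg\<close>)
qed

lemma L2_mult_continuous:
 fixes f :: "'a::euclidean_space => 'b::euclidean_space"
 assumes "compact D" "L2_on D f" "continuous_on D g" shows "L2_on D (%x. g x *R f x)" proof -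
 have "bounded (g ` D)" using assms by (intro compact_imp_bounded compact_continuous_image)
 then obtain B where "ALL x:D. \<bar>g x\<bar> <= B" unfolding bounded_iff by auto
 thus ?thesis using assms
  by (intro L2_mult_bounded[where B = B] cont_meas compact_leb) auto
qed

lemma L2_component:
 fixes f :: "'a::euclidean_space => point" shows "L2_on D f <-> (ALL i. L2_on D (%x. f x $ i))" proof
 assume f: "L2_on D f"
 show "ALL i. L2_on D (%x. f x $ i)" proof (intro allI L2_onI)
  fix i
  show m: "(%x. f x $ i) : borel_measurable (leb D)" proof -
   have "(%x. f x <.> axis i 1) : borel_measurable (leb D)"
   using L2_measurable[OF f] by (intro borel_measurable_inner borel_measurable_const)
   thus ?thesis by (simp add: inner_axis)
  qed
  show "integrable (leb D) (%x. (norm (f x $ i))^2)"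
  proof (rule Bochner_Integration.integrable_bound[OF L2_square[OF f]])
   show "(%x. (norm (f x $ i))^2) : borel_measurable (leb D)"
   using m unfolding power2_norm_eq_inner by (intro borel_measurable_inner)
   show "AE x in leb D. norm ((norm (f x $ i))^2) <= norm ((norm (f x))^2)"
   using power_mono[OF component_le_norm_cart abs_ge_zero, of _ i 2] by (intro AE_I2) simp
  qed
 qed
next
 assume f: "ALL i. L2_on D (%x. f x $ i)"
 have e: "f x = (f x $ 1) *R axis 1 1 + (f x $ 2) *R axis 2 1" for x by (simp add: vec_eq_iff forall_2 axis_def)
 have "(%x. (f x $ 1) *R axis 1 1 + (f x $ 2) *R axis 2 1 :: point) : borel_measurable (leb D)"
  using f by (intro borel_measurable_add borel_measurable_scaleR borel_measurable_const L2_measurable) auto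
 hence "f : borel_measurable (leb D)" by (simp flip: e)
 moreover have "integrable (leb D) (%x. (norm (f x))^2)" proof -
  have "integrable (leb D) (%x. (f x $ i)^2)" for i using L2_square[of D "%x. f x $ i"] f by simp
  thus ?thesis unfolding norm_point by (intro Bochner_Integration.integrable_add)
 qed
 ultimately show "L2_on D f" by (rule L2_onI)
qed

section \<open>Density of continuous functions in mean square\<close>

definition clamp1 :: "real => real => real" where
 "clamp1 M y = max (- M) (min M y)"

lemma clamp1_bounds: "0 <= M ==> \<bar>clamp1 M y\<bar> <= M" "0 <= M ==> \<bar>y - clamp1 M y\<bar> <= \<bar>y\<bar>"
 by (auto simp: clamp1_def)

lemma clamp1_continuous: "continuous_on S f ==> continuous_on S (%x. clamp1 M (f x))"
 unfolding clamp1_def by (intro continuous_intros)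

lemma AE_limit_of_continuous:
 fixes f :: "'a::euclidean_space => real"
 assumes "D : sets lebesgue" "f : borel_measurable (leb D)"
 obtains g where "!!n. continuous_on UNIV (g n :: 'a => real)" "AE x in leb D. (%n. g n x) \<longlonglongrightarrow> f x"
proof -
 obtain N g where g: "negligible N" "!!n. continuous_on UNIV (g n :: 'a => real)"
  "!!x. x ~: N ==> (%n. g n x) \<longlonglongrightarrow> (if x : D then f x else 0)"
  using assms measurable_on_iff_borel_measurable[OF assms(1), of f] unfolding measurable_on_def by blast
 have "AE x in lebesgue. x : D --> (%n. g n x) \<longlonglongrightarrow> f x"
  unfolding eventually_ae_filter_negligible using g(1,3) by (intro exI[of _ N]) force
 hence "AE x in leb D. (%n. g n x) \<longlonglongrightarrow> f x" using assms(1) by (subst AE_restrict_space_iff) auto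
 with g(2) that show thesis by blast
qed

lemma tendsto_clamp1: "(%n. g n) \<longlonglongrightarrow> a ==> (%n. clamp1 M (g n)) \<longlonglongrightarrow> clamp1 M a"
 unfolding clamp1_def by (intro tendsto_intros)

text \<open>Truncation comes first: truncating at the same level the continuous functions that
  converge almost everywhere gives a uniform bound, so dominated convergence upgrades pointwise
  convergence to convergence in mean square.\<close>

lemma L2_approx_continuous:
 fixes f :: "'a::euclidean_space => real"
 assumes D: "compact D" and f: "L2_on D f" and e: "e > 0"
 shows "EX w. continuous_on UNIV w & (LINT x|leb D. (f x - w x)^2) < e" proof -
 have Dl: "D : sets lebesgue" using D by (rule compact_leb)
 have fm: "f : borel_measurable (leb D)" using f by (rule L2_measurable)
 have f2: "integrable (leb D) (%x. (f x)^2)" using L2_square[OF f] by simp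
 have cm: "(%x. clamp1 M (f x)) : borel_measurable (leb D)" for M
  unfolding clamp1_def using fm by (intro borel_measurable_max borel_measurable_min) auto
 have "(%n. LINT x|leb D. (f x - clamp1 (real n) (f x))^2) \<longlonglongrightarrow> (LINT x|leb D. 0)"
 proof (rule integral_dominated_convergence[where w = "%x. (f x)^2"])
  have "(%n. (y - clamp1 (real n) y)^2) \<longlonglongrightarrow> 0" for y proof (rule tendsto_eventually)
   show "\<forall>\<^sub>F n in sequentially. (y - clamp1 (real n) y)^2 = 0"
   using eventually_ge_at_top[of "nat \<lceil>\<bar>y\<bar>\<rceil>"] proof eventually_elim
   case (elim n)
   hence "\<bar>y\<bar> <= real n" by linarith
   thus ?case by (auto simp: clamp1_def)
   qed
  qed
  thus "AE x in leb D. (%n. (f x - clamp1 (real n) (f x))^2) \<longlonglongrightarrow> 0" by (intro AE_I2)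
  show "AE x in leb D. norm ((f x - clamp1 (real n) (f x))^2) <= (f x)^2" for n
   using clamp1_bounds(2)[of "real n"] by (intro AE_I2) (simp flip: abs_le_square_iff)
 qed (use fm cm f2 in auto)
 hence "\<forall>\<^sub>F n in sequentially. (LINT x|leb D. (f x - clamp1 (real n) (f x))^2) < e / 4"
  using e by (intro order_tendstoD(2)) auto
 then obtain n where n: "(LINT x|leb D. (f x - clamp1 (real n) (f x))^2) < e / 4"
  using eventually_happens'[OF sequentially_bot] by blast
 obtain g where g: "!!n. continuous_on UNIV (g n :: 'a => real)" "AE x in leb D. (%n. g n x) \<longlonglongrightarrow> f x"
  using AE_limit_of_continuous[OF Dl fm] by blast
 define w where "w k x = clamp1 (real n) (g k x)" for k x
 have wc: "continuous_on S (w k)" for S k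
  unfolding w_def using continuous_on_subset[OF clamp1_continuous[OF g(1)]] by auto
 have wm: "w k : borel_measurable (leb D)" for k by (intro cont_meas Dl wc)
 have ci: "integrable (leb D) (%_. c :: real)" for c using D by (intro int_cont continuous_intros)
 have b: "(clamp1 (real n) a - clamp1 (real n) b)^2 <= (2 * real n)^2" for a b
  using clamp1_bounds(1)[of "real n" a] clamp1_bounds(1)[of "real n" b] by (intro abs_le_square_iff[THEN iffD1]) auto
 have "(%k. LINT x|leb D. (clamp1 (real n) (f x) - w k x)^2) \<longlonglongrightarrow> (LINT x|leb D. 0)"
 proof (rule integral_dominated_convergence[where w = "%x. (2 * real n)^2"])
  show "AE x in leb D. (%k. (clamp1 (real n) (f x) - w k x)^2) \<longlonglongrightarrow> 0" using g(2)
  proof eventually_elim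
   case (elim x)
   hence "(%k. (clamp1 (real n) (f x) - w k x)^2) \<longlonglongrightarrow> (clamp1 (real n) (f x) - clamp1 (real n) (f x))^2"
   unfolding w_def by (intro tendsto_intros tendsto_clamp1)
   thus ?case by simp
  qed
  show "AE x in leb D. norm ((clamp1 (real n) (f x) - w k x)^2) <= (2 * real n)^2" for k
   using b by (intro AE_I2) (simp add: w_def)
  show "(%x. (clamp1 (real n) (f x) - w k x)^2) : borel_measurable (leb D)" for k
   by (intro borel_measurable_power borel_measurable_diff cm wm)
 qed (use ci in auto)
 hence "\<forall>\<^sub>F k in sequentially. (LINT x|leb D. (clamp1 (real n) (f x) - w k x)^2) < e / 4"
  using e by (intro order_tendstoD(2)) auto
 then obtain k where k: "(LINT x|leb D. (clamp1 (real n) (f x) - w k x)^2) < e / 4"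
  using eventually_happens'[OF sequentially_bot] by blast
 have i1: "integrable (leb D) (%x. (f x - clamp1 (real n) (f x))^2)"
 proof (rule Bochner_Integration.integrable_bound[OF f2])
  show "AE x in leb D. norm ((f x - clamp1 (real n) (f x))^2) <= norm ((f x)^2)"
   using clamp1_bounds(2)[of "real n"] by (intro AE_I2) (simp flip: abs_le_square_iff)
  show "(%x. (f x - clamp1 (real n) (f x))^2) : borel_measurable (leb D)"
   by (intro borel_measurable_power borel_measurable_diff cm fm)
 qed
 have i2: "integrable (leb D) (%x. (clamp1 (real n) (f x) - w k x)^2)"
 proof (rule Bochner_Integration.integrable_bound[OF ci[of "(2 * real n)^2"]])
  show "AE x in leb D. norm ((clamp1 (real n) (f x) - w k x)^2) <= norm ((2 * real n)^2)"
   using b by (intro AE_I2) (simp add: w_def)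
  show "(%x. (clamp1 (real n) (f x) - w k x)^2) : borel_measurable (leb D)"
   by (intro borel_measurable_power borel_measurable_diff cm wm)
 qed
 have sq: "(a + b)^2 <= 2 * a^2 + 2 * b^2" for a b :: real proof -
  have "0 <= (a - b)^2" by simp
  thus ?thesis by (simp add: power2_diff power2_sum)
 qed
 have "(LINT x|leb D. (f x - w k x)^2) <=
   (LINT x|leb D. 2 * (f x - clamp1 (real n) (f x))^2 + 2 * (clamp1 (real n) (f x) - w k x)^2)"
 proof (rule integral_mono)
  have "L2_on D (%x. f x - w k x)" by (intro L2_diff f L2_continuous D wc)
  from L2_square[OF this] show "integrable (leb D) (%x. (f x - w k x)^2)" by simp
  show "(f x - w k x)^2 <= 2 * (f x - clamp1 (real n) (f x))^2 + 2 * (clamp1 (real n) (f x) - w k x)^2" for x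
   using sq[of "f x - clamp1 (real n) (f x)" "clamp1 (real n) (f x) - w k x"] by simp
 qed (use i1 i2 in auto)
 also have "... < e" using i1 i2 n k by simp
 finally show ?thesis using wc by blast
qed

section \<open>Convolution with a smooth kernel\<close>

text \<open>Polynomials are dense: \<open>f\<close> is approximated by a continuous function in mean
  square and that one uniformly by a polynomial \<open>p\<close>. Orthogonality turns the squared
  norm of \<open>f\<close> into its pairing with \<open>f - p\<close>, so the norm is arbitrarily
  small.\<close>

lemma poly_orth_AE_zero:
 fixes f :: "'a::euclidean_space => real"
 assumes D: "compact D" and f: "L2_on D f"
  and orth: "!!p. real_polynomial_function p ==> (LINT x|leb D. f x * p x) = 0" shows "AE x in leb D. f x = 0" proof -
 have Dl: "D : sets lebesgue" using D by (rule compact_leb)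
 define I where "I = (LINT x|leb D. (f x)^2)"
 define m where "m = (LINT x|leb D. 1::real)"
 have i1: "integrable (leb D) (%x. a)" for a :: real by (intro int_cont D continuous_intros)
 have m0: "0 <= m" and I0: "0 <= I" by (simp_all add: m_def I_def)
 have "I <= 0 + e" if e: "e > 0" for e proof -
  \<comment> \<open>\<open>d <= 1\<close> lets \<open>d^2\<close> be replaced by \<open>d\<close>,
    and the second bound keeps the uniform error, integrated over \<open>D\<close>, small against
    \<open>e\<close>.\<close>
  define d where "d = min 1 (e / (4 * (m + 1)))"
  have d: "d > 0" "d * m <= e / 4" proof -
   have "d * m <= e / (4 * (m + 1)) * m" using m0 by (intro mult_right_mono) (auto simp: d_def)
   also have "... <= e / 4" using m0 e by (simp add: field_simps)
   finally show "d * m <= e / 4" .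
  qed (use e m0 in \<open>simp add: d_def\<close>)
  have "d <= 1" by (simp add: d_def)
  hence d2: "d^2 <= d" using d(1) mult_left_le[of d d] by (simp add: power2_eq_square)
  obtain w where w: "continuous_on UNIV w" "(LINT x|leb D. (f x - w x)^2) < e / 4"
   using L2_approx_continuous[OF D f, of "e / 4"] e by auto
  have wD: "continuous_on D w" using w(1) continuous_on_subset by blast
  obtain p where p: "real_polynomial_function p" "!!x. x : D ==> \<bar>w x - p x\<bar> < d"
   using Stone_Weierstrass_real_polynomial_function[OF D wD d(1)] by auto
  have pc: "continuous_on D p" using p(1) by (simp add: real_polynomial_function_eq continuous_on_polymonial_function)
  have fp: "L2_on D (%x. f x - p x)" "L2_on D (%x. f x - w x)" by (intro L2_diff f L2_continuous[OF D] pc wD)+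
  have "(LINT x|leb D. (f x - p x)^2) <= (LINT x|leb D. 2 * (f x - w x)^2 + 2 * d)" proof (rule integral_mono)
   fix x assume "x : space (leb D)"
   hence "(w x - p x)^2 <= d^2" using p(2)[of x] by (subst abs_le_square_iff[symmetric]) simp
   moreover have "(f x - p x)^2 <= 2 * (f x - w x)^2 + 2 * (w x - p x)^2"
   using sum_squares_bound[of "f x - w x" "w x - p x"] by (simp add: power2_eq_square algebra_simps)
   ultimately show "(f x - p x)^2 <= 2 * (f x - w x)^2 + 2 * d" using d2 by simp
  qed (use fp[THEN L2_square] i1[of "2 * d"] in auto)
  also have "... = 2 * (LINT x|leb D. (f x - w x)^2) + 2 * d * m"
   using fp(2)[THEN L2_square] i1[of "2 * d"] by (simp add: m_def mult_ac)
  also have "... <= e" using w(2) d(2) by simp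
  finally have J: "(LINT x|leb D. (f x - p x)^2) <= e" .
  have "I = (LINT x|leb D. f x * (f x - p x))"
   using orth[OF p(1)] L2_inner_int[OF f f] L2_inner_int[OF f L2_continuous[OF D pc]]
   by (simp add: right_diff_distrib I_def power2_eq_square)
  hence "I^2 <= I * (LINT x|leb D. (f x - p x)^2)" using L2_CS[OF f fp(1)] by (simp add: I_def)
  also have "... <= I * e" using J I0 by (rule mult_left_mono)
  finally show ?thesis using I0 e by (cases "I = 0") (auto simp: power2_eq_square)
 qed
 hence "I = 0" using I0 field_le_epsilon[of I 0] by fastforce
 hence "AE x in leb D. (f x)^2 = 0"
  using L2_square[OF f] unfolding I_def by (subst integral_nonneg_eq_0_iff_AE[symmetric]) auto
 thus ?thesis by simp
qed

lemma int_mult_cont: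
 fixes a q :: "'a::euclidean_space => real"
 assumes D: "compact D" and a: "integrable (leb D) a" and q: "continuous_on D q"
 shows "integrable (leb D) (%x. a x * q x)" proof -
 have Dl: "D : sets lebesgue" using D by (rule compact_leb)
 have "bounded (q ` D)" using D q by (intro compact_imp_bounded compact_continuous_image)
 then obtain B where B: "ALL x:D. \<bar>q x\<bar> <= B" unfolding bounded_iff by auto
 show ?thesis proof (rule Bochner_Integration.integrable_bound[of _ "%x. B * a x"])
  show "(%x. a x * q x) : borel_measurable (leb D)"
   using a cont_meas[OF q Dl] by (intro borel_measurable_times) auto
  have "\<bar>a x\<bar> * \<bar>q x\<bar> <= \<bar>B\<bar> * \<bar>a x\<bar>" if "x : D" for x
   using B that by (subst mult.commute) (intro mult_right_mono, auto)
  thus "AE x in leb D. norm (a x * q x) <= norm (B * a x)" using Dl by (intro AE_I2) (auto simp: abs_mult)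
 qed (use a in simp)
qed

lemma integral_mult_abs_le:
 fixes a q :: "'a::euclidean_space => real"
 assumes D: "compact D" and a: "integrable (leb D) a" and q: "continuous_on D q"
  and b: "!!x. x : D ==> \<bar>q x\<bar> <= B"
 shows "\<bar>LINT x|leb D. a x * q x\<bar> <= B * (LINT x|leb D. \<bar>a x\<bar>)" proof -
 have "\<bar>LINT x|leb D. a x * q x\<bar> <= (LINT x|leb D. \<bar>a x * q x\<bar>)" by (rule integral_abs_bound)
 also have "... <= (LINT x|leb D. B * \<bar>a x\<bar>)" proof (rule integral_mono)
  show "integrable (leb D) (%x. \<bar>a x * q x\<bar>)" by (intro integrable_abs int_mult_cont D a q)
  fix x assume "x : space (leb D)"
  hence "\<bar>q x\<bar> <= B" using b compact_leb[OF D] by simp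
  thus "\<bar>a x * q x\<bar> <= B * \<bar>a x\<bar>" unfolding abs_mult by (subst mult.commute) (rule mult_right_mono, auto)
 qed (use a in auto)
 finally show ?thesis by simp
qed

lemma convolution_continuous:
 fixes a :: "point => real"
 assumes D: "compact D" and a: "integrable (leb D) a" and q: "continuous_on UNIV (q :: point => real)"
 shows "continuous_on UNIV (%X. LINT y|leb D. a y * q (X - y))" proof (intro continuous_at_imp_continuous_on ballI)
 fix X :: point
 define A where "A = (LINT x|leb D. \<bar>a x\<bar>)"
 have A: "0 <= A" unfolding A_def by simp
 obtain R where R: "ALL y:D. norm y <= R" using compact_imp_bounded[OF D] unfolding bounded_iff by blast
 define C where "C = cball (0::point) (norm X + \<bar>R\<bar> + 1)"
 have cq: "continuous_on D (%y. q (X' - y))" for X'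
  by (rule continuous_on_compose2[OF q]) (auto intro!: continuous_intros)
 have "uniformly_continuous_on C q"
  unfolding C_def by (rule compact_uniformly_continuous[OF continuous_on_subset[OF q]]) auto
 note uc = this[unfolded uniformly_continuous_on_def, rule_format]
 show "isCont (%X. LINT y|leb D. a y * q (X - y)) X" unfolding isCont_def LIM_eq proof (intro allI impI)
  fix e :: real assume e: "0 < e"
  obtain d where d: "d > 0" "!!x x'. x : C ==> x' : C ==> dist x' x < d ==> dist (q x') (q x) < e / (A + 1)"
   using uc[of "e / (A + 1)"] e A by (metis add_nonneg_pos divide_pos_pos zero_less_one)
  have "norm ((LINT y|leb D. a y * q (Y - y)) - (LINT y|leb D. a y * q (X - y))) < e"
   if Y: "norm (Y - X) < min d 1" for Y proof -
   have i: "integrable (leb D) (%y. a y * q (X' - y))" for X' by (intro int_mult_cont D a cq)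
   have "(LINT y|leb D. a y * q (Y - y)) - (LINT y|leb D. a y * q (X - y)) =
   (LINT y|leb D. a y * (q (Y - y) - q (X - y)))" using i[of X] i[of Y] by (simp add: right_diff_distrib)
   also have "\<bar>...\<bar> <= e / (A + 1) * A" unfolding A_def proof (rule integral_mult_abs_le[OF D a])
   show "continuous_on D (%y. q (Y - y) - q (X - y))" by (intro continuous_intros cq)
   fix y assume y: "y : D"
   have "norm y <= \<bar>R\<bar>" using R y by fastforce
   moreover have "norm (X - y) <= norm X + norm y" by (rule norm_triangle_ineq4)
   moreover have "norm (Y - y) <= norm (Y - X) + norm (X - y)" using norm_triangle_ineq[of "Y - X" "X - y"] by simp
   ultimately have "X - y : C" "Y - y : C" using Y by (auto simp: C_def)
   moreover have "dist (Y - y) (X - y) < d" using Y by (simp add: dist_norm)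
   ultimately have "dist (q (Y - y)) (q (X - y)) < e / (A + 1)" using d(2) by blast
   thus "\<bar>q (Y - y) - q (X - y)\<bar> <= e / ((LINT x|leb D. \<bar>a x\<bar>) + 1)"
   by (simp add: dist_real_def A_def)
   qed
   also have "... < e" using e A by (simp add: field_simps)
   finally show ?thesis by simp
  qed
  thus "EX s>0. ALL Y. Y ~= X & norm (Y - X) < s -->
   norm ((LINT y|leb D. a y * q (Y - y)) - (LINT y|leb D. a y * q (X - y))) < e"
   using d(1) by (intro exI[of _ "min d 1"]) auto
 qed
qed

text \<open>Differentiation under the integral: uniform continuity of the partial derivatives, on a
  ball containing all arguments, bounds the linearisation error of \<open>q\<close> uniformly in
  \<open>y\<close>, and this bound is integrated against \<open>a\<close>.\<close>

lemma convolution_has_derivative: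
 fixes a :: "point => real"
 assumes D: "compact D" and a: "integrable (leb D) a" and q: "C1_fun q"
 shows "((%X. LINT y|leb D. a y * q (X - y)) has_derivative
  (%d. (LINT y|leb D. a y * partial 1 q (X - y)) * d $ 1 +
   (LINT y|leb D. a y * partial 2 q (X - y)) * d $ 2)) (at X)" proof -
 define A where "A = (LINT x|leb D. \<bar>a x\<bar>)"
 have A: "0 <= A" unfolding A_def by simp
 obtain R where R: "ALL y:D. norm y <= R" using compact_imp_bounded[OF D] unfolding bounded_iff by blast
 define C where "C = cball (0::point) (norm X + \<bar>R\<bar> + 1)"
 have comp: "continuous_on D (%y. f (X' - y))" if "continuous_on UNIV f" for X' and f :: "point => real"
  by (rule continuous_on_compose2[OF that]) (auto intro!: continuous_intros)
 have i: "integrable (leb D) (%y. a y * f (X' - y))" if "continuous_on UNIV f" for X' and f :: "point => real"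
  by (intro int_mult_cont D a comp that)
 have cq: "continuous_on UNIV q" and cp: "continuous_on UNIV (partial i q)" for i
  using C1_continuous[OF q] C1_partial_continuous[OF q] by auto
 have uc: "uniformly_continuous_on C (partial i q)" for i
  unfolding C_def by (rule compact_uniformly_continuous[OF continuous_on_subset[OF cp]]) auto
 let ?D = "%d. (LINT y|leb D. a y * partial 1 q (X - y)) * d $ 1 +
   (LINT y|leb D. a y * partial 2 q (X - y)) * d $ 2"
 let ?P = "%X. LINT y|leb D. a y * q (X - y)"
 have "bounded_linear ?D"
  by (intro bounded_linear_add bounded_linear_mult_right[THEN bounded_linear_compose] bounded_linear_vec_nth)
 moreover have "EX d>0. ALL Y. norm (Y - X) < d --> norm (?P Y - ?P X - ?D (Y - X)) <= e * norm (Y - X)" if e: "0 < e" for e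
 proof -
  \<comment> \<open>The factor 2 accounts for the two partial derivatives, \<open>A + 1\<close> for
    the total mass of \<open>a\<close>.\<close>
  define e' where "e' = e / (2 * (A + 1))"
  have e': "e' > 0" using e A by (simp add: e'_def)
  have "EX d>0. ALL x:C. ALL x':C. dist x' x < d --> dist (partial i q x') (partial i q x) < e'" for i
   using uc[of i] e' unfolding uniformly_continuous_on_def by blast
  then obtain d where d: "!!i. d i > 0" "!!i x x'. x : C ==> x' : C ==> dist x' x < d i ==>
   dist (partial i q x') (partial i q x) < e'" by metis
  define s where "s = min 1 (min (d 1) (d 2))"
  have s: "s > 0" using d(1) by (simp add: s_def)
  have "norm (?P Y - ?P X - ?D (Y - X)) <= e * norm (Y - X)" if Y: "norm (Y - X) < s" for Y proof -
   define r where "r y = q (Y - y) - q (X - y) -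
   (partial 1 q (X - y) * (Y - X) $ 1 + partial 2 q (X - y) * (Y - X) $ 2)" for y
   have "?P Y - ?P X - ?D (Y - X) = (LINT y|leb D. a y * q (Y - y) - a y * q (X - y) -
   (a y * partial 1 q (X - y) * (Y - X) $ 1 + a y * partial 2 q (X - y) * (Y - X) $ 2))"
   using i[OF cq, of Y] i[OF cq, of X] i[OF cp, of 1 X] i[OF cp, of 2 X] by simp
   also have "... = (LINT y|leb D. a y * r y)" by (simp add: r_def algebra_simps)
   also have "\<bar>...\<bar> <= (norm (Y - X) * (2 * e')) * A" unfolding A_def
   proof (rule integral_mult_abs_le[OF D a])
   show "continuous_on D r" unfolding r_def by (intro continuous_intros comp cq cp)
   fix y assume y: "y : D"
   have ny: "norm y <= \<bar>R\<bar>" using R y by fastforce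
   define S where "S = cball (X - y) (norm (Y - X))"
   have SC: "S <= C" proof
   fix x assume "x : S"
   hence "norm (x - (X - y)) <= norm (Y - X)" by (simp add: S_def dist_norm norm_minus_commute)
   moreover have "norm x <= norm (x - (X - y)) + norm (X - y)"
   using norm_triangle_ineq[of "x - (X - y)" "X - y"] by simp
   moreover have "norm (X - y) <= norm X + norm y" by (rule norm_triangle_ineq4)
   ultimately show "x : C" using Y ny by (simp add: C_def s_def)
   qed
   define f' where "f' x = (%h::point. partial 1 q x * h $ 1 + partial 2 q x * h $ 2)" for x
   have "norm (q (Y - y) - q (X - y) - f' (X - y) ((Y - y) - (X - y))) <= norm ((Y - y) - (X - y)) * (2 * e')"
   proof (rule differentiable_bound_linearization[where S = S])
   show "X - y + t *R (Y - y - (X - y)) : S" if "t : {0..1}" for t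
   using that by (auto simp: S_def dist_norm mult_left_le_one_le)
   show "(q has_derivative f' x) (at x within S)" for x unfolding f'_def using differentiable_partial[of q x] q
   by (simp add: C1_fun_def has_derivative_at_withinI)
   show "X - y : S" by (simp add: S_def)
   show "onorm (f' x - f' (X - y)) <= 2 * e'" if x: "x : S" for x proof (rule onorm_le)
   have dx: "dist x (X - y) < d i" for i proof -
   have "dist x (X - y) <= norm (Y - X)" using x by (simp add: S_def dist_commute)
   thus ?thesis using Y exhaust_2[of i] by (auto simp: s_def)
   qed
   have xc: "x : C" "X - y : C" using x SC by (auto simp: S_def)
   have pd: "\<bar>partial i q x - partial i q (X - y)\<bar> <= e'" for i
   using d(2)[OF xc(2,1) dx, of i] by (simp add: dist_real_def)
   fix h :: point
   have "\<bar>(f' x - f' (X - y)) h\<bar> <= \<bar>partial 1 q x - partial 1 q (X - y)\<bar> * \<bar>h $ 1\<bar> +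
   \<bar>partial 2 q x - partial 2 q (X - y)\<bar> * \<bar>h $ 2\<bar>" proof -
   have "(f' x - f' (X - y)) h = (partial 1 q x - partial 1 q (X - y)) * h $ 1 +
   (partial 2 q x - partial 2 q (X - y)) * h $ 2" by (simp add: f'_def algebra_simps)
   thus ?thesis by (simp only: abs_mult[symmetric] abs_triangle_ineq)
   qed
   also have "... <= e' * norm h + e' * norm h"
   using pd e' component_le_norm_cart[of h] by (intro add_mono mult_mono) auto
   finally show "norm ((f' x - f' (X - y)) h) <= 2 * e' * norm h" by simp
   qed
   qed
   thus "\<bar>r y\<bar> <= norm (Y - X) * (2 * e')" by (simp add: r_def f'_def)
   qed
   also have "... = norm (Y - X) * (e * (A / (A + 1)))" using A by (simp add: e'_def field_simps)
   also have "... <= norm (Y - X) * e" using A e by (intro mult_left_mono mult_left_le) auto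
   finally show ?thesis by (simp add: mult.commute)
  qed
  thus ?thesis using s by blast
 qed
 ultimately show ?thesis unfolding has_derivative_within_alt by simp
qed

section \<open>Regularisation of curl-free fields\<close>

lemma C1_affine:
 assumes q: "C1_fun q"
 shows "C1_fun (%y. q (z + t *R y))" "partial i (%y. q (z + t *R y)) y = t * partial i q (z + t *R y)" proof -
 show p: "partial i (%y. q (z + t *R y)) y = t * partial i q (z + t *R y)" for i y
  by (rule partial_scaled) (use q in \<open>simp add: C1_fun_def\<close>)
 show "C1_fun (%y. q (z + t *R y))" unfolding C1_fun_def proof (intro conjI allI)
  fix x
  have "(%y. z + t *R y) differentiable (at x)" by simp
  moreover have "q differentiable (at (z + t *R x))" using q by (simp add: C1_fun_def)
  ultimately show "(%y. q (z + t *R y)) differentiable (at x)"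
   using differentiable_chain_at[of "%y. z + t *R y" x q] by (simp add: o_def)
  fix i
  have "partial i (%y. q (z + t *R y)) = (%y. t * partial i q (z + t *R y))" using p by blast
  thus "continuous_on UNIV (partial i (%y. q (z + t *R y)))"
   by (simp, intro continuous_intros continuous_on_compose2[OF C1_partial_continuous[OF q, of UNIV]]) auto
 qed
qed

lemma C1_reflect:
 assumes q: "C1_fun q" shows "C1_fun (%y. q (X - y))" "partial i (%y. q (X - y)) y = - partial i q (X - y)"
 using C1_affine(1)[OF q, of X "-1"] C1_affine(2)[OF q, of i X "-1" y] by simp_all

lemma C1_I:
 assumes "!!x. (q has_derivative (%h. p1 x * h $ 1 + p2 x * h $ 2)) (at x)"
  "continuous_on UNIV p1" "continuous_on UNIV p2" shows "C1_fun q" "partial 1 q = p1" "partial 2 q = p2" proof -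
 show 1: "partial 1 q = p1" "partial 2 q = p2" using partial_eq[OF assms(1)] by blast+
 have "continuous_on UNIV (partial i q)" for i using exhaust_2[of i] 1 assms(2,3) by auto
 thus "C1_fun q" unfolding C1_fun_def differentiable_def using assms(1) by blast
qed

text \<open>The function \<open>1 / s\<close>, continued below \<open>1\<close> by its tangent line.
  At \<open>s = (x <.> x) / eps^2\<close> it removes the singularity of the logarithmic gradient
  while keeping it continuously differentiable.\<close>

definition kap :: "real => real" where "kap s = (if s : {..<1} then 2 - s else 1 / s)"
definition kap' :: "real => real" where "kap' s = - 1 / (max 1 s)^2"

lemma kap_deriv: "(kap has_real_derivative kap' s) (at s)" proof -
 have "((%x. if x : {..<1} then 2 - x else 1 / x) has_derivative
   (if s : {..<1} then (%d. - d) else (%d. - d / s^2))) (at s within {..<1} Un {1..})"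
 proof (rule has_derivative_If_within_closures[of s "{..<1}" "{1..}" "%x. 2 - x" "%x d. - d" "%x. 1 / x" "%x d. - d / x^2"])
  assume "s : {1..} Un closure {..<1} Int closure {1..}"
  hence "s ~= 0" by auto
  thus "((%x. 1 / x) has_derivative (%d. - d / s^2)) (at s within {1..} Un closure {..<1} Int closure {1..})"
   by (auto intro!: derivative_eq_intros simp: field_simps power2_eq_square)
 qed (auto intro!: derivative_eq_intros)
 moreover have "{..<1} Un {1..} = (UNIV :: real set)" by auto
 ultimately have "(kap has_derivative (if s : {..<1} then (%d. - d) else (%d. - d / s^2))) (at s)"
  unfolding kap_def[abs_def] by simp
 moreover have "(if s : {..<1} then (%d. - d) else (%d. - d / s^2)) = (*) (kap' s)"
  by (auto simp: kap'_def fun_eq_iff max_def)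
 ultimately show ?thesis by (simp add: has_field_derivative_def)
qed

lemma kap_continuous: "continuous_on S kap" "continuous_on S kap'" proof -
 show "continuous_on S kap" using kap_deriv by (intro continuous_at_imp_continuous_on ballI) (rule DERIV_isCont)
 show "continuous_on S kap'" unfolding kap'_def by (intro continuous_intros) auto
qed

text \<open>\<open>ker \<epsilon>\<close> is the gradient of the logarithm, made \<open>C\<^sup>1\<close> inside the ball of radius \<open>\<epsilon>\<close>.
 Its divergence \<open>bump \<epsilon>\<close> is an approximate identity up to a constant factor, and its rotation
 vanishes, so that convolution with \<open>ker\<close> produces potentials of regularised curl-free fields.\<close>

definition ker :: "real => 2 => point => real" where
 "ker eps i x = kap ((x <.> x) / eps^2) / eps^2 * x $ i"

definition bump :: "real => point => real" where
 "bump eps x = 4 * max 0 (1 - (x <.> x) / eps^2) / eps^2"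

lemma ker_C1:
 fixes i j :: 2
 assumes e: "eps > 0" shows "C1_fun (ker eps i)" "partial j (ker eps i) x =
  2 * kap' ((x <.> x) / eps^2) * x $ i * x $ j / eps^4 + (if i = j then kap ((x <.> x) / eps^2) / eps^2 else 0)" proof -
 define P where "P j x = 2 * kap' ((x <.> x) / eps^2) * x $ i * x $ j / eps^4 +
  (if i = j then kap ((x <.> x) / eps^2) / eps^2 else 0)" for j and x :: point
 have d: "(ker eps i has_derivative (%h. P 1 x * h $ 1 + P 2 x * h $ 2)) (at x)" for x proof -
  have "((%x::point. (x <.> x) / eps^2) has_derivative (%h. 2 * (x <.> h) / eps^2)) (at x)"
   using e by (auto intro!: derivative_eq_intros simp: inner_commute power2_eq_square)
  from diff_chain_at[OF this kap_deriv[unfolded has_field_derivative_def]]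
  have "((%x::point. kap ((x <.> x) / eps^2)) has_derivative (%h. kap' ((x <.> x) / eps^2) * (2 * (x <.> h) / eps^2))) (at x)"
   by (simp add: o_def)
  from has_derivative_mult[OF has_derivative_mult_right[OF this, of "1 / eps^2"]
   bounded_linear.has_derivative[OF bounded_linear_vec_nth has_derivative_ident, of i]]
  have "(ker eps i has_derivative (%h. 1 / eps^2 * kap ((x <.> x) / eps^2) * h $ i +
   1 / eps^2 * (kap' ((x <.> x) / eps^2) * (2 * (x <.> h) / eps^2)) * x $ i)) (at x)"
   by (simp add: ker_def[abs_def] field_simps)
  thus ?thesis proof (rule has_derivative_eq_rhs)
   have "eps^4 = eps^2 * eps^2" by (simp add: power2_eq_square power4_eq_xxxx)
   thus "(%h. 1 / eps^2 * kap ((x <.> x) / eps^2) * h $ i +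
   1 / eps^2 * (kap' ((x <.> x) / eps^2) * (2 * (x <.> h) / eps^2)) * x $ i) = (%h. P 1 x * h $ 1 + P 2 x * h $ 2)"
   unfolding P_def fun_eq_iff using exhaust_2[of i] e
   by (auto simp: inner_point[of x] add_divide_distrib algebra_simps)
  qed
 qed
 have c: "continuous_on UNIV (P j)" for j proof -
  have s: "continuous_on UNIV (%x::point. (x <.> x) / eps^2)" using e by (intro continuous_intros) auto
  have "continuous_on UNIV (%x::point. kap ((x <.> x) / eps^2))"
   by (rule continuous_on_compose2[OF kap_continuous(1)[of UNIV] s]) simp
  moreover have "continuous_on UNIV (%x::point. kap' ((x <.> x) / eps^2))"
   by (rule continuous_on_compose2[OF kap_continuous(2)[of UNIV] s]) simp
  ultimately show ?thesis unfolding P_def using e by (cases "i = j") (auto intro!: continuous_intros)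
 qed
 note I = C1_I[OF d c c]
 show "C1_fun (ker eps i)" by (rule I(1))
 have "partial j (ker eps i) = P j" using I(2,3) exhaust_2[of j] by auto
 thus "partial j (ker eps i) x =
  2 * kap' ((x <.> x) / eps^2) * x $ i * x $ j / eps^4 + (if i = j then kap ((x <.> x) / eps^2) / eps^2 else 0)"
  by (simp add: P_def)
qed

lemma ker_curl: "eps > 0 ==> partial 1 (ker eps 2) x = partial 2 (ker eps 1) x" by (simp add: ker_C1(2))

lemma ker_div: "eps > 0 ==> partial 1 (ker eps 1) x + partial 2 (ker eps 2) x = bump eps x" proof -
 assume e: "eps > 0"
 define s where "s = (x <.> x) / eps^2"
 have "partial 1 (ker eps 1) x + partial 2 (ker eps 2) x = 2 * kap' s * ((x $ 1 * x $ 1 + x $ 2 * x $ 2) / eps^4) + 2 * kap s / eps^2"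
  unfolding ker_C1(2)[OF e] s_def[symmetric] by (simp add: algebra_simps add_divide_distrib)
 also have "(x $ 1 * x $ 1 + x $ 2 * x $ 2) / eps^4 = s / eps^2"
  by (simp add: s_def inner_point power2_eq_square power4_eq_xxxx)
 also have "2 * kap' s * (s / eps^2) + 2 * kap s / eps^2 = 4 * max 0 (1 - s) / eps^2" proof (cases "s < 1")
  case True
  hence "kap s = 2 - s" "kap' s = -1" "max 0 (1 - s) = 1 - s" by (auto simp: kap_def kap'_def max_def)
  thus ?thesis using e by (simp add: field_simps)
 next
  case False
  hence k: "kap s = 1 / s" "kap' s = -1 / s^2" "max 0 (1 - s) = 0" by (auto simp: kap_def kap'_def max_def)
  show ?thesis unfolding k using e False by (simp add: field_simps power2_eq_square)
 qed
 finally show ?thesis by (simp add: bump_def s_def)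
qed

lemma bump_nonneg: "0 <= bump eps x" by (simp add: bump_def)

lemma bump_le: "bump eps x <= 4 / eps^2" unfolding bump_def by (intro divide_right_mono) auto

lemma bump_support: "eps > 0 ==> eps < norm x ==> bump eps x = 0" proof -
 assume e: "eps > 0" "eps < norm x"
 hence "eps^2 <= x <.> x" unfolding power2_norm_eq_inner[symmetric] by (intro power_mono) auto
 thus ?thesis using e by (simp add: bump_def)
qed

lemma bump_continuous: "continuous_on S (bump eps)"
 unfolding bump_def by (cases "eps = 0") (auto intro!: continuous_intros)

lemma bump_comp_continuous: "continuous_on S g ==> continuous_on S (%x. bump eps (g x))"
 by (rule continuous_on_compose2[OF bump_continuous[of UNIV]]) auto

definition bump_mass :: real where
 "bump_mass = (LINT y|leb (cball 0 1 :: point set). bump 1 y)"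

lemma bump_mass_pos: "bump_mass > 0" proof -
 have s: "(sqrt (bump 1 y))^2 = bump 1 y" for y using bump_nonneg by simp
 have "bump_mass ~= 0" proof
  assume "bump_mass = 0"
  hence "sqrt (bump 1 (0::point)) = 0" by (intro integral_sq_zero_imp[of "cball 0 1" "%y. sqrt (bump 1 y)"])
   (auto simp: s bump_mass_def intro!: continuous_intros bump_continuous)
  thus False by (simp add: bump_def)
 qed
 moreover have "0 <= bump_mass" unfolding bump_mass_def by (simp add: bump_nonneg)
 ultimately show ?thesis by simp
qed

text \<open>The maximum \<open>4 / eps^2\<close> of \<open>bump eps\<close> times the area of its
  supporting disk, a number independent of \<open>eps\<close>.\<close>

definition bump_bound :: real where
 "bump_bound = 4 * unit_ball_vol 2"

lemma bump_bound_nonneg: "0 <= bump_bound" by (simp add: bump_bound_def)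

lemma integral_le_bump_bound:
 fixes q :: "point => real"
 assumes D: "compact D" and q: "continuous_on D q" and e: "eps > 0"
  and b: "!!x. q x <= 4 / eps^2" "!!x. x ~: cball p eps ==> q x = 0" shows "(LINT x|leb D. q x) <= bump_bound" proof -
 have Dl: "D : sets lebesgue" using D by (rule compact_leb)
 have ml: "D Int cball p eps : lmeasurable" using D by (intro lmeasurable_compact compact_Int) auto
 have ii: "integrable lebesgue (%x. indicator (D Int cball p eps) x *R (4 / eps^2))"
  using ml by (intro integrable_scaleR_left) (auto simp: fmeasurable_def)
 have eq: "indicator D x *R (indicator (cball p eps) x *R (4 / eps^2)) = indicator (D Int cball p eps) x *R (4 / eps^2)" for x
  by (simp add: indicator_def)
 have "(LINT x|leb D. q x) <= (LINT x|leb D. indicator (cball p eps) x *R (4 / eps^2))" proof (rule integral_mono)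
  show "integrable (leb D) q" using D q by (rule int_cont)
  show "integrable (leb D) (%x. indicator (cball p eps) x *R (4 / eps^2))"
   using ii Dl unfolding eq[symmetric] by (subst integrable_restrict_space) auto
  show "q x <= indicator (cball p eps) x *R (4 / eps^2)" for x using b[of x] by (auto simp: indicator_def)
 qed
 also have "... = (LINT x|lebesgue. indicator (D Int cball p eps) x *R (4 / eps^2))"
  using Dl unfolding eq[symmetric] by (subst integral_restrict_space) auto
 also have "... = measure lebesgue (D Int cball p eps) * (4 / eps^2)"
  using ml by (subst integral_scaleR_left) (auto simp: fmeasurable_def)
 also have "... <= measure lebesgue (cball p eps) * (4 / eps^2)"
  using ml by (intro mult_right_mono measure_mono_fmeasurable lmeasurable_cball fmeasurableD) auto
 also have "measure lebesgue (cball p eps) = unit_ball_vol 2 * eps^2" using e by (simp add: content_cball)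
 finally show ?thesis using e by (simp add: bump_bound_def)
qed

text \<open>Schur's test: both marginals of the kernel are at most \<open>bump_bound\<close>. In the
  variable \<open>x\<close> the dilation by \<open>t >= 1\<close> only shrinks the support, so the
  same bound serves. Its uniformity in \<open>eps\<close> and \<open>t\<close> carries the limit in
  \<open>curl_free_orthogonal\<close>.\<close>

lemma schur_bound:
 fixes a :: "point => real"
 assumes D: "compact D" and a: "L2_on D a" and e: "eps > 0" and t: "t >= 1"
 shows "(LINT x|leb D. (LINT y|leb D. a y * bump eps (c + t *R (x - c) - y))^2) <=
  bump_bound^2 * (LINT y|leb D. (a y)^2)"
  "continuous_on S (%x. LINT y|leb D. a y * bump eps (c + t *R (x - c) - y))" proof -
 let ?M = "leb D"
 define X where "X x = c + t *R (x - c)" for x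
 have Xc: "continuous_on S X" for S unfolding X_def by (intro continuous_intros)
 have ai: "integrable ?M a" using D a by (rule L2_integrable)
 have a2: "integrable ?M (%y. (a y)^2)" using L2_square[OF a] by simp
 have am: "a : borel_measurable ?M" using a by (rule L2_measurable)
 define U where "U x = (LINT y|?M. a y * bump eps (X x - y))" for x
 define V where "V x = (LINT y|?M. (a y)^2 * bump eps (X x - y))" for x
 define J where "J y = (LINT x|?M. bump eps (X x - y))" for y
 have conv: "continuous_on S (%x. LINT y|?M. f y * bump eps (X x - y))" if "integrable ?M f" for f S
  by (rule continuous_on_compose2[OF convolution_continuous[OF D that bump_continuous] Xc]) simp
 show "continuous_on S (%x. LINT y|leb D. a y * bump eps (c + t *R (x - c) - y))" using conv[OF ai] by (simp add: X_def)
 have bc: "continuous_on D (%y. bump eps (X x - y))" "continuous_on D (%x. bump eps (X x - y))" for x y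
  by (intro bump_comp_continuous continuous_intros Xc)+
 \<comment> \<open>Cauchy-Schwarz with the kernel split into two square roots.\<close>
 have U2: "(U x)^2 <= bump_bound * V x" for x proof -
  define f where "f y = sqrt (bump eps (X x - y)) *R a y" for y
  define g where "g y = sqrt (bump eps (X x - y))" for y
  have gc: "continuous_on D g" unfolding g_def using bc by (intro continuous_intros)
  have f: "L2_on D f" unfolding f_def using L2_mult_continuous[OF D a gc] by (simp add: g_def)
  have g: "L2_on D g" by (rule L2_continuous[OF D gc])
  have "f y <.> g y = a y * bump eps (X x - y)" for y
   unfolding f_def g_def using bump_nonneg[of eps "X x - y"] by (simp add: mult_ac flip: real_sqrt_mult)
  moreover have "(norm (f y))^2 = (a y)^2 * bump eps (X x - y)" for y
   unfolding f_def using bump_nonneg[of eps "X x - y"] by (simp add: power_mult_distrib mult.commute)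
  moreover have "(norm (g y))^2 = bump eps (X x - y)" for y unfolding g_def using bump_nonneg[of eps "X x - y"] by simp
  ultimately have "(U x)^2 <= V x * (LINT y|?M. bump eps (X x - y))" using L2_CS[OF f g] by (simp add: U_def V_def)
  also have "... <= V x * bump_bound" proof (rule mult_left_mono)
   show "(LINT y|?M. bump eps (X x - y)) <= bump_bound" by (rule integral_le_bump_bound[OF D bc(1) e bump_le, of "X x"])
   (auto intro!: bump_support e simp: dist_norm)
   show "0 <= V x" unfolding V_def by (auto intro!: integral_nonneg_AE simp: bump_nonneg)
  qed
  finally show ?thesis by (simp add: mult.commute)
 qed
 have J: "0 <= J y" "J y <= bump_bound" for y proof -
  show "0 <= J y" unfolding J_def by (simp add: bump_nonneg)
  show "J y <= bump_bound" unfolding J_def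
  proof (rule integral_le_bump_bound[OF D bc(2) e bump_le, of "c + (1 / t) *R (y - c)"])
   fix x assume "x ~: cball (c + (1 / t) *R (y - c)) eps"
   hence "eps < norm (x - (c + (1 / t) *R (y - c)))" by (simp add: dist_norm norm_minus_commute)
   also have "... <= t * norm (x - (c + (1 / t) *R (y - c)))" using t by (simp add: mult_le_cancel_right1)
   also have "... = norm (t *R (x - (c + (1 / t) *R (y - c))))" using t by simp
   also have "t *R (x - (c + (1 / t) *R (y - c))) = X x - y" using t by (simp add: X_def algebra_simps)
   finally show "bump eps (X x - y) = 0" by (rule bump_support[OF e])
  qed
 qed
 have "finite_measure ?M" using D by (intro finite_measure_lebesgue_on lmeasurable_compact)
 then interpret finite_measure ?M .
 interpret P: pair_sigma_finite ?M ?M ..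
 define f where "f y x = (a y)^2 * bump eps (X x - y)" for y x
 have idm: "(%x. x) : borel_measurable ?M"
  using compact_leb[OF D] by (intro cont_meas continuous_intros)
 have Xm: "X : borel_measurable ?M" using compact_leb[OF D] by (intro cont_meas Xc)
 have fm: "case_prod f : borel_measurable (?M \<Otimes>\<^sub>M ?M)" proof -
  have "(%p. a (fst p)) : borel_measurable (?M \<Otimes>\<^sub>M ?M)" by (rule measurable_compose[OF measurable_fst am])
  moreover have "(%p. X (snd p) - fst p) : borel_measurable (?M \<Otimes>\<^sub>M ?M)"
   by (intro borel_measurable_diff measurable_compose[OF measurable_snd Xm] measurable_compose[OF measurable_fst idm])
  hence "(%p. bump eps (X (snd p) - fst p)) : borel_measurable (?M \<Otimes>\<^sub>M ?M)"
   by (rule measurable_compose[OF _ borel_measurable_continuous_onI[OF bump_continuous]])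
  ultimately show ?thesis unfolding f_def case_prod_beta' by (intro borel_measurable_times borel_measurable_power)
 qed
 have inner: "(LINT x|?M. norm (f y x)) = (a y)^2 * J y" for y unfolding f_def J_def by (simp add: abs_mult bump_nonneg)
 have aJ: "integrable ?M (%y. (a y)^2 * J y)" proof (rule Bochner_Integration.integrable_bound)
  show "integrable ?M (%y. (a y)^2 * bump_bound)" using a2 by simp
  have "(%y. LINT x|?M. norm (f y x)) : borel_measurable ?M" proof (rule borel_measurable_lebesgue_integral)
   show "(%(y, x). norm (f y x)) : borel_measurable (?M \<Otimes>\<^sub>M ?M)"
   using measurable_compose[OF fm borel_measurable_norm] by (simp add: case_prod_beta')
  qed
  thus "(%y. (a y)^2 * J y) : borel_measurable ?M" unfolding inner .
  show "AE y in ?M. norm ((a y)^2 * J y) <= norm ((a y)^2 * bump_bound)"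
   using J bump_bound_nonneg by (intro AE_I2) (auto simp: abs_mult intro!: mult_left_mono)
 qed
 have fi: "integrable (?M \<Otimes>\<^sub>M ?M) (case_prod f)" proof (rule P.Fubini_integrable[OF fm])
  show "integrable ?M (%y. LINT x|?M. norm (case_prod f (y, x)))" using aJ by (simp add: inner del: real_norm_def)
  show "AE y in ?M. integrable ?M (%x. case_prod f (y, x))"
   unfolding f_def using D bc by (intro AE_I2) (auto intro!: int_cont)
 qed
 have "(LINT x|?M. (U x)^2) <= (LINT x|?M. bump_bound * V x)" proof (rule integral_mono)
  show "integrable ?M (%x. (U x)^2)" unfolding U_def by (intro int_cont D continuous_intros conv ai)
  show "integrable ?M (%x. bump_bound * V x)" unfolding V_def by (intro int_cont D continuous_intros conv a2)
 qed (rule U2)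
 also have "... = bump_bound * (LINT x|?M. V x)" by simp
 also have "(LINT x|?M. V x) = (LINT y|?M. (a y)^2 * J y)"
  using P.Fubini_integral[OF fi] unfolding V_def f_def J_def by simp
 also have "... <= (LINT y|?M. bump_bound * (a y)^2)"
  using aJ a2 J by (intro integral_mono) (auto simp: mult.commute intro!: mult_right_mono)
 also have "... = bump_bound * (LINT y|?M. (a y)^2)" by simp
 finally show "(LINT x|leb D. (LINT y|leb D. a y * bump eps (c + t *R (x - c) - y))^2) <=
  bump_bound^2 * (LINT y|leb D. (a y)^2)"
  using bump_bound_nonneg by (simp add: U_def X_def power2_eq_square mult_left_mono mult.assoc)
qed

text \<open>Since \<open>H\<close> admits every \<open>C1\<close> function, it says that
  \<open>u\<close> extended by zero is curl free on the whole plane. Testing with the reflected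
  kernels exchanges components and derivatives, so the gradient of the sum of the convolutions of
  \<open>u $ i\<close> with \<open>ker eps i\<close> is the convolution of \<open>u\<close> with the
  divergence of the kernel, which is \<open>bump eps\<close>.\<close>

lemma convolution_potential:
 fixes u :: "point => point"
 assumes D: "compact D" and u: "L2_on D u" and e: "eps > 0"
  and H: "!!ph. C1_fun ph ==> (LINT y|leb D. u y $ 2 * partial 1 ph y - u y $ 1 * partial 2 ph y) = 0"
 shows "EX Ph. ALL X. (Ph has_derivative (%d. (LINT y|leb D. u y $ 1 * bump eps (X - y)) * d $ 1 +
   (LINT y|leb D. u y $ 2 * bump eps (X - y)) * d $ 2)) (at X)" proof -
 let ?M = "leb D"
 have ui: "integrable ?M (%y. u y $ i)" for i using u L2_component[of D u] L2_integrable[OF D] by blast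
 define I where "I i f X = (LINT y|?M. u y $ i * f (X - y))" for i and f :: "point => real" and X
 have int: "integrable ?M (%y. u y $ i * f (X - y))" if "continuous_on UNIV f" for i f X
  by (intro int_mult_cont D ui continuous_on_compose2[OF that] continuous_intros) auto
 have pc: "continuous_on UNIV (partial j (ker eps i))" for i j by (intro C1_partial_continuous ker_C1 e)
 have sw: "I 2 (partial 1 (ker eps j)) X = I 1 (partial 2 (ker eps j)) X" for j X proof -
  have "(LINT y|?M. u y $ 2 * (- partial 1 (ker eps j) (X - y)) - u y $ 1 * (- partial 2 (ker eps j) (X - y))) = 0"
   using H[OF C1_reflect(1)[OF ker_C1(1)[OF e], of j X]] by (simp add: C1_reflect(2)[OF ker_C1(1)[OF e]])
  hence "(LINT y|?M. u y $ 1 * partial 2 (ker eps j) (X - y) - u y $ 2 * partial 1 (ker eps j) (X - y)) = 0" by simp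
  thus ?thesis unfolding I_def using int[OF pc, of 1 2 j X] int[OF pc, of 2 1 j X] by simp
 qed
 have bump: "I i (bump eps) X = I i (partial 1 (ker eps 1)) X + I i (partial 2 (ker eps 2)) X" for i X
  unfolding I_def ker_div[OF e, symmetric] distrib_left using int[OF pc, of i 1 1 X] int[OF pc, of i 2 2 X] by simp
 have cu: "I i (partial 1 (ker eps 2)) X = I i (partial 2 (ker eps 1)) X" for i X unfolding I_def ker_curl[OF e] ..
 define Ph where "Ph X = I 1 (ker eps 1) X + I 2 (ker eps 2) X" for X
 have "(Ph has_derivative (%d. I 1 (bump eps) X * d $ 1 + I 2 (bump eps) X * d $ 2)) (at X)" for X proof -
  have d: "(I i (ker eps j) has_derivative (%d. I i (partial 1 (ker eps j)) X * d $ 1 + I i (partial 2 (ker eps j)) X * d $ 2)) (at X)"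
   for i j unfolding I_def[abs_def] by (rule convolution_has_derivative[OF D ui ker_C1(1)[OF e]])
  have "I 1 (bump eps) X = I 1 (partial 1 (ker eps 1)) X + I 2 (partial 1 (ker eps 2)) X" unfolding bump sw[of 2] ..
  moreover have "I 2 (bump eps) X = I 1 (partial 2 (ker eps 1)) X + I 2 (partial 2 (ker eps 2)) X"
   unfolding bump sw[of 1] ..
  ultimately show ?thesis unfolding Ph_def[abs_def] using has_derivative_add[OF d[of 1 1] d[of 2 2]]
   by (simp add: algebra_simps)
 qed
 thus ?thesis unfolding I_def by blast
qed

lemma bump_integral:
 assumes e: "eps > 0" and D: "compact D" "cball X eps <= D" shows "(LINT y|leb D. bump eps (X - y)) = bump_mass" proof -
 have Dl: "D : sets lebesgue" using D(1) by (rule compact_leb)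
 have eq: "indicator D y *R bump eps (X - y) = indicator (cball X eps) y *R bump eps (X - y)" for y
  using D(2) bump_support[OF e, of "X - y"] by (auto simp: indicator_def dist_norm)
 have "(LINT y|leb D. bump eps (X - y)) = (LINT y|leb (cball X eps). bump eps (X - y))"
  using Dl by (simp add: integral_restrict_space eq del: real_scaleR_def)
 also have "... = eps^2 * (LINT x|leb (cball 0 1). bump eps (X - (X + eps *R x)))"
  using scaling_subst[of eps 1 X "%y. bump eps (X - y)"] e by (simp add: bump_comp_continuous continuous_on_diff)
 also have "... = (LINT x|leb (cball 0 1 :: point set). eps^2 * bump eps (- (eps *R x)))" by simp
 also have "... = bump_mass" unfolding bump_mass_def proof (rule int_congr)
  show "eps^2 * bump eps (- (eps *R x)) = bump 1 x" for x :: point using e by (simp add: bump_def power2_eq_square)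
 qed simp
 finally show ?thesis .
qed

text \<open>\<open>u\<close> is curl free with zero trace, being tested against all
  \<open>C1\<close> functions, while \<open>z\<close> is divergence free, tested only inside.
  Smoothing \<open>u\<close> and dilating about \<open>c\<close> gives the gradient of a function
  supported in the interior, to which \<open>Z\<close> applies. The limit combines a bound uniform
  in the smoothing with convergence for continuous functions.\<close>

theorem curl_free_orthogonal:
 fixes u z :: "point => point"
 assumes F: "compact F" "convex F" and ball: "ball c r <= F" "r > 0"
  and u: "L2_on F u" and z: "L2_on F z"
  and H: "!!ph. C1_fun ph ==> (LINT y|leb F. u y $ 2 * partial 1 ph y - u y $ 1 * partial 2 ph y) = 0"
  and Z: "!!ps. test_fun F ps ==> (LINT y|leb F. z y $ 1 * partial 1 ps y + z y $ 2 * partial 2 ps y) = 0"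
 shows "(LINT x|leb F. z x <.> u x) = 0" proof -
 let ?M = "leb F"
 let ?I = "%i w. LINT x|?M. z x $ i * w x"
 \<comment> \<open>The smoothing radius is \<open>r / 2\<close> times \<open>t n - 1\<close>, so the
   dilation by \<open>t n\<close> more than compensates the enlargement of the support.\<close>
 define eps where "eps n = r / (2 * real (Suc n))" for n
 define t where "t n = 1 + 1 / real (Suc n)" for n
 have e: "eps n > 0" for n using ball(2) by (simp add: eps_def)
 have t: "t n > 1" for n by (simp add: t_def)
 define X where "X n x = c + t n *R (x - c)" for n x
 define W where "W n a x = (LINT y|?M. a y * bump (eps n) (X n x - y))" for n a x
 have ci: "c : interior F" using ball by (meson centre_in_ball interiorI open_ball)
 have Fne: "F ~= {}" using ci interior_subset by blast
 have Fl: "F : sets lebesgue" using F(1) by (rule compact_leb)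
 have uc: "L2_on F (%y. u y $ i)" and zc: "L2_on F (%y. z y $ i)" for i using u z L2_component by blast+
 have Wc: "continuous_on S (W n a)" if "L2_on F a" for S n a
  unfolding W_def X_def using schur_bound(2)[OF F(1) that e] t[of n] by simp
 have Wi: "integrable ?M (%x. z x $ i * W n a x)" if "L2_on F a" for n a i
  using L2_inner_int[OF zc L2_continuous[OF F(1) Wc[OF that]]] by simp
 have orth: "?I 1 (W n (%y. u y $ 1)) + ?I 2 (W n (%y. u y $ 2)) = 0" for n proof -
  define V where "V i X = (LINT y|?M. u y $ i * bump (eps n) (X - y))" for i X
  obtain Ph where Ph: "!!X. (Ph has_derivative (%d. V 1 X * d $ 1 + V 2 X * d $ 2)) (at X)"
   using convolution_potential[OF F(1) u e H] unfolding V_def by blast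
  have Vc: "continuous_on UNIV (V i)" for i unfolding V_def
   by (rule convolution_continuous[OF F(1) L2_integrable[OF F(1) uc] bump_continuous])
  have PhC: "C1_fun Ph" and Php: "partial i Ph = V i" for i using C1_I[OF Ph Vc Vc] exhaust_2[of i] by auto
  define A where "A = (UN x:F. UN y:cball 0 (eps n). {x + y})"
  have A: "A = {x + y | x y. x : F & y : cball 0 (eps n)}" unfolding A_def by blast
  have cA: "compact A" unfolding A using F(1) compact_cball by (rule compact_sums)
  \<comment> \<open>\<open>A\<close> is convex and bounded, so its complement is connected, and the
    potential, whose gradient vanishes there, equals a constant \<open>k\<close>. Subtracting
    \<open>k\<close> gives compact support.\<close>
  have "convex A" unfolding A_def by (rule convex_sums[OF F(2) convex_cball])
  hence con: "connected (- A)" using cA by (intro connected_complement_bounded_convex compact_imp_bounded) auto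
  have V0: "V i Y = 0" if "Y : - A" for Y i proof -
   have "bump (eps n) (Y - y) = 0" if "y : F" for y proof (rule bump_support[OF e])
   have "Y = y + (Y - y)" by simp
   hence "Y - y ~: cball 0 (eps n)" using \<open>Y : - A\<close> that unfolding A by blast
   thus "eps n < norm (Y - y)" by simp
   qed
   hence "V i Y = (LINT y|?M. 0)" unfolding V_def using Fl by (intro int_congr) auto
   thus ?thesis by simp
  qed
  have "Ph constant_on - A" proof (rule has_derivative_zero_connected_constant_on[of "- A" "{}"])
   show "ALL x:- A - {}. (Ph has_derivative (%h. 0)) (at x within - A)" proof
   fix x assume "x : - A - {}"
   hence "(Ph has_derivative (%h. 0)) (at x)" using Ph[of x] V0[of x] by simp
   thus "(Ph has_derivative (%h. 0)) (at x within - A)" by (rule has_derivative_at_withinI)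
   qed
  qed (use con cA in \<open>auto intro!: C1_continuous[OF PhC] open_Compl compact_imp_closed\<close>)
  then obtain k where k: "!!Y. Y ~: A ==> Ph Y = k" unfolding constant_on_def by auto
  define ps where "ps x = Ph ((c - t n *R c) + t n *R x) - k" for x
  have Xe: "(c - t n *R c) + t n *R x = X n x" for x by (simp add: X_def algebra_simps)
  have psd: "(ps has_derivative (%d. (t n * V 1 (X n x)) * d $ 1 + (t n * V 2 (X n x)) * d $ 2)) (at x)" for x proof -
   have "C1_fun (%x. Ph ((c - t n *R c) + t n *R x))" by (rule C1_affine(1)[OF PhC])
   hence "(%x. Ph ((c - t n *R c) + t n *R x)) differentiable (at x)" by (simp add: C1_fun_def)
   note 1 = differentiable_partial[OF this, unfolded C1_affine(2)[OF PhC] Php]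
   show ?thesis using has_derivative_diff[OF 1 has_derivative_const[of k]] unfolding Xe ps_def[abs_def] by simp
  qed
  have Xc: "continuous_on S (X n)" for S unfolding X_def by (intro continuous_intros)
  have c': "continuous_on UNIV (%x. t n * V i (X n x))" for i
   by (intro continuous_intros continuous_on_compose2[OF Vc Xc]) auto
  note psC = C1_I[OF psd c' c']
  have "test_fun F ps" unfolding test_fun_def proof (intro conjI exI)
   show "C1_fun ps" by (rule psC(1))
   define K where "K = (%Y. c + (1 / t n) *R (Y - c)) ` A"
   show "compact K" unfolding K_def using cA by (intro compact_continuous_image continuous_intros)
   show "ALL x. x ~: K --> ps x = 0" proof (intro allI impI)
   fix x assume "x ~: K"
   moreover have "x = c + (1 / t n) *R (X n x - c)" using t[of n] by (simp add: X_def)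
   ultimately have "X n x ~: A" unfolding K_def by blast
   thus "ps x = 0" unfolding ps_def Xe using k by simp
   qed
   show "K <= interior F" proof
   fix x assume "x : K"
   then obtain f y where fy: "f : F" "norm y <= eps n" "x = c + (1 / t n) *R (f + y - c)" unfolding K_def A by auto
   define l where "l = 1 - 1 / t n"
   have l: "0 < l" "l <= 1" using t[of n] by (auto simp: l_def)
   have ln: "l = 1 / (real (Suc n) * t n)" proof -
   have "l = (t n - 1) / t n" using t[of n] by (simp add: l_def diff_divide_distrib)
   also have "t n - 1 = 1 / real (Suc n)" by (simp add: t_def)
   finally show ?thesis by simp
   qed
   \<comment> \<open>\<open>x\<close> is a contraction of the polygon point \<open>f\<close> towards
     \<open>c'\<close>, and the choice of \<open>eps n\<close> keeps \<open>c'\<close> within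
     \<open>r / 2\<close> of \<open>c\<close>.\<close>
   define c' where "c' = c + real (Suc n) *R y"
   have "norm (real (Suc n) *R y) <= real (Suc n) * eps n" using fy(2) by simp
   also have "... = r / 2" by (simp add: eps_def del: of_nat_Suc)
   finally have "c' : ball c r" using ball(2) by (simp add: c'_def dist_norm)
   hence "c' : interior F" using ball(1) by (meson interiorI open_ball)
   hence "f - l *R (f - c') : interior F" using F(2) fy(1) l by (intro mem_interior_convex_shrink)
   moreover have "f - l *R (f - c') = x" proof -
   have "l *R (real (Suc n) *R y) = (1 / t n) *R y" using t[of n] by (simp add: ln)
   hence "l *R c' = l *R c + (1 / t n) *R y" unfolding c'_def scaleR_add_right by simp
   thus ?thesis unfolding fy(3) scaleR_diff_right by (simp add: l_def algebra_simps)
   qed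
   ultimately show "x : interior F" by simp
   qed
  qed
  from Z[OF this] have "(LINT y|?M. t n * (z y $ 1 * W n (%y. u y $ 1) y + z y $ 2 * W n (%y. u y $ 2) y)) = 0"
   unfolding psC(2,3) by (simp add: V_def W_def algebra_simps)
  hence "(LINT y|?M. z y $ 1 * W n (%y. u y $ 1) y + z y $ 2 * W n (%y. u y $ 2) y) = 0" using t[of n] by simp
  thus ?thesis using Wi[OF uc, of 1 n 1] Wi[OF uc, of 2 n 2] by simp
 qed
 \<comment> \<open>Cauchy-Schwarz and Schur's test, uniformly in \<open>n\<close>.\<close>
 have bd: "\<bar>?I i (W n a)\<bar> <= sqrt (LINT x|?M. (z x $ i)^2) * (bump_bound * sqrt (LINT x|?M. (a x)^2))"
  if a: "L2_on F a" for a i n proof -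
  have "?I i (W n a)^2 <= (LINT x|?M. (z x $ i)^2) * (LINT x|?M. (W n a x)^2)"
   using L2_CS[OF zc[of i] L2_continuous[OF F(1) Wc[OF a]], of n] by simp
  also have "... <= (LINT x|?M. (z x $ i)^2) * (bump_bound^2 * (LINT x|?M. (a x)^2))"
   using schur_bound(1)[OF F(1) a e[of n], of "t n" c] t[of n] by (intro mult_left_mono) (auto simp: W_def X_def)
  finally have "sqrt (?I i (W n a)^2) <=
   sqrt ((LINT x|?M. (z x $ i)^2) * (bump_bound^2 * (LINT x|?M. (a x)^2)))" by (rule real_sqrt_le_mono)
  thus ?thesis using bump_bound_nonneg by (simp add: real_sqrt_mult)
 qed
 \<comment> \<open>For continuous \<open>w\<close> the smoothed and dilated functions converge at
   interior points, and \<open>B * bump_bound\<close> dominates them.\<close>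
 have lim: "(%n. ?I i (W n w)) \<longlonglongrightarrow> ?I i (%x. bump_mass * w x)"
  if w: "continuous_on UNIV w" for w i proof -
  have wF: "continuous_on F w" using w continuous_on_subset by blast
  have w2: "L2_on F w" by (rule L2_continuous[OF F(1) wF])
  have "bounded (w ` F)" using F(1) wF by (intro compact_imp_bounded compact_continuous_image)
  then obtain B where B: "ALL y:F. \<bar>w y\<bar> <= B" unfolding bounded_iff by auto
  have B0: "0 <= B" using B Fne by force
  have bi: "integrable ?M (%y. bump (eps n) (X n x - y))" for n x
   by (intro int_cont F bump_comp_continuous continuous_intros)
  have bm: "(LINT y|?M. bump (eps n) (X n x - y)) <= bump_bound" for n x
   by (rule integral_le_bump_bound[OF F(1) _ e bump_le, where p = "X n x"])
   (auto intro!: bump_support e bump_comp_continuous continuous_intros simp: dist_norm)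
  have bW: "integrable ?M (%y. w y * bump (eps n) (X n x - y))" for n x
   by (intro int_cont F bump_comp_continuous continuous_intros wF)
  have Wb: "\<bar>W n w x\<bar> <= B * bump_bound" for n x proof -
   have "\<bar>W n w x\<bar> <= (LINT y|?M. \<bar>w y * bump (eps n) (X n x - y)\<bar>)" unfolding W_def by (rule integral_abs_bound)
   also have "... <= (LINT y|?M. B * bump (eps n) (X n x - y))" proof (rule integral_mono)
   show "integrable ?M (%y. \<bar>w y * bump (eps n) (X n x - y)\<bar>)" by (rule integrable_abs[OF bW])
   show "integrable ?M (%y. B * bump (eps n) (X n x - y))" using bi by simp
   fix y assume "y : space ?M"
   hence "\<bar>w y\<bar> <= B" using B Fl by simp
   thus "\<bar>w y * bump (eps n) (X n x - y)\<bar> <= B * bump (eps n) (X n x - y)"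
   by (simp add: abs_mult bump_nonneg mult_right_mono)
   qed
   also have "... <= B * bump_bound" using bm[of n x] B0 by (simp add: mult_left_mono)
   finally show ?thesis .
  qed
  have pt: "(%n. W n w x) \<longlonglongrightarrow> bump_mass * w x" if x: "x : interior F" for x proof (rule LIMSEQ_I)
   fix e' :: real assume e': "0 < e'"
   define e'' where "e'' = e' / (bump_mass + 1)"
   have e'': "e'' > 0" using e' bump_mass_pos by (simp add: e''_def)
   have "isCont w x" using w by (simp add: continuous_on_eq_continuous_at)
   then obtain d1 where d1: "d1 > 0" "!!y. dist y x < d1 ==> dist (w y) (w x) < e''"
   using e'' unfolding continuous_at_eps_delta by blast
   obtain d2 where d2: "d2 > 0" "ball x d2 <= F" using x mem_interior by blast
   have "(%n. eps n + 1 / real (Suc n) * norm (x - c)) \<longlonglongrightarrow> 0 + 0 * norm (x - c)"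
   proof (intro tendsto_intros)
   show l: "(%n. 1 / real (Suc n)) \<longlonglongrightarrow> 0" using LIMSEQ_inverse_real_of_nat by (simp add: inverse_eq_divide)
   have "(%n. (r / 2) * (1 / real (Suc n))) \<longlonglongrightarrow> (r / 2) * 0" by (intro tendsto_intros l)
   thus "eps \<longlonglongrightarrow> 0" by (simp add: eps_def[abs_def])
   qed
   hence "\<forall>\<^sub>F n in sequentially. eps n + 1 / real (Suc n) * norm (x - c) < min d1 d2"
   using d1(1) d2(1) by (intro order_tendstoD(2)) auto
   then obtain N where N: "!!n. n >= N ==> eps n + 1 / real (Suc n) * norm (x - c) < min d1 d2"
   unfolding eventually_sequentially by blast
   have "norm (W n w x - bump_mass * w x) < e'" if n: "n >= N" for n proof -
   have near: "dist y x < min d1 d2" if "y : cball (X n x) (eps n)" for y proof -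
   have "X n x - x = (1 / real (Suc n)) *R (x - c)" by (simp add: X_def t_def algebra_simps)
   hence "dist (X n x) x = 1 / real (Suc n) * norm (x - c)" by (simp add: dist_norm)
   moreover have "dist y x <= dist y (X n x) + dist (X n x) x" by (rule dist_triangle)
   ultimately show ?thesis using that N[OF n] by (simp add: dist_commute)
   qed
   have "cball (X n x) (eps n) <= F" proof
   fix y assume "y : cball (X n x) (eps n)"
   hence "dist y x < d2" using near by force
   thus "y : F" using d2(2) by (auto simp: dist_commute)
   qed
   hence m: "(LINT y|?M. bump (eps n) (X n x - y)) = bump_mass" by (rule bump_integral[OF e F(1)])
   have "W n w x - bump_mass * w x = (LINT y|?M. (w y - w x) * bump (eps n) (X n x - y))"
   unfolding W_def m[symmetric] left_diff_distrib using bW bi by simp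
   also have "norm ... <= (LINT y|?M. \<bar>(w y - w x) * bump (eps n) (X n x - y)\<bar>)"
   unfolding real_norm_def by (rule integral_abs_bound)
   also have "... <= (LINT y|?M. e'' * bump (eps n) (X n x - y))" proof (rule integral_mono)
   show "integrable ?M (%y. \<bar>(w y - w x) * bump (eps n) (X n x - y)\<bar>)"
   by (intro int_cont F bump_comp_continuous continuous_intros wF)
   fix y
   show "\<bar>(w y - w x) * bump (eps n) (X n x - y)\<bar> <= e'' * bump (eps n) (X n x - y)"
   proof (cases "y : cball (X n x) (eps n)")
   case True
   hence "dist (w y) (w x) < e''" using d1(2) near by force
   thus ?thesis by (simp add: dist_real_def abs_mult bump_nonneg mult_right_mono)
   next
   case False
   hence "bump (eps n) (X n x - y) = 0" by (intro bump_support e) (simp add: dist_norm)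
   thus ?thesis by simp
   qed
   qed (use bi in simp)
   also have "... = e'' * bump_mass" using m by simp
   also have "... < e'" using e' bump_mass_pos by (simp add: e''_def field_simps)
   finally show ?thesis .
   qed
   thus "EX N. ALL n>=N. norm (W n w x - bump_mass * w x) < e'" by blast
  qed
  show ?thesis proof (rule integral_dominated_convergence[where w = "%x. \<bar>z x $ i\<bar> * (B * bump_bound)"])
   have zm: "(%x. z x $ i) : borel_measurable ?M" using zc by (rule L2_measurable)
   show "(%x. z x $ i * (bump_mass * w x)) : borel_measurable ?M"
   by (intro borel_measurable_times zm borel_measurable_const L2_measurable[OF w2])
   show "(%x. z x $ i * W n w x) : borel_measurable ?M" for n using Wi[OF w2] by blast
   show "integrable ?M (%x. \<bar>z x $ i\<bar> * (B * bump_bound))" using L2_integrable[OF F(1) zc[of i]] by simp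
   have "negligible (frontier F)" using F(2) by (rule negligible_convex_frontier)
   hence "AE x in lebesgue. x : F --> x : interior F"
   unfolding eventually_ae_filter_negligible using closure_subset by (fastforce simp: frontier_def)
   hence "AE x in ?M. x : interior F" using Fl by (subst AE_restrict_space_iff) auto
   thus "AE x in ?M. (%n. z x $ i * W n w x) \<longlonglongrightarrow> z x $ i * (bump_mass * w x)"
   by eventually_elim (intro tendsto_intros pt)
   show "AE x in ?M. norm (z x $ i * W n w x) <= \<bar>z x $ i\<bar> * (B * bump_bound)" for n
   using Wb by (intro AE_I2) (simp add: abs_mult mult_left_mono)
  qed
 qed
 define S where "S = sqrt (LINT x|?M. (z x $ 1)^2) + sqrt (LINT x|?M. (z x $ 2)^2)"
 have S0: "0 <= S" by (simp add: S_def)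
 define Q where "Q = ?I 1 (%x. u x $ 1) + ?I 2 (%x. u x $ 2)"
 \<comment> \<open>A three-term argument: each component of \<open>u\<close> is replaced by a
   continuous function at a cost of order \<open>d\<close>, both in the smoothed and in the plain
   pairing. The factor \<open>bump_mass\<close> appears because the kernel is not
   normalised.\<close>
 have small: "bump_mass * \<bar>Q\<bar> <= (bump_mass + bump_bound) * S * d" if d: "d > 0" for d proof -
  have "EX w. continuous_on UNIV w & (LINT x|?M. (u x $ i - w x)^2) < d^2" for i
   using d by (intro L2_approx_continuous F uc) auto
  hence "ALL i. EX w. continuous_on UNIV w & (LINT x|?M. (u x $ i - w x)^2) < d^2" by (rule allI)
  from choice[OF this] obtain w where
   "ALL i. continuous_on UNIV (w i) & (LINT x|?M. (u x $ i - w i x)^2) < d^2" by (rule exE)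
  hence w: "!!i. continuous_on UNIV (w i)" "!!i. (LINT x|?M. (u x $ i - w i x)^2) < d^2" by simp_all
  have wd: "sqrt (LINT x|?M. (u x $ i - w i x)^2) <= d" for i
   using real_sqrt_le_mono[OF less_imp_le[OF w(2)[of i]]] d by simp
  have w2: "L2_on F (w i)" for i by (rule L2_continuous[OF F(1) continuous_on_subset[OF w(1)]]) simp
  have dw: "L2_on F (%x. u x $ i - w i x)" for i by (intro L2_diff uc w2)
  define s where "s i = sqrt (LINT x|?M. (z x $ i)^2)" for i
  have s0: "0 <= s i" for i by (simp add: s_def)
  have bs: "\<bar>?I i (W n (%y. u y $ i)) - ?I i (W n (w i))\<bar> <= s i * (bump_bound * d)" for i n proof -
   have "W n (%x. u x $ i - w i x) x = W n (%y. u y $ i) x - W n (w i) x" for x unfolding W_def left_diff_distrib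
   by (rule Bochner_Integration.integral_diff)
   (intro int_mult_cont F L2_integrable[OF F(1)] uc w2 bump_comp_continuous continuous_intros)+
   hence "?I i (W n (%x. u x $ i - w i x)) =
   ?I i (W n (%y. u y $ i)) - ?I i (W n (w i))" using Wi[OF uc] Wi[OF w2] by (simp add: right_diff_distrib)
   moreover have "\<bar>?I i (W n (%x. u x $ i - w i x))\<bar> <= s i * (bump_bound * d)"
   using bd[OF dw[of i], of i n] unfolding s_def[symmetric]
   by (rule order_trans) (intro mult_left_mono wd s0 bump_bound_nonneg)
   ultimately show ?thesis by simp
  qed
  have "(%n. ?I 1 (W n (w 1)) + ?I 2 (W n (w 2))) \<longlonglongrightarrow>
   ?I 1 (%x. bump_mass * w 1 x) + ?I 2 (%x. bump_mass * w 2 x)" (is "?f \<longlonglongrightarrow> ?l")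
   by (intro tendsto_add lim w)
  hence "(%n. \<bar>?f n\<bar>) \<longlonglongrightarrow> \<bar>?l\<bar>" by (rule tendsto_rabs)
  moreover have "\<bar>?f n\<bar> <= bump_bound * S * d" for n proof -
   have "\<bar>?f n\<bar> <= s 1 * (bump_bound * d) + s 2 * (bump_bound * d)"
   using orth[of n] bs[of 1 n] bs[of 2 n] by linarith
   also have "... = bump_bound * S * d" by (simp add: S_def s_def algebra_simps)
   finally show ?thesis .
  qed
  ultimately have l: "\<bar>?l\<bar> <= bump_bound * S * d" by (intro LIMSEQ_le_const2) auto
  have z1: "\<bar>?I i (%x. u x $ i) - ?I i (w i)\<bar> <= s i * d" for i proof -
   have "?I i (%x. u x $ i - w i x)^2 <= (LINT x|?M. (z x $ i)^2) * (LINT x|?M. (u x $ i - w i x)^2)"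
   using L2_CS[OF zc[of i] dw[of i]] by simp
   from real_sqrt_le_mono[OF this]
   have "\<bar>?I i (%x. u x $ i - w i x)\<bar> <= s i * sqrt (LINT x|?M. (u x $ i - w i x)^2)"
   by (simp add: real_sqrt_mult s_def)
   also have "... <= s i * d" by (intro mult_left_mono wd s0)
   finally have "\<bar>?I i (%x. u x $ i - w i x)\<bar> <= s i * d" .
   moreover have "?I i (%x. u x $ i - w i x) = ?I i (%x. u x $ i) - ?I i (w i)"
   using L2_inner_int[OF zc[of i] uc[of i]] L2_inner_int[OF zc[of i] w2[of i]]
   by (simp add: right_diff_distrib)
   ultimately show ?thesis by simp
  qed
  have lw: "?l = bump_mass * (?I 1 (w 1) + ?I 2 (w 2))" by (simp add: mult.left_commute[of _ bump_mass] distrib_left)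
  have "\<bar>Q\<bar> <= S * d + \<bar>?I 1 (w 1) + ?I 2 (w 2)\<bar>"
   using z1[of 1] z1[of 2] unfolding Q_def S_def s_def distrib_right by linarith
  hence "bump_mass * \<bar>Q\<bar> <= bump_mass * (S * d) + \<bar>?l\<bar>"
   unfolding lw abs_mult using bump_mass_pos by (simp flip: distrib_left)
  thus ?thesis using l by (simp add: algebra_simps)
 qed
 have "bump_mass * \<bar>Q\<bar> <= 0 + e'" if e': "e' > 0" for e' proof -
  define C where "C = (bump_mass + bump_bound) * S"
  have C: "0 <= C" using bump_mass_pos bump_bound_nonneg S0 by (simp add: C_def)
  have "bump_mass * \<bar>Q\<bar> <= C * (e' / (C + 1))" unfolding C_def
   by (rule small) (use C e' in \<open>simp add: C_def\<close>)
  also have "... <= e'" using C e' by (simp add: field_simps)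
  finally show ?thesis by simp
 qed
 hence "bump_mass * \<bar>Q\<bar> <= 0" by (rule field_le_epsilon)
 hence "Q = 0" using bump_mass_pos by (simp add: mult_le_0_iff)
 thus ?thesis unfolding Q_def inner_point
  using L2_inner_int[OF zc[of 1] uc[of 1]] L2_inner_int[OF zc[of 2] uc[of 2]] by simp
qed

section \<open>Weak operators and traces on polygons\<close>

lemma C1_mult:
 assumes "C1_fun p" "C1_fun q" shows "C1_fun (%x. p x * q x)" proof -
 have d: "p differentiable (at x)" "q differentiable (at x)" for x using assms by (simp_all add: C1_fun_def)
 have "partial i (%x. p x * q x) = (%x. p x * partial i q x + partial i p x * q x)" for i
  using partial_mult[OF d] by blast
 moreover have "continuous_on UNIV (%x. p x * partial i q x + partial i p x * q x)" for i
  by (intro continuous_intros C1_continuous C1_partial_continuous assms)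
 ultimately show ?thesis unfolding C1_fun_def using d by (auto intro: differentiable_mult)
qed

lemma C1_diff:
 assumes "C1_fun p" "C1_fun q"
 shows "C1_fun (%x. p x - q x)" "partial i (%x. p x - q x) x = partial i p x - partial i q x" proof -
 have d: "p differentiable (at x)" "q differentiable (at x)" for x using assms by (simp_all add: C1_fun_def)
 have e: "partial i (%x. p x - q x) x = partial i p x - partial i q x" for i x
  using partial_lin[OF d, of i 1 "-1" x] by simp
 hence "partial i (%x. p x - q x) = (%x. partial i p x - partial i q x)" for i by blast
 moreover have "continuous_on UNIV (%x. partial i p x - partial i q x)" for i
  by (intro continuous_intros C1_partial_continuous assms)
 ultimately show "C1_fun (%x. p x - q x)" unfolding C1_fun_def using d by (auto intro: differentiable_diff)
 show "partial i (%x. p x - q x) x = partial i p x - partial i q x" by (rule e)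
qed

lemma real_polynomial_function_Pol:
 fixes p :: "point => real" shows "real_polynomial_function p ==> EX m>=0. p : Pol m"
proof (induction rule: real_polynomial_function.induct)
 case (linear f)
 then interpret bounded_linear f .
 have "f = (%x. f (axis 1 1) * x $ 1 + f (axis 2 1) * x $ 2)" proof
  fix x :: point
  have "x = (x $ 1) *R axis 1 1 + (x $ 2) *R axis 2 1" by (simp add: vec_eq_iff forall_2 axis_def)
  hence "f x = f ((x $ 1) *R axis 1 1 + (x $ 2) *R axis 2 1)" by simp
  thus "f x = f (axis 1 1) * x $ 1 + f (axis 2 1) * x $ 2" by (simp add: add scaleR)
 qed
 moreover have "(%x. f (axis 1 1) * x $ 1 + f (axis 2 1) * x $ 2) : Pol 1" by (intro Pol_add Pol_smult Pol_coord)
 ultimately have "f : Pol 1" by metis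
 thus ?case by (intro exI[of _ 1]) simp
next
 case (const c)
 show ?case by (rule exI[of _ 0]) (simp add: Pol_const)
next
 case (add f g)
 then obtain m n where m: "m >= 0" "f : Pol m" "n >= 0" "g : Pol n" by blast
 have "f : Pol (m + n)" "g : Pol (m + n)"
  by (rule Pol_mono[OF m(2)], use m in simp) (rule Pol_mono[OF m(4)], use m in simp)
 thus ?case using m(1,3) by (intro exI[of _ "m + n"] conjI Pol_add) auto
next
 case (mult f g)
 then obtain m n where m: "m >= 0" "f : Pol m" "n >= 0" "g : Pol n" by blast
 thus ?case by (intro exI[of _ "m + n"] conjI Pol_mult) auto
qed

text \<open>A bubble on the disk of radius \<open>s\<close>; the outer square makes it continuously
  differentiable across the circle.\<close>

definition bub :: "point => real => point => real" where
 "bub z s x = (max 0 (s^2 - (x - z) <.> (x - z)))^2"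

lemma max_sq_deriv: "((%y. (max 0 y)^2) has_real_derivative 2 * max 0 y) (at y)" proof -
 have "((%x. if x : {..<0} then 0 else x^2) has_derivative
   (if y : {..<0} then (%d. 0) else (%d. 2 * y * d))) (at y within {..<0} Un {0..})"
  by (rule has_derivative_If_within_closures[of y "{..<0}" "{0..}" "%x. 0" "%x d. 0" "%x. x^2" "%x d. 2 * x * d"])
   (auto intro!: derivative_eq_intros)
 moreover have "{..<0} Un {0..} = (UNIV :: real set)" by auto
 moreover have "(%x. if x : {..<0} then 0 else x^2) = (%y::real. (max 0 y)^2)" by (auto simp: fun_eq_iff max_def)
 ultimately have "((%y. (max 0 y)^2) has_derivative (if y : {..<0} then (%d. 0) else (%d. 2 * y * d))) (at y)" by simp
 moreover have "(if y : {..<0} then (%d. 0) else (%d. 2 * y * d)) = (*) (2 * max 0 y)"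
  by (auto simp: fun_eq_iff max_def)
 ultimately show ?thesis by (simp add: has_field_derivative_def)
qed

lemma bub_C1: "C1_fun (bub z s)" "partial i (bub z s) x = - 4 * max 0 (s^2 - (x - z) <.> (x - z)) * (x - z) $ i" proof -
 define P where "P i x = - 4 * max 0 (s^2 - (x - z) <.> (x - z)) * (x - z) $ i" for i x
 have d: "(bub z s has_derivative (%h. P 1 x * h $ 1 + P 2 x * h $ 2)) (at x)" for x proof -
  have "((%x. s^2 - (x - z) <.> (x - z)) has_derivative (%h. - 2 * ((x - z) <.> h))) (at x)"
   by (auto intro!: derivative_eq_intros simp: inner_commute inner_diff_left inner_diff_right)
  from diff_chain_at[OF this max_sq_deriv[unfolded has_field_derivative_def]]
  have "(bub z s has_derivative (%h. 2 * max 0 (s^2 - (x - z) <.> (x - z)) * (- 2 * ((x - z) <.> h)))) (at x)"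
   by (simp add: o_def bub_def[abs_def])
  thus ?thesis proof (rule has_derivative_eq_rhs)
   show "(%h. 2 * max 0 (s^2 - (x - z) <.> (x - z)) * (- 2 * ((x - z) <.> h))) = (%h. P 1 x * h $ 1 + P 2 x * h $ 2)"
   proof
   fix h :: point
   define M where "M = max 0 (s^2 - (x - z) <.> (x - z))"
   have "2 * M * (- 2 * ((x - z) <.> h)) = - 4 * M * (x - z) $ 1 * h $ 1 + - 4 * M * (x - z) $ 2 * h $ 2"
   unfolding inner_point[of "x - z" h] by (simp add: algebra_simps)
   thus "2 * max 0 (s^2 - (x - z) <.> (x - z)) * (- 2 * ((x - z) <.> h)) = P 1 x * h $ 1 + P 2 x * h $ 2"
   by (simp only: P_def M_def)
   qed
  qed
 qed
 have c: "continuous_on UNIV (P i)" for i unfolding P_def by (intro continuous_intros)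
 note I = C1_I[OF d c c]
 show "C1_fun (bub z s)" by (rule I(1))
 show "partial i (bub z s) x = - 4 * max 0 (s^2 - (x - z) <.> (x - z)) * (x - z) $ i"
  using I(2,3) exhaust_2[of i] unfolding P_def by auto
qed

lemma bub_pos: "s > 0 ==> x : ball z s ==> bub z s x > 0" proof -
 assume "s > 0" "x : ball z s"
 hence "(norm (x - z))^2 < s^2" by (intro power_strict_mono) (auto simp: dist_norm norm_minus_commute)
 thus ?thesis by (simp add: bub_def power2_norm_eq_inner)
qed

lemma bub_zero: "s > 0 ==> x ~: cball z s ==> bub z s x = 0" proof -
 assume "s > 0" "x ~: cball z s"
 hence "s^2 <= (norm (x - z))^2" by (intro power_mono) (auto simp: dist_norm norm_minus_commute)
 thus ?thesis by (simp add: bub_def power2_norm_eq_inner)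
qed

lemma test_fun_bub:
 assumes "s > 0" "cball z s <= interior F" "C1_fun p" shows "test_fun F (%x. bub z s x * p x)" unfolding test_fun_def
 using C1_mult[OF bub_C1(1) assms(3)] assms(1,2) bub_zero[of s _ z] by (intro conjI exI[of _ "cball z s"]) auto

lemma integrable_L2_mult_continuous:
 fixes f g :: "'a::euclidean_space => real"
 assumes "compact D" "L2_on D f" "continuous_on D g" shows "integrable (leb D) (%x. f x * g x)"
 using int_mult_cont[OF assms(1) L2_integrable[OF assms(1,2)] assms(3)] .

text \<open>A polynomial times a bubble is a test function, so \<open>f\<close> times the bubble is
  orthogonal to all polynomials and vanishes almost everywhere, while the bubble is positive in its
  disk. Local negligibility then covers the interior, and the frontier of a convex set is
  negligible.\<close>

lemma weak_orthogonal_AE_zero: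
 fixes f :: "point => real"
 assumes F: "compact F" "convex F" and f: "L2_on F f"
  and orth: "!!ph. test_fun F ph ==> (LINT x|leb F. f x * ph x) = 0" shows "AE x in leb F. f x = 0" proof -
 have Fl: "F : sets lebesgue" using F(1) by (rule compact_leb)
 define B where "B = {x : interior F. f x ~= 0}"
 have "negligible B" unfolding locally_negligible_alt[of B] proof
  fix x0 assume x0: "x0 : B"
  then obtain s where s: "s > 0" "cball x0 s <= interior F"
   unfolding B_def using open_contains_cball[of "interior F"] by blast
  have cb: "continuous_on F (bub x0 s)" by (rule C1_continuous[OF bub_C1(1)])
  have "AE x in leb F. f x * bub x0 s x = 0" proof (rule poly_orth_AE_zero[OF F(1)])
   show "L2_on F (%x. f x * bub x0 s x)" using L2_mult_continuous[OF F(1) f cb] by (simp add: mult.commute)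
   fix p :: "point => real" assume "real_polynomial_function p"
   hence "C1_fun p" using real_polynomial_function_Pol Pol_C1 by blast
   from orth[OF test_fun_bub[OF s this]] show "(LINT x|leb F. f x * bub x0 s x * p x) = 0" by (simp add: mult.assoc)
  qed
  hence "AE x in lebesgue. x : F --> f x * bub x0 s x = 0" using Fl by (subst (asm) AE_restrict_space_iff) auto
  then obtain N where N: "negligible N" "{x. ~ (x : F --> f x * bub x0 s x = 0)} <= N"
   unfolding eventually_ae_filter_negligible by blast
  have "B Int ball x0 s <= N" proof
   fix x assume x: "x : B Int ball x0 s"
   hence "x : F" "f x ~= 0" "bub x0 s x > 0" using interior_subset bub_pos[OF s(1)] by (auto simp: B_def)
   thus "x : N" using N(2) by auto
  qed
  hence "negligible (B Int ball x0 s)" using N(1) negligible_subset by blast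
  thus "EX U. openin (top_of_set B) U & x0 : U & negligible U"
   using x0 s(1) by (intro exI[of _ "B Int ball x0 s"]) (auto intro: openin_open_Int)
 qed
 moreover have "negligible (frontier F)" using F(2) by (rule negligible_convex_frontier)
 ultimately have "negligible (B Un frontier F)" by simp
 moreover have "{x. ~ (x : F --> f x = 0)} <= B Un frontier F" using closure_subset by (auto simp: B_def frontier_def)
 ultimately have "AE x in lebesgue. x : F --> f x = 0" unfolding eventually_ae_filter_negligible by blast
 thus ?thesis using Fl by (subst AE_restrict_space_iff) auto
qed

section \<open>Uniqueness of weak rotations and tangential traces\<close>

context mesh_polygon
begin

abbreviation MF :: "point measure" where "MF == leb F"

lemma test_fun_C1: "test_fun F ph ==> C1_fun ph" by (simp add: test_fun_def)

lemma test_fun_seg: "test_fun F ph ==> e : E ==> x : seg e ==> ph x = 0" proof -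
 assume t: "test_fun F ph" and "e : E" "x : seg e"
 hence "x ~: interior F" using seg_frontier by (auto simp: frontier_def)
 thus "ph x = 0" using t unfolding test_fun_def by blast
qed

lemma linepath_seg: "0 <= t ==> t <= 1 ==> el e t : seg e" unfolding seg_def by (simp add: linepath_in_path)

lemma edge_int_cong: "(!!x. x : seg e ==> f x = g x) ==> edge_int e f = edge_int e g"
 unfolding edge_int_def using linepath_seg
 by (intro arg_cong[of _ _ "(*) (elen e)"] int_congr) auto

lemma bdry_int_cong: "(!!e x. e : E ==> x : seg e ==> f e x = g e x) ==> bdry_int vs f = bdry_int vs g"
 unfolding bdry_int_def by (intro sum.cong edge_int_cong) auto

lemma L2_mult_integrable: "L2_on F f ==> continuous_on F g ==> integrable MF (%x. f x * g x)" for f g :: "point => real"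
 by (rule integrable_L2_mult_continuous[OF compact_F])

lemma L2_comp: "L2_on F v ==> L2_on F (%x. v x $ i)" for v :: "point => point" using L2_component by blast

text \<open>\<open>rot\<close> is an arbitrarily chosen representative; this uniqueness allows it to
  be replaced under integrals by the polynomial one.\<close>

lemma weak_rot_unique:
 assumes "has_weak_rot F v r" "has_weak_rot F v r'" shows "AE x in MF. r x = r' x" proof -
 have L: "L2_on F r" "L2_on F r'" using assms by (auto simp: has_weak_rot_def)
 have "AE x in MF. r x - r' x = 0" proof (rule weak_orthogonal_AE_zero[OF compact_F convex_F L2_diff[OF L]])
  fix ph assume t: "test_fun F ph"
  hence "continuous_on F ph" by (intro C1_continuous test_fun_C1)
  thus "(LINT x|MF. (r x - r' x) * ph x) = 0" using assms t L2_mult_integrable[OF L(1)] L2_mult_integrable[OF L(2)]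
   by (simp add: has_weak_rot_def left_diff_distrib)
 qed
 thus ?thesis by simp
qed

lemma rot_weak: "has_weak_rot F v r ==> has_weak_rot F v (rot F v)"
 unfolding rot_def by (rule someI[of "has_weak_rot F v"])

lemma rot_AE: "has_weak_rot F v r ==> AE x in MF. rot F v x = r x" using weak_rot_unique rot_weak by blast

lemma rot_integral:
 assumes "has_weak_rot F v r" "continuous_on F ph" shows "(LINT x|MF. rot F v x * ph x) = (LINT x|MF. r x * ph x)"
proof (rule integral_cong_AE)
 have "L2_on F (rot F v)" "L2_on F r" using assms(1) rot_weak by (auto simp: has_weak_rot_def)
 thus "(%x. rot F v x * ph x) : borel_measurable MF" "(%x. r x * ph x) : borel_measurable MF"
  using L2_mult_integrable assms(2) by blast+
 show "AE x in MF. rot F v x * ph x = r x * ph x" using rot_AE[OF assms(1)] by eventually_elim simp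
qed

lemma rot_norm:
 assumes "has_weak_rot F v r" shows "L2_inner F (rot F v) (rot F v) = (LINT x|MF. (r x)^2)" unfolding L2_inner_def
proof (rule integral_cong_AE)
 have L: "L2_on F (rot F v)" "L2_on F r" using assms rot_weak by (auto simp: has_weak_rot_def)
 show "(%x. rot F v x <.> rot F v x) : borel_measurable MF" using L2_inner_int[OF L(1) L(1)] by blast
 show "(%x. (r x)^2) : borel_measurable MF" using L2_square[OF L(2)] by simp
 show "AE x in MF. rot F v x <.> rot F v x = (r x)^2"
  using rot_AE[OF assms] by eventually_elim (simp add: power2_eq_square)
qed

text \<open>The parameter of the orthogonal projection to the line of \<open>e\<close>, defined on
  the whole plane; on the line it is the parameter of \<open>linepath\<close>.\<close>

definition tc :: "edge => point => real" where
 "tc e x = (1 / (elen e)^2) * ((snd e - fst e) <.> (x - fst e))"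

lemma tc_Pol: "tc e : Pol 1" unfolding tc_def[abs_def] by (intro Pol_smult Pol_inner)

lemma tc_line: "e : E ==> tc e (el e t) = t" proof -
 assume e: "e : E"
 have "el e t - fst e = t *R (snd e - fst e)" by (simp add: linepath_def algebra_simps)
 moreover have "(snd e - fst e) <.> (snd e - fst e) = (elen e)^2"
  by (simp add: elen_def dist_commute[of "fst e"]) (simp add: dist_norm power2_norm_eq_inner)
 ultimately show ?thesis using elen_bounds(3)[OF e] by (simp add: tc_def)
qed

text \<open>Vanishes on every edge other than \<open>e\<close>, so that a boundary integral weighted
  by it sees only \<open>e\<close>. Division by \<open>h\<close> makes the weight
  dimensionless.\<close>

definition oth :: "edge => point => real" where
 "oth e x = (PROD e':E - {e}. lin e' x / h)"

lemma lin_Pol: "(%x. lin e x / h) : Pol 1" proof -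
 have "(%x. (- 1 / h) * (nrm e <.> (x - fst e))) : Pol 1" by (intro Pol_smult Pol_inner)
 moreover have "(- 1 / h) * (nrm e <.> (x - fst e)) = lin e x / h" for x
  unfolding lin_def inner_diff_right by (simp add: diff_divide_distrib)
 ultimately show ?thesis by simp
qed

lemma oth_Pol: "oth e : Pol (int (card (E - {e})))"
 unfolding oth_def[abs_def] by (rule Pol_prod) (use E_rel(1) lin_Pol in auto)

lemma oth_zero:
 assumes "e' : E" "e' ~= e" "x : seg e'" shows "oth e x = 0" proof -
 have "lin e' x / h = 0" using lin_seg[OF assms(1,3)] by simp
 thus ?thesis unfolding oth_def using assms E_rel(1) by (intro prod_zero) blast+
qed

lemma oth_lower:
 assumes e: "e : E" and t: "0 <= t" "t <= 1" shows "(dl * (t * (1 - t))) ^ card (E - {e}) <= oth e (el e t)" proof -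
 have "(PROD e':E - {e}. dl * (t * (1 - t))) <= oth e (el e t)" unfolding oth_def proof (rule prod_mono)
  fix e' assume e': "e' : E - {e}"
  have "dl * (t * (1 - t)) * h <= lin e' (el e t)" using lin_on_edge[OF e _ _ t, of e'] e' by (auto simp: mult_ac)
  thus "0 <= dl * (t * (1 - t)) & dl * (t * (1 - t)) <= lin e' (el e t) / h"
   using delta_pos t h_pos by (simp add: le_divide_eq)
 qed
 thus ?thesis by simp
qed

lemma tc_poly_Pol: "(%x. SUM j<=n. c j * tc e x ^ j) : Pol (int n)" proof (intro Pol_sum Pol_smult)
 fix j assume "j : {..n}"
 moreover have "(%x. tc e x ^ j) : Pol (int j * 1)" by (rule Pol_power[OF tc_Pol])
 ultimately show "(%x. tc e x ^ j) : Pol (int n)" by (elim Pol_mono) simp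
qed

lemma trace_integrable:
 fixes g ph :: "point => real"
 assumes "L2_on {0..1} (%t. g (el e t))" "continuous_on UNIV ph"
 shows "integrable (leb {0..1}) (%t. g (el e t) * ph (el e t))" by (rule integrable_L2_mult_continuous[OF _ assms(1)])
   (auto intro!: continuous_on_compose2[OF assms(2)] continuous_intros)

lemma has_tan_traceD:
 "has_tan_trace vs v g ==> C1_fun ph ==>
  (LINT x|MF. rot F v x * ph x) + (LINT x|MF. v x $ 2 * partial 1 ph x - v x $ 1 * partial 2 ph x) =
  bdry_int vs (%e x. g e x * ph x)" by (simp add: has_tan_trace_def)

text \<open>Test functions of the form \<open>oth e\<close> times a polynomial in
  \<open>tc e\<close> isolate the edge \<open>e\<close> and realise all polynomials along it up to a
  fixed weight. The weight is positive inside the edge, so orthogonality to all polynomials forces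
  the traces to agree almost everywhere.\<close>

lemma tan_trace_unique:
 assumes g: "has_tan_trace vs v g" "has_tan_trace vs v g'" and e: "e : E"
 shows "AE t in leb {0..1}. g e (el e t) = g' e (el e t)" proof -
 let ?l = "el e"
 define f where "f t = g e (?l t) - g' e (?l t)" for t
 have L: "L2_on {0..1} (%t. g e (el e t))" "L2_on {0..1} (%t. g' e (el e t))"
  if "e : E" for e using g that by (auto simp: has_tan_trace_def)
 have f: "L2_on {0..1} f" unfolding f_def by (intro L2_diff L e)
 have mc: "continuous_on S (%t. oth e (?l t))" for S
  by (rule continuous_on_compose2[OF Pol_continuous[OF oth_Pol, of UNIV]]) (auto intro!: continuous_intros)
 have "AE t in leb {0..1}. f t * oth e (?l t) = 0" proof (rule poly_orth_AE_zero)
  show "L2_on {0..1} (%t. f t * oth e (?l t))" using L2_mult_continuous[OF _ f mc] by (simp add: mult.commute)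
  fix p :: "real => real" assume "real_polynomial_function p"
  then obtain c n where p: "p = (%t. SUM j<=n. c j * t ^ j)" using real_polynomial_function_iff_sum by blast
  define ph where "ph x = oth e x * (SUM j<=n. c j * tc e x ^ j)" for x
  have phP: "ph : Pol (int (card (E - {e})) + int n)" unfolding ph_def[abs_def] by (intro Pol_mult oth_Pol tc_poly_Pol)
  have phC: "C1_fun ph" by (rule Pol_C1[OF phP])
  have phc: "continuous_on UNIV ph" by (rule Pol_continuous[OF phP])
  have d: "edge_int e' (%x. g e' x * ph x) - edge_int e' (%x. g' e' x * ph x) =
   edge_int e' (%x. (g e' x - g' e' x) * ph x)" if "e' : E" for e'
   unfolding edge_int_def using trace_integrable[OF L(1)[OF that] phc] trace_integrable[OF L(2)[OF that] phc]
   by (simp add: left_diff_distrib right_diff_distrib)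
  have "bdry_int vs (%e x. g e x * ph x) = bdry_int vs (%e x. g' e x * ph x)"
   using has_tan_traceD[OF g(1) phC] has_tan_traceD[OF g(2) phC] by simp
  hence "(SUM e':E. edge_int e' (%x. (g e' x - g' e' x) * ph x)) = 0"
   unfolding bdry_int_def by (simp add: sum_subtractf flip: d)
  moreover have "edge_int e' (%x. (g e' x - g' e' x) * ph x) = 0" if "e' : E - {e}" for e' proof -
   have "edge_int e' (%x. (g e' x - g' e' x) * ph x) = edge_int e' (%x. 0)"
   using oth_zero[of e' e] that by (intro edge_int_cong) (auto simp: ph_def)
   thus ?thesis by (simp add: edge_int_def)
  qed
  hence "(SUM e':E. edge_int e' (%x. (g e' x - g' e' x) * ph x)) = edge_int e (%x. (g e x - g' e x) * ph x)"
   using E_rel(1) e by (subst sum.remove[of E e]) auto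
  ultimately have "edge_int e (%x. (g e x - g' e x) * ph x) = 0" by simp
  thus "(LINT t|leb {0..1}. f t * oth e (?l t) * p t) = 0"
   using elen_bounds(3)[OF e] by (simp add: edge_int_def ph_def f_def p tc_line[OF e] mult.assoc)
 qed simp
 moreover have "AE t in leb {0..1}. t ~= 0 & t ~= (1::real)" proof -
  have "AE t in lebesgue. t ~= 0 & t ~= (1::real)"
   unfolding eventually_ae_filter_negligible by (intro exI[of _ "{0, 1}"]) auto
  thus ?thesis by (subst AE_restrict_space_iff) auto
 qed
 moreover have "AE t in leb {0..1}. t : {0..1::real}" by (intro AE_I2) simp
 ultimately show ?thesis proof eventually_elim
  case (elim t)
  hence "0 < t" "t < 1" by auto
  hence "0 < (dl * (t * (1 - t))) ^ card (E - {e})" using delta_pos by simp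
  also have "... <= oth e (?l t)" using \<open>0 < t\<close> \<open>t < 1\<close> by (intro oth_lower e) auto
  finally show ?case using elim(1) by (simp add: f_def)
 qed
qed

lemma tan_trace_has: "has_tan_trace vs v g ==> has_tan_trace vs v (tan_trace vs v)"
 unfolding tan_trace_def by (rule someI[of "has_tan_trace vs v"])

text \<open>\<open>tan_trace\<close> is again a choice, determined only up to null sets; edge
  integrals may be computed with any trace at hand.\<close>

lemma edge_int_tan_trace:
 assumes g: "has_tan_trace vs v g" and e: "e : E" and ph: "continuous_on UNIV ph"
 shows "edge_int e (%x. tan_trace vs v e x * ph x) = edge_int e (%x. g e x * ph x)"
  "edge_int e (%x. tan_trace vs v e x * tan_trace vs v e x) = edge_int e (%x. g e x * g e x)" proof -
 let ?l = "el e"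
 have L: "L2_on {0..1} (%t. g e (?l t))" "L2_on {0..1} (%t. tan_trace vs v e (?l t))"
  using g tan_trace_has[OF g] e by (auto simp: has_tan_trace_def)
 note ae = tan_trace_unique[OF tan_trace_has[OF g] g e]
 have "(LINT t|leb {0..1}. tan_trace vs v e (?l t) * ph (?l t)) = (LINT t|leb {0..1}. g e (?l t) * ph (?l t))"
 proof (rule integral_cong_AE)
  show "(%t. tan_trace vs v e (?l t) * ph (?l t)) : borel_measurable (leb {0..1})"
   using trace_integrable[OF L(2) ph] by blast
  show "(%t. g e (?l t) * ph (?l t)) : borel_measurable (leb {0..1})" using trace_integrable[OF L(1) ph] by blast
  show "AE t in leb {0..1}. tan_trace vs v e (?l t) * ph (?l t) = g e (?l t) * ph (?l t)"
   using ae by eventually_elim simp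
 qed
 thus "edge_int e (%x. tan_trace vs v e x * ph x) = edge_int e (%x. g e x * ph x)" by (simp add: edge_int_def)
 have "(LINT t|leb {0..1}. tan_trace vs v e (?l t) * tan_trace vs v e (?l t)) =
   (LINT t|leb {0..1}. g e (?l t) * g e (?l t))" proof (rule integral_cong_AE)
  show "(%t. tan_trace vs v e (?l t) * tan_trace vs v e (?l t)) : borel_measurable (leb {0..1})"
   by (intro borel_measurable_times L2_measurable[OF L(2)])
  show "(%t. g e (?l t) * g e (?l t)) : borel_measurable (leb {0..1})"
   by (intro borel_measurable_times L2_measurable[OF L(1)])
  show "AE t in leb {0..1}. tan_trace vs v e (?l t) * tan_trace vs v e (?l t) = g e (?l t) * g e (?l t)"
   using ae by eventually_elim simp
 qed
 thus "edge_int e (%x. tan_trace vs v e x * tan_trace vs v e x) = edge_int e (%x. g e x * g e x)"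
  by (simp add: edge_int_def)
qed

lemma green_product:
 fixes P :: "point => point"
 assumes P: "!!i. C1_fun (%x. P x $ i)" and ph: "C1_fun ph"
 shows "(LINT x|MF. rotp P x * ph x) + (LINT x|MF. P x $ 2 * partial 1 ph x - P x $ 1 * partial 2 ph x) =
  bdry_int vs (%e x. (P x <.> tng e) * ph x)" proof -
 define Q where "Q x = ph x *R P x" for x
 have Q: "C1_fun (%x. Q x $ i)" for i unfolding Q_def using C1_mult[OF ph P[of i]] by simp
 have d: "ph differentiable (at x)" "(%x. P x $ i) differentiable (at x)" for x i
  using ph P by (simp_all add: C1_fun_def)
 have r: "rotp Q x = rotp P x * ph x + (P x $ 2 * partial 1 ph x - P x $ 1 * partial 2 ph x)" for x
  using partial_mult[OF d(1)[of x] d(2)[of 2 x], of 1] partial_mult[OF d(1)[of x] d(2)[of 1 x], of 2]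
  by (simp add: rotp_def Q_def algebra_simps)
 have i1: "integrable MF (%x. rotp P x * ph x)"
  unfolding rotp_def by (intro int_cont compact_F continuous_intros C1_continuous C1_partial_continuous P ph)
 have i2: "integrable MF (%x. P x $ 2 * partial 1 ph x - P x $ 1 * partial 2 ph x)"
  by (intro int_cont compact_F continuous_intros C1_continuous C1_partial_continuous P ph)
 have "(LINT x|MF. rotp Q x) = bdry_int vs (%e x. Q x <.> tng e)" by (rule green_polygon[OF Q])
 thus ?thesis unfolding r using i1 i2 by (simp add: Q_def mult.commute)
qed

lemma C1_cont_vec:
 fixes P :: "point => point"
 assumes "!!i. C1_fun (%x. P x $ i)" shows "continuous_on S P" proof -
 have e: "P x = (P x $ 1) *R axis 1 1 + (P x $ 2) *R axis 2 1" for x by (simp add: vec_eq_iff forall_2 axis_def)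
 have "continuous_on S (%x. (P x $ 1) *R axis 1 1 + (P x $ 2) *R axis 2 1 :: point)"
  by (intro continuous_intros C1_continuous assms)
 thus ?thesis by (simp flip: e)
qed

lemma bdry_int_zero: "(!!e x. e : E ==> x : seg e ==> f e x = 0) ==> bdry_int vs f = 0"
 using bdry_int_cong[of f "%_ _. 0"] by (simp add: bdry_int_def edge_int_def)


lemma weak_rot_diff:
 fixes P :: "point => point"
 assumes v: "L2_on F v" "has_weak_rot F v r" and P: "!!i. C1_fun (%x. P x $ i)"
 shows "has_weak_rot F (%x. v x - P x) (%x. r x - rotp P x)" unfolding has_weak_rot_def proof (intro conjI allI impI)
 have cr: "continuous_on F (rotp P)" unfolding rotp_def by (intro continuous_intros C1_partial_continuous P)
 have Lr: "L2_on F r" using v(2) by (simp add: has_weak_rot_def)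
 show "L2_on F (%x. r x - rotp P x)" by (intro L2_diff Lr L2_continuous compact_F cr)
 fix ph assume t: "test_fun F ph"
 note ph = test_fun_C1[OF t]
 note c = C1_continuous[OF ph, of F] C1_partial_continuous[OF ph, of F]
 have z: "bdry_int vs (%e x. (P x <.> tng e) * ph x) = 0" using test_fun_seg[OF t] by (intro bdry_int_zero) simp
 have i: "integrable MF (%x. v x $ i * partial j ph x)" for i j by (intro L2_mult_integrable L2_comp v(1) c)
 have iP: "integrable MF (%x. P x $ i * partial j ph x)" for i j
  by (intro int_cont compact_F continuous_intros C1_continuous P c)
 have irP: "integrable MF (%x. rotp P x * ph x)" by (intro int_cont compact_F continuous_intros cr c)
 have "(LINT x|MF. (r x - rotp P x) * ph x) = (LINT x|MF. r x * ph x) - (LINT x|MF. rotp P x * ph x)"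
  using L2_mult_integrable[OF Lr c(1)] irP by (simp add: left_diff_distrib)
 also have "... = - (LINT x|MF. v x $ 2 * partial 1 ph x - v x $ 1 * partial 2 ph x) +
   (LINT x|MF. P x $ 2 * partial 1 ph x - P x $ 1 * partial 2 ph x)"
  using v(2) t green_product[OF P ph] z by (simp add: has_weak_rot_def)
 also have "... = - (LINT x|MF. (v x - P x) $ 2 * partial 1 ph x - (v x - P x) $ 1 * partial 2 ph x)"
  using i[of 2 1] i[of 1 2] iP[of 2 1] iP[of 1 2] by (simp add: left_diff_distrib)
 finally show "(LINT x|MF. (r x - rotp P x) * ph x) =
   - (LINT x|MF. (v x - P x) $ 2 * partial 1 ph x - (v x - P x) $ 1 * partial 2 ph x)" .
qed

lemma tan_trace_diff:
 fixes P :: "point => point"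
 assumes v: "L2_on F v" "has_weak_rot F v r" "has_tan_trace vs v g" and P: "!!i. C1_fun (%x. P x $ i)"
 shows "has_tan_trace vs (%x. v x - P x) (%e x. g e x - P x <.> tng e)" unfolding has_tan_trace_def
proof (intro conjI ballI allI impI)
 have cP: "continuous_on S P" for S by (rule C1_cont_vec[OF P])
 have L: "L2_on {0..1} (%t. g e (el e t))" if "e : E" for e using v(3) that by (auto simp: has_tan_trace_def)
 have LP: "L2_on {0..1} (%t. P (el e t) <.> tng e)" for e
  by (intro L2_continuous continuous_intros continuous_on_compose2[OF cP[of UNIV]]) auto
 show "L2_on {0..1} (%t. g e (el e t) - P (el e t) <.> tng e)" if "e : E" for e by (intro L2_diff L LP that)
 fix ph assume ph: "C1_fun ph"
 note c = C1_continuous[OF ph] C1_partial_continuous[OF ph]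
 have Lr: "L2_on F r" using v(2) by (simp add: has_weak_rot_def)
 have cr: "continuous_on F (rotp P)" unfolding rotp_def by (intro continuous_intros C1_partial_continuous P)
 have i: "integrable MF (%x. v x $ i * partial j ph x)" for i j by (intro L2_mult_integrable L2_comp v(1) c)
 have iP: "integrable MF (%x. P x $ i * partial j ph x)" for i j
  by (intro int_cont compact_F continuous_intros C1_continuous P c)
 have irP: "integrable MF (%x. rotp P x * ph x)" by (intro int_cont compact_F continuous_intros cr c)
 have "(LINT x|MF. rot F (%x. v x - P x) x * ph x) = (LINT x|MF. (r x - rotp P x) * ph x)"
  by (rule rot_integral[OF weak_rot_diff[OF v(1,2) P] c(1)])
 also have "... = (LINT x|MF. rot F v x * ph x) - (LINT x|MF. rotp P x * ph x)"
  using L2_mult_integrable[OF Lr c(1)] irP rot_integral[OF v(2) c(1)] by (simp add: left_diff_distrib)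
 also have "(LINT x|MF. (v x - P x) $ 2 * partial 1 ph x - (v x - P x) $ 1 * partial 2 ph x) =
   (LINT x|MF. v x $ 2 * partial 1 ph x - v x $ 1 * partial 2 ph x) -
   (LINT x|MF. P x $ 2 * partial 1 ph x - P x $ 1 * partial 2 ph x)"
  using i[of 2 1] i[of 1 2] iP[of 2 1] iP[of 1 2] by (simp add: left_diff_distrib)
 moreover have "bdry_int vs (%e x. (g e x - P x <.> tng e) * ph x) =
   bdry_int vs (%e x. g e x * ph x) - bdry_int vs (%e x. (P x <.> tng e) * ph x)"
  unfolding bdry_int_def sum_subtractf[symmetric] proof (rule sum.cong)
  fix e assume e: "e : E"
  show "edge_int e (%x. (g e x - P x <.> tng e) * ph x) = edge_int e (%x. g e x * ph x) - edge_int e (%x. (P x <.> tng e) * ph x)"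
   unfolding edge_int_def using trace_integrable[OF L[OF e] c(1)] trace_integrable[OF LP c(1)]
   by (simp add: left_diff_distrib right_diff_distrib)
 qed simp
 ultimately show "(LINT x|MF. rot F (%x. v x - P x) x * ph x) +
   (LINT x|MF. (v x - P x) $ 2 * partial 1 ph x - (v x - P x) $ 1 * partial 2 ph x) =
   bdry_int vs (%e x. (g e x - P x <.> tng e) * ph x)"
  using has_tan_traceD[OF v(3) ph] green_product[OF P ph] by linarith
qed

end

abbreviation nsq :: "'a::euclidean_space set => ('a => 'b::real_normed_vector) => real" where
 "nsq D f == (LINT x|leb D. (norm (f x))^2)"

abbreviation rsq :: "'a::euclidean_space set => ('a => real) => real" where
 "rsq D f == (LINT x|leb D. (f x)^2)"

section \<open>Polynomial potentials and the Euler operator\<close>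

lemma partial_coord: "partial i (%x::point. x $ j - a) x = axis i 1 $ j" proof -
 have "((%x::point. x $ j - a) has_derivative (%h. h $ j - 0)) (at x)"
  by (intro has_derivative_diff has_derivative_const bounded_linear_imp_has_derivative bounded_linear_vec_nth)
 hence "((%x::point. x $ j - a) has_derivative (%h. h $ j)) (at x)" by simp
 from frechet_derivative_at[OF this] show ?thesis unfolding partial_def by metis
qed

lemma partial_add_C1:
 assumes "C1_fun p" "C1_fun q" shows "partial i (%x. p x + q x) = (%x. partial i p x + partial i q x)" proof
 fix x
 have "p differentiable (at x)" "q differentiable (at x)" using assms by (simp_all add: C1_fun_def)
 from partial_lin[OF this, of i 1 1] show "partial i (%x. p x + q x) x = partial i p x + partial i q x" by simp
qed

lemma partial_smult_C1:
 assumes "C1_fun p" shows "partial i (%x. a * p x) = (%x. a * partial i p x)" proof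
 fix x
 have "p differentiable (at x)" using assms by (simp add: C1_fun_def)
 from partial_lin[OF this this, of i a 0] show "partial i (%x. a * p x) x = a * partial i p x" by simp
qed

lemma partial_const [simp]: "partial i (%x. c) x = 0"
 using frechet_derivative_at[OF has_derivative_const[of c "at x"]] unfolding partial_def by metis

lemma partial_mon:
 "partial 1 (%x. mon x (i, j)) = (%x. real i * mon x (i - 1, j))"
 "partial 2 (%x. mon x (i, j)) = (%x. real j * mon x (i, j - 1))" proof -
 have "((%x. mon x (i, j)) has_derivative (%h. real i * mon x (i - 1, j) * h $ 1 + real j * mon x (i, j - 1) * h $ 2)) (at x)" for x
  unfolding mon_def
  by (rule derivative_eq_intros bounded_linear_imp_has_derivative bounded_linear_vec_nth refl)+ (simp add: fun_eq_iff algebra_simps)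
 note partial_eq[OF this]
 thus "partial 1 (%x. mon x (i, j)) = (%x. real i * mon x (i - 1, j))"
  "partial 2 (%x. mon x (i, j)) = (%x. real j * mon x (i, j - 1))" by (auto simp only: fun_eq_iff)
qed

lemma mon_C1: "C1_fun (%x. mon x k)"
 by (rule Pol_C1[OF Pol_mon[of k "int (fst k + snd k)"]]) (simp add: idx_def split_beta)

lemma Pol_partial_commute:
 "p : Pol m ==> partial 1 (partial 2 p) = partial 2 (partial 1 p)" proof (induction rule: Pol_induct)
 case zero
 have "partial i (%x::point. 0::real) = (%x. 0)" for i by (simp add: fun_eq_iff)
 thus ?case by simp
next
 case (add p q)
 thus ?case by (simp add: partial_add_C1 Pol_C1[OF add(1)] Pol_C1[OF add(2)]
   partial_add_C1[OF Pol_C1[OF Pol_partial[OF add(1)]] Pol_C1[OF Pol_partial[OF add(2)]]])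
next
 case (mono a k)
 obtain i j where k: "k = (i, j)" by (cases k)
 show ?case unfolding k by (simp add: partial_smult_C1 mon_C1 partial_mon mult.assoc[symmetric]) (simp add: mult_ac)
qed

lemma Pol_antiderivative:
 "p : Pol m ==> EX q:Pol (m + 1). partial 1 q = p" proof (induction rule: Pol_induct)
 case zero
 show ?case by (rule bexI[of _ "%x. 0"]) (auto simp: fun_eq_iff)
next
 case (add p q)
 then obtain p' q' where *: "p' : Pol (m + 1)" "partial 1 p' = p" "q' : Pol (m + 1)" "partial 1 q' = q" by blast
 have "partial 1 (%x. p' x + q' x) = (%x. p x + q x)"
  using partial_add_C1[OF Pol_C1[OF *(1)] Pol_C1[OF *(3)], of 1] by (simp only: *)
 thus ?case using Pol_add[OF *(1,3)] by blast
next
 case (mono a k)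
 obtain i j where k: "k = (i, j)" by (cases k)
 have "(%x. mon x (Suc i, j)) : Pol (m + 1)" by (rule Pol_mon) (use mono in \<open>simp add: idx_def k\<close>)
 hence "(%x. (a / real (Suc i)) * mon x (Suc i, j)) : Pol (m + 1)" by (rule Pol_smult)
 moreover have "partial 1 (%x. (a / real (Suc i)) * mon x (Suc i, j)) = (%x. a * mon x k)"
  unfolding partial_smult_C1[OF mon_C1] partial_mon k by (simp add: fun_eq_iff)
 ultimately show ?case by blast
qed

lemma Pol_zero_on_ball:
 assumes "p : Pol m" "e > 0" "!!x. x : ball z e ==> p x = 0" shows "p = (%x. 0)" proof -
 obtain c where c: "p = (%x. SUM k:idx m. c k * mon x k)" using assms(1) unfolding Pol_iff by blast
 have "c k = 0" if "k : idx m" for k by (rule Pol_vanish[OF assms(2) _ that, of z]) (use assms(3) c in simp)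
 thus ?thesis unfolding c by simp
qed

lemma grad_nth [simp]: "grad q x $ i = partial i q x" by (simp add: grad_def)

lemma C1_along_line:
 assumes "C1_fun q" shows "((%s. q (z + s *R a)) has_real_derivative (grad q (z + s *R a) <.> a)) (at s)"
 using C1_line[OF assms, of z a s] by (simp add: inner_point)

text \<open>Integrating the first component in the first variable leaves a defect in the second
  component. It does not depend on the first variable, because the rotation vanishes, so it is
  integrated in the second variable alone.\<close>

lemma Pol_potential:
 assumes w: "w : Pol_vec (int k)" and r: "!!x. rotp w x = 0" shows "EX q:Pol (int k + 1). ALL x. grad q x = w x" proof -
 have wP: "(%x. w x $ i) : Pol (int k)" for i using w by (simp add: Pol_vec_def)
 obtain q0 where q0: "q0 : Pol (int k + 1)" "partial 1 q0 = (%x. w x $ 1)"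
  using Pol_antiderivative[OF wP[of 1]] by blast
 define g where "g x = w x $ 2 - partial 2 q0 x" for x
 have p2: "partial 2 q0 : Pol (int k)" using Pol_partial[OF q0(1), of 2] by simp
 have gP: "g : Pol (int k)" unfolding g_def[abs_def] by (intro Pol_diff wP p2)
 have "partial 1 g x = 0" for x proof -
  have "partial 1 g x = partial 1 (%x. w x $ 2) x - partial 1 (partial 2 q0) x"
   using C1_diff(2)[OF Pol_C1[OF wP[of 2]] Pol_C1[OF p2], of 1 x] by (simp add: g_def[abs_def])
  also have "partial 1 (partial 2 q0) x = partial 2 (%x. w x $ 1) x" unfolding Pol_partial_commute[OF q0(1)] q0(2) ..
  finally show ?thesis using r[of x] by (simp add: rotp_def)
 qed
 hence "((%s. g (z + s *R axis 1 1)) has_real_derivative 0) (at s)" for z s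
  using C1_line[OF Pol_C1[OF gP], of z "axis 1 1" s] by (simp add: axis_def)
 hence gc: "g (z + s *R axis 1 1) = g z" for z s using DERIV_isconst_all[of "%s. g (z + s *R axis 1 1)" s 0] by simp
 obtain c where c: "!!t. g (0 + t *R axis 2 1) = (SUM j<=k. c j * t ^ j)" using Pol_line[OF gP] by blast
 have gx: "g x = (SUM j<=k. c j * mon x (0, j))" for x proof -
  have "x = (0 + (x $ 2) *R axis 2 1) + (x $ 1) *R axis 1 1" by (simp add: vec_eq_iff forall_2 axis_def)
  hence "g x = g (0 + (x $ 2) *R axis 2 1)" using gc by metis
  thus ?thesis unfolding c by (simp add: mon_def)
 qed
 define q1 where "q1 x = (SUM j<=k. (c j / real (Suc j)) * mon x (0, Suc j))" for x
 have q1P: "q1 : Pol (int k + 1)" unfolding q1_def[abs_def] by (intro Pol_sum Pol_smult Pol_mon) (auto simp: idx_def)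
 have dm: "(%x. mon x (0, Suc j)) differentiable (at x)" for j x using mon_C1 by (simp add: C1_fun_def)
 have q1p: "partial 1 q1 x = 0" "partial 2 q1 x = g x" for x unfolding q1_def[abs_def] gx
  by (subst partial_sum[OF _ dm]; simp add: partial_mon)+
 have "(%x. q0 x + q1 x) : Pol (int k + 1)" using q0(1) q1P by (rule Pol_add)
 moreover have "grad (%x. q0 x + q1 x) x = w x" for x
  unfolding vec_eq_iff forall_2 grad_nth partial_add_C1[OF Pol_C1[OF q0(1)] Pol_C1[OF q1P]]
  using q0(2) q1p by (simp add: g_def)
 ultimately show ?thesis by blast
qed

text \<open>The divergence of \<open>p x *R (x - z)\<close> and, after a quarter turn, the rotation
  of \<open>rfield z p\<close>.\<close>

definition euler :: "point => (point => real) => point => real" where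
 "euler z p x = 2 * p x + (x - z) <.> grad p x"

definition rfield :: "point => (point => real) => point => point" where
 "rfield z s x = s x *R rotl (x - z)"

lemma rfield_nth: "rfield z s x $ 1 = - 1 * (s x * (x $ 2 - z $ 2))" "rfield z s x $ 2 = s x * (x $ 1 - z $ 1)"
 by (simp_all add: rfield_def algebra_simps)

lemma rfield_inner: "rfield z s x <.> (x - z) = 0" "(x - z) <.> rfield z s x = 0"
 by (simp_all add: inner_point rfield_nth algebra_simps)

lemma rfield_norm: "norm (rfield z s x) = \<bar>s x\<bar> * norm (x - z)" by (simp add: rfield_def)

lemma coord_Pol: "(%x. x $ i - a) : Pol 1" by (intro Pol_diff Pol_coord Pol_const) simp

lemma rfield_Pol:
 assumes "s : Pol m" shows "(%x. rfield z s x $ i) : Pol (m + 1)" proof -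
 have "(%x. s x * (x $ j - a)) : Pol (m + 1)" for j a by (intro Pol_mult assms coord_Pol)
 from Pol_smult[OF this, of "- 1"] this have "(%x. rfield z s x $ 1) : Pol (m + 1)" "(%x. rfield z s x $ 2) : Pol (m + 1)"
  unfolding rfield_nth by blast+
 thus ?thesis using exhaust_2[of i] by metis
qed

lemma rfield_C1: "C1_fun s ==> C1_fun (%x. rfield z s x $ i)" and rotp_rfield: "C1_fun s ==> rotp (rfield z s) x = euler z s x"
proof -
 assume s: "C1_fun s"
 have c: "C1_fun (%x. x $ j - a)" for j and a :: real by (rule Pol_C1[OF coord_Pol])
 have m: "C1_fun (%x. s x * (x $ j - a))" for j a by (rule C1_mult[OF s c])
 have "C1_fun (%x. - 1 * (s x * (x $ 2 - z $ 2)))" using C1_mult[OF Pol_C1[OF Pol_const[of 0 "- 1"]] m] by simp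
 hence "C1_fun (%x. rfield z s x $ 1)" "C1_fun (%x. rfield z s x $ 2)" unfolding rfield_nth using m by blast+
 thus "C1_fun (%x. rfield z s x $ i)" using exhaust_2[of i] by metis
 have d: "s differentiable (at x)" "(%x. x $ j - a) differentiable (at x)" for j and a :: real
  using s c by (simp_all add: C1_fun_def)
 have "partial 1 (%x. s x * (x $ 1 - z $ 1)) x = s x + partial 1 s x * (x $ 1 - z $ 1)"
  "partial 2 (%x. s x * (x $ 2 - z $ 2)) x = s x + partial 2 s x * (x $ 2 - z $ 2)"
  unfolding partial_mult[OF d] by (simp_all add: partial_coord axis_def)
 thus "rotp (rfield z s) x = euler z s x"
  unfolding rotp_def rfield_nth partial_smult_C1[OF m] by (simp add: euler_def inner_point)
qed

lemma euler_Pol: "p : Pol m ==> euler z p : Pol m" proof -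
 assume p: "p : Pol m"
 have "(%x. (x $ i - z $ i) * partial i p x) : Pol (1 + (m - 1))" for i by (intro Pol_mult coord_Pol Pol_partial p)
 hence "(%x. 2 * p x + ((x $ 1 - z $ 1) * partial 1 p x + (x $ 2 - z $ 2) * partial 2 p x)) : Pol m"
  by (intro Pol_add Pol_smult p) simp_all
 thus ?thesis by (simp add: euler_def[abs_def] inner_point)
qed

lemma euler_lin:
 assumes "C1_fun p" "C1_fun q" shows "euler z (%x. a * p x + q x) x = a * euler z p x + euler z q x" proof -
 have d: "p differentiable (at x)" "q differentiable (at x)" using assms by (simp_all add: C1_fun_def)
 have "partial i (%x. a * p x + q x) x = a * partial i p x + partial i q x" for i
  using partial_lin[OF d, of i a 1] by simp
 thus ?thesis by (simp add: euler_def inner_point algebra_simps)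
qed

text \<open>Along a ray from \<open>z\<close> the Euler operator is \<open>t\<^sup>-\<^sup>1 d/dt (t\<^sup>2 p)\<close>.\<close>

lemma euler_injective:
 assumes p: "C1_fun p" and z: "!!x. euler z p x = 0" shows "p x = 0" proof -
 define g where "g t = t^2 * p (z + t *R (x - z))" for t
 have "(g has_real_derivative 0) (at t)" for t proof -
  have "(g has_real_derivative (2 * t * p (z + t *R (x - z)) + t^2 * (grad p (z + t *R (x - z)) <.> (x - z)))) (at t)"
   unfolding g_def by (auto intro!: derivative_eq_intros C1_along_line[OF p])
  moreover have "2 * t * p (z + t *R (x - z)) + t^2 * (grad p (z + t *R (x - z)) <.> (x - z)) = t * euler z p (z + t *R (x - z))"
   by (simp add: euler_def inner_commute power2_eq_square algebra_simps)
  ultimately show ?thesis using z by simp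
 qed
 hence "g 1 = g 0" by (intro DERIV_isconst_all) blast
 thus ?thesis by (simp add: g_def)
qed

lemma Pol_linear_sum:
 fixes L :: "(point => real) => real"
 assumes L: "!!a p q. p : Pol m ==> q : Pol m ==> L (%x. a * p x + q x) = a * L p + L q"
  and A: "finite A" "A <= idx m" shows "L (%x. SUM k:A. c k * mon x k) = (SUM k:A. c k * L (%x. mon x k))" using A
proof (induction A rule: finite_induct)
 case empty
 have "L (%x. 1 * (%x. 0) x + (%x. 0) x) = 1 * L (%x. 0) + L (%x. 0)" by (rule L) simp_all
 thus ?case by simp
next
 case (insert k A)
 have "L (%x. c k * mon x k + (SUM k:A. c k * mon x k)) = c k * L (%x. mon x k) + L (%x. SUM k:A. c k * mon x k)"
  by (rule L) (use insert(4) in \<open>auto intro!: Pol_mon Pol_sum Pol_smult\<close>)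
 thus ?case using insert by simp
qed

text \<open>Representation of a functional by a semidefinite form on polynomials, written in
  monomial coefficients so that \<open>psd_solve\<close> applies. Both the boundary part and the
  interior part of the projection are obtained from it.\<close>

lemma Pol_riesz:
 fixes B :: "(point => real) => (point => real) => real"
 assumes L: "!!a p q. p : Pol m ==> q : Pol m ==> L (%x. a * p x + q x) = a * L p + L q"
  and B: "!!a p q r. p : Pol m ==> q : Pol m ==> r : Pol m ==> B (%x. a * p x + q x) r = a * B p r + B q r"
  and sym: "!!p q. B p q = B q p"
  and psd: "!!p. p : Pol m ==> 0 <= B p p"
  and ker: "!!p. p : Pol m ==> B p p = 0 ==> L p = 0" shows "EX q:Pol m. ALL p:Pol m. B q p = L p" proof -
 let ?S = "%c x. SUM k:idx m. c k * mon x k"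
 define M where "M i j = B (%x. mon x i) (%x. mon x j)" for i j
 have S: "?S c : Pol m" for c using Pol_iff by blast
 have Ls: "L (?S c) = (SUM k:idx m. c k * L (%x. mon x k))" for c by (rule Pol_linear_sum[OF L]) auto
 have Bs: "B (?S c) r = (SUM k:idx m. c k * B (%x. mon x k) r)" if "r : Pol m" for c r
  by (rule Pol_linear_sum[of m "%p. B p r"]) (use B that in auto)
 have Bm: "B (?S a) (%x. mon x j) = (SUM i:idx m. M j i * a i)" if "j : idx m" for a j
  unfolding Bs[OF Pol_mon[OF that]] M_def using sym by (simp add: mult.commute)
 have Bq: "B (?S a) (?S b) = qf (idx m) M a b" for a b unfolding Bs[OF S] qf_def proof (rule sum.cong[OF refl])
  fix i assume i: "i : idx m"
  have "B (%x. mon x i) (?S b) = (SUM j:idx m. M i j * b j)" using Bm[OF i, of b] sym by simp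
  thus "a i * B (%x. mon x i) (?S b) = (SUM j:idx m. a i * b j * M i j)" by (simp add: sum_distrib_left algebra_simps)
 qed
 have "EX b. ALL i:idx m. (SUM j:idx m. M i j * b j) = L (%x. mon x i)" proof (rule psd_solve)
  show "ALL i:idx m. ALL j:idx m. M i j = M j i" unfolding M_def using sym by blast
  show "ALL a. 0 <= qf (idx m) M a a" unfolding Bq[symmetric] using psd S by blast
  show "ALL a. qf (idx m) M a a = 0 --> (SUM i:idx m. a i * L (%x. mon x i)) = 0"
   unfolding Bq[symmetric] Ls[symmetric] using ker S by blast
 qed simp
 then obtain b where b: "!!i. i : idx m ==> (SUM j:idx m. M i j * b j) = L (%x. mon x i)" by blast
 have "B (?S b) p = L p" if "p : Pol m" for p proof -
  obtain c where c: "p = ?S c" using \<open>p : Pol m\<close> unfolding Pol_iff by (elim exE) (rule that)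
  have "B (?S b) (?S c) = B (?S c) (?S b)" by (rule sym)
  also have "... = (SUM k:idx m. c k * B (?S b) (%x. mon x k))" unfolding Bs[OF S] using sym by simp
  also have "... = L (?S c)" unfolding Ls using Bm b by simp
  finally show ?thesis unfolding c .
 qed
 thus ?thesis using S by blast
qed

lemma integral_le_measure:
 fixes f :: "'a::euclidean_space => real"
 assumes "compact S" "integrable (leb S) f" "!!x. x : S ==> f x <= B"
 shows "(LINT x|leb S. f x) <= B * measure lebesgue S" proof -
 have S: "S : sets lebesgue" using assms(1) by (rule compact_leb)
 have "(LINT x|leb S. f x) <= (LINT x|leb S. B)"
  using assms int_cont[OF assms(1) continuous_on_const, of B] by (intro integral_mono) auto
 also have "... = B * measure lebesgue S" using S by (simp add: measure_restrict_space)
 finally show ?thesis .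
qed

lemma integral_subset_mono:
 fixes f :: "'a::euclidean_space => real"
 assumes "compact T" "compact S" "S <= T" "continuous_on T f" "!!x. x : T ==> 0 <= f x"
 shows "(LINT x|leb S. f x) <= (LINT x|leb T. f x)" proof -
 have S: "S : sets lebesgue" "T : sets lebesgue" using assms(1,2) compact_leb by auto
 have i: "integrable (leb T) f" "integrable (leb S) f"
  using assms int_cont continuous_on_subset[OF assms(4,3)] by blast+
 have "integrable lebesgue (%x. indicator S x *R f x)" "integrable lebesgue (%x. indicator T x *R f x)"
  using i S by (simp_all add: integrable_restrict_space)
 hence "(LINT x|lebesgue. indicator S x *R f x) <= (LINT x|lebesgue. indicator T x *R f x)"
  using assms(3,5) by (intro integral_mono) (auto simp: indicator_def)
 thus ?thesis using S by (simp add: integral_restrict_space)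
qed

text \<open>Joint constants for polynomials in one variable. \<open>S\<close> may exceed
  \<open>1\<close> since \<open>tc\<close> can take values up to \<open>1 / rho\<close> on the
  polygon; the middle half serves weights that vanish at the vertices, the full interval serves edge
  integrals.\<close>

definition uni_est :: "real => nat => real => bool" where
 "uni_est S n C <-> (ALL c::nat=>real.
  (ALL t. \<bar>t\<bar> <= S --> (SUM j<=n. c j * t ^ j)^2 <= C * (SUM j<=n. (c j)^2)) &
  (SUM j<=n. (c j)^2) <= C * (LINT t|leb {1/4..3/4}. (SUM j<=n. c j * t ^ j)^2) &
  (SUM j<=n. (c j)^2) <= C * (LINT t|leb {0..1}. (SUM j<=n. c j * t ^ j)^2))"

lemma univariate_bound:
 assumes "S >= 1" shows "EX C>0. uni_est S n C" proof -
 obtain C where C: "C > 0" "!!c::nat=>real. (SUM j<=n. (c j)^2) <= C * (LINT t|leb {1/4..3/4}. (SUM j<=n. c j * t ^ j)^2)"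
  using univariate_coefficient_bound[of n] by blast
 define K where "K = max C (real (card {..n}) * (S ^ n)^2)"
 have K: "K > 0" "C <= K" using C(1) by (auto simp: K_def)
 have "(SUM j<=n. c j * t ^ j)^2 <= K * (SUM j<=n. (c j)^2)" if "\<bar>t\<bar> <= S" for c t proof -
  have "\<bar>t ^ j\<bar> <= S ^ n" if "j <= n" for j proof -
   have "\<bar>t\<bar> ^ j <= S ^ j" using \<open>\<bar>t\<bar> <= S\<close> by (intro power_mono) auto
   also have "... <= S ^ n" using assms that by (rule power_increasing[rotated])
   finally show ?thesis by (simp add: power_abs)
  qed
  hence "(SUM j<=n. c j * t ^ j)^2 <= (SUM j<=n. (c j)^2) * (real (card {..n}) * (S ^ n)^2)"
   by (intro sum_mult_sq_le) simp
  also have "... <= (SUM j<=n. (c j)^2) * K" by (intro mult_left_mono sum_nonneg) (auto simp: K_def)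
  finally show ?thesis by (simp add: mult.commute)
 qed
 moreover have "(SUM j<=n. (c j)^2) <= K * (LINT t|leb {1/4..3/4}. (SUM j<=n. c j * t ^ j)^2)" (is "_ <= _ * ?I c") for c
 proof -
  have "0 <= ?I c" by (rule integral_nonneg_AE) simp
  hence "C * ?I c <= K * ?I c" using K(2) by (rule mult_right_mono[rotated])
  thus ?thesis using C(2)[of c] by linarith
 qed
 moreover have "?I c <= (LINT t|leb {0..1}. (SUM j<=n. c j * t ^ j)^2)" for c
  by (rule integral_subset_mono) (auto intro!: continuous_intros)
 hence "K * ?I c <= K * (LINT t|leb {0..1}. (SUM j<=n. c j * t ^ j)^2)" for c using K(1) by (intro mult_left_mono) auto
 ultimately show ?thesis unfolding uni_est_def using K(1) by (intro exI[of _ K]) (fastforce intro: order_trans)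
qed

lemma unit_interval_monomial: "(LINT t|leb {0..1}. t ^ j) = 1 / real (Suc j)" proof -
 have "((%t::real. t ^ j) has_integral (1 ^ Suc j / real (Suc j) - 0 ^ Suc j / real (Suc j))) {0..1}"
 proof (rule fundamental_theorem_of_calculus)
  show "((%t. t ^ Suc j / real (Suc j)) has_vector_derivative t ^ j) (at t within {0..1})" for t :: real
   using DERIV_cdivide[OF DERIV_pow[of "Suc j" t "{0..1}"], of "real (Suc j)"]
   by (simp flip: has_real_derivative_iff_has_vector_derivative)
 qed simp
 moreover have "integrable (leb {0..1}) (%t::real. t ^ j)" by (intro int_cont continuous_intros) simp
 ultimately show ?thesis using lebesgue_integral_eq_integral[of "{0..1}" "%t::real. t ^ j"]
  by (simp add: integral_unique)
qed

lemma absorb_square: "0 <= V ==> 0 <= A ==> V^2 <= V * A ==> V <= A" for V A :: real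
 by (cases "V = 0") (auto simp: power2_eq_square)

lemma sum_sq_3: "(a + b + c)^2 <= 3 * (a^2 + b^2 + c^2)" for a b c :: real proof -
 have "0 <= (a - b)^2 + (b - c)^2 + (a - c)^2" by simp
 thus ?thesis by (simp add: power2_eq_square algebra_simps)
qed

section \<open>Estimates on polygons of the mesh\<close>

lemma absorb_square2: "0 <= s ==> 0 <= B ==> (a * s)^2 <= s * B ==> a^2 * s <= B" for s B a :: real
 by (cases "s = 0") (auto simp: power2_eq_square mult_ac)

lemma sum_sq_2: "(a + b)^2 <= 2 * (a^2 + b^2)" for a b :: real
 using sum_squares_ge_zero[of "a - b" 0] by (simp add: power2_eq_square algebra_simps)

lemma norm_grad: "(norm (grad p x))^2 = (partial 1 p x)^2 + (partial 2 p x)^2" by (simp add: norm_point)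

lemma grad_continuous: "C1_fun p ==> continuous_on S (grad p)" proof -
 assume p: "C1_fun p"
 have e: "grad p x = (partial 1 p x) *R axis 1 1 + (partial 2 p x) *R axis 2 1" for x
  by (simp add: vec_eq_iff forall_2 axis_def)
 have "continuous_on S (%x. (partial 1 p x) *R axis 1 1 + (partial 2 p x) *R axis 2 1 :: point)"
  by (intro continuous_intros C1_partial_continuous p)
 thus ?thesis by (simp flip: e)
qed

section \<open>Size of the polygon and number of its edges\<close>

context mesh_polygon
begin

abbreviation bc :: point where "bc == barycenter F"

lemma F_measurable: "F : lmeasurable" using compact_F by (rule lmeasurable_compact)

lemma F_measure_pos: "0 < measure lebesgue F" proof -
 have "0 < measure lebesgue (ball ctr (rho * h))" using content_ball_pos[OF rhoh_pos, of ctr] by simp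
 also have "... <= measure lebesgue F" by (rule measure_mono_fmeasurable[OF ball_F]) (use F_measurable in auto)
 finally show ?thesis .
qed

lemma F_measure_le: "measure lebesgue F <= pi * h^2" proof -
 have "measure lebesgue F <= measure lebesgue (cball ctr h)"
  by (rule measure_mono_fmeasurable[OF F_cball]) (use F_lebesgue in auto)
 also have "... = pi * h^2" using content_cball[of h ctr] h_pos unit_ball_vol_2 by simp
 finally show ?thesis .
qed

lemma F_integral_le:
 fixes f :: "point => real"
 assumes "continuous_on F f" "!!x. x : F ==> f x <= B" "0 <= B" shows "(LINT x|MF. f x) <= B * (pi * h^2)" proof -
 have "(LINT x|MF. f x) <= B * measure lebesgue F"
  by (rule integral_le_measure[OF compact_F int_cont[OF compact_F assms(1)] assms(2)])
 also have "... <= B * (pi * h^2)" using F_measure_le assms(3) by (rule mult_left_mono)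
 finally show ?thesis .
qed

lemma bc_ctr: "dist bc ctr <= h" proof -
 define m where "m = measure lebesgue F"
 have m: "m > 0" using F_measure_pos by (simp add: m_def)
 have ix: "integrable MF (%x::point. x)" by (intro int_cont compact_F continuous_intros)
 have ic: "integrable MF (%x::point. ctr)" by (intro int_cont compact_F continuous_intros)
 have mF: "measure MF (space MF) = m" using F_lebesgue by (simp add: m_def measure_restrict_space)
 have "(LINT x|MF. x - ctr) = (LINT x|MF. x) - m *R ctr" using ix ic mF by simp
 hence "(LINT x|MF. x - ctr) = m *R (bc - ctr)" using m by (simp add: barycenter_def m_def scaleR_diff_right)
 hence "m * dist bc ctr = norm (LINT x|MF. x - ctr)" using m by (simp add: dist_norm)
 also have "... <= (LINT x|MF. norm (x - ctr))" by (rule integral_norm_bound)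
 also have "... <= h * m" unfolding m_def proof (rule integral_le_measure[OF compact_F])
  show "integrable MF (%x. norm (x - ctr))" by (intro int_cont compact_F continuous_intros)
  show "norm (x - ctr) <= h" if "x : F" for x using dist_le_h[OF that ctr_F] by (simp add: dist_norm)
 qed
 finally show ?thesis using m by (simp add: mult.commute)
qed

lemma bc_F: "x : F ==> norm (x - bc) <= 2 * h"
 using bc_ctr dist_le_h[OF _ ctr_F, of x] dist_triangle[of x bc ctr] by (simp add: dist_norm norm_minus_commute)

lemma weighted_bound:
 assumes "x : F" "a^2 <= C / h^2 * I" shows "a^2 * (norm (x - bc))^2 <= 4 * C * I" proof -
 have "(norm (x - bc))^2 <= (2 * h)^2" using bc_F[OF assms(1)] by (intro power_mono) auto
 hence "a^2 * (norm (x - bc))^2 <= (C / h^2 * I) * (2 * h)^2"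
  using assms(2) order_trans[OF zero_le_power2 assms(2)] by (intro mult_mono) auto
 also have "... = 4 * C * I" using h_pos by (simp add: power2_eq_square)
 finally show ?thesis .
qed

lemma tangent_diff_bound:
 assumes "e : E" "a^2 <= K" "(norm X)^2 <= B" shows "(a - X <.> tng e)^2 <= 2 * (K + B)" proof -
 have "\<bar>X <.> tng e\<bar> <= norm X" using Cauchy_Schwarz_ineq2[of X "tng e"] norm_tangent[OF assms(1)] by simp
 hence "(X <.> tng e)^2 <= (norm X)^2" by (simp add: power2_le_iff_abs_le)
 thus ?thesis using sum_sq_2[of a "- (X <.> tng e)"] assms(2,3) by simp
qed

lemma edge_int_const: "edge_int e (%_. c) = elen e * c" by (simp add: edge_int_def measure_restrict_space)

text \<open>Green's formula for the rotated position field expresses twice the area as the sum of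
  edge length times distance of the centre to the edge line. Each term is at least
  \<open>(rho * h)^2\<close>, and the area is at most \<open>pi * h^2\<close>.\<close>

lemma card_E_bound: "real (card E) * rho^2 <= 2 * pi" proof -
 let ?Q = "rfield ctr (%_. 1)"
 have c: "C1_fun (%_. 1)" by (rule Pol_C1[OF Pol_const[of 0]]) simp
 have "(LINT x|MF. rotp ?Q x) = bdry_int vs (%e x. ?Q x <.> tng e)" by (rule green_polygon[OF rfield_C1[OF c]])
 moreover have "grad (%_. 1) x = (0 :: point)" for x by (simp add: vec_eq_iff)
 hence "rotp ?Q x = 2" for x unfolding rotp_rfield[OF c] by (simp add: euler_def)
 hence "(LINT x|MF. rotp ?Q x) = 2 * measure lebesgue F" using F_lebesgue by (simp add: measure_restrict_space)
 moreover have "bdry_int vs (%e x. ?Q x <.> tng e) = bdry_int vs (%e x. lin e ctr)" proof (rule bdry_int_cong)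
  fix e x assume "e : E" "x : seg e"
  hence "lin e x = 0" by (rule lin_seg)
  thus "?Q x <.> tng e = lin e ctr" by (simp add: rfield_def tangent_rotl lin_def inner_point algebra_simps)
 qed
 ultimately have "2 * measure lebesgue F = (SUM e:E. elen e * lin e ctr)" by (simp add: bdry_int_def edge_int_const)
 moreover have "(SUM e:E. (rho * h) * (rho * h)) <= (SUM e:E. elen e * lin e ctr)"
  by (intro sum_mono mult_mono elen_bounds lin_ctr) (use rhoh_pos elen_bounds(3) in \<open>auto intro: less_imp_le\<close>)
 ultimately have "real (card E) * ((rho * h) * (rho * h)) <= 2 * (pi * h^2)" using F_measure_le by simp
 hence "(real (card E) * rho^2) * h^2 <= (2 * pi) * h^2" by (simp add: power2_eq_square mult_ac)
 thus ?thesis using h_pos by simp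
qed

lemma has_tan_trace_cong:
 assumes g: "has_tan_trace vs v g" and p: "!!e. e : E ==> continuous_on UNIV (p e)"
  and eq: "!!e x. e : E ==> x : seg e ==> g e x = p e x" shows "has_tan_trace vs v p" unfolding has_tan_trace_def
proof (intro conjI ballI allI impI)
 show "L2_on {0..1} (%t. p e (el e t))" if "e : E" for e
  by (intro L2_continuous continuous_on_compose2[OF p[OF that]] continuous_intros) auto
 fix ph assume "C1_fun ph"
 moreover have "bdry_int vs (%e x. g e x * ph x) = bdry_int vs (%e x. p e x * ph x)"
  by (rule bdry_int_cong) (simp add: eq)
 ultimately show "(LINT x|MF. rot F v x * ph x) + (LINT x|MF. v x $ 2 * partial 1 ph x - v x $ 1 * partial 2 ph x) =
   bdry_int vs (%e x. p e x * ph x)" using has_tan_traceD[OF g] by simp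
qed

text \<open>Witnesses for membership in \<open>Ve\<close>, with the trace replaced on each edge by a
  polynomial on the whole plane, so that it can be treated as a continuous function.\<close>

definition ve_data :: "nat => (point => point) => (point => real) => (point => real) => (edge => point => real) => bool" where
 "ve_data k v d r p <-> L2_on F v & d : Pol (int k) & has_weak_div F v d & r : Pol (int k - 1) & has_weak_rot F v r &
  has_tan_trace vs v p & (ALL e:E. p e : Pol (int k))"

lemma Ve_data:
 assumes "v : Ve k vs" shows "EX d r p. ve_data k v d r p" proof -
 obtain d r g where *: "L2_on F v" "d : Pol (int k)" "has_weak_div F v d" "r : Pol (int k - 1)" "has_weak_rot F v r"
  "has_tan_trace vs v g" "ALL e:E. EX p:Pol (int k). ALL x:seg e. g e x = p x" using assms unfolding Ve_def by blast
 have "ALL e:E. EX p. p : Pol (int k) & (ALL x:seg e. g e x = p x)" using *(7) by blast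
 from bchoice[OF this] obtain p where p: "ALL e:E. p e : Pol (int k) & (ALL x:seg e. g e x = p e x)" by (elim exE)
 have "has_tan_trace vs v p" proof (rule has_tan_trace_cong[OF *(6)])
  show "continuous_on UNIV (p e)" if "e : E" for e using p that Pol_continuous[of "p e"] by blast
 qed (use p in blast)
 thus ?thesis unfolding ve_data_def using * p by blast
qed

lemma tc_bound: "e : E ==> x : F ==> \<bar>tc e x\<bar> <= 1 / rho" proof -
 assume e: "e : E" and x: "x : F"
 have l: "0 < elen e" "rho * h <= elen e" using elen_bounds e by auto
 have "\<bar>(snd e - fst e) <.> (x - fst e)\<bar> <= elen e * dist x (fst e)"
  using Cauchy_Schwarz_ineq2[of "snd e - fst e" "x - fst e"] by (simp add: elen_def dist_norm norm_minus_commute)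
 also have "... <= elen e * h" using dist_le_h[OF x ends_F(1)[OF e]] l by (intro mult_left_mono) auto
 finally have "\<bar>tc e x\<bar> <= elen e * h / (elen e)^2"
  unfolding tc_def abs_mult using l by (simp add: divide_right_mono)
 also have "... = h / elen e" using l by (simp add: power2_eq_square)
 also have "... <= 1 / rho" using l rho by (simp add: field_simps)
 finally show ?thesis .
qed

lemma lin_bounds: "e : E ==> x : F ==> 0 <= lin e x / h & lin e x / h <= 1"
 using outer_nml(3)[of e x] lin_dist[of e x "fst e"] lin_fst[of e] dist_le_h[of x "fst e"] ends_F(1)[of e] h_pos
 by (simp add: divide_le_eq)

lemma oth_bounds: "x : F ==> 0 <= oth e x & oth e x <= 1"
 unfolding oth_def using lin_bounds by (intro conjI prod_nonneg prod_le_1) auto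

end

section \<open>Inverse, dual and trace estimates with constants independent of the polygon\<close>

definition supb_est :: "point list => real => real => int => real => bool" where
 "supb_est vs rho R m C <->
  ((ALL p:Pol m. ALL y:region vs. ALL x. dist y x <= 2 * diameter (region vs) -->
  (p x)^2 <= C / (diameter (region vs))^2 * (LINT z|leb (cball (mesh_polygon.ctr vs rho) (R * diameter (region vs))). (p z)^2) &
  (ALL i. (partial i p x)^2 <= C / (diameter (region vs))^4 * (LINT z|leb (cball (mesh_polygon.ctr vs rho) (R * diameter (region vs))). (p z)^2))))"

text \<open>All evaluation points are within \<open>3 * h\<close> of the centre, so the scaled
  inverse estimate applies. Points outside the polygon are included because the Euler operator is
  inverted on a disk about the barycenter.\<close>

lemma poly_sup_ball:
 assumes "R > 0" shows "EX C>0. ALL vs. mesh_polygon vs rho eps --> supb_est vs rho R m C" proof -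
 obtain C where C: "C > 0" "ALL p:Pol m. ALL z. ALL h>0. ALL x:cball z (3 * h).
  (p x)^2 <= C / h^2 * (LINT y|leb (cball z (R * h)). (p y)^2) &
  (ALL i. (partial i p x)^2 <= C / h^4 * (LINT y|leb (cball z (R * h)). (p y)^2))"
  using Pol_inverse_estimate[OF assms, of m 3] by (elim exE conjE) (rule that)
 show ?thesis unfolding supb_est_def proof (intro exI[of _ C] conjI allI impI ballI C(1))
  fix vs p y x assume v: "mesh_polygon vs rho eps" and p: "p : Pol m" and y: "y : region vs" and x: "dist y x <= 2 * diameter (region vs)"
  interpret mesh_polygon vs rho eps by (rule v)
  have "dist ctr x <= 3 * h" using dist_le_h[OF ctr_F y] x dist_triangle[of ctr x y] by linarith
  hence xc: "x : cball ctr (3 * h)" by simp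
  note * = C(2)[rule_format, OF p h_pos xc]
  show "(p x)^2 <= C / h^2 * (LINT z|leb (cball ctr (R * h)). (p z)^2)" using * by blast
  show "(partial i p x)^2 <= C / h^4 * (LINT z|leb (cball ctr (R * h)). (p z)^2)" for i using * by blast
 qed
qed

definition sup_est :: "point list => int => real => bool" where
 "sup_est vs m C <->
  ((ALL p:Pol m. ALL y:region vs. ALL x. dist y x <= 2 * diameter (region vs) -->
  (p x)^2 <= C / (diameter (region vs))^2 * (rsq (region vs) p) &
  (ALL i. (partial i p x)^2 <= C / (diameter (region vs))^4 * (rsq (region vs) p))))"

lemma poly_sup:
 assumes "rho > 0" shows "EX C>0. ALL vs. mesh_polygon vs rho eps --> sup_est vs m C" proof -
 obtain C where C: "C > 0" "ALL vs. mesh_polygon vs rho eps --> supb_est vs rho rho m C"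
  using poly_sup_ball[OF assms, of rho eps m] by blast
 show ?thesis unfolding sup_est_def proof (intro exI[of _ C] conjI allI impI ballI C(1))
  fix vs p y x assume v: "mesh_polygon vs rho eps" and p: "p : Pol m" and y: "y : region vs" and x: "dist y x <= 2 * diameter (region vs)"
  interpret mesh_polygon vs rho eps by (rule v)
  note * = C(2)[rule_format, OF v, unfolded supb_est_def, rule_format, OF p y x]
  have "continuous_on F (%z. (p z)^2)" by (intro continuous_intros Pol_continuous[OF p])
  hence m: "(LINT z|leb (cball ctr (rho * h)). (p z)^2) <= (rsq F p)" (is "?a <= ?b")
   by (intro integral_subset_mono compact_F compact_cball cball_rho_F) auto
  have "C / h^2 * ?a <= C / h^2 * ?b" "C / h^4 * ?a <= C / h^4 * ?b" using C(1) by (intro mult_left_mono m; simp)+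
  thus "(p x)^2 <= C / h^2 * (rsq F p)" "(partial i p x)^2 <= C / h^4 * (rsq F p)" for i
   using * by (blast intro: order_trans)+
 qed
qed

text \<open>Testing against the polynomial times a bump function supported in the inscribed disk.\<close>

definition dual_est :: "point list => int => real => bool" where
 "dual_est vs m C <->
  ((ALL p:Pol m. ALL w. L2_on (region vs) w -->
  (ALL ph. test_fun (region vs) ph --> (LINT x|leb (region vs). p x * ph x) = (LINT x|leb (region vs). w x <.> grad ph x)) -->
  (diameter (region vs))^2 * (rsq (region vs) p) <= C * (nsq (region vs) w)))"

lemma poly_dual_bound:
 assumes "rho > 0" shows "EX C>0. ALL vs. mesh_polygon vs rho eps --> dual_est vs m C" proof -
 have r4: "rho / 4 > 0" using assms by simp
 obtain C where C: "C > 0" "ALL vs. mesh_polygon vs rho eps --> supb_est vs rho (rho / 4) m C"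
  using poly_sup_ball[OF r4, of rho eps m] by blast
 \<comment> \<open>With the bubble radius \<open>s = rho * h / 2\<close>, the two terms are
   \<open>s^8\<close> and \<open>16 * s^4\<close> freed of powers of \<open>h\<close>: they come
   from the bubble and its gradient in the product rule. \<open>c0 * h^4\<close> is the value of the
   bubble at distance \<open>s / 2\<close> from its centre.\<close>
 define K0 where "K0 = rho^8 / 256 + rho^4"
 define c0 where "c0 = 9 / 256 * rho^4"
 have K0: "K0 > 0" and c0: "c0 > 0" using assms by (simp_all add: K0_def c0_def add_pos_pos)
 define D where "D = pi * C * (4 * pi * C * K0) / c0^2"
 have D: "D > 0" using C(1) K0 c0 by (simp add: D_def)
 show ?thesis unfolding dual_est_def proof (intro exI[of _ D] conjI allI impI ballI D)
  fix vs p and w :: "point => point"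
  assume v: "mesh_polygon vs rho eps" and p: "p : Pol m" and w: "L2_on (region vs) w"
   and T: "ALL ph. test_fun (region vs) ph --> (LINT x|leb (region vs). p x * ph x) = (LINT x|leb (region vs). w x <.> grad ph x)"
  interpret mesh_polygon vs rho eps by (rule v)
  define I where "I = (LINT z|leb (cball ctr ((rho / 4) * h)). (p z)^2)"
  have I0: "I >= 0" unfolding I_def by (rule integral_nonneg_AE) simp
  have sup: "(p x)^2 <= C / h^2 * I" "(partial i p x)^2 <= C / h^4 * I" if "x : F" for x i
   using C(2)[rule_format, OF v, unfolded supb_est_def, rule_format, OF p that, of x] h_pos unfolding I_def by simp_all
  define s where "s = rho * h / 2"
  have s: "s > 0" using rhoh_pos by (simp add: s_def)
  have sub: "cball ctr s <= interior F" proof (rule order_trans)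
   show "cball ctr s <= ball ctr (rho * h)" using rhoh_pos by (auto simp: s_def)
   show "ball ctr (rho * h) <= interior F" using ball_F by (intro interior_maximal) auto
  qed
  have pC: "C1_fun p" by (rule Pol_C1[OF p])
  define ph where "ph x = bub ctr s x * p x" for x
  have tf: "test_fun F ph" unfolding ph_def[abs_def] by (rule test_fun_bub[OF s sub pC])
  have phC: "C1_fun ph" using tf by (rule test_fun_C1)
  define A where "A = (LINT x|MF. w x <.> grad ph x)"
  have bl: "c0 * h^4 <= bub ctr s x" if "x : cball ctr ((rho / 4) * h)" for x proof -
   have "norm (x - ctr) <= s / 2" using that by (simp add: s_def dist_norm norm_minus_commute)
   hence "(norm (x - ctr))^2 <= (s / 2)^2" by (intro power_mono) auto
   hence "(x - ctr) <.> (x - ctr) <= s^2 / 4" by (simp add: power2_norm_eq_inner power_divide)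
   hence "3 / 4 * s^2 <= max 0 (s^2 - (x - ctr) <.> (x - ctr))" by linarith
   hence "(3 / 4 * s^2)^2 <= bub ctr s x" unfolding bub_def by (intro power_mono) auto
   moreover have "(3 / 4 * s^2)^2 = c0 * h^4" by (simp add: s_def c0_def power2_eq_square power4_eq_xxxx)
   ultimately show ?thesis by simp
  qed
  have cp: "continuous_on S p" for S by (rule Pol_continuous[OF p])
  have cb: "continuous_on S (bub ctr s)" for S by (rule C1_continuous[OF bub_C1(1)])
  have sc: "cball ctr ((rho / 4) * h) <= F" by (rule order_trans[OF _ cball_rho_F]) (use rhoh_pos in auto)
  have "c0 * h^4 * I = (LINT x|leb (cball ctr ((rho / 4) * h)). c0 * h^4 * (p x)^2)" by (simp add: I_def)
  also have "... <= (LINT x|leb (cball ctr ((rho / 4) * h)). bub ctr s x * (p x)^2)"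
   by (intro integral_mono int_cont compact_cball continuous_intros cp cb mult_right_mono bl) auto
  also have "... <= (LINT x|MF. bub ctr s x * (p x)^2)"
   by (intro integral_subset_mono compact_F compact_cball sc continuous_intros cp cb) (simp add: bub_def)
  also have "... = (LINT x|MF. p x * ph x)" by (simp add: ph_def power2_eq_square mult_ac)
  also have "... = A" unfolding A_def using T tf by blast
  finally have low: "c0 * h^4 * I <= A" .
  have gb: "(norm (grad ph x))^2 <= 4 * C * K0 * h^4 * I" if x: "x : F" for x proof -
   have d: "bub ctr s differentiable (at x)" "p differentiable (at x)" using pC bub_C1(1) by (simp_all add: C1_fun_def)
   have M: "0 <= max 0 (s^2 - (x - ctr) <.> (x - ctr))" "max 0 (s^2 - (x - ctr) <.> (x - ctr)) <= s^2" by auto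
   have b1: "(bub ctr s x)^2 <= (s^4)^2" proof (rule power_mono)
   have "bub ctr s x <= (s^2)^2" unfolding bub_def by (rule power_mono[OF M(2,1)])
   thus "bub ctr s x <= s^4" by simp
   qed (simp add: bub_def)
   have b2: "(partial i (bub ctr s) x)^2 <= (4 * s^2 * h)^2" for i proof -
   have "\<bar>(x - ctr) $ i\<bar> <= h" using component_le_norm_cart[of "x - ctr" i] dist_le_h[OF x ctr_F] by (simp add: dist_norm)
   hence "\<bar>partial i (bub ctr s) x\<bar> <= 4 * s^2 * h"
   unfolding bub_C1(2) abs_mult using M h_pos by (intro mult_mono) auto
   thus ?thesis by (rule power2_le_iff_abs_le[THEN iffD2, rotated]) (use h_pos in simp)
   qed
   have "(partial i ph x)^2 <= 2 * C * K0 * h^4 * I" for i proof -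
   have "(partial i ph x)^2 = (bub ctr s x * partial i p x + partial i (bub ctr s) x * p x)^2"
   unfolding ph_def[abs_def] partial_mult[OF d] ..
   also have "... <= 2 * ((bub ctr s x)^2 * (partial i p x)^2 + (partial i (bub ctr s) x)^2 * (p x)^2)"
   using sum_sq_2[of "bub ctr s x * partial i p x" "partial i (bub ctr s) x * p x"] by (simp add: power_mult_distrib)
   also have "... <= 2 * ((s^4)^2 * (C / h^4 * I) + (4 * s^2 * h)^2 * (C / h^2 * I))"
   by (intro mult_left_mono add_mono mult_mono b1 b2 sup x) auto
   also have "... = 2 * C * K0 * h^4 * I"
   unfolding s_def K0_def using h_pos by (simp add: field_simps power2_eq_square power4_eq_xxxx eval_nat_numeral)
   finally show ?thesis .
   qed
   from add_mono[OF this[of 1] this[of 2]] show ?thesis unfolding norm_grad by (simp add: mult_ac)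
  qed
  have Lg: "L2_on F (grad ph)" by (intro L2_continuous compact_F grad_continuous phC)
  have W0: "0 <= (nsq F w)" by (rule integral_nonneg_AE) simp
  have "(nsq F (grad ph)) <= 4 * C * K0 * h^4 * I * (pi * h^2)"
   using C(1) K0 I0 by (intro F_integral_le gb continuous_intros grad_continuous phC) simp_all
  hence "A^2 <= (nsq F w) * (4 * C * K0 * h^4 * I * (pi * h^2))"
   unfolding A_def using L2_CS[OF w Lg] mult_left_mono[OF _ W0] by (blast intro: order_trans)
  moreover have "(c0 * h^4 * I)^2 <= A^2" using low c0 I0 by (intro power_mono) auto
  ultimately have "(c0 * h^4 * I)^2 <= I * ((nsq F w) * (4 * C * K0 * h^4 * (pi * h^2)))" by (simp add: mult_ac)
  hence "(c0 * h^4)^2 * I <= (nsq F w) * (4 * C * K0 * h^4 * (pi * h^2))"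
   by (rule absorb_square2[rotated 2]) (use I0 W0 C(1) K0 in simp_all)
  hence "h^6 * (c0^2 * (h^2 * I)) <= h^6 * ((4 * pi * C * K0) * (nsq F w))"
   by (simp add: power2_eq_square power4_eq_xxxx eval_nat_numeral mult_ac)
  hence "c0^2 * (h^2 * I) <= (4 * pi * C * K0) * (nsq F w)" using h_pos by simp
  hence hI: "h^2 * I <= (4 * pi * C * K0) * (nsq F w) / c0^2" using c0 by (simp add: field_simps)
  have "(rsq F p) <= C / h^2 * I * (pi * h^2)" using C(1) I0 by (intro F_integral_le sup continuous_intros cp) simp_all
  also have "... = (pi * C) * I" using h_pos by simp
  finally have "h^2 * (rsq F p) <= h^2 * ((pi * C) * I)" by (rule mult_left_mono) simp
  also have "... = (pi * C) * (h^2 * I)" by simp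
  also have "... <= (pi * C) * ((4 * pi * C * K0) * (nsq F w) / c0^2)" using C(1) by (intro mult_left_mono hI) simp
  also have "... = D * (nsq F w)" by (simp add: D_def)
  finally show "h^2 * (rsq F p) <= D * (nsq F w)" .
 qed
qed

text \<open>Testing the trace formula with an extension of the trace on one edge times the product of the
 distances to the other edges.\<close>

definition trace_est :: "point list => nat => real => bool" where
 "trace_est vs k C <->
  ((ALL v r p. L2_on (region vs) v & has_weak_rot (region vs) v r &
  has_tan_trace vs v p & (ALL e:edges vs. p e : Pol (int k)) --> (ALL e:edges vs. ALL t. 0 <= t & t <= 1 -->
   (diameter (region vs))^2 * (p e (el e t))^2 <=
   C * ((nsq (region vs) v) + (diameter (region vs))^2 * (rsq (region vs) r)))))"

abbreviation "meshN vs r d N == mesh_polygon vs r d & card (edges vs) = N"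

lemma trace_bound:
 assumes "rho > 0" "eps > 0" shows "EX C>0. ALL vs. meshN vs rho eps N --> trace_est vs k C" proof -
 define S where "S = max 1 (1 / rho)"
 have S: "S >= 1" by (simp add: S_def)
 obtain C1 where C1: "C1 > 0" "uni_est S k C1" using univariate_bound[OF S, of k] by blast
 define m where "m = int (N - 1) + int k"
 obtain C2 where C2: "C2 > 0" "ALL vs. mesh_polygon vs rho eps --> sup_est vs m C2"
  using poly_sup[OF assms(1), of eps m] by blast
 \<comment> \<open>This is the value of \<open>dl\<close>, named before the polygon is fixed. On the
   middle half of an edge \<open>t * (1 - t)\<close> is at least \<open>3 / 16\<close>, whence
   \<open>ka\<close>.\<close>
 define d where "d = sin eps * rho"
 define ka where "ka = (d * (3 / 16)) ^ (N - 1) / C1"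
 define B where "B = 2 * C1 * pi + 4 * C2 * C1 * pi^2"
 have B: "B > 0" using C1(1) C2(1) by (simp add: B_def add_pos_pos)
 show ?thesis proof (cases "sin eps > 0")
  \<comment> \<open>If \<open>sin eps\<close> is not positive there is no admissible
    polygon.\<close>
  case False
  hence "~ mesh_polygon vs rho eps" for vs using mesh_polygon.sin_eps_pos by blast
  thus ?thesis by (intro exI[of _ 1]) simp
 next
  case True
  have d: "d > 0" using True assms(1) by (simp add: d_def)
  have ka: "ka > 0" using d C1(1) by (simp add: ka_def)
  define D where "D = C1 * (B / (rho * ka)^2)"
  have D: "D > 0" using C1(1) B assms(1) ka by (simp add: D_def)
  show ?thesis unfolding trace_est_def proof (intro exI[of _ D] conjI allI impI ballI D)
   fix vs v r p e t
   assume vsN: "meshN vs rho eps N"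
   and H: "L2_on (region vs) v & has_weak_rot (region vs) v r & has_tan_trace vs v p & (ALL e:edges vs. p e : Pol (int k))"
   and e: "e : edges vs" and t: "0 <= t & (t::real) <= 1"
   interpret mesh_polygon vs rho eps using vsN by blast
   have v: "L2_on F v" and r: "has_weak_rot F v r" and tr: "has_tan_trace vs v p" and pP: "p e : Pol (int k)" using H e by auto
   let ?l = "el e"
   have cE: "card (E - {e}) = N - 1" using vsN e E_rel(1) by simp
   have ddl: "d = dl" by (simp add: d_def dl_def)
   obtain c where c: "!!t. p e (fst e + t *R (snd e - fst e)) = (SUM j<=k. c j * t ^ j)" using Pol_line[OF pP] by blast
   have G: "p e (?l t) = (SUM j<=k. c j * t ^ j)" for t using c[of t] by (simp add: linepath_def algebra_simps)
   define s where "s = (SUM j<=k. (c j)^2)"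
   have s0: "s >= 0" unfolding s_def by (intro sum_nonneg) simp
   \<comment> \<open>The trace on \<open>e\<close> is extended constantly along the normal and
     multiplied by the weight of the other edges, so the boundary term becomes a weighted square of
     the trace.\<close>
   define ph where "ph x = oth e x * (SUM j<=k. c j * tc e x ^ j)" for x
   have phP: "ph : Pol m" unfolding ph_def[abs_def] m_def using Pol_mult[OF oth_Pol[of e] tc_poly_Pol[where e = e and n = k and c = c]] unfolding cE .
   have phC: "C1_fun ph" by (rule Pol_C1[OF phP])
   have phb: "(ph x)^2 <= C1 * s" if x: "x : F" for x proof -
   have "(oth e x)^2 <= 1" using oth_bounds[OF x, of e] by (simp add: power_le_one)
   moreover have "(SUM j<=k. c j * tc e x ^ j)^2 <= C1 * s"
   using C1(2)[unfolded uni_est_def] tc_bound[OF e x] unfolding s_def S_def by (simp add: max.coboundedI2)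
   ultimately have "(oth e x)^2 * (SUM j<=k. c j * tc e x ^ j)^2 <= 1 * (C1 * s)" by (intro mult_mono) auto
   thus ?thesis by (simp add: ph_def power_mult_distrib)
   qed
   have cph: "continuous_on A ph" for A by (rule C1_continuous[OF phC])
   have iph: "(rsq F ph) <= C1 * s * (pi * h^2)" using C1(1) s0 by (intro F_integral_le phb continuous_intros cph) auto
   have gb: "(norm (grad ph x))^2 <= 2 * C2 * C1 * pi * s / h^2" if x: "x : F" for x proof -
   have "(partial i ph x)^2 <= C2 * C1 * pi * s / h^2" for i proof -
   have "(partial i ph x)^2 <= C2 / h^4 * (rsq F ph)"
   using C2(2)[rule_format, OF conjunct1[OF vsN], unfolded sup_est_def, rule_format, OF phP x, of x] h_pos by simp
   also have "... <= C2 / h^4 * (C1 * s * (pi * h^2))" using C2(1) by (intro mult_left_mono iph) simp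
   also have "... = C2 * C1 * pi * s / h^2" using h_pos by (simp add: power2_eq_square power4_eq_xxxx)
   finally show ?thesis .
   qed
   from add_mono[OF this[of 1] this[of 2]] show ?thesis unfolding norm_grad by (simp add: mult_ac)
   qed
   have ig: "(nsq F (grad ph)) <= 2 * C2 * C1 * pi * s / h^2 * (pi * h^2)"
   using C1(1) C2(1) s0 by (intro F_integral_le gb continuous_intros grad_continuous phC) auto
   define V where "V = (nsq F v)"
   define R where "R = (rsq F r)"
   have VR: "V >= 0" "R >= 0" unfolding V_def R_def by (rule integral_nonneg_AE; simp)+
   define a1 where "a1 = (LINT x|MF. r x * ph x)"
   define a2 where "a2 = (LINT x|MF. v x $ 2 * partial 1 ph x - v x $ 1 * partial 2 ph x)"
   have Lr: "L2_on F r" using r by (simp add: has_weak_rot_def)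
   have "a1^2 <= R * (rsq F ph)" using L2_CS[OF Lr L2_continuous[OF compact_F cph]] by (simp add: a1_def R_def)
   also have "... <= R * (C1 * s * (pi * h^2))" by (intro mult_left_mono iph VR)
   finally have a1: "a1^2 <= R * (C1 * s * (pi * h^2))" .
   have crot: "continuous_on F (%x. - rotl (grad ph x))" proof -
   have "rotl (grad ph x) = (- partial 2 ph x) *R axis 1 1 + partial 1 ph x *R axis 2 1" for x
   by (simp add: vec_eq_iff forall_2 axis_def)
   moreover have "continuous_on F (%x. - ((- partial 2 ph x) *R axis 1 1 + partial 1 ph x *R axis 2 1) :: point)"
   by (intro continuous_intros C1_partial_continuous phC)
   ultimately show ?thesis by simp
   qed
   have "a2 = - (LINT x|MF. v x <.> (- rotl (grad ph x)))"
   unfolding a2_def by (simp add: inner_point flip: Bochner_Integration.integral_minus)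
   hence "a2^2 <= V * (LINT x|MF. (norm (- rotl (grad ph x)))^2)"
   using L2_CS[OF v L2_continuous[OF compact_F crot]] by (simp add: V_def)
   also have "... <= V * (2 * C2 * C1 * pi * s / h^2 * (pi * h^2))" using ig by (simp add: VR mult_left_mono)
   finally have a2: "a2^2 <= V * (2 * C2 * C1 * pi * s / h^2 * (pi * h^2))" .
   have "a1 + a2 = bdry_int vs (%e x. p e x * ph x)"
   unfolding a1_def a2_def rot_integral[OF r cph, symmetric] by (rule has_tan_traceD[OF tr phC])
   also have "... = edge_int e (%x. p e x * ph x)" proof -
   have "edge_int e' (%x. p e' x * ph x) = edge_int e' (%x. 0)" if "e' : E - {e}" for e'
   using oth_zero[of e' e] that by (intro edge_int_cong) (auto simp: ph_def)
   thus ?thesis unfolding bdry_int_def using E_rel(1) e by (subst sum.remove[of E e]) (auto simp: edge_int_const)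
   qed
   also have "... = elen e * (LINT t|leb {0..1}. oth e (?l t) * (SUM j<=k. c j * t ^ j)^2)"
   by (simp add: edge_int_def ph_def G tc_line[OF e] power2_eq_square mult_ac)
   finally have id: "a1 + a2 = elen e * (LINT t|leb {0..1}. oth e (?l t) * (SUM j<=k. c j * t ^ j)^2)" .
   have co: "continuous_on A (%t. oth e (?l t))" for A
   by (rule continuous_on_compose2[OF Pol_continuous[OF oth_Pol, of UNIV]]) (auto intro!: continuous_intros)
   have lF: "?l t : F" if "0 <= t" "t <= 1" for t using linepath_seg[OF that] seg_F[OF e] by blast
   have "ka * s <= (d * (3 / 16)) ^ (N - 1) * (LINT t|leb {1/4..3/4}. (SUM j<=k. c j * t ^ j)^2)" proof -
   have "s <= C1 * (LINT t|leb {1/4..3/4}. (SUM j<=k. c j * t ^ j)^2)" unfolding s_def using C1(2)[unfolded uni_est_def] by blast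
   hence "ka * s <= ka * (C1 * (LINT t|leb {1/4..3/4}. (SUM j<=k. c j * t ^ j)^2))"
   using ka by (intro mult_left_mono) auto
   thus ?thesis using C1(1) by (simp add: ka_def)
   qed
   also have "... = (LINT t|leb {1/4..3/4}. (d * (3 / 16)) ^ (N - 1) * (SUM j<=k. c j * t ^ j)^2)" by simp
   also have "... <= (LINT t|leb {1/4..3/4}. oth e (?l t) * (SUM j<=k. c j * t ^ j)^2)"
   proof (intro integral_mono int_cont compact_Icc continuous_intros co mult_right_mono)
   fix t :: real assume "t : space (leb {1/4..3/4})"
   hence t: "1/4 <= t" "t <= 3/4" by auto
   have "0 <= (t - 1/4) * (3/4 - t)" using t by (intro mult_nonneg_nonneg) auto
   hence "3 / 16 <= t * (1 - t)" by (simp add: field_simps)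
   hence "(d * (3 / 16)) ^ (N - 1) <= (d * (t * (1 - t))) ^ (N - 1)" using d by (intro power_mono mult_left_mono) auto
   also have "... <= oth e (?l t)" using oth_lower[OF e, of t] t unfolding cE ddl by simp
   finally show "(d * (3 / 16)) ^ (N - 1) <= oth e (?l t)" .
   qed simp
   also have "... <= (LINT t|leb {0..1}. oth e (?l t) * (SUM j<=k. c j * t ^ j)^2)"
   using oth_bounds lF by (intro integral_subset_mono compact_Icc continuous_intros co) auto
   finally have "(rho * h) * (ka * s) <= a1 + a2"
   unfolding id using elen_bounds[OF e] rhoh_pos ka s0 by (intro mult_mono) auto
   hence "((rho * h) * (ka * s))^2 <= (a1 + a2)^2" using rhoh_pos ka s0 by (intro power_mono) auto
   also have "... <= 2 * (a1^2 + a2^2)" by (rule sum_sq_2)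
   also have "... <= 2 * (R * (C1 * s * (pi * h^2)) + V * (2 * C2 * C1 * pi * s / h^2 * (pi * h^2)))"
   using a1 a2 by simp
   also have "... = s * (2 * C1 * pi * (h^2 * R) + 4 * C2 * C1 * pi^2 * V)"
   using h_pos by (simp add: power2_eq_square algebra_simps)
   also have "... <= s * (B * (V + h^2 * R))" proof (rule mult_left_mono[OF _ s0])
   have "0 <= 2 * C1 * pi * V" "0 <= 4 * C2 * C1 * pi^2 * (h^2 * R)" using C1(1) C2(1) VR by simp_all
   thus "2 * C1 * pi * (h^2 * R) + 4 * C2 * C1 * pi^2 * V <= B * (V + h^2 * R)" by (simp add: B_def algebra_simps)
   qed
   finally have "((rho * h * ka) * s)^2 <= s * (B * (V + h^2 * R))" by (simp add: mult_ac)
   \<comment> \<open>One factor \<open>s\<close>, the squared size of the trace coefficients,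
     cancels.\<close>
   hence "(rho * h * ka)^2 * s <= B * (V + h^2 * R)" by (rule absorb_square2[rotated 2]) (use s0 B VR in simp_all)
   hence "(h^2 * s) * (rho * ka)^2 <= B * (V + h^2 * R)" by (simp add: power_mult_distrib mult_ac)
   hence hs: "h^2 * s <= B * (V + h^2 * R) / (rho * ka)^2" using assms(1) ka by (simp add: pos_le_divide_eq)
   have "(p e (?l t))^2 <= C1 * s" unfolding G s_def using C1(2)[unfolded uni_est_def] t S by auto
   hence "h^2 * (p e (?l t))^2 <= h^2 * (C1 * s)" by (rule mult_left_mono) simp
   also have "... = C1 * (h^2 * s)" by simp
   also have "... <= C1 * (B * (V + h^2 * R) / (rho * ka)^2)" using C1(1) by (intro mult_left_mono hs) simp
   also have "... = D * (V + h^2 * R)" by (simp add: D_def)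
   finally show "h^2 * (p e (?l t))^2 <= D * ((nsq F v) + h^2 * (rsq F r))" unfolding V_def R_def .
  qed
 qed
qed

section \<open>Polynomials controlled by their boundary values\<close>

definition euler_est :: "point list => int => real => bool" where
 "euler_est vs m C <->
  ((ALL r:Pol m. EX s:Pol m. (ALL x. euler (barycenter (region vs)) s x = r x) &
  (ALL x:region vs. (s x)^2 <= C / (diameter (region vs))^2 * (rsq (region vs) r))))"

text \<open>The inverse is controlled by the norm on the disk of radius \<open>h\<close> about the
  barycenter, which may leave the polygon; the sup estimate brings the bound back to the
  polygon.\<close>

lemma euler_bound:
 assumes "rho > 0" shows "EX C>0. ALL vs. mesh_polygon vs rho eps --> euler_est vs m C" proof -
 obtain C1 where C1: "C1 > 0" "ALL r:Pol m. ALL z. ALL h>0. EX s:Pol m.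
  (ALL x. 2 * s x + (x - z) <.> grad s x = r x) &
  (ALL x:cball z (2 * h). (s x)^2 <= C1 / h^2 * (LINT y|leb (cball z h). (r y)^2))"
  using Pol_euler_inverse[of m 2] by (elim exE conjE) (rule that)
 obtain C2 where C2: "C2 > 0" "ALL vs. mesh_polygon vs rho eps --> sup_est vs m C2"
  using poly_sup[OF assms, of eps m] by blast
 show ?thesis unfolding euler_est_def proof (intro exI[of _ "C1 * (C2 * pi)"] conjI allI impI ballI)
  show "C1 * (C2 * pi) > 0" using C1(1) C2(1) by simp
  fix vs r assume v: "mesh_polygon vs rho eps" and r: "r : Pol m"
  interpret mesh_polygon vs rho eps by (rule v)
  obtain s where s: "s : Pol m" "ALL x. 2 * s x + (x - bc) <.> grad s x = r x"
   "ALL x:cball bc (2 * h). (s x)^2 <= C1 / h^2 * (LINT y|leb (cball bc h). (r y)^2)"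
   using C1(2)[rule_format, OF r h_pos, of bc] by blast
  have "(LINT y|leb (cball bc h). (r y)^2) <= C2 / h^2 * (rsq F r) * measure lebesgue (cball bc h)"
  proof (rule integral_le_measure[OF compact_cball])
   show "integrable (leb (cball bc h)) (%y. (r y)^2)"
   by (intro int_cont compact_cball continuous_intros Pol_continuous[OF r])
   fix y assume "y : cball bc h"
   hence "dist ctr y <= 2 * h" using bc_ctr dist_triangle[of ctr y bc] by (simp add: dist_commute)
   thus "(r y)^2 <= C2 / h^2 * (rsq F r)" using C2(2)[rule_format, OF v, unfolded sup_est_def, rule_format, OF r ctr_F] by blast
  qed
  also have "measure lebesgue (cball bc h) = pi * h^2" using content_cball[of h bc] h_pos unit_ball_vol_2 by simp
  also have "C2 / h^2 * (rsq F r) * (pi * h^2) = (C2 * pi) * (rsq F r)" using h_pos by simp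
  finally have "C1 / h^2 * (LINT y|leb (cball bc h). (r y)^2) <= C1 / h^2 * ((C2 * pi) * (rsq F r))"
   using C1(1) by (intro mult_left_mono) auto
  hence le: "C1 / h^2 * (LINT y|leb (cball bc h). (r y)^2) <= C1 * (C2 * pi) / h^2 * (rsq F r)" by simp
  have "(s x)^2 <= C1 * (C2 * pi) / h^2 * (rsq F r)" if "x : F" for x proof -
   have "x : cball bc (2 * h)" using bc_F[OF that] by (simp add: dist_norm norm_minus_commute)
   thus ?thesis using s(3) le by (blast intro: order_trans)
  qed
  thus "EX s:Pol m. (ALL x. euler bc s x = r x) & (ALL x:F. (s x)^2 <= C1 * (C2 * pi) / h^2 * (rsq F r))"
   using s(1,2) unfolding euler_def by blast
 qed
qed

definition grad_est :: "point list => int => real => bool" where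
 "grad_est vs m C <->
  ((ALL p:Pol m. ALL B>=0. (ALL x:region vs. (p x)^2 <= B) -->
  (ALL x:region vs. (norm (grad p x))^2 <= C / (diameter (region vs))^2 * B)) &
  (ALL p:Pol m. (nsq (region vs) (grad p)) <= C / (diameter (region vs))^2 * (rsq (region vs) p)))"

lemma grad_bound:
 assumes "rho > 0" shows "EX C>0. ALL vs. mesh_polygon vs rho eps --> grad_est vs m C" proof -
 obtain C2 where C2: "C2 > 0" "ALL vs. mesh_polygon vs rho eps --> sup_est vs m C2"
  using poly_sup[OF assms, of eps m] by blast
 show ?thesis unfolding grad_est_def proof (intro exI[of _ "2 * C2 * pi"] conjI allI impI ballI)
  show "2 * C2 * pi > 0" using C2(1) by simp
  fix vs p assume v: "mesh_polygon vs rho eps" and p: "p : Pol m"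
  interpret mesh_polygon vs rho eps by (rule v)
  have c: "continuous_on F p" by (rule Pol_continuous[OF p])
  have g: "(norm (grad p x))^2 <= 2 * C2 / h^4 * (rsq F p)" if x: "x : F" for x proof -
   have "(partial i p x)^2 <= C2 / h^4 * (rsq F p)" for i
   using C2(2)[rule_format, OF v, unfolded sup_est_def, rule_format, OF p x, of x] h_pos by simp
   from add_mono[OF this[of 1] this[of 2]] show ?thesis unfolding norm_grad by simp
  qed
  have i0: "0 <= (rsq F p)" by (rule integral_nonneg_AE) simp
  have "(nsq F (grad p)) <= 2 * C2 / h^4 * (rsq F p) * (pi * h^2)"
   using C2(1) i0 by (intro F_integral_le g continuous_intros grad_continuous Pol_C1[OF p]) auto
  thus "(nsq F (grad p)) <= 2 * C2 * pi / h^2 * (rsq F p)"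
   using h_pos by (simp add: power2_eq_square power4_eq_xxxx mult_ac)
  fix B x assume B: "0 <= B" "ALL x:F. (p x)^2 <= B" and x: "x : F"
  have "(rsq F p) <= B * (pi * h^2)" using B by (intro F_integral_le continuous_intros c) auto
  hence "2 * C2 / h^4 * (rsq F p) <= 2 * C2 / h^4 * (B * (pi * h^2))" using C2(1) by (intro mult_left_mono) auto
  also have "... = 2 * C2 * pi / h^2 * B" using h_pos by (simp add: power2_eq_square power4_eq_xxxx mult_ac)
  finally show "(norm (grad p x))^2 <= 2 * C2 * pi / h^2 * B" using g[OF x] by linarith
 qed
qed

section \<open>The polygon bubble and division by the edge equations\<close>

context mesh_polygon
begin

text \<open>The bubble of the polygon, a polynomial of degree equal to the number of edges.\<close>

definition bdist :: "point => real" where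
 "bdist x = (PROD e:E. lin e x / h)"

lemma bdist_Pol: "bdist : Pol (int (card E))"
 unfolding bdist_def[abs_def] by (rule Pol_prod) (use E_rel(1) lin_Pol in auto)

lemma bdist_seg: "e : E ==> lin e x = 0 ==> bdist x = 0" unfolding bdist_def using E_rel(1) by (intro prod_zero) auto

lemma bdist_bounds: "x : F ==> 0 <= bdist x & bdist x <= 1"
 unfolding bdist_def using lin_bounds by (intro conjI prod_nonneg prod_le_1) auto

lemma bdist_lower: "x : cball ctr ((rho / 2) * h) ==> (rho / 2) ^ card E <= bdist x" proof -
 assume x: "x : cball ctr ((rho / 2) * h)"
 have "(PROD e:E. rho / 2) <= bdist x" unfolding bdist_def proof (rule prod_mono)
  fix e assume e: "e : E"
  have "lin e ctr - lin e x <= (rho / 2) * h" using lin_dist[OF e, of ctr x] x by simp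
  hence "(rho / 2) * h <= lin e x" using lin_ctr[OF e] by simp
  thus "0 <= rho / 2 & rho / 2 <= lin e x / h" using h_pos rho by (simp add: pos_le_divide_eq)
 qed
 thus ?thesis by simp
qed

text \<open>Moving to the edge line along the normal is a shift of the form required by
  \<open>Pol_division\<close>.\<close>

lemma line_foot:
 assumes e: "e : E" shows "el e (tc e x) = x + ((nrm e <.> (x - fst e)) * (- 1)) *R nrm e" proof -
 define y where "y = x - fst e"
 define n where "n = nrm e"
 have n: "norm n = 1" "n <.> n = 1" using outer_nml(1)[OF e] by (simp_all add: n_def dot_square_norm)
 have nr: "n <.> rotl n = 0" by (simp add: inner_point)
 have "n <.> (y - (n <.> y) *R n) = 0" using n(2) by (simp add: inner_diff_right)
 from orthogonal_rotl(1)[OF n(1) this] have y: "y - (n <.> y) *R n = (y <.> rotl n) *R rotl n"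
  using nr by (simp add: inner_diff_left)
 have l: "elen e > 0" using elen_bounds(3)[OF e] .
 have d: "snd e - fst e = (ori * elen e) *R rotl n" using edge_tangent[OF e] by (simp add: n_def tangent_rotl)
 have "tc e x *R (snd e - fst e) = (1 / (elen e)^2 * ((ori * elen e) * (rotl n <.> y)) * (ori * elen e)) *R rotl n"
  unfolding tc_def y_def[symmetric] d by simp
 also have "1 / (elen e)^2 * ((ori * elen e) * (rotl n <.> y)) * (ori * elen e) = (ori * ori) * (rotl n <.> y)"
  using l by (simp add: power2_eq_square)
 finally have "tc e x *R (snd e - fst e) = (y <.> rotl n) *R rotl n" using ori_sq(1) by (simp add: inner_commute)
 hence "tc e x *R (snd e - fst e) = y - (n <.> y) *R n" using y by simp
 moreover have "el e (tc e x) = fst e + tc e x *R (snd e - fst e)" by (simp add: linepath_def algebra_simps)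
 ultimately show ?thesis by (simp add: y_def n_def)
qed

lemma divide_edge:
 assumes e: "e : E" and q: "q : Pol m" shows "EX q':Pol (m - 1). ALL x. q x = q (el e (tc e x)) + lin e x / h * q' x"
proof -
 obtain q0 where q0: "q0 : Pol (m - 1)" "ALL x. q x - q (el e (tc e x)) = nrm e <.> (x - fst e) * q0 x"
  using Pol_division[OF q line_foot[OF e]] by blast
 have "nrm e <.> (x - fst e) = - lin e x" for x by (simp add: lin_def inner_diff_right)
 hence "q x = q (el e (tc e x)) + lin e x / h * ((- h) * q0 x)" for x using q0(2)[rule_format, of x] h_pos by simp
 thus ?thesis by (intro bexI[of _ "%x. (- h) * q0 x"] Pol_smult q0(1)) blast
qed

lemma line_coefficients:
 assumes "q : Pol (int n)" shows "EX c. ALL t. q (el e t) = (SUM j<=n. c j * t ^ j)"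
 using Pol_line[OF assms, of "fst e" "snd e - fst e"] by (simp add: linepath_def algebra_simps)

end

definition weight_est :: "point list => int => real => bool" where
 "weight_est vs m C <->
  ((ALL s:Pol m.
  (rsq (region vs) s) <= C * (LINT x|leb (region vs). mesh_polygon.bdist vs x * (s x)^2)))"

text \<open>The weight is at least \<open>(rho / 2) ^ N\<close> on the disk of half the inscribed
  radius, and the unweighted norm on that disk already controls the norm over the polygon.\<close>

lemma weight_bound:
 assumes "rho > 0" shows "EX C>0. ALL vs. meshN vs rho eps N --> weight_est vs m C" proof -
 have r2: "rho / 2 > 0" using assms by simp
 obtain C where C: "C > 0" "ALL vs. mesh_polygon vs rho eps --> supb_est vs rho (rho / 2) m C"
  using poly_sup_ball[OF r2, of rho eps m] by blast
 define a where "a = (rho / 2) ^ N"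
 have a: "a > 0" using assms by (simp add: a_def)
 show ?thesis unfolding weight_est_def proof (intro exI[of _ "C * pi / a"] conjI allI impI ballI)
  show "C * pi / a > 0" using C(1) a by simp
  fix vs s assume vN: "meshN vs rho eps N" and s: "s : Pol m"
  hence v: "mesh_polygon vs rho eps" by blast
  interpret mesh_polygon vs rho eps by (rule v)
  let ?B = "cball ctr ((rho / 2) * h)"
  define I where "I = (LINT z|leb ?B. (s z)^2)"
  have I0: "I >= 0" unfolding I_def by (rule integral_nonneg_AE) simp
  have cs: "continuous_on S s" "continuous_on S bdist" for S using Pol_continuous s bdist_Pol by blast+
  have sub: "?B <= F" by (rule order_trans[OF _ cball_rho_F]) (use rhoh_pos in auto)
  have "(rsq F s) <= C / h^2 * I * (pi * h^2)" proof (rule F_integral_le)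
   show "(s x)^2 <= C / h^2 * I" if "x : F" for x
   using C(2)[rule_format, OF v, unfolded supb_est_def, rule_format, OF s that, of x] h_pos unfolding I_def by simp
  qed (use C(1) I0 in \<open>auto intro!: continuous_intros cs\<close>)
  also have "... = C * pi / a * (a * I)" using h_pos a by simp
  also have "a * I = (LINT x|leb ?B. a * (s x)^2)" by (simp add: I_def)
  also have "... <= (LINT x|leb ?B. bdist x * (s x)^2)" using bdist_lower vN unfolding a_def
   by (intro integral_mono int_cont compact_cball continuous_intros cs mult_right_mono) auto
  also have "... <= (LINT x|MF. bdist x * (s x)^2)"
   using bdist_bounds by (intro integral_subset_mono compact_F compact_cball sub continuous_intros cs) auto
  finally show "(rsq F s) <= C * pi / a * (LINT x|MF. bdist x * (s x)^2)" using C(1) a by (simp add: divide_right_mono)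
 qed
qed

text \<open>The factors are split off one edge after the other: each remainder is the pull back of the
 current quotient under the orthogonal projection to the line of the edge.\<close>

definition ext_est :: "point list => nat => nat => real => bool" where
 "ext_est vs k j C <->
  ((ALL q:Pol (int k). ALL K>=0.
  (ALL e:edges vs. ALL t. 0 <= t & t <= 1 --> (q (el e t))^2 <= K) -->
  (ALL A<=edges vs. card A = j --> (EX z:Pol (int k). EX q':Pol (int k - int j).
   (ALL x. q x = z x + (PROD e:A. mesh_polygon.lin vs e x / diameter (region vs)) * q' x) & (ALL x:region vs. (z x)^2 <= C * K)))))"

lemma boundary_extension:
 assumes "rho > 0" "eps > 0" shows "EX C>0. ALL vs. mesh_polygon vs rho eps --> ext_est vs k j C" proof (induction j)
 case 0
 have base: "EX z:Pol (int k). EX q':Pol (int k). (ALL x. q x = z x + q' x) & (ALL x:region vs. (z x)^2 <= 1 * K)"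
  if "q : Pol (int k)" "K >= 0" for q vs K using that by (intro bexI[of _ "%x. 0"] bexI[of _ q]) auto
 have A0: "A = {}" if "mesh_polygon vs rho eps" "A <= edges vs" "card A = 0" for vs A proof -
  interpret mesh_polygon vs rho eps by (rule that)
  show ?thesis using that(2,3) E_rel(1) by (simp add: finite_subset)
 qed
 have "EX z:Pol (int k). EX q':Pol (int k - int 0).
   (ALL x. q x = z x + (PROD e:A. mesh_polygon.lin vs e x / diameter (region vs)) * q' x) & (ALL x:region vs. (z x)^2 <= 1 * K)"
  if "mesh_polygon vs rho eps" "q : Pol (int k)" "K >= 0" "A <= edges vs" "card A = 0" for vs q K A

 proof -
  have "A = {}" by (rule A0[OF that(1,4,5)])
  thus ?thesis using base[OF that(2,3), of vs] by simp
 qed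
 thus ?case unfolding ext_est_def by (intro exI[of _ 1] conjI allI impI ballI) simp_all
next
 case (Suc j)
 obtain C where C: "C > 0" "ALL vs. mesh_polygon vs rho eps --> ext_est vs k j C" using Suc.IH by blast
 define S where "S = max 1 (1 / rho)"
 have S: "S >= 1" by (simp add: S_def)
 obtain C1 where C1: "C1 > 0" "uni_est S k C1" using univariate_bound[OF S, of k] by blast
 \<comment> \<open>\<open>a\<close> bounds the product of the \<open>j\<close> factors already split
   off from below on the middle half of the next edge; \<open>M\<close> bounds the quotient there,
   and \<open>D\<close> its extension together with the previous remainder.\<close>
 define a where "a = (sin eps * rho * (3 / 16)) ^ j"
 define M where "M = 2 * (1 + C) / a^2"
 define D where "D = 2 * (C + C1 * (C1 * M)) + 1"
 have D: "D > 0" using C(1) C1(1) by (simp add: D_def M_def add_pos_nonneg)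
 show ?case unfolding ext_est_def proof (intro exI[of _ D] conjI allI impI ballI D)
  fix vs q K A
  assume v: "mesh_polygon vs rho eps" and q: "q : Pol (int k)" and K: "K >= 0"
   and qK: "ALL e:edges vs. ALL t. 0 <= t & t <= 1 --> (q (el e t))^2 <= K"
   and A: "A <= edges vs" and cA: "card A = Suc j"
  interpret mesh_polygon vs rho eps by (rule v)
  obtain e A' where eA: "A = insert e A'" "e ~: A'" "card A' = j" using cA card_Suc_eq[of A j] by blast
  have e: "e : E" and A': "A' <= E" and fA: "finite A'" using eA A E_rel(1) finite_subset by auto
  obtain z q' where z: "z : Pol (int k)" "q' : Pol (int k - int j)"
   "ALL x. q x = z x + (PROD e:A'. lin e x / h) * q' x" "ALL x:F. (z x)^2 <= C * K"
   using C(2)[rule_format, OF v, unfolded ext_est_def, rule_format, OF q K, of A'] qK A' eA(3) by blast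
  let ?l = "el e"
  define PA where "PA x = (PROD e:A'. lin e x / h)" for x
  have PAP: "PA : Pol (int j)" unfolding PA_def[abs_def] eA(3)[symmetric] by (rule Pol_prod) (use fA lin_Pol in auto)
  have PAb: "0 <= PA x & PA x <= 1" if "x : F" for x
   unfolding PA_def using lin_bounds[OF _ that] A' by (intro conjI prod_nonneg prod_le_1) auto
  obtain q2 where q2: "q2 : Pol (int k - int j - 1)" "ALL x. q' x = q' (?l (tc e x)) + lin e x / h * q2 x"
   using divide_edge[OF e z(2)] by blast
  \<comment> \<open>The new remainder adds the quotient on the line of \<open>e\<close>, extended
    constantly along the normal; what is left of the quotient is divisible by the form of
    \<open>e\<close>.\<close>
  define z' where "z' x = z x + PA x * q' (?l (tc e x))" for x
  have "(%x. ?l (tc e x) $ i) : Pol 1" for i proof -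
   have "(%x. fst e $ i + (snd e $ i - fst e $ i) * tc e x) : Pol 1" by (intro Pol_add Pol_const Pol_smult tc_Pol) simp
   thus ?thesis by (simp add: linepath_def algebra_simps)
  qed
  hence qlP: "(%x. q' (?l (tc e x))) : Pol (int k - int j)" by (rule Pol_comp[OF z(2)])
  have "(%x. PA x * q' (?l (tc e x))) : Pol (int j + (int k - int j))" by (rule Pol_mult[OF PAP qlP])
  hence z'P: "z' : Pol (int k)" unfolding z'_def[abs_def] by (intro Pol_add z(1)) simp
  have split: "q x = z' x + (PROD e:A. lin e x / h) * q2 x" for x proof -
   have "q x = z x + PA x * (q' (?l (tc e x)) + lin e x / h * q2 x)" using z(3) q2(2) unfolding PA_def by metis
   also have "... = z' x + (lin e x / h * PA x) * q2 x" by (simp add: z'_def algebra_simps)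
   also have "lin e x / h * PA x = (PROD e:A. lin e x / h)" unfolding PA_def eA(1) using fA eA(2) by simp
   finally show ?thesis .
  qed
  have a0: "a > 0" using delta_pos by (simp add: a_def dl_def)
  have M0: "M >= 0" using C(1) by (simp add: M_def)
  have "q' : Pol (int k)" by (rule Pol_mono[OF z(2)]) simp
  then obtain c where c: "!!t. q' (?l t) = (SUM j<=k. c j * t ^ j)" using line_coefficients[of q' k e] by blast
  \<comment> \<open>In the middle of \<open>e\<close> the quotient is recovered through division by
    \<open>PA\<close>; its univariate coefficients then bound it for all parameters up to
    \<open>S\<close>.\<close>
  have mid: "(SUM j<=k. c j * t ^ j)^2 <= M * K" if t: "t : {1/4..3/4}" for t proof -
   have t': "0 <= t" "t <= 1" "1/4 <= t" "t <= 3/4" using t by auto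
   have lF: "?l t : F" using linepath_seg[OF t'(1,2)] seg_F[OF e] by blast
   have "0 <= (t - 1/4) * (3/4 - t)" using t' by (intro mult_nonneg_nonneg) auto
   hence tt: "3 / 16 <= t * (1 - t)" by (simp add: field_simps)
   have "(PROD e':A'. dl * (3 / 16)) <= PA (?l t)" unfolding PA_def proof (rule prod_mono)
   fix e' assume e': "e' : A'"
   hence e'': "e' : E" "e ~= e'" using A' eA(2) by auto
   have "dl * h * (3 / 16) <= dl * h * (t * (1 - t))" using tt delta_pos h_pos by (intro mult_left_mono) auto
   also have "... <= lin e' (?l t)" by (rule lin_on_edge[OF e e'' t'(1,2)])
   finally show "0 <= dl * (3 / 16) & dl * (3 / 16) <= lin e' (?l t) / h"
   using delta_pos h_pos by (simp add: pos_le_divide_eq mult_ac)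
   qed
   hence al: "a <= PA (?l t)" by (simp add: a_def dl_def eA(3))
   have "PA (?l t) * q' (?l t) = q (?l t) - z (?l t)" using z(3) by (simp add: PA_def)
   hence "(PA (?l t) * q' (?l t))^2 <= 2 * ((q (?l t))^2 + (z (?l t))^2)"
   using sum_sq_2[of "q (?l t)" "- z (?l t)"] by simp
   also have "... <= 2 * (K + C * K)" using qK e t' z(4) lF by (intro mult_left_mono add_mono) auto
   finally have "(PA (?l t))^2 * (q' (?l t))^2 <= 2 * (1 + C) * K" by (simp add: power_mult_distrib algebra_simps)
   moreover have "a^2 * (q' (?l t))^2 <= (PA (?l t))^2 * (q' (?l t))^2" using al a0 by (intro mult_right_mono power_mono) auto
   ultimately have "a^2 * (q' (?l t))^2 <= 2 * (1 + C) * K" by linarith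
   thus ?thesis using a0 by (simp add: M_def c pos_le_divide_eq mult_ac)
  qed
  have "(LINT t|leb {1/4..3/4}. (SUM j<=k. c j * t ^ j)^2) <= M * K * measure lebesgue {1/4..3/4::real}"
   by (intro integral_le_measure mid int_cont continuous_intros) auto
  also have "... <= M * K" using M0 K by (simp add: mult_left_le)
  finally have "C1 * (LINT t|leb {1/4..3/4}. (SUM j<=k. c j * t ^ j)^2) <= C1 * (M * K)" using C1(1) by (intro mult_left_mono) auto
  hence cb: "(SUM j<=k. (c j)^2) <= C1 * (M * K)" using C1(2)[unfolded uni_est_def] by (blast intro: order_trans)
  have "(z' x)^2 <= D * K" if x: "x : F" for x proof -
   have "\<bar>tc e x\<bar> <= S" using tc_bound[OF e x] by (simp add: S_def)
   hence "(q' (?l (tc e x)))^2 <= C1 * (SUM j<=k. (c j)^2)" unfolding c using C1(2)[unfolded uni_est_def] by blast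
   also have "... <= C1 * (C1 * (M * K))" using C1(1) by (intro mult_left_mono cb) auto
   finally have "(PA x)^2 * (q' (?l (tc e x)))^2 <= 1 * (C1 * (C1 * (M * K)))"
   using PAb[OF x] by (intro mult_mono) (auto simp: power_le_one)
   hence pq: "(PA x)^2 * (q' (?l (tc e x)))^2 <= C1 * (C1 * (M * K))" by simp
   have "(z' x)^2 <= 2 * ((z x)^2 + (PA x)^2 * (q' (?l (tc e x)))^2)"
   using sum_sq_2[of "z x" "PA x * q' (?l (tc e x))"] by (simp add: z'_def power_mult_distrib)
   also have "... <= 2 * (C * K + C1 * (C1 * (M * K)))" by (intro mult_left_mono add_mono pq) (use z(4) x in auto)
   finally have "(z' x)^2 <= 2 * (C * K + C1 * (C1 * (M * K)))" .
   also have "... <= D * K" using K by (simp add: D_def algebra_simps)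
   finally show ?thesis .
  qed
  thus "EX z:Pol (int k). EX q':Pol (int k - int (Suc j)).
   (ALL x. q x = z x + (PROD e:A. lin e x / h) * q' x) & (ALL x:F. (z x)^2 <= D * K)"
   using z'P q2(1) split by (intro bexI[of _ z'] bexI[of _ q2]) (auto simp: algebra_simps)
 qed
qed

section \<open>Potentials controlled by their tangential derivatives\<close>

context mesh_polygon
begin

lemma edge_derivative:
 assumes e: "e : E" and q: "q : Pol (int k + 1)"
  and c: "!!t. q (el e t) = (SUM j<=Suc k. c j * t ^ j)"
 shows "ori * elen e * (grad q (el e t) <.> tng e) = (SUM j<=k. (real (Suc j) * c (Suc j)) * t ^ j)" proof -
 have l: "el e t = fst e + t *R (snd e - fst e)" for t by (simp add: linepath_def algebra_simps)
 have "((%t. q (el e t)) has_real_derivative (grad q (el e t) <.> (snd e - fst e))) (at t)"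
  unfolding l by (rule C1_along_line[OF Pol_C1[OF q]])
 moreover have "((%t. q (el e t)) has_real_derivative (SUM j<=Suc k. c j * (real j * t ^ (j - Suc 0)))) (at t)"
  unfolding c by (intro DERIV_sum DERIV_cmult DERIV_pow)
 ultimately have "grad q (el e t) <.> (snd e - fst e) = (SUM j<=Suc k. c j * (real j * t ^ (j - Suc 0)))"
  by (rule DERIV_unique)
 also have "... = (SUM j<=k. (real (Suc j) * c (Suc j)) * t ^ j)" unfolding sum.atMost_Suc_shift by (simp add: mult_ac)
 finally show ?thesis unfolding edge_tangent[OF e] by simp
qed

lemma edge_int_mono:
 assumes "e : E" "continuous_on UNIV f" "continuous_on UNIV g" "!!x. x : seg e ==> f x <= g x"
 shows "edge_int e f <= edge_int e g" unfolding edge_int_def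
 using elen_bounds(3)[OF assms(1)] linepath_seg[of _ e] assms(4)
 by (intro mult_left_mono integral_mono int_cont continuous_on_compose2[OF assms(2)]
   continuous_on_compose2[OF assms(3)] continuous_intros) auto

lemma edge_int_add:
 fixes f g :: "point => real"
 assumes "continuous_on UNIV f" "continuous_on UNIV g"
 shows "edge_int e (%x. a * f x + b * g x) = a * edge_int e f + b * edge_int e g" proof -
 have "integrable (leb {0..1}) (%t. f (el e t))" "integrable (leb {0..1}) (%t. g (el e t))"
  by (intro int_cont continuous_on_compose2[OF assms(1)] continuous_on_compose2[OF assms(2)] continuous_intros; simp)+
 thus ?thesis by (simp add: edge_int_def algebra_simps)
qed

end

definition pot_est :: "point list => nat => real => bool" where
 "pot_est vs k C <->
  ((ALL q:Pol (int k + 1). ALL K>=0. ALL g.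
  (ALL e:edges vs. continuous_on UNIV (g e) & (ALL x:seg e. (g e x)^2 <= K)) &
  bdry_int vs (%e x. (g e x - grad q x <.> tangent vs e) * (grad q x <.> tangent vs e)) = 0 -->
  (ALL e:edges vs. ALL t. 0 <= t & t <= 1 --> (q (el e t) - q (hd vs))^2 <= C * ((diameter (region vs))^2 * K))))"

text \<open>The hypothesis makes the tangential derivative of \<open>q\<close> orthogonal to its
  difference from \<open>g\<close>, so its mean square is at most that of \<open>g\<close>. Norm
  equivalence in one variable turns this into increments of \<open>q\<close> along each edge, and
  walking around the boundary sums them.\<close>

lemma potential_bound:
 assumes "rho > 0" shows "EX C>0. ALL vs. meshN vs rho eps N --> pot_est vs k C" proof -
 obtain C1 where C1: "C1 > 0" "uni_est 1 k C1" using univariate_bound[OF order_refl, of k] by blast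
 \<comment> \<open>Bounds the squared increment of \<open>q\<close> along one edge;
   \<open>real N / rho\<close> comes from the mean square over the whole boundary divided by the
   least edge length.\<close>
 define D where "D = real (Suc k) * C1 * (real N / rho)"
 have D: "D >= 0" using C1(1) assms by (simp add: D_def)
 show ?thesis unfolding pot_est_def proof (intro exI[of _ "(real N + 1)^2 * D + 1"] conjI allI impI ballI)
  show "(real N + 1)^2 * D + 1 > 0" using D by (simp add: add_nonneg_pos)
  fix vs q K e t and g :: "edge => point => real"
  assume vN: "meshN vs rho eps N" and q: "q : Pol (int k + 1)" and K: "0 <= K"
   and H: "(ALL e:edges vs. continuous_on UNIV (g e) & (ALL x:seg e. (g e x)^2 <= K)) &
   bdry_int vs (%e x. (g e x - grad q x <.> tangent vs e) * (grad q x <.> tangent vs e)) = 0"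
   and e: "e : edges vs" and t: "0 <= t & (t::real) <= 1"
  interpret mesh_polygon vs rho eps using vN by blast
  define f where "f e x = grad q x <.> tng e" for e x
  have cf: "continuous_on UNIV (f e)" for e unfolding f_def[abs_def] by (intro continuous_intros grad_continuous Pol_C1[OF q])
  have cg: "continuous_on UNIV (g e)" if "e : E" for e using H that by blast
  have one: "edge_int e (%x. (f e x)^2) <= K * h - 2 * edge_int e (%x. (g e x - f e x) * f e x)" if e: "e : E" for e
  proof -
   \<comment> \<open>The square of \<open>g e x - f e x\<close> is expanded, with
     \<open>(g e x)^2 <= K\<close>; the mixed term sums to zero over the boundary.\<close>
   have "edge_int e (%x. (f e x)^2) <= edge_int e (%x. 1 * K + (- 2) * ((g e x - f e x) * f e x))"
   proof (rule edge_int_mono[OF e])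
   fix x assume "x : seg e"
   hence "(g e x)^2 <= K" using H e by blast
   moreover have "0 <= (g e x - f e x)^2" by simp
   ultimately show "(f e x)^2 <= 1 * K + (- 2) * ((g e x - f e x) * f e x)" by (simp add: power2_eq_square algebra_simps)
   qed (intro continuous_intros cf cg e)+
   also have "... = 1 * edge_int e (%x. K) + (- 2) * edge_int e (%x. (g e x - f e x) * f e x)"
   by (rule edge_int_add) (intro continuous_intros cf cg e)+
   also have "edge_int e (%x. K) <= K * h" unfolding edge_int_const using elen_bounds(2)[OF e] K by (simp add: mult.commute mult_left_mono)
   finally show ?thesis by simp
  qed
  have nn: "0 <= edge_int e (%x. (f e x)^2)" if "e : E" for e
   unfolding edge_int_def using elen_bounds(3)[OF that] by (intro mult_nonneg_nonneg integral_nonneg_AE) auto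
  have "(SUM e:E. edge_int e (%x. (f e x)^2)) <= (SUM e:E. K * h - 2 * edge_int e (%x. (g e x - f e x) * f e x))"
   by (intro sum_mono one)
  also have "... = real N * (K * h)"
   using H vN unfolding bdry_int_def f_def by (simp add: sum_subtractf flip: sum_distrib_left)
  finally have tot: "(SUM e:E. edge_int e (%x. (f e x)^2)) <= real N * (K * h)" .
  have inc: "(q (el e t) - q (fst e))^2 <= D * (h^2 * K)" if e: "e : E" and t: "0 <= t" "t <= 1" for e t proof -
   let ?l = "el e"
   have l: "0 < elen e" "rho * h <= elen e" "elen e <= h" using elen_bounds[OF e] by auto
   define I where "I = (LINT t|leb {0..1}. (f e (?l t))^2)"
   have I0: "0 <= I" unfolding I_def by (rule integral_nonneg_AE) simp
   have "elen e * I = edge_int e (%x. (f e x)^2)" by (simp add: edge_int_def I_def)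
   also have "... <= real N * (K * h)"
   using tot member_le_sum[of e E "%e. edge_int e (%x. (f e x)^2)"] nn E_rel(1) e by fastforce
   finally have "(rho * h) * I <= real N * (K * h)" using mult_right_mono[OF l(2) I0] by linarith
   hence "h * (rho * I) <= h * (real N * K)" by (simp add: mult_ac)
   hence "rho * I <= real N * K" using h_pos by simp
   hence I: "I <= real N / rho * K" using rho by (simp add: pos_le_divide_eq mult_ac)
   have "q : Pol (int (Suc k))" using q by (simp add: add.commute)
   then obtain c where c: "!!t. q (?l t) = (SUM j<=Suc k. c j * t ^ j)" using line_coefficients[of q "Suc k" e] by blast
   define c' where "c' j = real (Suc j) * c (Suc j)" for j
   have d: "ori * elen e * f e (?l t) = (SUM j<=k. c' j * t ^ j)" for t
   unfolding f_def c'_def by (rule edge_derivative[OF e q c])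
   have "(SUM j<=k. (c' j)^2) <= C1 * (LINT t|leb {0..1}. (SUM j<=k. c' j * t ^ j)^2)" using C1(2)[unfolded uni_est_def] by blast
   also have "(LINT t|leb {0..1}. (SUM j<=k. c' j * t ^ j)^2) = (elen e)^2 * I"
   unfolding d[symmetric] I_def using ori_sq(1) by (simp add: power_mult_distrib power2_eq_square[of ori])
   also have "C1 * ((elen e)^2 * I) <= C1 * (h^2 * (real N / rho * K))"
   using C1(1) l I I0 by (intro mult_left_mono mult_mono power_mono) auto
   finally have cb: "(SUM j<=k. (c' j)^2) <= C1 * (h^2 * (real N / rho * K))" .
   have "q (?l t) - q (fst e) = (SUM j<=k. c (Suc j) * t ^ Suc j)" proof -
   have "q (fst e) = c 0" using c[of 0] unfolding sum.atMost_Suc_shift by (simp add: linepath_def)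
   thus ?thesis unfolding c sum.atMost_Suc_shift by simp
   qed
   also have "...^2 <= (SUM j<=k. (c (Suc j))^2) * (real (card {..k}) * 1^2)"
   using t by (intro sum_mult_sq_le) (simp add: power_le_one mult_le_one)
   also have "... <= (SUM j<=k. (c' j)^2) * real (Suc k)" proof -
   have "(c (Suc j))^2 <= (c' j)^2" for j proof -
   have "1^2 <= (real (Suc j))^2" by (intro power_mono) auto
   hence "1 * (c (Suc j))^2 <= (real (Suc j))^2 * (c (Suc j))^2" by (intro mult_right_mono) auto
   thus ?thesis by (simp add: c'_def power_mult_distrib)
   qed
   hence "(SUM j<=k. (c (Suc j))^2) <= (SUM j<=k. (c' j)^2)" by (intro sum_mono)
   thus ?thesis by simp
   qed
   also have "... <= C1 * (h^2 * (real N / rho * K)) * real (Suc k)" by (intro mult_right_mono cb) simp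
   also have "... = D * (h^2 * K)" by (simp add: D_def)
   finally show ?thesis .
  qed
  define m where "m = sqrt (D * (h^2 * K))"
  have m2: "m^2 = D * (h^2 * K)" and m0: "0 <= m" unfolding m_def using D K by auto
  have incm: "\<bar>q (el e t) - q (fst e)\<bar> <= m" if "e : E" "0 <= t" "t <= 1" for e t
   using inc[OF that] m0 unfolding m2[symmetric] by (simp add: power2_le_iff_abs_le)
  have "\<bar>q (fst e) - q (hd vs)\<bar> <= (SUM e:E. \<bar>q (snd e) - q (fst e)\<bar>)"
   by (rule edges_walk[OF simple]) (use e E_rel(4) in auto)
  also have "... <= (SUM e:E. m)" proof (rule sum_mono)
   fix e assume "e : E"
   from incm[OF this, of 1] show "\<bar>q (snd e) - q (fst e)\<bar> <= m" by (simp add: linepath_def)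
  qed
  also have "... = real N * m" using vN by simp
  finally have "\<bar>q (el e t) - q (hd vs)\<bar> <= (real N + 1) * m"
   using incm[OF e, of t] t by (simp add: algebra_simps)
  hence "(q (el e t) - q (hd vs))^2 <= ((real N + 1) * m)^2" by (rule power2_le_iff_abs_le[THEN iffD2, rotated]) (use m0 in simp)
  also have "... = (real N + 1)^2 * D * (h^2 * K)" by (simp add: power_mult_distrib m2)
  also have "... <= ((real N + 1)^2 * D + 1) * (h^2 * K)" using K by (intro mult_right_mono) auto
  finally show "(q (el e t) - q (hd vs))^2 <= ((real N + 1)^2 * D + 1) * (h^2 * K)" .
 qed
qed

section \<open>The projection\<close>

lemma rotp_add:
 assumes "!!i. C1_fun (%x. A x $ i)" "!!i. C1_fun (%x. B x $ i)" shows "rotp (%x. A x + B x) x = rotp A x + rotp B x"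
 by (simp add: rotp_def partial_add_C1[OF assms])

lemma rotp_diff:
 assumes "!!i. C1_fun (%x. A x $ i)" "!!i. C1_fun (%x. B x $ i)" shows "rotp (%x. A x - B x) x = rotp A x - rotp B x"
 by (simp add: rotp_def C1_diff(2)[OF assms])

lemma rotp_grad: "q : Pol m ==> rotp (grad q) x = 0" using Pol_partial_commute[of q m] by (simp add: rotp_def)

lemma rotp_Pol: "P : Pol_vec m ==> rotp P : Pol (m - 1)"
 unfolding rotp_def[abs_def] Pol_vec_def by (intro Pol_diff Pol_partial) auto

lemma Pol_vec_C1: "P : Pol_vec m ==> C1_fun (%x. P x $ i)" unfolding Pol_vec_def using Pol_C1 by blast

lemma Pol_vec_grad: "q : Pol (m + 1) ==> grad q : Pol_vec m" using Pol_partial[of q "m + 1"] by (simp add: Pol_vec_def)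

lemma Pol_vec_add: "A : Pol_vec m ==> B : Pol_vec m ==> (%x. A x + B x) : Pol_vec m" by (auto simp: Pol_vec_def)

lemma Pol_vec_diff: "A : Pol_vec m ==> B : Pol_vec m ==> (%x. A x - B x) : Pol_vec m" by (auto simp: Pol_vec_def)

lemma rfield_Pol_vec: "s : Pol (m - 1) ==> rfield z s : Pol_vec m"
 using rfield_Pol[of s "m - 1" z] by (simp add: Pol_vec_def)


lemma norm_sq_2: "(norm (a - b))^2 <= 2 * ((norm a)^2 + (norm b)^2)" proof -
 have "(norm (a - b))^2 <= (norm a + norm b)^2" by (intro power_mono norm_triangle_ineq4) simp
 also have "... <= 2 * ((norm a)^2 + (norm b)^2)" by (rule sum_sq_2)
 finally show ?thesis .
qed

lemma norm_sq_3: "(norm (a + b + c))^2 <= 3 * ((norm a)^2 + (norm b)^2 + (norm c)^2)" proof -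
 have "norm (a + b + c) <= norm a + norm b + norm c"
  using norm_triangle_ineq[of "a + b" c] norm_triangle_ineq[of a b] by linarith
 hence "(norm (a + b + c))^2 <= (norm a + norm b + norm c)^2" by (intro power_mono) auto
 also have "... <= 3 * ((norm a)^2 + (norm b)^2 + (norm c)^2)" by (rule sum_sq_3)
 finally show ?thesis .
qed

lemma Pol_0_constant: "D : Pol 0 ==> EX c. D = (%_. c)" proof -
 assume "D : Pol 0"
 then obtain c where "D = (%x. SUM k:idx 0. c k * mon x k)" unfolding Pol_iff by blast
 moreover have "idx 0 = {(0, 0)}" by (auto simp: idx_def)
 ultimately have "D = (%_. c (0, 0))" by (simp add: mon_def)
 thus ?thesis by blast
qed

section \<open>Reformulation of the conditions on the projection\<close>

context mesh_polygon
begin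

text \<open>The conditions on the projection without choice operators: (b) and (c) merge into a
  pointwise prescription of the rotation, traces are given by functions \<open>p e\<close> that can
  be taken polynomial, and negative \<open>beta\<close> is absorbed by the zero polynomial
  space.\<close>

definition pi_cond :: "nat => (point => real) => (edge => point => real) => (point => point) => (point => point) => bool" where
 "pi_cond k r p v P <-> P : Pol_vec (int k) &
  (ALL q:Pol (int k + 1). bdry_int vs (%e x. (p e x - P x <.> tng e) * (grad q x <.> tng e)) = 0) &
  (ALL x. rotp P x = r x) &
  (ALL q:Pol (int k + 1 - int (card E)). int_against_x vs (%x. v x - P x) q = 0)"

lemma Pol_vec_continuous: "P : Pol_vec m ==> continuous_on S P" by (rule C1_cont_vec) (rule Pol_vec_C1)

lemma beta_eq: "beta k vs = int k + 1 - int (card E)" by (simp add: beta_def eta_eq E_rel(2))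

lemma Pol_zero_F:
 assumes "D : Pol m" "(rsq F D) = 0" shows "D = (%x. 0)" proof (rule Pol_zero_on_ball[OF assms(1) rhoh_pos, of ctr])
 fix x assume "x : ball ctr (rho * h)"
 hence "x : interior F" using ball_F by (meson interior_maximal open_ball subsetD)
 thus "D x = 0" by (rule integral_sq_zero_imp[OF compact_F Pol_continuous[OF assms(1)] assms(2)])
qed

lemma grad_const [simp]: "grad (%x. c) x = 0" by (simp add: vec_eq_iff)

text \<open>The defect \<open>D\<close> between \<open>r\<close> and \<open>rotp P\<close> is a
  polynomial of degree \<open>k - 1\<close>. Green's formula with the constant \<open>1\<close>
  turns (b) into zero mean of \<open>D\<close>, and (c) makes \<open>D\<close> orthogonal to itself
  up to a constant; hence \<open>D\<close> vanishes. Both kinds of average lead to the same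
  condition.\<close>

lemma pi_iff:
 assumes dat: "ve_data k v d r p" and k: "1 <= k" shows "is_Pi_S k avg vs v P <-> pi_cond k r p v P"
proof (cases "P : Pol_vec (int k)")
 case False
 thus ?thesis by (simp add: is_Pi_S_def pi_cond_def)
next
 case P: True
 let ?w = "%x. v x - P x"
 have v: "L2_on F v" "has_weak_rot F v r" "has_tan_trace vs v p" and rP: "r : Pol (int k - 1)" and pP: "!!e. e : E ==> p e : Pol (int k)"
  using dat by (auto simp: ve_data_def)
 note PC = Pol_vec_C1[OF P]
 define D where "D x = r x - rotp P x" for x
 have DP: "D : Pol (int k - 1)" unfolding D_def[abs_def] by (intro Pol_diff rP rotp_Pol P)
 have cD: "continuous_on S D" for S by (rule Pol_continuous[OF DP])
 have wr: "has_weak_rot F ?w D" unfolding D_def[abs_def] by (rule weak_rot_diff[OF v(1,2) PC])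
 have wt: "has_tan_trace vs ?w (%e x. p e x - P x <.> tng e)" by (rule tan_trace_diff[OF v PC])
 have a: "bdry_int vs (%e x. tan_trace vs ?w e x * (grad q x <.> tng e)) = bdry_int vs (%e x. (p e x - P x <.> tng e) * (grad q x <.> tng e))"
  if "q : Pol (int k + 1)" for q unfolding bdry_int_def
  by (intro sum.cong edge_int_tan_trace(1)[OF wt] refl continuous_intros grad_continuous Pol_C1[OF that])
 have one: "C1_fun (%_::point. 1::real)" by (rule Pol_C1[OF Pol_const[of 0]]) simp
 have "bdry_int vs (%e x. tan_trace vs ?w e x * 1) = bdry_int vs (%e x. (p e x - P x <.> tng e) * 1)"
  unfolding bdry_int_def by (intro sum.cong edge_int_tan_trace(1)[OF wt] refl continuous_intros)
 also have "... = (LINT x|MF. D x)"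
  using has_tan_traceD[OF wt one] rot_integral[OF wr continuous_on_const[of F 1]] by simp
 finally have b: "bdry_int vs (tan_trace vs ?w) = (LINT x|MF. D x)" by simp
 have c: "(LINT x|MF. rot F ?w x * q x) = (LINT x|MF. D x * q x)" if "q : Pol m" for q m
  by (rule rot_integral[OF wr Pol_continuous[OF that]])
 have d: "(beta k vs >= 0 --> (ALL q:Pol (beta k vs). int_against_x vs ?w q = 0)) <->
   (ALL q:Pol (int k + 1 - int (card E)). int_against_x vs ?w q = 0)"
  unfolding beta_eq by (cases "int k + 1 - int (card E) >= 0") (auto simp: Pol_neg int_against_x_def)
 have bc': "(LINT x|MF. D x) = 0 & (k > 1 --> (ALL q:Pol0 avg (int k - 1) vs. (LINT x|MF. D x * q x) = 0)) <-> (ALL x. D x = 0)"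
 proof (intro iffI conjI impI ballI)
  assume H: "(LINT x|MF. D x) = 0 & (k > 1 --> (ALL q:Pol0 avg (int k - 1) vs. (LINT x|MF. D x * q x) = 0))"
  \<comment> \<open>\<open>c\<close> is chosen so that \<open>D - c\<close> has zero average in the
    prescribed sense and is admissible in (c); the constant is harmless because \<open>D\<close> has
    zero mean over the region. For \<open>k = 1\<close> the defect is itself a constant.\<close>
  have "EX c. (LINT x|MF. D x * (D x - c)) = 0" proof (cases "k > 1")
   case False
   hence "int k - 1 = 0" using k by simp
   hence "D : Pol 0" using DP by (simp only:)
   then obtain c where "D = (%_. c)" using Pol_0_constant by blast
   thus ?thesis by (intro exI[of _ c]) simp
  next
   case True
   have kk: "0 <= int k - 1" using True by simp
   show ?thesis proof (cases avg)
   case Over_region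
   hence "D : Pol0 avg (int k - 1) vs" using DP H by (simp add: Pol0_def)
   thus ?thesis using H True by (intro exI[of _ 0]) simp
   next
   case Over_boundary
   define l where "l = (SUM e:E. elen e)"
   have "0 < l" unfolding l_def using E_rel(1) E_nonempty elen_bounds(3) by (intro sum_pos) auto
   define c where "c = bdry_int vs (%_. D) / l"
   have "bdry_int vs (%_ x. 1 * D x + (- 1) * c) = bdry_int vs (%_. D) - l * c"
   unfolding bdry_int_def l_def sum_distrib_right sum_subtractf[symmetric] proof (rule sum.cong[OF refl])
   fix e assume "e : E"
   show "edge_int e (%x. 1 * D x + (- 1) * c) = edge_int e D - elen e * c"
   using edge_int_add[OF cD continuous_on_const[of UNIV c], of e 1 "- 1"] by (simp add: edge_int_const)
   qed
   hence "bdry_int vs (%_ x. D x - c) = 0" using \<open>0 < l\<close> by (simp add: c_def)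
   moreover have "(%x. D x - c) : Pol (int k - 1)" by (intro Pol_diff DP Pol_const kk)
   ultimately have "(%x. D x - c) : Pol0 avg (int k - 1) vs" using Over_boundary by (simp add: Pol0_def)
   hence "(LINT x|MF. D x * (%x. D x - c) x) = 0" using H True by (elim conjE) (drule mp, simp, drule bspec, assumption, simp)
   thus ?thesis by (intro exI[of _ c]) simp
   qed
  qed
  then obtain c where c: "(LINT x|MF. D x * (D x - c)) = 0" by blast
  have i: "integrable MF (%x. (D x)^2)" "integrable MF D" by (intro int_cont compact_F continuous_intros cD)+
  have "(LINT x|MF. D x * (D x - c)) = (LINT x|MF. (D x)^2 - c * D x)"
   by (rule int_congr) (simp_all add: power2_eq_square algebra_simps)
  also have "... = (rsq F D) - c * (LINT x|MF. D x)" using i by simp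
  finally have "(rsq F D) = 0" using c H by simp
  from Pol_zero_F[OF DP this] show "ALL x. D x = 0" by simp
 qed simp_all
 have r: "(ALL x. rotp P x = r x) <-> (ALL x. D x = 0)" unfolding D_def by auto
 have c0: "(ALL q:Pol0 avg (int k - 1) vs. (LINT x|MF. rot F ?w x * q x) = 0) <-> (ALL q:Pol0 avg (int k - 1) vs. (LINT x|MF. D x * q x) = 0)"
 proof (rule ball_cong[OF refl])
  fix q assume "q : Pol0 avg (int k - 1) vs"
  hence "q : Pol (int k - 1)" by (simp add: Pol0_def)
  from c[OF this] show "(LINT x|MF. rot F ?w x * q x) = 0 <-> (LINT x|MF. D x * q x) = 0" by simp
 qed
 have a0: "(ALL q:Pol (int k + 1). bdry_int vs (%e x. tan_trace vs ?w e x * (grad q x <.> tng e)) = 0) <->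
  (ALL q:Pol (int k + 1). bdry_int vs (%e x. (p e x - P x <.> tng e) * (grad q x <.> tng e)) = 0)" using a by simp
 show ?thesis unfolding is_Pi_S_def Let_def pi_cond_def r bc'[symmetric] a0 b c0 d by blast
qed

text \<open>Integration by parts for the divergence, obtained from the rotational Green formula
  through the rotated field. It converts moments of gradients against \<open>x - bc\<close> into the
  Euler operator.\<close>

lemma green_rfield:
 assumes p: "p : Pol m" and ph: "C1_fun ph" and z: "!!e x. e : E ==> x : seg e ==> ph x = 0"
 shows "(LINT x|MF. (grad ph x <.> (x - bc)) * p x) = - (LINT x|MF. euler bc p x * ph x)" proof -
 note C = Pol_C1[OF p] ph
 have "bdry_int vs (%e x. (rfield bc p x <.> tng e) * ph x) = 0" using z by (intro bdry_int_zero) simp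
 hence "(LINT x|MF. euler bc p x * ph x) + (LINT x|MF. rfield bc p x $ 2 * partial 1 ph x - rfield bc p x $ 1 * partial 2 ph x) = 0"
  using green_product[OF rfield_C1[OF C(1)] C(2), of bc] by (simp add: rotp_rfield[OF C(1)])
 moreover have "rfield bc p x $ 2 * partial 1 ph x - rfield bc p x $ 1 * partial 2 ph x = (grad ph x <.> (x - bc)) * p x" for x
  by (simp add: rfield_nth inner_point algebra_simps)
 ultimately show ?thesis by simp
qed

lemma bdist_mult_seg: "e : E ==> x : seg e ==> bdist x * s x = 0" using bdist_seg lin_seg by simp

end

definition stab_est :: "point list => nat => real => bool" where
 "stab_est vs k C <->
  ((ALL v r p P K. L2_on (region vs) v & r : Pol (int k - 1) &
  (ALL e:edges vs. continuous_on UNIV (p e) & (ALL x:seg e. (p e x)^2 <= K)) & 0 <= K & (rsq (region vs) r) <= K &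
  mesh_polygon.pi_cond vs k r p v P -->
  (nsq (region vs) P) <= C * ((diameter (region vs))^2 * K + (nsq (region vs) v))))"

text \<open>\<open>P\<close> splits into a field with the given rotation, the gradient of a bounded
  extension of boundary values, and the gradient of a multiple of the bubble. The first two are
  controlled by the data; the factor of the bubble has degree \<open>beta\<close>, so (d) can be
  tested with its inverse under the Euler operator. Beyond \<open>pi_cond\<close> no relation
  between \<open>v\<close> and the data is assumed, so zero data yield uniqueness.\<close>

lemma stability:
 assumes "rho > 0" "eps > 0" shows "EX C>0. ALL vs. meshN vs rho eps N --> stab_est vs k C" proof -
 let ?b = "int k + 1 - int N"
 obtain Ce where Ce: "Ce > 0" "ALL vs. mesh_polygon vs rho eps --> euler_est vs (int k - 1) Ce"
  using euler_bound[OF assms(1), of eps "int k - 1"] by blast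
 obtain Cp where Cp: "Cp > 0" "ALL vs. meshN vs rho eps N --> pot_est vs k Cp"
  using potential_bound[OF assms(1), of eps N k] by blast
 obtain Cb where Cb: "Cb > 0" "ALL vs. mesh_polygon vs rho eps --> ext_est vs (Suc k) N Cb"
  using boundary_extension[OF assms, of "Suc k" N] by blast
 obtain Cg where Cg: "Cg > 0" "ALL vs. mesh_polygon vs rho eps --> grad_est vs (int k + 1) Cg"
  using grad_bound[OF assms(1), of eps "int k + 1"] by blast
 obtain Cf where Cf: "Cf > 0" "ALL vs. mesh_polygon vs rho eps --> euler_est vs ?b Cf"
  using euler_bound[OF assms(1), of eps ?b] by blast
 obtain Cw where Cw: "Cw > 0" "ALL vs. meshN vs rho eps N --> weight_est vs ?b Cw"
  using weight_bound[OF assms(1), of eps N ?b] by blast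
 \<comment> \<open>\<open>a1\<close> is the constant of the boundary extension and \<open>a2\<close>
   that of the bubble part in the splitting below.\<close>
 define a1 where "a1 = pi * Cg * Cb * Cp * (2 * (1 + 4 * Ce))"
 define a2 where "a2 = 8 * pi * Cg * Cf * Cw^2"
 define D where "D = 3 * (4 * pi * Ce + a1 + a2 + a2 * a1)"
 have pos: "a1 > 0" "a2 > 0" using Ce(1) Cp(1) Cb(1) Cg(1) Cf(1) Cw(1) by (simp_all add: a1_def a2_def)
 hence D: "D > 0" using Ce(1) by (simp add: D_def add_pos_pos)
 show ?thesis unfolding stab_est_def proof (intro exI[of _ D] conjI allI impI D)
  fix vs v r p P and K :: real
  assume vN: "meshN vs rho eps N"
   and H: "L2_on (region vs) v & r : Pol (int k - 1) &
   (ALL e:edges vs. continuous_on UNIV (p e) & (ALL x:seg e. (p e x)^2 <= K)) & 0 <= K & (rsq (region vs) r) <= K &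
   mesh_polygon.pi_cond vs k r p v P"
  hence m: "mesh_polygon vs rho eps" by blast
  interpret mesh_polygon vs rho eps by (rule m)
  have v: "L2_on F v" and r: "r : Pol (int k - 1)" and p: "!!e. e : E ==> continuous_on UNIV (p e)"
   "!!e x. e : E ==> x : seg e ==> (p e x)^2 <= K" and K: "0 <= K" "(rsq F r) <= K" using H by auto
  have P: "P : Pol_vec (int k)" and Pa: "!!q. q : Pol (int k + 1) ==> bdry_int vs (%e x. (p e x - P x <.> tng e) * (grad q x <.> tng e)) = 0"
   and Pr: "!!x. rotp P x = r x" and Pd: "!!q. q : Pol ?b ==> int_against_x vs (%x. v x - P x) q = 0"
   using H vN unfolding pi_cond_def by auto
  obtain s where s: "s : Pol (int k - 1)" "ALL x. euler bc s x = r x" "ALL x:F. (s x)^2 <= Ce / h^2 * (rsq F r)"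
   using Ce(2)[rule_format, OF m, unfolded euler_est_def, rule_format, OF r] by blast
  define X where "X = rfield bc s"
  have XP: "X : Pol_vec (int k)" unfolding X_def by (rule rfield_Pol_vec[OF s(1)])
  have Xb: "(norm (X x))^2 <= 4 * Ce * K" if x: "x : F" for x proof -
   have "(s x)^2 <= Ce / h^2 * K" using s(3) x mult_left_mono[OF K(2), of "Ce / h^2"] Ce(1) by fastforce
   from weighted_bound[OF x this] show ?thesis by (simp add: X_def rfield_norm power_mult_distrib)
  qed
  define w where "w x = P x - X x" for x
  have wP: "w : Pol_vec (int k)" unfolding w_def[abs_def] by (intro Pol_vec_diff P XP)
  have "rotp w x = 0" for x unfolding w_def[abs_def] rotp_diff[OF Pol_vec_C1[OF P] Pol_vec_C1[OF XP]] Pr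
   by (simp add: X_def rotp_rfield[OF Pol_C1[OF s(1)]] s(2))
  then obtain q where q: "q : Pol (int k + 1)" "ALL x. grad q x = w x" using Pol_potential[OF wP] by blast
  define g where "g e x = p e x - X x <.> tng e" for e x
  define K1 where "K1 = 2 * (1 + 4 * Ce) * K"
  have K1: "K1 >= 0" using Ce(1) K(1) by (simp add: K1_def)
  have gb: "(g e x)^2 <= K1" if e: "e : E" and x: "x : seg e" for e x
   using tangent_diff_bound[OF e p(2)[OF e x] Xb] seg_F[OF e] x by (auto simp: g_def K1_def algebra_simps)
  have "g e x - grad q x <.> tng e = p e x - P x <.> tng e" for e x by (simp add: g_def q(2) w_def inner_diff_left)
  hence "bdry_int vs (%e x. (g e x - grad q x <.> tng e) * (grad q x <.> tng e)) = 0" using Pa[OF q(1)] by simp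
  moreover have "continuous_on UNIV (g e)" if "e : E" for e
   unfolding g_def[abs_def] by (intro continuous_intros p(1) that Pol_vec_continuous[OF XP])
  ultimately have qb: "(q (el e t) - q (hd vs))^2 <= Cp * (h^2 * K1)" if "e : E" "0 <= t" "t <= 1" for e t
   using Cp(2)[rule_format, OF vN, unfolded pot_est_def, rule_format, OF q(1) K1, of g e t] gb that by blast
  define q1 where "q1 x = q x - q (hd vs)" for x
  have q1P: "q1 : Pol (int (Suc k))" proof -
   have "q1 : Pol (int k + 1)" unfolding q1_def[abs_def] by (intro Pol_diff q(1) Pol_const) simp
   thus ?thesis by (simp add: add.commute)
  qed
  define ka where "ka = Cp * (h^2 * K1)"
  have ka: "ka >= 0" using Cp(1) K1 by (simp add: ka_def)
  \<comment> \<open>Splitting off all \<open>N\<close> edge factors leaves a quotient of degree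
    \<open>k + 1 - N\<close>, which is \<open>beta\<close>.\<close>
  have "EX z:Pol (int (Suc k)). EX q':Pol (int (Suc k) - int N). (ALL x. q1 x = z x + (PROD e:E. lin e x / h) * q' x) & (ALL x:F. (z x)^2 <= Cb * ka)"
   by (rule Cb(2)[rule_format, OF m, unfolded ext_est_def, rule_format, OF q1P ka]) (use qb vN in \<open>auto simp: q1_def ka_def\<close>)
  then obtain z s' where zs: "z : Pol (int (Suc k))" "s' : Pol (int (Suc k) - int N)"
   "ALL x. q1 x = z x + (PROD e:E. lin e x / h) * s' x" "ALL x:F. (z x)^2 <= Cb * ka" by (elim bexE conjE) (rule that)
  have zP: "z : Pol (int k + 1)" and s'P: "s' : Pol ?b" using zs(1,2) by (simp_all add: algebra_simps)
  define ph where "ph x = bdist x * s' x" for x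
  have bP: "bdist : Pol (int N)" using bdist_Pol vN by simp
  have phP: "ph : Pol (int k + 1)" using Pol_mult[OF bP s'P] by (simp add: ph_def[abs_def])
  have Pdec: "P x = X x + grad z x + grad ph x" for x proof -
   have "q1 = (%x. z x + ph x)" using zs(3) by (simp add: ph_def bdist_def fun_eq_iff)
   moreover have "partial i q1 x = partial i q x" for i
   using C1_diff(2)[OF Pol_C1[OF q(1)] Pol_C1[OF Pol_const[of 0 "q (hd vs)"]], of i x] by (simp add: q1_def[abs_def])
   ultimately have "grad q x = grad z x + grad ph x"
   using partial_add_C1[OF Pol_C1[OF zP] Pol_C1[OF phP]] by (simp add: vec_eq_iff)
   thus ?thesis using q(2) by (simp add: w_def algebra_simps)
  qed
  define V where "V = (nsq F v)"
  define Z where "Z = (nsq F (grad z))"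
  define S where "S = (rsq F s')"
  have nn: "V >= 0" "Z >= 0" "S >= 0" unfolding V_def Z_def S_def by (rule integral_nonneg_AE; simp)+
  have cz: "continuous_on A (grad z)" for A by (rule grad_continuous[OF Pol_C1[OF zP]])
  have cph: "continuous_on A (grad ph)" for A by (rule grad_continuous[OF Pol_C1[OF phP]])
  have cX: "continuous_on A X" for A by (rule Pol_vec_continuous[OF XP])
  have "(norm (grad z x))^2 <= Cg / h^2 * (Cb * ka)" if "x : F" for x proof -
   have "0 <= Cb * ka" using Cb(1) ka by simp
   thus ?thesis using Cg(2)[rule_format, OF m, unfolded grad_est_def, THEN conjunct1, rule_format, OF zP _ _ that] zs(4) by blast
  qed
  hence "Z <= Cg / h^2 * (Cb * ka) * (pi * h^2)"
   unfolding Z_def using Cg(1) Cb(1) ka by (intro F_integral_le continuous_intros cz) auto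
  also have "... = a1 * (h^2 * K)" using h_pos by (simp add: a1_def ka_def K1_def)
  finally have Z: "Z <= a1 * (h^2 * K)" .
  \<comment> \<open>Testing (d) with the Euler preimage of \<open>s'\<close> turns the moment of
    \<open>grad ph\<close> into minus the weighted norm \<open>T\<close>.\<close>
  obtain pd where pd: "pd : Pol ?b" "ALL x. euler bc pd x = s' x" "ALL x:F. (pd x)^2 <= Cf / h^2 * S"
   using Cf(2)[rule_format, OF m, unfolded euler_est_def, rule_format, OF s'P] unfolding S_def by blast
  define y where "y x = pd x *R (x - bc)" for x
  have cy: "continuous_on A y" for A unfolding y_def[abs_def] by (intro continuous_intros Pol_continuous[OF pd(1)])
  have Ly: "L2_on F y" "L2_on F (grad z)" by (intro L2_continuous compact_F cy cz)+
  define T where "T = (LINT x|MF. bdist x * (s' x)^2)"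
  have T0: "T >= 0" unfolding T_def using bdist_bounds by (intro integral_nonneg_AE AE_I2) simp
  have "(LINT x|MF. (grad ph x <.> (x - bc)) * pd x) = - T"
   using green_rfield[OF pd(1) Pol_C1[OF phP]] bdist_mult_seg unfolding T_def ph_def[abs_def]
   by (simp add: pd(2) power2_eq_square mult_ac)
  moreover have "(LINT x|MF. (v x - grad z x) <.> y x) = (LINT x|MF. (grad ph x <.> (x - bc)) * pd x)" proof -
   have "0 = int_against_x vs (%x. v x - P x) pd" using Pd[OF pd(1)] by simp
   also have "... = (LINT x|MF. (v x - grad z x) <.> y x - (grad ph x <.> (x - bc)) * pd x)" unfolding int_against_x_def
   proof (rule int_congr[OF refl])
   fix x
   have "X x <.> (x - bc) = 0" unfolding X_def by (rule rfield_inner)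
   hence "(v x - P x) <.> (x - bc) = (v x - grad z x) <.> (x - bc) - grad ph x <.> (x - bc)"
   unfolding Pdec inner_diff_left inner_add_left by linarith
   hence "(v x - P x) <.> (x - bc) * pd x = ((v x - grad z x) <.> (x - bc) - grad ph x <.> (x - bc)) * pd x" by (simp only:)
   thus "(v x - P x) <.> (x - bc) * pd x = (v x - grad z x) <.> y x - (grad ph x <.> (x - bc)) * pd x"
   unfolding y_def inner_scaleR_right left_diff_distrib by (simp only: mult.commute)
   qed
   also have "... = (LINT x|MF. (v x - grad z x) <.> y x) - (LINT x|MF. (grad ph x <.> (x - bc)) * pd x)"
   by (intro Bochner_Integration.integral_diff L2_inner_int L2_diff v Ly
   int_cont compact_F continuous_intros cph Pol_continuous[OF pd(1)])
   finally show ?thesis by simp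
  qed
  ultimately have "T^2 = (LINT x|MF. (v x - grad z x) <.> y x)^2" by simp
  also have "... <= (LINT x|MF. (norm (v x - grad z x))^2) * (nsq F y)" by (intro L2_CS L2_diff v Ly)
  also have "... <= (2 * (V + Z)) * (4 * Cf * S * (pi * h^2))" proof (rule mult_mono)
   have "(LINT x|MF. (norm (v x - grad z x))^2) <= (LINT x|MF. 2 * ((norm (v x))^2 + (norm (grad z x))^2))"
   using norm_sq_2 L2_square[OF v] L2_square[OF Ly(2)] L2_square[OF L2_diff[OF v Ly(2)]]
   by (intro integral_mono) auto
   also have "... = 2 * (V + Z)" unfolding V_def Z_def using L2_square[OF v] L2_square[OF Ly(2)] by simp
   finally show "(LINT x|MF. (norm (v x - grad z x))^2) <= 2 * (V + Z)" .
   show "(nsq F y) <= 4 * Cf * S * (pi * h^2)" proof (rule F_integral_le)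
   fix x assume x: "x : F"
   from weighted_bound[OF x pd(3)[rule_format, OF x]]
   show "(norm (y x))^2 <= 4 * Cf * S" by (simp add: y_def power_mult_distrib)
   qed (use Cf(1) nn in \<open>auto intro!: continuous_intros cy\<close>)
  qed (use nn in \<open>auto intro!: integral_nonneg_AE\<close>)
  finally have T2: "T^2 <= (2 * (V + Z)) * (4 * Cf * S * (pi * h^2))" .
  have "S <= Cw * T" unfolding S_def T_def using Cw(2)[rule_format, OF vN, unfolded weight_est_def, rule_format, OF s'P] .
  hence "S^2 <= (Cw * T)^2" using nn by (intro power_mono) auto
  also have "... = Cw^2 * T^2" by (simp add: power_mult_distrib)
  also have "... <= Cw^2 * ((2 * (V + Z)) * (4 * Cf * S * (pi * h^2)))" by (intro mult_left_mono T2) simp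
  also have "... = S * (8 * pi * Cf * Cw^2 * h^2 * (V + Z))" by (simp add: algebra_simps)
  finally have S: "S <= 8 * pi * Cf * Cw^2 * h^2 * (V + Z)"
   by (rule absorb_square[rotated 2]) (use nn Cf(1) in simp_all)
  define Ph where "Ph = (nsq F (grad ph))"
  have cs': "continuous_on A s'" "continuous_on A bdist" for A using Pol_continuous s'P bP by blast+
  have "(rsq F ph) <= S" unfolding S_def proof (intro integral_mono int_cont compact_F continuous_intros)
   show "(ph x)^2 <= (s' x)^2" if "x : space MF" for x proof -
   have "(bdist x)^2 <= 1" using bdist_bounds[of x] that by (simp add: power_le_one)
   hence "(bdist x)^2 * (s' x)^2 <= 1 * (s' x)^2" by (intro mult_right_mono) auto
   thus ?thesis by (simp add: ph_def power_mult_distrib)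
   qed
  qed (intro cs' Pol_continuous[OF phP])+
  hence "Cg / h^2 * (rsq F ph) <= Cg / h^2 * (8 * pi * Cf * Cw^2 * h^2 * (V + Z))"
   using S Cg(1) by (intro mult_left_mono) auto
  moreover have "Ph <= Cg / h^2 * (rsq F ph)"
   unfolding Ph_def by (rule Cg(2)[rule_format, OF m, unfolded grad_est_def, THEN conjunct2, rule_format, OF phP])
  moreover have "Cg / h^2 * (8 * pi * Cf * Cw^2 * h^2 * (V + Z)) = a2 * (V + Z)" using h_pos by (simp add: a2_def)
  ultimately have Ph: "Ph <= a2 * (V + Z)" by linarith
  have iX: "(nsq F X) <= 4 * Ce * K * (pi * h^2)" using Ce(1) K(1) by (intro F_integral_le Xb continuous_intros cX) auto
  have ii: "integrable MF (%x. (norm (X x))^2)" "integrable MF (%x. (norm (grad z x))^2)" "integrable MF (%x. (norm (grad ph x))^2)"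
   "integrable MF (%x. (norm (P x))^2)"
   by (intro int_cont compact_F continuous_intros cX cz cph Pol_vec_continuous[OF P])+
  have "(nsq F P) <= (LINT x|MF. 3 * ((norm (X x))^2 + (norm (grad z x))^2 + (norm (grad ph x))^2))"
   using norm_sq_3 ii unfolding Pdec[symmetric] by (intro integral_mono) (auto simp: Pdec)
  also have "... = 3 * ((nsq F X) + Z + Ph)" unfolding Z_def Ph_def using ii by simp
  also have "... <= 3 * (4 * Ce * K * (pi * h^2) + a1 * (h^2 * K) + a2 * (V + a1 * (h^2 * K)))" proof -
   have "a2 * (V + Z) <= a2 * (V + a1 * (h^2 * K))" using Z pos by (intro mult_left_mono) auto
   thus ?thesis using iX Z Ph by simp
  qed
  also have "... = 3 * (4 * pi * Ce + a1 + a2 * a1) * (h^2 * K) + 3 * a2 * V" by (simp add: algebra_simps)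
  also have "... <= D * (h^2 * K) + D * V"
   using pos Ce(1) K(1) nn unfolding D_def by (intro add_mono mult_right_mono) auto
  finally show "(nsq F P) <= D * (h^2 * K + (nsq F v))" by (simp add: V_def distrib_left)
 qed
qed

section \<open>Existence and uniqueness of the projection\<close>

context mesh_polygon
begin

lemma grad_lin:
 assumes "C1_fun p" "C1_fun q" shows "grad (%x. a * p x + q x) x = a *R grad p x + grad q x" proof -
 have d: "p differentiable (at x)" "q differentiable (at x)" using assms by (simp_all add: C1_fun_def)
 show ?thesis using partial_lin[OF d, of _ a 1] by (simp add: vec_eq_iff)
qed

lemma bdry_int_lin:
 assumes "!!e. e : E ==> continuous_on UNIV (f e)" "!!e. e : E ==> continuous_on UNIV (g e)"
 shows "bdry_int vs (%e x. a * f e x + g e x) = a * bdry_int vs f + bdry_int vs g"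
 unfolding bdry_int_def sum_distrib_left sum.distrib[symmetric] proof (rule sum.cong[OF refl])
 fix e assume "e : E"
 from edge_int_add[OF assms(1)[OF this] assms(2)[OF this], of e a 1]
 show "edge_int e (%x. a * f e x + g e x) = a * edge_int e (f e) + edge_int e (g e)" by simp
qed

lemma edge_int_nonneg: "e : E ==> (!!x. 0 <= f x) ==> 0 <= edge_int e f"
 unfolding edge_int_def using less_imp_le[OF elen_bounds(3)[of e]] by (intro mult_nonneg_nonneg integral_nonneg_AE) simp_all

lemma edge_int_CS_zero:
 assumes "continuous_on UNIV f" "continuous_on UNIV g" "edge_int e (%x. g x * g x) = 0" "e : E"
 shows "edge_int e (%x. f x * g x) = 0" proof -
 let ?l = "el e"
 have L: "L2_on {0..1} (%t. f (?l t))" "L2_on {0..1} (%t. g (?l t))"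
  by (intro L2_continuous continuous_on_compose2[OF assms(1)] continuous_on_compose2[OF assms(2)] continuous_intros; simp)+
 have "(LINT t|leb {0..1}. (norm (g (?l t)))^2) = 0"
  using assms(3) elen_bounds(3)[OF assms(4)] by (simp add: edge_int_def power2_eq_square)
 hence "(LINT t|leb {0..1}. f (?l t) * g (?l t))^2 <= 0" using L2_CS[OF L] by simp
 thus ?thesis by (simp add: edge_int_def)
qed

lemma tangential_zero:
 assumes e: "e : E" and ph: "C1_fun ph" and z: "!!t. ph (el e t) = 0" and x: "x : seg e" shows "grad ph x <.> tng e = 0"
proof -
 obtain t where t: "x = el e t" using x unfolding seg_def linepath_image_01[symmetric] by blast
 have l: "el e t = fst e + t *R (snd e - fst e)" for t by (simp add: linepath_def algebra_simps)
 have "((%t. ph (el e t)) has_real_derivative (grad ph x <.> (snd e - fst e))) (at t)"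
  unfolding t l by (rule C1_along_line[OF ph])
 hence "grad ph x <.> (snd e - fst e) = 0" unfolding z using DERIV_unique[OF _ DERIV_const] by blast
 thus ?thesis unfolding edge_tangent[OF e] using ori_sq(2) elen_bounds(3)[OF e] by auto
qed

lemma lin_line: "e : E ==> lin e (el e t) = 0" unfolding linepath_def lin_affine using lin_fst lin_snd by simp

text \<open>The splitting of \<open>stability\<close> read backwards: \<open>X\<close> supplies the
  rotation, \<open>q0\<close> solves the boundary problem (a), and a multiple of the bubble corrects
  the moments (d) without touching the tangential trace.\<close>

lemma pi_exists:
 assumes dat: "ve_data k v d r p" shows "EX P. pi_cond k r p v P" proof -
 let ?b = "int k + 1 - int (card E)"
 have v: "L2_on F v" and r: "r : Pol (int k - 1)" and pP: "!!e. e : E ==> p e : Pol (int k)"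
  using dat by (auto simp: ve_data_def)
 obtain s where s: "s : Pol (int k - 1)" "ALL x. euler bc s x = r x"
  using euler_bound[OF rho, of eps "int k - 1"] mesh_polygon_axioms r unfolding euler_est_def by blast
 define X where "X = rfield bc s"
 have XP: "X : Pol_vec (int k)" unfolding X_def by (rule rfield_Pol_vec[OF s(1)])
 define g where "g e x = p e x - X x <.> tng e" for e x
 have cg: "continuous_on A (g e)" if "e : E" for e A
  unfolding g_def[abs_def] by (intro continuous_intros Pol_continuous[OF pP[OF that]] Pol_vec_continuous[OF XP])
 define f where "f q e x = grad q x <.> tng e" for q e x
 have cf: "continuous_on A (f q e)" if "C1_fun q" for q e A
  unfolding f_def[abs_def] by (intro continuous_intros grad_continuous that)
 have fl: "f (%x. a * p x + q x) e x = a * f p e x + f q e x" if "C1_fun p" "C1_fun q" for a p q e x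
  by (simp add: f_def grad_lin[OF that] inner_add_left)
 \<comment> \<open>The boundary form is only semidefinite, but the right-hand side vanishes on its
   kernel by Cauchy-Schwarz on each edge.\<close>
 have "EX q:Pol (int k + 1). ALL q':Pol (int k + 1). bdry_int vs (%e x. f q e x * f q' e x) = bdry_int vs (%e x. g e x * f q' e x)"
 proof (rule Pol_riesz)
  fix a p q assume "p : Pol (int k + 1)" "q : Pol (int k + 1)"
  hence C: "C1_fun p" "C1_fun q" using Pol_C1 by blast+
  have "bdry_int vs (%e x. a * (g e x * f p e x) + g e x * f q e x) =
   a * bdry_int vs (%e x. g e x * f p e x) + bdry_int vs (%e x. g e x * f q e x)"
   by (intro bdry_int_lin continuous_intros cg cf C)
  thus "bdry_int vs (%e x. g e x * f (%x. a * p x + q x) e x) =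
   a * bdry_int vs (%e x. g e x * f p e x) + bdry_int vs (%e x. g e x * f q e x)"
   unfolding fl[OF C] by (simp add: algebra_simps)
 next
  fix a p q r assume "p : Pol (int k + 1)" "q : Pol (int k + 1)" "r : Pol (int k + 1)"
  hence C: "C1_fun p" "C1_fun q" "C1_fun r" using Pol_C1 by blast+
  have "bdry_int vs (%e x. a * (f p e x * f r e x) + f q e x * f r e x) =
   a * bdry_int vs (%e x. f p e x * f r e x) + bdry_int vs (%e x. f q e x * f r e x)"
   by (intro bdry_int_lin continuous_intros cf C)
  thus "bdry_int vs (%e x. f (%x. a * p x + q x) e x * f r e x) =
   a * bdry_int vs (%e x. f p e x * f r e x) + bdry_int vs (%e x. f q e x * f r e x)"
   unfolding fl[OF C(1,2)] by (simp add: algebra_simps)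
 next
  fix p q show "bdry_int vs (%e x. f p e x * f q e x) = bdry_int vs (%e x. f q e x * f p e x)" by (simp add: mult.commute)
 next
  fix p show "0 <= bdry_int vs (%e x. f p e x * f p e x)" unfolding bdry_int_def by (intro sum_nonneg edge_int_nonneg) auto
 next
  fix p assume p: "p : Pol (int k + 1)" and "bdry_int vs (%e x. f p e x * f p e x) = 0"
  hence z: "edge_int e (%x. f p e x * f p e x) = 0" if "e : E" for e
   using sum_nonneg_eq_0_iff[OF E_rel(1), of "%e. edge_int e (%x. f p e x * f p e x)"] edge_int_nonneg that
   unfolding bdry_int_def by simp
  show "bdry_int vs (%e x. g e x * f p e x) = 0" unfolding bdry_int_def proof (intro sum.neutral ballI)
   fix e assume e: "e : E"
   show "edge_int e (%x. g e x * f p e x) = 0" by (rule edge_int_CS_zero[OF cg[OF e] cf[OF Pol_C1[OF p]] z[OF e] e])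
  qed
 qed
 then obtain q0 where q0: "q0 : Pol (int k + 1)"
  "!!q'. q' : Pol (int k + 1) ==> bdry_int vs (%e x. f q0 e x * f q' e x) = bdry_int vs (%e x. g e x * f q' e x)" by blast
 define u where "u x = v x - grad q0 x" for x
 have Lu: "L2_on F u" unfolding u_def[abs_def]
  by (intro L2_diff v L2_continuous compact_F grad_continuous Pol_C1[OF q0(1)])
 have iu: "integrable MF (%x. (u x <.> (x - bc)) * q x)" if "q : Pol m" for q m proof -
  have "L2_on F (%x. q x *R (x - bc))" by (intro L2_continuous compact_F continuous_intros Pol_continuous[OF that])
  from L2_inner_int[OF Lu this] show ?thesis by (simp add: mult.commute)
 qed
 have cb: "continuous_on A bdist" for A by (rule Pol_continuous[OF bdist_Pol])
 have ce: "continuous_on A (euler bc q)" if "q : Pol m" for q m A by (rule Pol_continuous[OF euler_Pol[OF that]])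
 have ib: "integrable MF (%x. bdist x * euler bc p x * euler bc q x)" if "p : Pol m" "q : Pol m" for p q m
  by (intro int_cont compact_F continuous_intros cb ce[OF that(1)] ce[OF that(2)])
 \<comment> \<open>For \<open>ph x = bdist x * euler bc b x\<close> the moments of
   \<open>grad ph\<close> are minus this symmetric form, which is definite since the Euler operator
   is injective.\<close>
 have "EX b:Pol ?b. ALL q:Pol ?b. (LINT x|MF. bdist x * euler bc b x * euler bc q x) = - (LINT x|MF. (u x <.> (x - bc)) * q x)"
 proof (rule Pol_riesz)
  fix a p q assume p: "p : Pol ?b" "q : Pol ?b"
  have "(LINT x|MF. (u x <.> (x - bc)) * (a * p x + q x)) = (LINT x|MF. a * ((u x <.> (x - bc)) * p x) + (u x <.> (x - bc)) * q x)"
   by (simp add: algebra_simps)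
  also have "... = a * (LINT x|MF. (u x <.> (x - bc)) * p x) + (LINT x|MF. (u x <.> (x - bc)) * q x)"
   using iu[OF p(1)] iu[OF p(2)] by simp
  finally show "- (LINT x|MF. (u x <.> (x - bc)) * (a * p x + q x)) =
   a * - (LINT x|MF. (u x <.> (x - bc)) * p x) + - (LINT x|MF. (u x <.> (x - bc)) * q x)" by simp
 next
  fix a p q r assume p: "p : Pol ?b" "q : Pol ?b" "r : Pol ?b"
  have "(LINT x|MF. bdist x * euler bc (%x. a * p x + q x) x * euler bc r x) =
   (LINT x|MF. a * (bdist x * euler bc p x * euler bc r x) + bdist x * euler bc q x * euler bc r x)"
   unfolding euler_lin[OF Pol_C1[OF p(1)] Pol_C1[OF p(2)]] by (simp add: algebra_simps)
  also have "... = a * (LINT x|MF. bdist x * euler bc p x * euler bc r x) + (LINT x|MF. bdist x * euler bc q x * euler bc r x)"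
   using ib[OF p(1,3)] ib[OF p(2,3)] by simp
  finally show "(LINT x|MF. bdist x * euler bc (%x. a * p x + q x) x * euler bc r x) =
   a * (LINT x|MF. bdist x * euler bc p x * euler bc r x) + (LINT x|MF. bdist x * euler bc q x * euler bc r x)" .
 next
  fix p q show "(LINT x|MF. bdist x * euler bc p x * euler bc q x) = (LINT x|MF. bdist x * euler bc q x * euler bc p x)"
   by (simp add: mult_ac)
 next
  fix p show "0 <= (LINT x|MF. bdist x * euler bc p x * euler bc p x)"
   using bdist_bounds by (intro integral_nonneg_AE AE_I2) (simp add: mult.assoc)
 next
  fix p assume p: "p : Pol ?b" and z: "(LINT x|MF. bdist x * euler bc p x * euler bc p x) = 0"
  obtain C where "(rsq F (euler bc p)) <= C * (LINT x|MF. bdist x * (euler bc p x)^2)"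
   using weight_bound[OF rho, of eps "card E" ?b] mesh_polygon_axioms euler_Pol[OF p, of bc] unfolding weight_est_def by blast
  moreover have "(LINT x|MF. bdist x * (euler bc p x)^2) = 0" using z by (simp add: power2_eq_square mult.assoc)
  moreover have "0 <= (rsq F (euler bc p))" by (rule integral_nonneg_AE) simp
  ultimately have "(rsq F (euler bc p)) = 0" by simp
  from Pol_zero_F[OF euler_Pol[OF p] this] have "p x = 0" for x by (intro euler_injective[OF Pol_C1[OF p], of bc]) simp
  thus "- (LINT x|MF. (u x <.> (x - bc)) * p x) = 0" by simp
 qed
 then obtain b where b: "b : Pol ?b"
  "!!q. q : Pol ?b ==> (LINT x|MF. bdist x * euler bc b x * euler bc q x) = - (LINT x|MF. (u x <.> (x - bc)) * q x)" by blast
 define ph where "ph x = bdist x * euler bc b x" for x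
 have phP: "ph : Pol (int k + 1)" using Pol_mult[OF bdist_Pol euler_Pol[OF b(1), of bc]] by (simp add: ph_def[abs_def])
 note phC = Pol_C1[OF phP]
 define q where "q x = q0 x + ph x" for x
 have qP: "q : Pol (int k + 1)" unfolding q_def[abs_def] by (intro Pol_add q0(1) phP)
 have gq: "grad q x = grad q0 x + grad ph x" for x
  using grad_lin[OF Pol_C1[OF q0(1)] phC, of 1 x] by (simp add: q_def[abs_def])
 define P where "P x = X x + grad q x" for x
 have "pi_cond k r p v P" unfolding pi_cond_def proof (intro conjI ballI allI)
  show "P : Pol_vec (int k)" unfolding P_def[abs_def] by (intro Pol_vec_add XP Pol_vec_grad qP)
  show "rotp P x = r x" for x
   unfolding P_def[abs_def] rotp_add[OF Pol_vec_C1[OF XP] Pol_vec_C1[OF Pol_vec_grad[OF qP]]] rotp_grad[OF qP]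
   by (simp add: X_def rotp_rfield[OF Pol_C1[OF s(1)]] s(2))
  fix q' assume q': "q' : Pol (int k + 1)"
  have "bdry_int vs (%e x. (p e x - P x <.> tng e) * (grad q' x <.> tng e)) =
   bdry_int vs (%e x. (- 1) * (f q0 e x * f q' e x) + g e x * f q' e x)" proof (rule bdry_int_cong)
   fix e x assume e: "e : E" and x: "x : seg e"
   have "grad ph x <.> tng e = 0"
   by (rule tangential_zero[OF e phC _ x]) (simp add: ph_def bdist_seg[OF e lin_line[OF e]])
   thus "(p e x - P x <.> tng e) * (grad q' x <.> tng e) = (- 1) * (f q0 e x * f q' e x) + g e x * f q' e x"
   by (simp add: P_def gq g_def f_def inner_add_left algebra_simps)
  qed
  also have "... = (- 1) * bdry_int vs (%e x. f q0 e x * f q' e x) + bdry_int vs (%e x. g e x * f q' e x)"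
   by (intro bdry_int_lin continuous_intros cg cf Pol_C1[OF q'] Pol_C1[OF q0(1)])
  finally show "bdry_int vs (%e x. (p e x - P x <.> tng e) * (grad q' x <.> tng e)) = 0" using q0(2)[OF q'] by simp
 next
  fix q' assume q': "q' : Pol ?b"
  have "int_against_x vs (%x. v x - P x) q' = (LINT x|MF. (u x <.> (x - bc)) * q' x - (grad ph x <.> (x - bc)) * q' x)"
   unfolding int_against_x_def proof (rule int_congr[OF refl])
   fix x
   have "X x <.> (x - bc) = 0" unfolding X_def by (rule rfield_inner)
   hence "(v x - P x) <.> (x - bc) = u x <.> (x - bc) - grad ph x <.> (x - bc)"
   unfolding P_def gq u_def inner_diff_left inner_add_left by linarith
   thus "(v x - P x) <.> (x - bc) * q' x = (u x <.> (x - bc)) * q' x - (grad ph x <.> (x - bc)) * q' x"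
   by (simp only: left_diff_distrib)
  qed
  also have "... = (LINT x|MF. (u x <.> (x - bc)) * q' x) - (LINT x|MF. (grad ph x <.> (x - bc)) * q' x)"
   by (intro Bochner_Integration.integral_diff iu[OF q'] int_cont compact_F continuous_intros
   grad_continuous phC Pol_continuous[OF q'])
  also have "(LINT x|MF. (grad ph x <.> (x - bc)) * q' x) = - (LINT x|MF. euler bc q' x * ph x)"
   by (rule green_rfield[OF q' phC]) (simp add: ph_def bdist_mult_seg)
  also have "(LINT x|MF. euler bc q' x * ph x) = (LINT x|MF. bdist x * euler bc b x * euler bc q' x)"
   by (simp add: ph_def mult_ac)
  finally show "int_against_x vs (%x. v x - P x) q' = 0" using b(2)[OF q'] by simp
 qed
 thus ?thesis by blast
qed

text \<open>The difference satisfies the conditions for zero data, so the stability estimate makes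
  its norm zero.\<close>

lemma pi_unique:
 assumes dat: "ve_data k v d r p" and P: "pi_cond k r p v P" "pi_cond k r p v P'" shows "P = P'" proof -
 have v: "L2_on F v" and pP: "!!e. e : E ==> p e : Pol (int k)" using dat by (auto simp: ve_data_def)
 have PP: "P : Pol_vec (int k)" "P' : Pol_vec (int k)" using P by (auto simp: pi_cond_def)
 define Q where "Q x = P x - P' x" for x
 have QP: "Q : Pol_vec (int k)" unfolding Q_def[abs_def] by (intro Pol_vec_diff PP)
 have cP: "continuous_on A P" "continuous_on A P'" for A by (intro Pol_vec_continuous[OF PP(1)] Pol_vec_continuous[OF PP(2)])+
 have pc: "pi_cond k (%_. 0) (%_ _. 0) (%_. 0) Q" unfolding pi_cond_def proof (intro conjI ballI allI QP)
  show "rotp Q x = 0" for x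
   unfolding Q_def[abs_def] rotp_diff[OF Pol_vec_C1[OF PP(1)] Pol_vec_C1[OF PP(2)]] using P by (simp add: pi_cond_def)
  fix q assume q: "q : Pol (int k + 1)"
  have "bdry_int vs (%e x. (- 1) * ((p e x - P' x <.> tng e) * (grad q x <.> tng e)) + (p e x - P x <.> tng e) * (grad q x <.> tng e)) =
   (- 1) * bdry_int vs (%e x. (p e x - P' x <.> tng e) * (grad q x <.> tng e)) + bdry_int vs (%e x. (p e x - P x <.> tng e) * (grad q x <.> tng e))"
   by (intro bdry_int_lin continuous_intros Pol_continuous[OF pP] cP grad_continuous Pol_C1[OF q])
  moreover have "(- 1) * ((p e x - P' x <.> tng e) * (grad q x <.> tng e)) + (p e x - P x <.> tng e) * (grad q x <.> tng e) =
   (0 - Q x <.> tng e) * (grad q x <.> tng e)" for e x by (simp add: Q_def inner_diff_left algebra_simps)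
  ultimately show "bdry_int vs (%e x. (0 - Q x <.> tng e) * (grad q x <.> tng e)) = 0" using P q by (simp add: pi_cond_def)
 next
  fix q assume q: "q : Pol (int k + 1 - int (card E))"
  have i: "integrable MF (%x. ((v x - R x) <.> (x - bc)) * q x)" if "continuous_on F R" for R proof -
   have "L2_on F (%x. q x *R (x - bc))" by (intro L2_continuous compact_F continuous_intros Pol_continuous[OF q])
   from L2_inner_int[OF L2_diff[OF v L2_continuous[OF compact_F that]] this] show ?thesis by (simp add: mult.commute)
  qed
  have "int_against_x vs (%x. 0 - Q x) q = (LINT x|MF. ((v x - P x) <.> (x - bc)) * q x - ((v x - P' x) <.> (x - bc)) * q x)"
   unfolding int_against_x_def by (rule int_congr) (simp_all add: Q_def inner_diff_left algebra_simps)
  also have "... = int_against_x vs (%x. v x - P x) q - int_against_x vs (%x. v x - P' x) q"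
   unfolding int_against_x_def using i[OF cP(1)] i[OF cP(2)] by simp
  finally show "int_against_x vs (%x. 0 - Q x) q = 0" using P q by (simp add: pi_cond_def)
 qed
 have L0: "L2_on F (%_. 0 :: point)" by (intro L2_continuous compact_F continuous_intros)
 obtain C where C: "!!v r p P K. L2_on F v & r : Pol (int k - 1) &
  (ALL e:E. continuous_on UNIV (p e) & (ALL x:seg e. (p e x)^2 <= K)) & 0 <= K & (rsq F r) <= K & pi_cond k r p v P ==>
  (nsq F P) <= C * (h^2 * K + (nsq F v))"
  using stability[OF rho eps, of "card E" k] mesh_polygon_axioms unfolding stab_est_def by blast
 have "(nsq F Q) <= C * (h^2 * 0 + (LINT x|MF. (norm ((%_. 0 :: point) x))^2))"
  by (rule C[of "%_. 0" "%_. 0" "%_ _. 0"]) (use pc L0 in simp)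
 hence le: "(nsq F Q) <= 0" by simp
 have cQ: "continuous_on A Q" for A by (rule Pol_vec_continuous[OF QP])
 have "Q x $ i = 0" for x i proof -
  have "(LINT x|MF. (Q x $ i)^2) <= (nsq F Q)" proof (intro integral_mono int_cont compact_F continuous_intros cQ)
   show "(Q x $ i)^2 <= (norm (Q x))^2" for x by (simp add: component_le_norm_cart power2_le_iff_abs_le)
  qed
  moreover have "0 <= (LINT x|MF. (Q x $ i)^2)" by (rule integral_nonneg_AE) simp
  ultimately have "(LINT x|MF. (Q x $ i)^2) = 0" using le by linarith
  moreover have "(%x. Q x $ i) : Pol (int k)" using QP by (simp add: Pol_vec_def)
  ultimately have "(%x. Q x $ i) = (%x. 0)" by (rule Pol_zero_F[rotated])
  thus ?thesis by meson
 qed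
 hence "Q x = 0" for x by (simp add: vec_eq_iff)
 thus ?thesis by (auto simp: Q_def)
qed

lemma Pi_S_cond:
 assumes dat: "ve_data k v d r p" and k: "1 <= k" shows "pi_cond k r p v (Pi_S k avg vs v)" proof -
 have "EX! P. is_Pi_S k avg vs v P" unfolding pi_iff[OF dat k] using pi_exists[OF dat] pi_unique[OF dat] by blast
 from theI'[OF this] show ?thesis unfolding Pi_S_def pi_iff[OF dat k] .
qed

text \<open>The moments vanish against \<open>Pol (beta k vs)\<close> by (d) and against
  \<open>W\<close> by the definition of the space; together these exhaust
  \<open>Pol (int k)\<close>, whatever complement was chosen.\<close>

lemma SVe_pair:
 assumes dat: "ve_data k v d r p" and k: "1 <= k" and v: "v : SVe k avg W vs"
  and W: "direct_complement (Pol (int k)) (Pol (beta k vs)) W" and q: "q : Pol (int k)"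
 shows "int_against_x vs (%x. v x - Pi_S k avg vs v x) q = 0" proof -
 let ?P = "Pi_S k avg vs v"
 have c: "pi_cond k r p v ?P" by (rule Pi_S_cond[OF dat k])
 hence PP: "?P : Pol_vec (int k)" by (simp add: pi_cond_def)
 have "ALL p:Pol (int k). EX! (q, r). q : Pol (beta k vs) & r : W & p = (%x. q x + r x)"
  using W by (simp add: direct_complement_def)
 from ex1_implies_ex[OF bspec[OF this q]] obtain a b where ab: "a : Pol (beta k vs)" "b : W" "q = (%x. a x + b x)" by auto
 have bP: "b : Pol (int k)" using W ab(2) by (auto simp: direct_complement_def)
 have vL: "L2_on F v" using dat by (simp add: ve_data_def)
 have i: "integrable MF (%x. ((v x - ?P x) <.> (x - bc)) * s x)" if "s : Pol m" for s m proof -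
  have "L2_on F (%x. s x *R (x - bc))" by (intro L2_continuous compact_F continuous_intros Pol_continuous[OF that])
  from L2_inner_int[OF L2_diff[OF vL L2_continuous[OF compact_F Pol_vec_continuous[OF PP]]] this]
  show ?thesis by (simp add: mult.commute)
 qed
 have "int_against_x vs (%x. v x - ?P x) q = int_against_x vs (%x. v x - ?P x) a + int_against_x vs (%x. v x - ?P x) b"
  unfolding int_against_x_def ab(3) using i[OF ab(1)] i[OF bP] by (simp add: distrib_left)
 moreover have "int_against_x vs (%x. v x - ?P x) a = 0" using c ab(1) by (simp add: pi_cond_def beta_eq)
 moreover have "int_against_x vs (%x. v x - ?P x) b = 0" using v ab(2) by (simp add: SVe_def)
 ultimately show ?thesis by simp
qed

end

section \<open>A curl-free lifting of the tangential trace\<close>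

lemma cross_abs_le: "\<bar>cross a b\<bar> <= norm a * norm b" proof -
 have "(cross a b)^2 <= (norm a * norm b)^2"
  using cross_inner[of a b] zero_le_power2[of "a <.> b"] unfolding power_mult_distrib by linarith
 thus ?thesis by (simp add: power2_le_iff_abs_le)
qed

lemma L2_sum:
 assumes "finite I" "compact D" "!!i. i : I ==> L2_on D (f i)" shows "L2_on D (%x. SUM i:I. f i x)" using assms(1,3)
proof (induction I rule: finite_induct)
 case empty
 show ?case using L2_continuous[OF assms(2) continuous_on_const[of D 0]] by simp
next
 case (insert i I)
 thus ?case using L2_add[of D "f i" "%x. SUM i:I. f i x"] by simp
qed

lemma integral_indicator_sub:
 fixes f :: "'a::euclidean_space => real"
 assumes "T : sets lebesgue" "D : sets lebesgue" "T <= D"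
 shows "(LINT x|leb D. indicator T x * f x) = (LINT x|leb T. f x)" proof -
 have "(LINT x|leb D. indicator T x * f x) = (LINT x|lebesgue. indicator D x *R (indicator T x * f x))"
  using assms(2) by (intro integral_restrict_space) simp
 also have "... = (LINT x|lebesgue. indicator T x *R f x)"
  using assms(3) by (intro int_congr) (auto simp: indicator_def)
 also have "... = (LINT x|leb T. f x)" using assms(1) by (intro integral_restrict_space[symmetric]) simp
 finally show ?thesis .
qed

context mesh_polygon
begin

text \<open>Together with \<open>barb\<close>, the barycentric coordinates of the triangle over
  \<open>e\<close> with apex \<open>ctr\<close>, extended to the plane; by \<open>cross_edge\<close>
  the denominator is twice the signed area.\<close>

definition bara :: "edge => point => real" where
 "bara e x = cross (x - ctr) (snd e - ctr) / (ori * elen e * lin e ctr)"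

definition barb :: "edge => point => real" where
 "barb e x = cross (fst e - ctr) (x - ctr) / (ori * elen e * lin e ctr)"

lemma tri_det: "e : E ==> cross (fst e - ctr) (snd e - ctr) ~= 0" "e : E ==> rho^2 * h^2 <= \<bar>ori * elen e * lin e ctr\<bar>"
proof -
 assume e: "e : E"
 have l: "rho * h <= elen e" "rho * h <= lin e ctr" using elen_bounds(1)[OF e] lin_ctr[OF e] by auto
 hence "(rho * h) * (rho * h) <= elen e * lin e ctr" using rhoh_pos by (intro mult_mono) auto
 moreover have "\<bar>ori * elen e * lin e ctr\<bar> = elen e * lin e ctr" using ori_sq(2) l rhoh_pos by (simp add: abs_mult)
 ultimately show le: "rho^2 * h^2 <= \<bar>ori * elen e * lin e ctr\<bar>" by (simp add: power2_eq_square mult_ac)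
 have "0 < rho^2 * h^2" using rho h_pos by simp
 thus "cross (fst e - ctr) (snd e - ctr) ~= 0" unfolding cross_edge[OF e] using le by auto
qed

lemma bar_Pol: "bara e : Pol 1" "barb e : Pol 1" proof -
 have "(%x. (x $ 1 - ctr $ 1) * a - (x $ 2 - ctr $ 2) * b) : Pol 1" for a b
  using Pol_lin[OF coord_Pol[of 1 "ctr $ 1"] coord_Pol[of 2 "ctr $ 2"], of a "- b"] by (simp add: mult.commute)
 from Pol_smult[OF this, of "1 / (ori * elen e * lin e ctr)"]
 have *: "(%x. (1 / (ori * elen e * lin e ctr)) * ((x $ 1 - ctr $ 1) * a - (x $ 2 - ctr $ 2) * b)) : Pol 1" for a b .
 show "bara e : Pol 1" using *[of "(snd e - ctr) $ 2" "(snd e - ctr) $ 1"] by (simp add: bara_def[abs_def] cross_def)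
 have "(%x. (1 / (ori * elen e * lin e ctr)) * (cross (fst e - ctr) (x - ctr))) : Pol 1"
  using *[of "- (fst e - ctr) $ 2" "- (fst e - ctr) $ 1"] by (simp add: cross_def algebra_simps)
 thus "barb e : Pol 1" by (simp add: barb_def[abs_def])
qed

lemma bar_coords:
 assumes e: "e : E" shows "bara e (ctr + a *R (fst e - ctr) + b *R (snd e - ctr)) = a"
  "barb e (ctr + a *R (fst e - ctr) + b *R (snd e - ctr)) = b" proof -
 let ?D = "cross (fst e - ctr) (snd e - ctr)"
 have "cross (a *R (fst e - ctr) + b *R (snd e - ctr)) (snd e - ctr) = a * ?D"
  "cross (fst e - ctr) (a *R (fst e - ctr) + b *R (snd e - ctr)) = b * ?D" by (simp_all add: cross_def algebra_simps)
 moreover have "ctr + a *R (fst e - ctr) + b *R (snd e - ctr) - ctr = a *R (fst e - ctr) + b *R (snd e - ctr)" by simp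
 ultimately show "bara e (ctr + a *R (fst e - ctr) + b *R (snd e - ctr)) = a"
  "barb e (ctr + a *R (fst e - ctr) + b *R (snd e - ctr)) = b"
  unfolding bara_def barb_def cross_edge[OF e, symmetric] using tri_det(1)[OF e] by simp_all
qed

lemma bar_bounds:
 assumes e: "e : E" and x: "x : F" shows "\<bar>bara e x\<bar> <= 1 / rho^2" "\<bar>barb e x\<bar> <= 1 / rho^2" proof -
 have n: "norm (y - ctr) <= h" if "y : F" for y using dist_le_h[OF that ctr_F] by (simp add: dist_norm)
 have pos: "0 < rho^2 * h^2" using rho h_pos by simp
 have *: "\<bar>cross a b\<bar> / \<bar>ori * elen e * lin e ctr\<bar> <= 1 / rho^2" if "norm a <= h" "norm b <= h" for a b
 proof -
  have "\<bar>cross a b\<bar> <= h * h" using cross_abs_le[of a b] mult_mono[OF that] h_pos by fastforce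
  hence "\<bar>cross a b\<bar> / \<bar>ori * elen e * lin e ctr\<bar> <= (h * h) / (rho^2 * h^2)"
   using tri_det(2)[OF e] pos h_pos by (intro frac_le) auto
  also have "... = 1 / rho^2" using h_pos by (simp add: power2_eq_square)
  finally show ?thesis .
 qed
 show "\<bar>bara e x\<bar> <= 1 / rho^2" unfolding bara_def abs_divide by (intro * n x ends_F[OF e])
 show "\<bar>barb e x\<bar> <= 1 / rho^2" unfolding barb_def abs_divide by (intro * n x ends_F[OF e])
qed

text \<open>The homogeneous extension of a polynomial on an edge to its triangle. On the two spokes it depends
 only on the value at the corresponding vertex, so that neighbouring extensions agree there.\<close>

definition spread :: "nat => edge => (nat => real) => point => real" where
 "spread m e a x = (SUM i<=m. a i * (barb e x ^ i * (bara e x + barb e x) ^ (m - i)))"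

lemma spread_Pol: "spread m e a : Pol (int m)" unfolding spread_def[abs_def] proof (intro Pol_sum Pol_smult)
 fix i assume i: "i : {..m}"
 have "(%x. barb e x ^ i * (bara e x + barb e x) ^ (m - i)) : Pol (int i * 1 + int (m - i) * 1)"
  by (intro Pol_mult Pol_power Pol_add bar_Pol)
 thus "(%x. barb e x ^ i * (bara e x + barb e x) ^ (m - i)) : Pol (int m)" using i by simp
qed

lemma spread_edge:
 assumes e: "e : E" shows "spread m e a (el e t) = (SUM i<=m. a i * t ^ i)" proof -
 have "el e t = ctr + (1 - t) *R (fst e - ctr) + t *R (snd e - ctr)" by (simp add: linepath_def algebra_simps)
 thus ?thesis unfolding spread_def by (simp add: bar_coords[OF e])
qed

lemma spread_spokes:
 assumes e: "e : E" shows "spread m e a (ctr + t *R (fst e - ctr)) = a 0 * t ^ m"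
  "spread m e a (ctr + t *R (snd e - ctr)) = (SUM i<=m. a i) * t ^ m" proof -
 have "bara e (ctr + t *R (fst e - ctr)) = t" "barb e (ctr + t *R (fst e - ctr)) = 0"
  using bar_coords[OF e, of t 0] by simp_all
 hence "spread m e a (ctr + t *R (fst e - ctr)) = (SUM i<=m. if i = 0 then a 0 * t ^ m else 0)"
  unfolding spread_def by (intro sum.cong) (auto simp: power_0_left)
 thus "spread m e a (ctr + t *R (fst e - ctr)) = a 0 * t ^ m" by simp
 have "bara e (ctr + t *R (snd e - ctr)) = 0" "barb e (ctr + t *R (snd e - ctr)) = t"
  using bar_coords[OF e, of 0 t] by simp_all
 hence "spread m e a (ctr + t *R (snd e - ctr)) = (SUM i<=m. a i * t ^ m)"
  unfolding spread_def by (intro sum.cong) (auto simp flip: power_add)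
 thus "spread m e a (ctr + t *R (snd e - ctr)) = (SUM i<=m. a i) * t ^ m" by (simp add: sum_distrib_right)
qed

lemma spread_bound:
 assumes e: "e : E" and x: "x : F"
 shows "(spread m e a x)^2 <= (SUM i<=m. (a i)^2) * (real (Suc m) * ((max 1 (2 / rho^2)) ^ m)^2)" proof -
 let ?S = "max 1 (2 / rho^2)"
 have "0 < 1 / rho^2" "2 / rho^2 = 2 * (1 / rho^2)" using rho by simp_all
 hence "\<bar>barb e x\<bar> <= 2 / rho^2" "\<bar>bara e x + barb e x\<bar> <= 2 / rho^2"
  using bar_bounds[OF e x] abs_triangle_ineq[of "bara e x" "barb e x"] by linarith+
 hence "\<bar>barb e x\<bar> <= ?S" "\<bar>bara e x + barb e x\<bar> <= ?S" by simp_all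
 hence "\<bar>barb e x ^ i * (bara e x + barb e x) ^ (m - i)\<bar> <= ?S ^ m" if "i : {..m}" for i proof -
  have "\<bar>barb e x\<bar> ^ i * \<bar>bara e x + barb e x\<bar> ^ (m - i) <= ?S ^ i * ?S ^ (m - i)"
   using \<open>\<bar>barb e x\<bar> <= ?S\<close> \<open>\<bar>bara e x + barb e x\<bar> <= ?S\<close> by (intro mult_mono power_mono) auto
  also have "... = ?S ^ m" using that by (simp flip: power_add)
  finally show ?thesis by (simp add: abs_mult power_abs)
 qed
 from sum_mult_sq_le[OF this, of "{..m}" "%i. i" a] show ?thesis
  using sum_mult_sq_le[of "{..m}" "%i. barb e x ^ i * (bara e x + barb e x) ^ (m - i)" "?S ^ m" a]
   \<open>!!i. i : {..m} ==> \<bar>barb e x ^ i * (bara e x + barb e x) ^ (m - i)\<bar> <= ?S ^ m\<close>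
  by (simp add: spread_def)
qed

text \<open>The result depends on the triangle only through the value \<open>a\<close> of the
  potential at the vertex \<open>w\<close>, so the two triangles at a spoke give the same
  integral.\<close>

lemma spoke_integral:
 assumes C: "C1_fun Ph" and s: "!!t. Ph (ctr + t *R (w - ctr)) = a * t ^ Suc k"
 shows "line_int (%x. ph x *R grad Ph x) ctr w = (LINT t|leb {0..1}. ph (linepath ctr w t) * (a * (real (Suc k) * t ^ k)))"
 unfolding line_int_def proof (rule int_congr[OF refl])
 fix t :: real
 have l: "linepath ctr w t = ctr + t *R (w - ctr)" by (simp add: linepath_def algebra_simps)
 have "((%t. Ph (ctr + t *R (w - ctr))) has_real_derivative (grad Ph (linepath ctr w t) <.> (w - ctr))) (at t)"
  unfolding l by (rule C1_along_line[OF C])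
 moreover have "((%t. Ph (ctr + t *R (w - ctr))) has_real_derivative a * (real (Suc k) * t ^ (Suc k - Suc 0))) (at t)"
  unfolding s by (intro DERIV_cmult DERIV_pow)
 ultimately have "grad Ph (linepath ctr w t) <.> (w - ctr) = a * (real (Suc k) * t ^ (Suc k - Suc 0))" by (rule DERIV_unique)
 thus "(ph (linepath ctr w t) *R grad Ph (linepath ctr w t)) <.> (w - ctr) = ph (linepath ctr w t) * (a * (real (Suc k) * t ^ k))" by simp
qed

lemma rotp_mult_grad:
 assumes ph: "C1_fun ph" and q: "q : Pol m"
 shows "rotp (%x. ph x *R grad q x) x = grad q x $ 2 * partial 1 ph x - grad q x $ 1 * partial 2 ph x" proof -
 have d: "ph differentiable (at x)" "partial i q differentiable (at x)" for i
  using ph Pol_C1[OF Pol_partial[OF q]] by (simp_all add: C1_fun_def)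
 have "partial 1 (partial 2 q) x = partial 2 (partial 1 q) x" using Pol_partial_commute[OF q] by simp
 thus ?thesis using partial_mult[OF d(1) d(2), of 1 2] partial_mult[OF d(1) d(2), of 2 1]
  by (simp add: rotp_def algebra_simps)
qed

end

definition lift_est :: "point list => nat => real => bool" where
 "lift_est vs k C <->
  ((ALL g K. (ALL e:edges vs. g e : Pol (int k) & (ALL x:seg e. (g e x)^2 <= K)) & 0 <= K &
  bdry_int vs g = 0 --> (EX G::point => point. L2_on (region vs) G & (nsq (region vs) G) <= C * ((diameter (region vs))^2 * K) &
   (ALL ph. C1_fun ph --> (LINT x|leb (region vs). G x $ 2 * partial 1 ph x - G x $ 1 * partial 2 ph x) = bdry_int vs (%e x. g e x * ph x)))))"

text \<open>A potential is built triangle by triangle: along each edge it is an oriented primitive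
  of \<open>g\<close>, with vertex values made consistent by the zero mean of \<open>g\<close>. The
  lifting \<open>G\<close> is the piecewise gradient, curl free across the spokes because
  neighbouring potentials agree there.\<close>

lemma curl_free_lifting:
 assumes "rho > 0" shows "EX C>0. ALL vs. meshN vs rho eps N --> lift_est vs k C" proof -
 obtain C1 where C1: "C1 > 0" "uni_est 1 k C1" using univariate_bound[OF order_refl, of k] by blast
 obtain Cg where Cg: "Cg > 0" "ALL vs. mesh_polygon vs rho eps --> grad_est vs (int (Suc k)) Cg"
  using grad_bound[OF assms(1), of eps "int (Suc k)"] by blast
 \<comment> \<open>Bounds the coefficients of the primitives: the first term comes from the vertex
   values, the second from the trace.\<close>
 define C3 where "C3 = (real N)^2 * (real (Suc k) * C1) + C1"
 define C4 where "C4 = Cg * (C3 * (real (Suc (Suc k)) * ((max 1 (2 / rho^2)) ^ Suc k)^2))"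
 have C3: "C3 > 0" using C1(1) by (simp add: C3_def add_nonneg_pos)
 have C4: "C4 >= 0" using Cg(1) C3 by (simp add: C4_def)
 define D where "D = (real N)^2 * C4 * pi + 1"
 have D: "D > 0" using C4 by (simp add: D_def add_nonneg_pos)
 show ?thesis unfolding lift_est_def proof (intro exI[of _ D] conjI allI impI D)
  fix vs g and K :: real
  assume vN: "meshN vs rho eps N"
   and H: "(ALL e:edges vs. g e : Pol (int k) & (ALL x:seg e. (g e x)^2 <= K)) & 0 <= K & bdry_int vs g = 0"
  hence m: "mesh_polygon vs rho eps" by blast
  interpret mesh_polygon vs rho eps by (rule m)
  have K: "0 <= K" using H by blast
  have "ALL e:E. EX c. ALL t. g e (el e t) = (SUM j<=k. c j * t ^ j)" using H line_coefficients by blast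
  from bchoice[OF this] obtain c where c: "!!e t. e : E ==> g e (el e t) = (SUM j<=k. c e j * t ^ j)" by blast
  have cs: "(SUM j<=k. (c e j)^2) <= C1 * K" if e: "e : E" for e proof -
   have "(LINT t|leb {0..1}. (SUM j<=k. c e j * t ^ j)^2) <= K * measure lebesgue {0..1::real}"
   proof (intro integral_le_measure int_cont continuous_intros)
   fix t :: real assume t: "t : {0..1}"
   hence "el e t : seg e" by (intro linepath_seg) auto
   hence "(g e (el e t))^2 <= K" using H e by blast
   thus "(SUM j<=k. c e j * t ^ j)^2 <= K" by (simp add: c[OF e])
   qed auto
   hence "C1 * (LINT t|leb {0..1}. (SUM j<=k. c e j * t ^ j)^2) <= C1 * K" using C1(1) by (intro mult_left_mono) auto
   thus ?thesis using C1(2)[unfolded uni_est_def] by (blast intro: order_trans)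
  qed
  \<comment> \<open>The integral of \<open>g e\<close> along \<open>e\<close>, signed by the
    direction in which the list traverses the boundary.\<close>
  define d where "d e = ori * elen e * (SUM j<=k. c e j / real (Suc j))" for e
  have "d e = ori * edge_int e (g e)" if e: "e : E" for e proof -
   have i: "integrable (leb {0..1}) (%t::real. c e j * t ^ j)" for j by (intro int_cont continuous_intros) auto
   have "(LINT t|leb {0..1}. (SUM j<=k. c e j * t ^ j)) = (SUM j<=k. c e j / real (Suc j))"
   using i by (simp add: unit_interval_monomial del: of_nat_Suc)
   thus ?thesis unfolding edge_int_def c[OF e] d_def by simp
  qed
  hence "(SUM e:E. d e) = ori * bdry_int vs g" by (simp add: bdry_int_def sum_distrib_left)
  hence "(SUM e:E. d e) = 0" using H by simp
  then obtain f where f: "f (hd vs) = 0" "ALL e:E. f (snd e) - f (fst e) = d e" using edges_potential[OF simple] by blast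
  define M where "M = sqrt (real (Suc k) * (C1 * K))"
  have M: "M >= 0" "M^2 = real (Suc k) * (C1 * K)" using C1(1) K by (simp_all add: M_def)
  have db: "\<bar>d e\<bar> <= h * M" if e: "e : E" for e proof -
   have "(SUM j<=k. c e j * (1 / real (Suc j)))^2 <= (SUM j<=k. (c e j)^2) * (real (card {..k}) * 1^2)"
   by (rule sum_mult_sq_le) simp
   also have "... <= (C1 * K) * real (Suc k)" using cs[OF e] by (simp add: mult_right_mono)
   also have "... = M^2" by (simp only: M mult.commute)
   finally have "\<bar>SUM j<=k. c e j / real (Suc j)\<bar> <= M" using M(1) by (simp add: power2_le_iff_abs_le del: of_nat_Suc)
   hence "elen e * \<bar>SUM j<=k. c e j / real (Suc j)\<bar> <= h * M"
   using elen_bounds[OF e] h_pos by (intro mult_mono) auto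
   thus ?thesis using ori_sq(2) elen_bounds(3)[OF e] by (simp add: d_def abs_mult)
  qed
  have fb: "(f v)^2 <= (real N)^2 * (h^2 * (real (Suc k) * (C1 * K)))" if v: "v : set vs" for v proof -
   have "\<bar>f v - f (hd vs)\<bar> <= (SUM e:E. \<bar>f (snd e) - f (fst e)\<bar>)" by (rule edges_walk[OF simple v])
   also have "... <= (SUM e:E. h * M)" using f(2) db by (intro sum_mono) simp
   also have "... = real N * (h * M)" using vN by simp
   finally have "\<bar>f v\<bar> <= real N * (h * M)" using f(1) by simp
   hence "(f v)^2 <= (real N * (h * M))^2" using M(1) h_pos by (subst power2_le_iff_abs_le) auto
   thus ?thesis by (simp add: power_mult_distrib M(2))
  qed
  \<comment> \<open>Coefficients of the primitive of \<open>ori * elen e * g e\<close> in the edge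
    parameter, starting from the vertex value.\<close>
  define a where "a e i = (case i of 0 => f (fst e) | Suc j => ori * elen e * c e j / real (Suc j))" for e i
  define Ph where "Ph e = spread (Suc k) e (a e)" for e
  have PhP: "Ph e : Pol (int (Suc k))" for e unfolding Ph_def by (rule spread_Pol)
  have PhP': "Ph e : Pol (int k + 1)" for e using PhP[of e] by (simp add: add.commute)
  have asum: "(SUM i<=Suc k. a e i) = f (snd e)" if e: "e : E" for e proof -
   have "(SUM i<=Suc k. a e i) = f (fst e) + d e"
   unfolding sum.atMost_Suc_shift d_def by (simp add: a_def sum_distrib_left del: of_nat_Suc)
   thus ?thesis using f(2) e by auto
  qed
  have asq: "(SUM i<=Suc k. (a e i)^2) <= C3 * (h^2 * K)" if e: "e : E" for e proof -
   have "(a e (Suc j))^2 <= h^2 * (c e j)^2" for j proof -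
   have "\<bar>a e (Suc j)\<bar> = elen e * \<bar>c e j\<bar> / real (Suc j)"
   using ori_sq(2) elen_bounds(3)[OF e] by (simp add: a_def abs_mult)
   also have "... <= elen e * \<bar>c e j\<bar> / 1" using elen_bounds(3)[OF e] by (intro divide_left_mono) auto
   also have "... <= h * \<bar>c e j\<bar>" using elen_bounds(2)[OF e] by (simp add: mult_right_mono)
   finally have "(a e (Suc j))^2 <= (h * \<bar>c e j\<bar>)^2" using h_pos by (subst power2_le_iff_abs_le) auto
   thus ?thesis by (simp add: power_mult_distrib)
   qed
   hence "(SUM j<=k. (a e (Suc j))^2) <= (SUM j<=k. h^2 * (c e j)^2)" by (intro sum_mono)
   also have "... <= h^2 * (C1 * K)" using cs[OF e] by (simp add: mult_left_mono flip: sum_distrib_left)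
   finally have "(SUM j<=k. (a e (Suc j))^2) <= h^2 * (C1 * K)" .
   moreover have "(a e 0)^2 <= (real N)^2 * (h^2 * (real (Suc k) * (C1 * K)))"
   using fb[of "fst e"] E_rel(4) e by (auto simp: a_def)
   ultimately show ?thesis unfolding sum.atMost_Suc_shift C3_def by (simp add: algebra_simps)
  qed
  have gb: "(norm (grad (Ph e) x))^2 <= C4 * K" if e: "e : E" and x: "x : F" for e x proof -
   define B where "B = C3 * (h^2 * K) * (real (Suc (Suc k)) * ((max 1 (2 / rho^2)) ^ Suc k)^2)"
   have B0: "B >= 0" using C3 K by (simp add: B_def)
   have "ALL x:F. (Ph e x)^2 <= B" proof
   fix x assume x: "x : F"
   have "(Ph e x)^2 <= (SUM i<=Suc k. (a e i)^2) * (real (Suc (Suc k)) * ((max 1 (2 / rho^2)) ^ Suc k)^2)"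
   unfolding Ph_def by (rule spread_bound[OF e x])
   also have "... <= B" unfolding B_def by (intro mult_right_mono asq e) auto
   finally show "(Ph e x)^2 <= B" .
   qed
   hence "(norm (grad (Ph e) x))^2 <= Cg / h^2 * B"
   using Cg(2)[rule_format, OF m, unfolded grad_est_def, THEN conjunct1, rule_format, OF PhP B0 _ x] by blast
   also have "... = C4 * K" using h_pos by (simp add: B_def C4_def)
   finally show ?thesis .
  qed
  have cG: "continuous_on A (grad (Ph e))" for A e by (rule grad_continuous[OF Pol_C1[OF PhP]])
  have ts: "tri e : sets MF" if "e : E" for e
   using tri_subset[OF that] tri_lebesgue[of e] F_lebesgue by (subst sets_restrict_space_iff) auto
  define G where "G x = (SUM e:E. indicator (tri e) x *R grad (Ph e) x)" for x
  have LG: "L2_on F G" unfolding G_def[abs_def] proof (rule L2_sum[OF E_rel(1) compact_F])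
   fix e assume e: "e : E"
   show "L2_on F (%x. indicator (tri e) x *R grad (Ph e) x)"
   by (rule L2_mult_bounded[OF L2_continuous[OF compact_F cG] borel_measurable_indicator[OF ts[OF e]] _ F_lebesgue, of 1])
   (simp add: indicator_def)
  qed
  have "(norm (G x))^2 <= (real N)^2 * (C4 * K)" if x: "x : F" for x proof -
   have "norm (G x) <= (SUM e:E. norm (indicator (tri e) x *R grad (Ph e) x))" unfolding G_def by (rule norm_sum)
   also have "... <= (SUM e:E. sqrt (C4 * K))" proof (rule sum_mono)
   fix e assume e: "e : E"
   have "norm (indicator (tri e) x *R grad (Ph e) x) <= norm (grad (Ph e) x)" by (simp add: indicator_def)
   also have "... <= sqrt (C4 * K)" by (rule real_le_rsqrt[OF gb[OF e x]])
   finally show "norm (indicator (tri e) x *R grad (Ph e) x) <= sqrt (C4 * K)" .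
   qed
   also have "... = real N * sqrt (C4 * K)" using vN by simp
   finally have "(norm (G x))^2 <= (real N * sqrt (C4 * K))^2" by (intro power_mono) auto
   also have "... = (real N)^2 * (C4 * K)" using C4 K by (simp add: power_mult_distrib)
   finally show ?thesis .
  qed
  hence "(nsq F G) <= (real N)^2 * (C4 * K) * measure lebesgue F"
   by (intro integral_le_measure compact_F L2_square LG)
  also have "... <= (real N)^2 * (C4 * K) * (pi * h^2)" using C4 K by (intro mult_left_mono F_measure_le) auto
  also have "... <= D * (h^2 * K)" using K by (simp add: D_def algebra_simps)
  finally have nG: "(nsq F G) <= D * (h^2 * K)" .
  have id: "(LINT x|MF. G x $ 2 * partial 1 ph x - G x $ 1 * partial 2 ph x) = bdry_int vs (%e x. g e x * ph x)"
   if ph: "C1_fun ph" for ph proof -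
   define Q where "Q e x = ph x *R grad (Ph e) x" for e x
   define J where "J w = (LINT t|leb {0..1}. ph (linepath ctr w t) * (f w * (real (Suc k) * t ^ k)))" for w
   have QC: "C1_fun (%x. Q e x $ i)" for e i unfolding Q_def using C1_mult[OF ph Pol_C1[OF Pol_partial[OF PhP]]] by simp
   have rQ: "rotp (Q e) x = grad (Ph e) x $ 2 * partial 1 ph x - grad (Ph e) x $ 1 * partial 2 ph x" for e x
   unfolding Q_def[abs_def] by (rule rotp_mult_grad[OF ph PhP])
   have crQ: "continuous_on A (rotp (Q e))" for e A
   unfolding rotp_def by (intro continuous_intros C1_partial_continuous QC)
   have "G x $ 2 * partial 1 ph x - G x $ 1 * partial 2 ph x = (SUM e:E. indicator (tri e) x * rotp (Q e) x)" for x
   unfolding rQ G_def by (simp add: sum_distrib_right sum_subtractf right_diff_distrib mult.assoc)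
   hence "(LINT x|MF. G x $ 2 * partial 1 ph x - G x $ 1 * partial 2 ph x) = (LINT x|MF. (SUM e:E. indicator (tri e) x * rotp (Q e) x))" by simp
   also have "... = (SUM e:E. LINT x|MF. indicator (tri e) x * rotp (Q e) x)"
   proof (rule Bochner_Integration.integral_sum)
   fix e assume e: "e : E"
   show "integrable MF (%x. indicator (tri e) x * rotp (Q e) x)"
   using integrable_real_mult_indicator[OF ts[OF e] int_cont[OF compact_F crQ]] by (simp add: mult.commute)
   qed
   also have "... = (SUM e:E. edge_int e (%x. g e x * ph x) + ori * (J (fst e) - J (snd e)))"
   proof (rule sum.cong[OF refl])
   fix e assume e: "e : E"
   have "(LINT x|MF. indicator (tri e) x * rotp (Q e) x) = (LINT x|leb (tri e). rotp (Q e) x)"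
   by (rule integral_indicator_sub[OF tri_lebesgue F_lebesgue tri_subset[OF e]])
   also have "... = edge_int e (%x. Q e x <.> tng e) + ori * (line_int (Q e) ctr (fst e) - line_int (Q e) ctr (snd e))"
   by (rule green_tri[OF e QC])
   also have "edge_int e (%x. Q e x <.> tng e) = edge_int e (%x. g e x * ph x)" proof (rule edge_int_cong)
   fix x assume "x : seg e"
   then obtain t where t: "x = el e t" unfolding seg_def linepath_image_01[symmetric] by blast
   have "ori * elen e * (grad (Ph e) x <.> tng e) = (SUM j<=k. (real (Suc j) * a e (Suc j)) * t ^ j)"
   unfolding t by (rule edge_derivative[OF e PhP']) (simp add: Ph_def spread_edge[OF e])
   also have "... = (SUM j<=k. ori * elen e * (c e j * t ^ j))"
   by (intro sum.cong) (auto simp: a_def simp del: of_nat_Suc)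
   also have "... = ori * elen e * g e x" unfolding t c[OF e] by (simp add: sum_distrib_left)
   finally have "grad (Ph e) x <.> tng e = g e x" using ori_sq(2) elen_bounds(3)[OF e] by auto
   thus "Q e x <.> tng e = g e x * ph x" by (simp add: Q_def)
   qed
   also have "line_int (Q e) ctr (fst e) = J (fst e)" unfolding Q_def[abs_def] J_def
   by (rule spoke_integral[OF Pol_C1[OF PhP]]) (simp add: Ph_def spread_spokes(1)[OF e] a_def)
   also have "line_int (Q e) ctr (snd e) = J (snd e)" unfolding Q_def[abs_def] J_def
   by (rule spoke_integral[OF Pol_C1[OF PhP]]) (simp only: Ph_def spread_spokes(2)[OF e] asum[OF e])
   finally show "(LINT x|MF. indicator (tri e) x * rotp (Q e) x) = edge_int e (%x. g e x * ph x) + ori * (J (fst e) - J (snd e))" .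
   qed
   also have "... = bdry_int vs (%e x. g e x * ph x) - ori * (SUM e:E. J (snd e) - J (fst e))"
   unfolding bdry_int_def by (simp add: sum.distrib sum_subtractf sum_distrib_left right_diff_distrib)
   also have "(SUM e:E. J (snd e) - J (fst e)) = 0" by (rule edges_sum_telescope[OF simple])
   finally show ?thesis by simp
  qed
  show "EX G::point => point. L2_on F G & (nsq F G) <= D * (h^2 * K) &
   (ALL ph. C1_fun ph --> (LINT x|MF. G x $ 2 * partial 1 ph x - G x $ 1 * partial 2 ph x) = bdry_int vs (%e x. g e x * ph x))"
   using LG nG id by blast
 qed
qed

section \<open>The stability estimate\<close>

context mesh_polygon
begin

lemma Pol_vec_inner: "X : Pol_vec m ==> (%x. X x <.> n) : Pol m" proof -
 assume "X : Pol_vec m"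
 hence "(%x. n $ 1 * (X x $ 1) + n $ 2 * (X x $ 2)) : Pol m" by (intro Pol_lin) (auto simp: Pol_vec_def)
 thus ?thesis by (simp add: inner_point mult.commute)
qed

text \<open>Puts the weak rotation into the form of \<open>dual_est\<close>, with the rotated field
  in place of \<open>w\<close>.\<close>

lemma weak_rot_dual:
 assumes "L2_on F v" "has_weak_rot F v r" "test_fun F ph"
 shows "(LINT x|MF. r x * ph x) = (LINT x|MF. rotl (v x) <.> grad ph x)" proof -
 have "rotl (v x) <.> grad ph x = - (v x $ 2 * partial 1 ph x - v x $ 1 * partial 2 ph x)" for x by (simp add: inner_point)
 hence "(LINT x|MF. rotl (v x) <.> grad ph x) = - (LINT x|MF. v x $ 2 * partial 1 ph x - v x $ 1 * partial 2 ph x)"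
  by (simp only: Bochner_Integration.integral_minus)
 thus ?thesis using assms(2,3) by (simp add: has_weak_rot_def)
qed

lemma weak_div_dual:
 assumes "has_weak_div F v d" "test_fun F ph" shows "(LINT x|MF. d x * ph x) = (LINT x|MF. (- v x) <.> grad ph x)"
proof -
 have "(- v x) <.> grad ph x = - (v x $ 1 * partial 1 ph x + v x $ 2 * partial 2 ph x)" for x by (simp add: inner_point)
 hence "(LINT x|MF. (- v x) <.> grad ph x) = - (LINT x|MF. v x $ 1 * partial 1 ph x + v x $ 2 * partial 2 ph x)"
  by (simp only: Bochner_Integration.integral_minus)
 thus ?thesis using assms by (simp add: has_weak_div_def)
qed

lemma L2_rotl: "L2_on F v ==> L2_on F (%x. rotl (v x))" proof -
 assume v: "L2_on F v"
 have "L2_on F (%x. rotl (v x) $ 1)" using L2_lin[OF L2_comp[OF v, of 2] L2_comp[OF v, of 2], of "- 1" 0] by simp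
 moreover have "L2_on F (%x. rotl (v x) $ 2)" using L2_comp[OF v, of 1] by simp
 ultimately show ?thesis unfolding L2_component forall_2 by simp
qed

lemma L2_uminus: "L2_on F v ==> L2_on F (%x. - v x)" for v :: "point => point"
 using L2_lin[of F v v "- 1" 0] by simp

lemma S_form_eq:
 assumes dat: "ve_data k v d r p"
 shows "S_form k avg vs v v = h * (SUM e:E. edge_int e (%x. (p e x)^2)) + h^2 * (rsq F r) +
  (nsq F (Pi_S k avg vs v))" proof -
 have v: "has_weak_rot F v r" "has_tan_trace vs v p" using dat by (auto simp: ve_data_def)
 have "(SUM e:E. edge_int e (%x. tan_trace vs v e x * tan_trace vs v e x)) = (SUM e:E. edge_int e (%x. (p e x)^2))"
  using edge_int_tan_trace(2)[OF v(2) _ continuous_on_const[of UNIV 0]]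
  by (intro sum.cong) (auto simp: power2_eq_square)
 thus ?thesis unfolding S_form_def Let_def rot_norm[OF v(1)] by (simp add: L2_inner_def power2_norm_eq_inner)
qed

end

definition low_est :: "point list => nat => real => bool" where
 "low_est vs k C <->
  ((ALL avg W v d r p K. mesh_polygon.ve_data vs k v d r p &
  direct_complement (Pol (int k)) (Pol (beta k vs)) W & v : SVe k avg W vs &
  (ALL e:edges vs. ALL x:seg e. (p e x)^2 <= K) & 0 <= K & (rsq (region vs) r) <= K -->
  (nsq (region vs) v) <=
   C * ((diameter (region vs))^2 * K + (nsq (region vs) (Pi_S k avg vs v)))))"

text \<open>Orthogonality writes the squared norm \<open>V\<close> of \<open>v\<close> as a pairing
  of \<open>v\<close> with \<open>X + G\<close> plus a pairing of \<open>y\<close> with the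
  projection minus \<open>G\<close>. Through \<open>poly_dual_bound\<close> the field
  \<open>y\<close> is itself bounded by \<open>v\<close>, so after Cauchy-Schwarz one factor
  \<open>V\<close> cancels.\<close>

lemma energy_lower_bound:
 assumes "rho > 0" "eps > 0" and k: "1 <= k" shows "EX C>0. ALL vs. meshN vs rho eps N --> low_est vs k C" proof -
 obtain Ce where Ce: "Ce > 0" "ALL vs. mesh_polygon vs rho eps --> euler_est vs (int k - 1) Ce"
  using euler_bound[OF assms(1), of eps "int k - 1"] by blast
 obtain Cd where Cd: "Cd > 0" "ALL vs. mesh_polygon vs rho eps --> euler_est vs (int k) Cd"
  using euler_bound[OF assms(1), of eps "int k"] by blast
 obtain Ca where Ca: "Ca > 0" "ALL vs. mesh_polygon vs rho eps --> dual_est vs (int k) Ca"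
  using poly_dual_bound[OF assms(1), of eps "int k"] by blast
 obtain Cl where Cl: "Cl > 0" "ALL vs. meshN vs rho eps N --> lift_est vs k Cl"
  using curl_free_lifting[OF assms(1), of eps N k] by blast
 \<comment> \<open>\<open>b1\<close>, \<open>b2\<close> and \<open>b3\<close> are the constants for
   \<open>X\<close>, for the lifting \<open>G\<close> and for \<open>y\<close>.\<close>
 define b1 where "b1 = 4 * pi * Ce"
 define b2 where "b2 = Cl * (2 * (1 + 4 * Ce))"
 define b3 where "b3 = 4 * pi * Cd * Ca"
 define D where "D = 4 * (b1 + b2) + 4 * b3 * (1 + b2)"
 have pos: "b1 > 0" "b2 > 0" "b3 > 0" using Ce(1) Cd(1) Ca(1) Cl(1) by (simp_all add: b1_def b2_def b3_def)
 hence D: "D > 0" by (simp add: D_def add_pos_pos)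
 show ?thesis unfolding low_est_def proof (intro exI[of _ D] conjI allI impI D)
  fix vs avg W v d r p and K :: real
  assume vN: "meshN vs rho eps N"
   and H: "mesh_polygon.ve_data vs k v d r p & direct_complement (Pol (int k)) (Pol (beta k vs)) W & v : SVe k avg W vs &
   (ALL e:edges vs. ALL x:seg e. (p e x)^2 <= K) & 0 <= K & (rsq (region vs) r) <= K"
  hence m: "mesh_polygon vs rho eps" by blast
  interpret mesh_polygon vs rho eps by (rule m)
  have dat: "ve_data k v d r p" and K: "0 <= K" "(rsq F r) <= K"
   and pK: "!!e x. e : E ==> x : seg e ==> (p e x)^2 <= K"
   and W: "direct_complement (Pol (int k)) (Pol (beta k vs)) W" and vS: "v : SVe k avg W vs" using H by auto
  have v: "L2_on F v" "has_weak_rot F v r" "has_tan_trace vs v p" "has_weak_div F v d" and rP: "r : Pol (int k - 1)"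
   and dP: "d : Pol (int k)" and pP: "!!e. e : E ==> p e : Pol (int k)" using dat by (auto simp: ve_data_def)
  define PV where "PV = Pi_S k avg vs v"
  have PVP: "PV : Pol_vec (int k)" using Pi_S_cond[OF dat k] by (simp add: pi_cond_def PV_def)
  obtain s where s: "s : Pol (int k - 1)" "ALL x. euler bc s x = r x" "ALL x:F. (s x)^2 <= Ce / h^2 * (rsq F r)"
   using Ce(2)[rule_format, OF m, unfolded euler_est_def, rule_format, OF rP] by blast
  define X where "X = rfield bc s"
  have XP: "X : Pol_vec (int k)" unfolding X_def by (rule rfield_Pol_vec[OF s(1)])
  have cX: "continuous_on A X" for A by (rule Pol_vec_continuous[OF XP])
  have Xr: "rotp X x = r x" for x by (simp add: X_def rotp_rfield[OF Pol_C1[OF s(1)]] s(2))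
  have Xb: "(norm (X x))^2 <= 4 * Ce * K" if x: "x : F" for x proof -
   have "(s x)^2 <= Ce / h^2 * K" using s(3) x mult_left_mono[OF K(2), of "Ce / h^2"] Ce(1) by fastforce
   from weighted_bound[OF x this] show ?thesis by (simp add: X_def rfield_norm power_mult_distrib)
  qed
  define g where "g e x = p e x - X x <.> tng e" for e x
  define K1 where "K1 = 2 * (1 + 4 * Ce) * K"
  have K1: "K1 >= 0" using Ce(1) K(1) by (simp add: K1_def)
  have gb: "(g e x)^2 <= K1" if e: "e : E" and x: "x : seg e" for e x
   using tangent_diff_bound[OF e pK[OF e x] Xb] seg_F[OF e] x by (auto simp: g_def K1_def algebra_simps)
  have gP: "g e : Pol (int k)" if "e : E" for e unfolding g_def[abs_def] by (intro Pol_diff pP that Pol_vec_inner XP)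
  have gl: "bdry_int vs (%e x. g e x * ph x) = bdry_int vs (%e x. p e x * ph x) - bdry_int vs (%e x. (X x <.> tng e) * ph x)"
   if ph: "C1_fun ph" for ph proof -
   have "bdry_int vs (%e x. (- 1) * ((X x <.> tng e) * ph x) + p e x * ph x) =
   (- 1) * bdry_int vs (%e x. (X x <.> tng e) * ph x) + bdry_int vs (%e x. p e x * ph x)"
   by (intro bdry_int_lin continuous_intros cX Pol_continuous[OF pP] C1_continuous[OF ph])
   moreover have "(- 1) * ((X x <.> tng e) * ph x) + p e x * ph x = g e x * ph x" for e x by (simp add: g_def algebra_simps)
   ultimately show ?thesis by simp
  qed
  have tv: "bdry_int vs (%e x. p e x * ph x) = (LINT x|MF. r x * ph x) + (LINT x|MF. v x $ 2 * partial 1 ph x - v x $ 1 * partial 2 ph x)"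
   if ph: "C1_fun ph" for ph using has_tan_traceD[OF v(3) ph] rot_integral[OF v(2) C1_continuous[OF ph]] by simp
  have tX: "bdry_int vs (%e x. (X x <.> tng e) * ph x) = (LINT x|MF. r x * ph x) + (LINT x|MF. X x $ 2 * partial 1 ph x - X x $ 1 * partial 2 ph x)"
   if ph: "C1_fun ph" for ph using green_product[OF Pol_vec_C1[OF XP] ph] by (simp add: Xr)
  have one: "C1_fun (%_::point. 1::real)" by (rule Pol_C1[OF Pol_const[of 0]]) simp
  \<comment> \<open>Testing both trace formulas with the constant \<open>1\<close> shows that the
    residual trace has zero mean, as the lifting requires.\<close>
  have "bdry_int vs g = 0" using gl[OF one] tv[OF one] tX[OF one] by simp
  then obtain G :: "point => point" where G: "L2_on F G" "(nsq F G) <= Cl * (h^2 * K1)"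
   "!!ph. C1_fun ph ==> (LINT x|MF. G x $ 2 * partial 1 ph x - G x $ 1 * partial 2 ph x) = bdry_int vs (%e x. g e x * ph x)"
   using Cl(2)[rule_format, OF vN, unfolded lift_est_def, rule_format, of g K1] gP gb K1 by blast
  have LX: "L2_on F X" by (rule L2_continuous[OF compact_F cX])
  have LXG: "L2_on F (%x. X x + G x)" by (rule L2_add[OF LX G(1)])
  \<comment> \<open>Rotation and trace of \<open>v\<close> are both removed, so \<open>u\<close> is
    orthogonal to the rotated gradients of all \<open>C1\<close> functions.\<close>
  define u where "u x = v x - (X x + G x)" for x
  have Lu: "L2_on F u" unfolding u_def[abs_def] by (rule L2_diff[OF v(1) LXG])
  have Hu: "(LINT y|MF. u y $ 2 * partial 1 ph y - u y $ 1 * partial 2 ph y) = 0" if ph: "C1_fun ph" for ph proof -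
   have i: "integrable MF (%x. a x $ i * partial j ph x)" if "L2_on F a" for a :: "point => point" and i j
   by (intro L2_mult_integrable L2_comp that C1_partial_continuous ph)
   have iw: "integrable MF (%x. a x $ 2 * partial 1 ph x - a x $ 1 * partial 2 ph x)" if "L2_on F a" for a :: "point => point"
   using i[OF that] by simp
   have "(LINT y|MF. u y $ 2 * partial 1 ph y - u y $ 1 * partial 2 ph y) =
   (LINT y|MF. (v y $ 2 * partial 1 ph y - v y $ 1 * partial 2 ph y) - ((X y $ 2 * partial 1 ph y - X y $ 1 * partial 2 ph y) +
   (G y $ 2 * partial 1 ph y - G y $ 1 * partial 2 ph y)))"
   by (rule int_congr) (simp_all add: u_def algebra_simps)
   also have "... = (LINT y|MF. v y $ 2 * partial 1 ph y - v y $ 1 * partial 2 ph y) - ((LINT y|MF. X y $ 2 * partial 1 ph y - X y $ 1 * partial 2 ph y) +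
   (LINT y|MF. G y $ 2 * partial 1 ph y - G y $ 1 * partial 2 ph y))" using iw[OF v(1)] iw[OF LX] iw[OF G(1)]
   by (subst Bochner_Integration.integral_diff) (auto intro: Bochner_Integration.integral_add Bochner_Integration.integrable_add)
   finally show ?thesis using G(3)[OF ph] gl[OF ph] tv[OF ph] tX[OF ph] by simp
  qed
  obtain pd where pd: "pd : Pol (int k)" "ALL x. euler bc pd x = d x" "ALL x:F. (pd x)^2 <= Cd / h^2 * (rsq F d)"
   using Cd(2)[rule_format, OF m, unfolded euler_est_def, rule_format, OF dP] by blast
  \<comment> \<open>\<open>y\<close> has the divergence of \<open>v\<close> by the choice of
    \<open>pd\<close>, and the moments of \<open>v\<close> against it are those that the serendipity
    space prescribes.\<close>
  define y where "y x = pd x *R (x - bc)" for x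
  have cy: "continuous_on A y" for A unfolding y_def[abs_def] by (intro continuous_intros Pol_continuous[OF pd(1)])
  have Ly: "L2_on F y" by (rule L2_continuous[OF compact_F cy])
  have Lz: "L2_on F (%x. v x - y x)" by (rule L2_diff[OF v(1) Ly])
  have Z: "(LINT x|MF. (v x - y x) $ 1 * partial 1 ps x + (v x - y x) $ 2 * partial 2 ps x) = 0" if t: "test_fun F ps" for ps
  proof -
   note ps = test_fun_C1[OF t]
   have Lg: "L2_on F (grad ps)" by (intro L2_continuous compact_F grad_continuous ps)
   have "(LINT x|MF. (v x - y x) $ 1 * partial 1 ps x + (v x - y x) $ 2 * partial 2 ps x) =
   (LINT x|MF. - ((- v x) <.> grad ps x) - (grad ps x <.> (x - bc)) * pd x)"
   by (rule int_congr) (simp_all add: y_def inner_point algebra_simps)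
   also have "... = - (LINT x|MF. (- v x) <.> grad ps x) - (LINT x|MF. (grad ps x <.> (x - bc)) * pd x)"
   using L2_inner_int[OF L2_uminus[OF v(1)] Lg]
   int_cont[OF compact_F, of "%x. (grad ps x <.> (x - bc)) * pd x"]
   by (simp add: continuous_intros grad_continuous[OF ps] Pol_continuous[OF pd(1)])
   also have "(LINT x|MF. (grad ps x <.> (x - bc)) * pd x) = - (LINT x|MF. euler bc pd x * ps x)"
   by (rule green_rfield[OF pd(1) ps]) (rule test_fun_seg[OF t])
   finally show ?thesis using weak_div_dual[OF v(4) t] pd(2) by simp
  qed
  have orth: "(LINT x|MF. (v x - y x) <.> u x) = 0"
   by (rule curl_free_orthogonal[OF compact_F convex_F ball_F rhoh_pos Lu Lz Hu Z])
  define V where "V = (nsq F v)"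
  define P2 where "P2 = (nsq F PV)"
  define G2 where "G2 = (nsq F G)"
  have nn: "V >= 0" "P2 >= 0" "G2 >= 0" unfolding V_def P2_def G2_def by (rule integral_nonneg_AE; simp)+
  have LPV: "L2_on F PV" by (rule L2_continuous[OF compact_F Pol_vec_continuous[OF PVP]])
  have LPVG: "L2_on F (%x. PV x - G x)" by (rule L2_diff[OF LPV G(1)])
  note ip = L2_inner_int
  have pair: "(LINT x|MF. y x <.> v x) = (LINT x|MF. y x <.> PV x)" proof -
   have "0 = int_against_x vs (%x. v x - PV x) pd" using SVe_pair[OF dat k vS W pd(1)] by (simp add: PV_def)
   also have "... = (LINT x|MF. y x <.> v x - y x <.> PV x)" unfolding int_against_x_def
   proof (rule int_congr[OF refl])
   fix x
   have "(v x - PV x) <.> (x - bc) = v x <.> (x - bc) - PV x <.> (x - bc)" by (rule inner_diff_left)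
   hence "(v x - PV x) <.> (x - bc) * pd x = pd x * (v x <.> (x - bc)) - pd x * (PV x <.> (x - bc))"
   by (simp only: right_diff_distrib mult.commute[of _ "pd x"])
   thus "(v x - PV x) <.> (x - bc) * pd x = y x <.> v x - y x <.> PV x"
   unfolding y_def inner_scaleR_left by (simp only: inner_commute[of "x - bc"])
   qed
   also have "... = (LINT x|MF. y x <.> v x) - (LINT x|MF. y x <.> PV x)" using ip[OF Ly v(1)] ip[OF Ly LPV] by simp
   finally show ?thesis by simp
  qed
  define A1 where "A1 = (LINT x|MF. v x <.> (X x + G x))"
  define A2 where "A2 = (LINT x|MF. y x <.> (PV x - G x))"
  have "(LINT x|MF. (v x - y x) <.> u x) = (LINT x|MF. v x <.> v x - v x <.> (X x + G x) - y x <.> v x + y x <.> G x)"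
  proof (rule int_congr[OF refl])
   fix x
   \<comment> \<open>\<open>X\<close> is a multiple of the rotated position vector and
     \<open>y\<close> of the position vector itself, so they are orthogonal pointwise.\<close>
   have "y x <.> X x = 0" by (simp add: y_def X_def rfield_inner)
   thus "(v x - y x) <.> u x = v x <.> v x - v x <.> (X x + G x) - y x <.> v x + y x <.> G x"
   by (simp add: u_def inner_diff_left inner_diff_right inner_add_right)
  qed
  also have "... = (LINT x|MF. v x <.> v x) - A1 - (LINT x|MF. y x <.> v x) + (LINT x|MF. y x <.> G x)"
   unfolding A1_def using ip[OF v(1) v(1)] ip[OF v(1) LXG] ip[OF Ly v(1)] ip[OF Ly G(1)] by simp
  also have "(LINT x|MF. v x <.> v x) = V" by (simp add: V_def power2_norm_eq_inner)
  finally have "V = A1 + ((LINT x|MF. y x <.> PV x) - (LINT x|MF. y x <.> G x))" using orth pair by simp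
  also have "(LINT x|MF. y x <.> PV x) - (LINT x|MF. y x <.> G x) = A2"
   unfolding A2_def inner_diff_right using ip[OF Ly LPV] ip[OF Ly G(1)] by simp
  finally have VA: "V = A1 + A2" .
  have sq2: "(LINT x|MF. (norm (a x - c x))^2) <= 2 * ((nsq F a) + (nsq F c))"
   if "L2_on F a" "L2_on F c" for a c :: "point => point" proof -
   have "(LINT x|MF. (norm (a x - c x))^2) <= (LINT x|MF. 2 * ((norm (a x))^2 + (norm (c x))^2))"
   using norm_sq_2 L2_square[OF that(1)] L2_square[OF that(2)] L2_square[OF L2_diff[OF that]]
   by (intro integral_mono) auto
   thus ?thesis using L2_square[OF that(1)] L2_square[OF that(2)] by simp
  qed
  have iX: "(nsq F X) <= b1 * (h^2 * K)" proof -
   have "(nsq F X) <= 4 * Ce * K * (pi * h^2)" using Ce(1) K(1) by (intro F_integral_le Xb continuous_intros cX) auto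
   thus ?thesis by (simp add: b1_def mult_ac)
  qed
  have iG: "G2 <= b2 * (h^2 * K)" using G(2) by (simp add: G2_def b2_def K1_def mult_ac)
  have B1: "(LINT x|MF. (norm (X x + G x))^2) <= 2 * ((b1 + b2) * (h^2 * K))"
   using sq2[OF LX L2_uminus[OF G(1)]] iX iG by (simp add: G2_def algebra_simps)
  have B2: "(LINT x|MF. (norm (PV x - G x))^2) <= 2 * (P2 + b2 * (h^2 * K))"
   using sq2[OF LPV G(1)] iG by (simp add: G2_def P2_def)
  have "h^2 * (rsq F d) <= Ca * (LINT x|MF. (norm (- v x))^2)"
   by (rule Ca(2)[rule_format, OF m, unfolded dual_est_def, rule_format, OF dP L2_uminus[OF v(1)] weak_div_dual[OF v(4)]])
  hence hd: "h^2 * (rsq F d) <= Ca * V" by (simp add: V_def)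
  have "(nsq F y) <= 4 * Cd * (rsq F d) * (pi * h^2)" proof (rule F_integral_le)
   have i0: "0 <= (rsq F d)" by (rule integral_nonneg_AE) simp
   thus "0 <= 4 * Cd * (rsq F d)" using Cd(1) by simp
   fix x assume x: "x : F"
   from weighted_bound[OF x pd(3)[rule_format, OF x]]
   show "(norm (y x))^2 <= 4 * Cd * (rsq F d)" by (simp add: y_def power_mult_distrib)
  qed (intro continuous_intros cy)
  also have "... = 4 * pi * Cd * (h^2 * (rsq F d))" by simp
  also have "... <= 4 * pi * Cd * (Ca * V)" using Cd(1) by (intro mult_left_mono hd) auto
  finally have iy: "(nsq F y) <= b3 * V" by (simp add: b3_def)
  have "A1^2 <= V * (LINT x|MF. (norm (X x + G x))^2)" unfolding A1_def V_def by (rule L2_CS[OF v(1) LXG])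
  also have "... <= V * (2 * ((b1 + b2) * (h^2 * K)))" by (rule mult_left_mono[OF B1 nn(1)])
  finally have a1: "A1^2 <= V * (2 * ((b1 + b2) * (h^2 * K)))" .
  have "A2^2 <= (nsq F y) * (LINT x|MF. (norm (PV x - G x))^2)" unfolding A2_def by (rule L2_CS[OF Ly LPVG])
  also have "... <= (b3 * V) * (2 * (P2 + b2 * (h^2 * K)))"
   using iy B2 pos nn by (intro mult_mono integral_nonneg_AE) auto
  finally have a2: "A2^2 <= (b3 * V) * (2 * (P2 + b2 * (h^2 * K)))" .
  have "V^2 <= 2 * (A1^2 + A2^2)" unfolding VA by (rule sum_sq_2)
  also have "... <= 2 * (V * (2 * ((b1 + b2) * (h^2 * K))) + (b3 * V) * (2 * (P2 + b2 * (h^2 * K))))" using a1 a2 by simp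
  also have "... = V * (4 * (b1 + b2) * (h^2 * K) + 4 * b3 * (P2 + b2 * (h^2 * K)))" by (simp add: algebra_simps)
  finally have "V <= 4 * (b1 + b2) * (h^2 * K) + 4 * b3 * (P2 + b2 * (h^2 * K))"
   by (rule absorb_square[rotated 2]) (use nn pos K(1) in auto)
  also have "... = (4 * (b1 + b2) + 4 * b3 * b2) * (h^2 * K) + 4 * b3 * P2" by (simp add: algebra_simps)
  also have "... <= D * (h^2 * K) + D * P2"
   using pos K(1) nn unfolding D_def by (intro add_mono mult_right_mono) (auto simp: algebra_simps)
  finally show "(nsq F v) <= D * (h^2 * K + (nsq F (Pi_S k avg vs v)))" by (simp add: V_def P2_def PV_def distrib_left)
 qed
qed

text \<open>Each direction uses one number bounding the squared traces and the squared norm of the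
  rotation at once: \<open>K\<close>, proportional to the squared norm of \<open>v\<close>, for the
  upper bound, and \<open>L\<close>, computed from the terms of the form itself, for the lower
  bound. The number \<open>N\<close> of edges is fixed because the constants depend on it.\<close>

lemma energy_equivalence:
 assumes "rho > 0" "eps > 0" and k: "1 <= k" shows "EX C1>0. EX C2>0. ALL vs. meshN vs rho eps N --> (ALL avg W v.
  direct_complement (Pol (int k)) (Pol (beta k vs)) W & v : SVe k avg W vs -->
  C1 * (nsq (region vs) v) <= S_form k avg vs v v &
  S_form k avg vs v v <= C2 * (nsq (region vs) v))" proof -
 obtain Cs where Cs: "Cs > 0" "ALL vs. meshN vs rho eps N --> stab_est vs k Cs"
  using stability[OF assms(1,2), of N k] by blast
 obtain Ca where Ca: "Ca > 0" "ALL vs. mesh_polygon vs rho eps --> dual_est vs (int k - 1) Ca"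
  using poly_dual_bound[OF assms(1), of eps "int k - 1"] by blast
 obtain Ct where Ct: "Ct > 0" "ALL vs. meshN vs rho eps N --> trace_est vs k Ct"
  using trace_bound[OF assms(1,2), of N k] by blast
 obtain Cl where Cl: "Cl > 0" "ALL vs. meshN vs rho eps N --> low_est vs k Cl"
  using energy_lower_bound[OF assms, of N] by blast
 obtain Cu where Cu: "Cu > 0" "uni_est 1 k Cu" using univariate_bound[OF order_refl, of k] by blast
 \<comment> \<open>\<open>a\<close> bounds traces and rotation by the norm of \<open>v\<close>;
   \<open>D2\<close> collects the three terms of the form.\<close>
 define a where "a = Ct * (1 + Ca) + Ca"
 define b where "b = Cl * (Cu^2 / rho + 1)"
 define D2 where "D2 = real N * a + Ca + Cs * (a + 1)"
 have a: "a > 0" "Ct * (1 + Ca) <= a" "Ca <= a" using Ct(1) Ca(1) by (simp_all add: a_def add_pos_pos)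
 have b: "b > 0" using Cl(1) Cu(1) assms(1) by (simp add: b_def add_pos_pos)
 have D2: "D2 > 0" using a(1) Ca(1) Cs(1) by (simp add: D2_def add_nonneg_pos add_pos_pos)
 have b1: "1 / b > 0" using b by simp
 show ?thesis proof (rule exI[of _ "1 / b"], rule conjI[OF b1], rule exI[of _ D2], intro conjI allI impI D2)
  fix vs avg W v
  assume vN: "meshN vs rho eps N"
   and H: "direct_complement (Pol (int k)) (Pol (beta k vs)) W & v : SVe k avg W vs"
  hence m: "mesh_polygon vs rho eps" by blast
  interpret mesh_polygon vs rho eps by (rule m)
  have "v : Ve k vs" using H by (simp add: SVe_def)
  then obtain d r p where dat: "ve_data k v d r p" using Ve_data by blast
  hence v: "L2_on F v" "has_weak_rot F v r" "has_tan_trace vs v p" and rP: "r : Pol (int k - 1)"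
   and pP: "!!e. e : E ==> p e : Pol (int k)" by (auto simp: ve_data_def)
  define V where "V = (nsq F v)"
  define R where "R = (rsq F r)"
  define P2 where "P2 = (nsq F (Pi_S k avg vs v))"
  define T where "T = (SUM e:E. edge_int e (%x. (p e x)^2))"
  have nn: "V >= 0" "R >= 0" "P2 >= 0" unfolding V_def R_def P2_def by (rule integral_nonneg_AE; simp)+
  have en: "0 <= edge_int e (%x. (p e x)^2)" if "e : E" for e by (rule edge_int_nonneg[OF that]) simp
  have T0: "T >= 0" unfolding T_def using en by (rule sum_nonneg)
  have S: "S_form k avg vs v v = h * T + h^2 * R + P2" unfolding S_form_eq[OF dat] T_def R_def P2_def ..
  have seg_l: "EX t. 0 <= t & t <= 1 & x = el e t" if "x : seg e" for x e
   using that unfolding seg_def linepath_image_01[symmetric] by auto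
  have "h^2 * R <= Ca * (LINT x|MF. (norm (rotl (v x)))^2)"
   unfolding R_def by (rule Ca(2)[rule_format, OF m, unfolded dual_est_def, rule_format, OF rP L2_rotl[OF v(1)] weak_rot_dual[OF v(1,2)]])
  hence hR: "h^2 * R <= Ca * V" by (simp add: V_def)
  \<comment> \<open>The trace estimate bounds the squared traces pointwise by \<open>K\<close>, the
    dual estimate does so for the squared norm of the rotation.\<close>
  define K where "K = a * V / h^2"
  have K0: "K >= 0" using a nn by (simp add: K_def)
  have hK: "h^2 * K = a * V" using h_pos by (simp add: K_def)
  have pK: "(p e x)^2 <= K" if e: "e : E" and x: "x : seg e" for e x proof -
   obtain t where t: "0 <= t" "t <= 1" "x = el e t" using seg_l[OF x] by blast
   have "h^2 * (p e x)^2 <= Ct * (V + h^2 * R)"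
   unfolding t(3) V_def R_def using Ct(2)[rule_format, OF vN, unfolded trace_est_def, rule_format, of v r p e t] v pP e t by blast
   also have "... <= Ct * (V + Ca * V)" using hR Ct(1) by (intro mult_left_mono) auto
   also have "... = Ct * (1 + Ca) * V" by (simp add: algebra_simps)
   also have "... <= a * V" by (intro mult_right_mono a nn)
   finally show ?thesis using h_pos by (simp add: K_def pos_le_divide_eq mult.commute)
  qed
  have RK: "R <= K" proof -
   have "h^2 * R <= a * V" using hR mult_right_mono[OF a(3) nn(1)] by linarith
   thus ?thesis using h_pos by (simp add: K_def pos_le_divide_eq mult.commute)
  qed
  have "P2 <= Cs * (h^2 * K + V)" unfolding P2_def V_def
  proof (rule Cs(2)[rule_format, OF vN, unfolded stab_est_def, rule_format, of v r p K], intro conjI ballI)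
   show "continuous_on UNIV (p e)" if "e : E" for e by (rule Pol_continuous[OF pP[OF that]])
   show "(p e x)^2 <= K" if "e : E" "x : seg e" for e x by (rule pK[OF that])
   show "(rsq F r) <= K" using RK by (simp add: R_def)
  qed (intro v rP K0 Pi_S_cond[OF dat k])+
  hence P2: "P2 <= Cs * (a + 1) * V" unfolding hK by (simp add: algebra_simps)
  have "edge_int e (%x. (p e x)^2) <= h * K" if e: "e : E" for e proof -
   have "edge_int e (%x. (p e x)^2) <= edge_int e (%x. K)"
   by (rule edge_int_mono[OF e]) (auto intro!: continuous_intros Pol_continuous[OF pP[OF e]] pK[OF e])
   also have "... <= h * K" unfolding edge_int_const by (rule mult_right_mono[OF elen_bounds(2)[OF e] K0])
   finally show ?thesis .
  qed
  hence "T <= (SUM e:E. h * K)" unfolding T_def by (rule sum_mono)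
  also have "... = real N * (h * K)" using vN by simp
  finally have "h * T <= h * (real N * (h * K))" using h_pos by (intro mult_left_mono) auto
  also have "... = real N * (h^2 * K)" by (simp add: power2_eq_square)
  also have "... = real N * a * V" by (simp add: hK)
  finally have "h * T + h^2 * R + P2 <= real N * a * V + Ca * V + Cs * (a + 1) * V" using hR P2 by linarith
  thus up: "S_form k avg vs v v <= D2 * (nsq F v)" unfolding S V_def[symmetric] by (simp add: D2_def algebra_simps)
  \<comment> \<open>Edge integrals control pointwise values of the traces by univariate norm
    equivalence, once in each direction, which gives \<open>Cu^2\<close>; \<open>rho * h\<close> is
    the lower bound for the edge lengths.\<close>
  define L where "L = Cu^2 * T / (rho * h) + R"
  have L0: "0 <= L" using T0 nn rhoh_pos by (simp add: L_def)
  have pL: "(p e x)^2 <= L" if e: "e : E" and x: "x : seg e" for e x proof -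
   obtain t where t: "0 <= t" "t <= 1" "x = el e t" using seg_l[OF x] by blast
   obtain c where c: "!!t. p e (el e t) = (SUM j<=k. c j * t ^ j)" using line_coefficients[OF pP[OF e], of e] by blast
   define I where "I = (LINT t|leb {0..1}. (SUM j<=k. c j * t ^ j)^2)"
   have I0: "0 <= I" unfolding I_def by (rule integral_nonneg_AE) simp
   have "(rho * h) * I <= elen e * I" using elen_bounds(1)[OF e] I0 by (rule mult_right_mono)
   also have "... = edge_int e (%x. (p e x)^2)" by (simp add: edge_int_def c I_def)
   also have "... <= T" unfolding T_def using en E_rel(1) e by (intro member_le_sum) auto
   finally have I: "I <= T / (rho * h)" using rhoh_pos by (simp add: pos_le_divide_eq mult.commute)
   have "(p e x)^2 <= Cu * (SUM j<=k. (c j)^2)" unfolding t(3) c using Cu(2)[unfolded uni_est_def] t by auto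
   also have "... <= Cu * (Cu * I)" unfolding I_def using Cu(1) Cu(2)[unfolded uni_est_def] by (intro mult_left_mono) auto
   also have "... <= Cu * (Cu * (T / (rho * h)))" using Cu(1) I by (intro mult_left_mono) auto
   also have "... <= L" using nn by (simp add: L_def power2_eq_square)
   finally show ?thesis .
  qed
  have "R <= L" using T0 rhoh_pos by (simp add: L_def)
  hence "V <= Cl * (h^2 * L + P2)" unfolding V_def P2_def
   using Cl(2)[rule_format, OF vN, unfolded low_est_def, rule_format, of v d r p W avg L] dat H pL L0 unfolding R_def by blast
  also have "h^2 * L = (Cu^2 / rho) * (h * T) + h^2 * R"
   using h_pos rho by (simp add: L_def power2_eq_square field_simps)
  also have "Cl * ((Cu^2 / rho) * (h * T) + h^2 * R + P2) <= Cl * ((Cu^2 / rho + 1) * (h * T + h^2 * R + P2))"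
  proof (rule mult_left_mono)
   have "0 <= h * T" "0 <= (Cu^2 / rho) * (h^2 * R + P2)" using T0 nn h_pos rho by simp_all
   thus "(Cu^2 / rho) * (h * T) + h^2 * R + P2 <= (Cu^2 / rho + 1) * (h * T + h^2 * R + P2)"
   by (simp only: distrib_left distrib_right)
  qed (use Cl(1) in simp)
  also have "... = b * S_form k avg vs v v" by (simp add: b_def S)
  finally show "1 / b * (nsq F v) <= S_form k avg vs v v" using b by (simp add: V_def pos_divide_le_eq mult.commute)
 qed
qed

theorem theorem5p2:
  fixes k :: nat and \<rho> \<epsilon>\<^sub>0 :: real
  assumes "k \<ge> 1" and "\<rho> > 0" and "\<epsilon>\<^sub>0 > 0"
  shows "\<exists>C\<^sub>1 > 0. \<exists>C\<^sub>2 > 0. \<forall>(vs :: point list) (avg :: average) (W :: (point \<Rightarrow> real) set).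
           simple_polygon vs \<and> mesh_regular \<rho> vs \<and> uniformly_convex \<epsilon>\<^sub>0 vs \<and>
           direct_complement (Pol (int k)) (Pol (beta k vs)) W \<longrightarrow>
           (\<forall>v \<in> SVe k avg W vs.
              C\<^sub>1 * (L2_norm (region vs) v)\<^sup>2 \<le> S_form k avg vs v v \<and>
              S_form k avg vs v v \<le> C\<^sub>2 * (L2_norm (region vs) v)\<^sup>2)"
proof -
 let ?P = "%N C1 C2. C1 > 0 & C2 > 0 & (ALL vs. mesh_polygon vs \<rho> \<epsilon>\<^sub>0 & card (edges vs) = N --> (ALL avg W v.
  direct_complement (Pol (int k)) (Pol (beta k vs)) W & v : SVe k avg W vs -->
  C1 * (nsq (region vs) v) <= S_form k avg vs v v &
  S_form k avg vs v v <= C2 * (nsq (region vs) v)))"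
 have "ALL N. EX C. ?P N (fst C) (snd C)" proof
  fix N
  obtain C1 C2 where "?P N C1 C2" using energy_equivalence[OF assms(2,3,1), of N] by blast
  thus "EX C. ?P N (fst C) (snd C)" by (intro exI[of _ "(C1, C2)"]) simp
 qed
 then obtain C where C: "!!N. ?P N (fst (C N)) (snd (C N))" by (rule choice[THEN exE]) blast
 \<comment> \<open>By \<open>card_E_bound\<close> the number of edges is at most
   \<open>2 * pi / \<rho>^2\<close>, so only finitely many pairs of constants occur and their
   minimum and maximum can be taken.\<close>
 define M where "M = nat \<lfloor>2 * pi / \<rho>^2\<rfloor>"
 define A where "A = Min ((%N. fst (C N)) ` {..M})"
 define B where "B = Max ((%N. snd (C N)) ` {..M})"
 have A: "A > 0" "!!N. N <= M ==> A <= fst (C N)" unfolding A_def using C by (subst Min_gr_iff) auto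
 have B: "!!N. N <= M ==> snd (C N) <= B" unfolding B_def by auto
 have "B > 0" using C[of 0] B[of 0] by linarith
 show ?thesis
 proof (rule exI[of _ A], rule conjI[OF A(1)], rule exI[of _ B], intro conjI allI impI ballI \<open>B > 0\<close>)
  fix vs avg W v
  assume H: "simple_polygon vs & mesh_regular \<rho> vs & uniformly_convex \<epsilon>\<^sub>0 vs & direct_complement (Pol (int k)) (Pol (beta k vs)) W"
   and v: "v : SVe k avg W vs"
  have m: "mesh_polygon vs \<rho> \<epsilon>\<^sub>0" using H assms by (simp add: mesh_polygon_def)
  interpret mesh_polygon vs \<rho> \<epsilon>\<^sub>0 by (rule m)
  have "real (card E) <= 2 * pi / \<rho>^2" using card_E_bound rho by (simp add: pos_le_divide_eq)
  hence N: "card E <= M" unfolding M_def by (simp add: le_nat_iff le_floor_iff)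
  define V where "V = (nsq F v)"
  have V: "V >= 0" unfolding V_def by (rule integral_nonneg_AE) simp
  have LV: "(L2_norm F v)^2 = V" using V by (simp add: L2_norm_def L2_inner_def V_def power2_norm_eq_inner)
  have "fst (C (card E)) * V <= S_form k avg vs v v" "S_form k avg vs v v <= snd (C (card E)) * V"
   using C[of "card E"] m H v unfolding V_def by blast+
  moreover have "A * V <= fst (C (card E)) * V" "snd (C (card E)) * V <= B * V" by (intro mult_right_mono A(2) B N V)+
  ultimately show "A * (L2_norm F v)^2 <= S_form k avg vs v v" "S_form k avg vs v v <= B * (L2_norm F v)^2"
   unfolding LV by linarith+
 qed
qed

end
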